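(* Let $\mathfrak g_i$, $i\in J$, be a collection of complete dglas indexed by a (nonempty) finite set $J$. Then there is a bijection $$\mathscr{MC}\Big(\bigsqcup_{i\in J}\mathfrak g_i\Big)\ \cong\ \bigcup_{i\in J}\mathscr{MC}(\mathfrak g_i)$$ (disjoint union) of the Maurer–Cartan moduli sets.
   Context: $\Bbbk$ is a field of characteristic zero. A dgla is a homologically $\mathbb Z$-graded differential graded Lie algebra over $\Bbbk$. A complete dgla is an inverse limit of finite-dimensional nilpotent dglas; $\hat{\mathscr L}$ is the category of complete dglas and continuous dgla maps. $\mathfrak g*\mathfrak h$ is the completed free product, i.e. the coproduct in $\hat{\mathscr L}$. A Maurer–Cartan (MC) element of a dgla $\mathfrak h$ is $\xi\in\mathfrak h_{-1}$ with $d\xi+\frac12[\xi,\xi]=0$, and $\mathfrak h^\xi$ is $\mathfrak h$ with the twisted differential $d^\xi=d+[\xi,-]$. $\mathfrak s$ is the dgla spanned by $x$ and $[x,x]$ with $|x|=-1$, $dx=-\frac12[x,x]$. The disjoint product of complete dglas is $\mathfrak g\sqcup\mathfrak h:=(\mathfrak g*\mathfrak s)^x*\mathfrak h$. It is associative up to natural isomorphism (but not commutative and without unit), and $\bigsqcup_{i\in J}\mathfrak g_i$ denotes the iterated disjoint product taken in some chosen linear order of $J$. $\mathrm{MC}_\bullet(\mathfrak g)$ is the simplicial set whose $n$-simplices are the MC elements of the dgla $\mathfrak g\otimes\Omega(\Delta^n)$. Here $\Omega(\Delta^n)$ is the Sullivan–de Rham algebra of polynomial forms on the standard $n$-simplex,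 regarded as homologically graded by $\Omega_*:=\Omega^{-*}$, and for $\mathfrak g=\lim_\alpha\mathfrak g_\alpha$ with $\mathfrak g_\alpha$ finite-dimensional, $\mathfrak g\otimes\Omega(\Delta^n):=\lim_\alpha(\mathfrak g_\alpha\otimes\Omega(\Delta^n))$. The MC moduli set is $\mathscr{MC}(\mathfrak g):=\pi_0\mathrm{MC}_\bullet(\mathfrak g)$. *)

theory Defs
  imports
    Complex_Main
    "HOL-Library.Poly_Mapping"
    "HOL-Library.Function_Algebras"
    "HOL-Library.Product_Plus"
begin

section \<open>Differential graded Lie algebras\<close>

text \<open>
  The homogeneous components \<open>gr G n\<close> are subspaces of one ambient vector space.  They are not
  required to be independent there: the grading is external, and this is why the bracket and the
  differential carry the degrees of their arguments.  Only values on homogeneous elements matter.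
\<close>

record ('k, 'a) dgla_data =
  smul :: "'k \<Rightarrow> 'a \<Rightarrow> 'a"
  gr :: "int \<Rightarrow> 'a set"
  brk :: "int \<Rightarrow> int \<Rightarrow> 'a \<Rightarrow> 'a \<Rightarrow> 'a"
  dif :: "int \<Rightarrow> 'a \<Rightarrow> 'a"

text \<open>\<open>ksign n\<close> is \<open>(-1)\<^sup>n\<close>, also for negative \<open>n\<close>.\<close>

definition ksign :: "int \<Rightarrow> 'k::ring_1"
  where "ksign n = (if even n then 1 else - 1)"

locale dgla = vector_space "smul G"
  for G :: "('k::field_char_0, 'a::ab_group_add, 'm) dgla_data_scheme" +
  assumes subspace_gr: "subspace (gr G n)"
    and brk_closed: "\<lbrakk>x \<in> gr G m; y \<in> gr G n\<rbrakk> \<Longrightarrow> brk G m n x y \<in> gr G (m + n)"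
    and brk_add_left: "\<lbrakk>x \<in> gr G m; x' \<in> gr G m; y \<in> gr G n\<rbrakk> \<Longrightarrow>
          brk G m n (x + x') y = brk G m n x y + brk G m n x' y"
    and brk_smul_left: "\<lbrakk>x \<in> gr G m; y \<in> gr G n\<rbrakk> \<Longrightarrow>
          brk G m n (smul G c x) y = smul G c (brk G m n x y)"
    and brk_antisym: "\<lbrakk>x \<in> gr G m; y \<in> gr G n\<rbrakk> \<Longrightarrow>
          brk G m n x y = smul G (- ksign (m * n)) (brk G n m y x)"
    and brk_Jacobi: "\<lbrakk>x \<in> gr G l; y \<in> gr G m; z \<in> gr G n\<rbrakk> \<Longrightarrow>
          brk G l (m + n) x (brk G m n y z) =
            brk G (l + m) n (brk G l m x y) z +
            smul G (ksign (l * m)) (brk G m (l + n) y (brk G l n x z))"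
    and dif_closed: "x \<in> gr G n \<Longrightarrow> dif G n x \<in> gr G (n - 1)"
    and dif_add: "\<lbrakk>x \<in> gr G n; x' \<in> gr G n\<rbrakk> \<Longrightarrow> dif G n (x + x') = dif G n x + dif G n x'"
    and dif_smul: "x \<in> gr G n \<Longrightarrow> dif G n (smul G c x) = smul G c (dif G n x)"
    and dif_dif: "x \<in> gr G n \<Longrightarrow> dif G (n - 1) (dif G n x) = 0"
    and dif_brk: "\<lbrakk>x \<in> gr G m; y \<in> gr G n\<rbrakk> \<Longrightarrow>
          dif G (m + n) (brk G m n x y) =
            brk G (m - 1) n (dif G m x) y +
            smul G (ksign m) (brk G m (n - 1) x (dif G n y))"

definition MC :: "('k::field_char_0, 'a::ab_group_add, 'm) dgla_data_scheme \<Rightarrow> 'a set"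
  where "MC G = {\<xi> \<in> gr G (- 1).
    dif G (- 1) \<xi> + smul G (1 / 2) (brk G (- 1) (- 1) \<xi> \<xi>) = 0}"

definition twist ::
    "('k, 'a::ab_group_add, 'm) dgla_data_scheme \<Rightarrow> 'a \<Rightarrow> ('k, 'a, 'm) dgla_data_scheme"
  where "twist G \<xi> = G\<lparr>dif := \<lambda>n y. dif G n y + brk G (- 1) n \<xi> y\<rparr>"

definition dg_ideal ::
    "('k::field_char_0, 'a::ab_group_add, 'm) dgla_data_scheme \<Rightarrow> (int \<Rightarrow> 'a set) \<Rightarrow> bool"
  where "dg_ideal G U \<longleftrightarrow>
    (\<forall>n. module.subspace (smul G) (U n) \<and> U n \<subseteq> gr G n) \<and>
    (\<forall>m n. \<forall>x \<in> gr G m. \<forall>u \<in> U n. brk G m n x u \<in> U (m + n)) \<and>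
    (\<forall>n. \<forall>u \<in> U n. dif G n u \<in> U (n - 1))"

definition finite_codim ::
    "('k::field_char_0, 'a::ab_group_add, 'm) dgla_data_scheme \<Rightarrow> (int \<Rightarrow> 'a set) \<Rightarrow> bool"
  where "finite_codim G U \<longleftrightarrow>
    finite {n. U n \<noteq> gr G n} \<and>
    (\<forall>n. \<exists>B. finite B \<and> B \<subseteq> gr G n \<and> gr G n \<subseteq> module.span (smul G) (B \<union> U n))"

fun lower_central ::
    "('k::field_char_0, 'a::ab_group_add, 'm) dgla_data_scheme \<Rightarrow> nat \<Rightarrow> int \<Rightarrow> 'a set"
  where
    "lower_central G 0 n = gr G n"
  | "lower_central G (Suc k) n = module.span (smul G)
       {brk G i (n - i) x y | i x y. x \<in> gr G i \<and> y \<in> lower_central G k (n - i)}"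

text \<open>The lower central series of \<open>G / U\<close> is the image of that of \<open>G\<close>.\<close>

definition nilpotent_quotient ::
    "('k::field_char_0, 'a::ab_group_add, 'm) dgla_data_scheme \<Rightarrow> (int \<Rightarrow> 'a set) \<Rightarrow> bool"
  where "nilpotent_quotient G U \<longleftrightarrow> (\<exists>k. \<forall>n. lower_central G k n \<subseteq> U n)"

section \<open>Complete dglas\<close>

text \<open>
  An inverse limit \<open>lim G\<^sub>\<alpha>\<close> of finite-dimensional nilpotent dglas is the limit of the
  quotients by the kernels of the projections to (finite products of) the \<open>G\<^sub>\<alpha>\<close>, which are again
  finite-dimensional and nilpotent.  So it is a dgla \<open>G\<close> together with a downward directed set
  \<open>opens G\<close> of dg ideals with finite-dimensional nilpotent quotients such that \<open>G\<close> maps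
  isomorphically, degree by degree, to the limit of the \<open>G / U\<close>: this is \<open>separated\<close> and
  \<open>complete\<close> below, where \<open>c\<close> is a compatible family of coset representatives.  The set
  \<open>opens G\<close> is a neighbourhood basis of zero, not the set of all open ideals.
\<close>

record ('k, 'a) cdgla_data = "('k, 'a) dgla_data" +
  opens :: "(int \<Rightarrow> 'a set) set"

locale complete_dgla = dgla G
  for G :: "('k::field_char_0, 'a::ab_group_add, 'm) cdgla_data_scheme" +
  assumes opens_nonempty: "opens G \<noteq> {}"
    and opens_directed: "\<lbrakk>U \<in> opens G; V \<in> opens G\<rbrakk> \<Longrightarrow> \<exists>W \<in> opens G. W \<le> U \<and> W \<le> V"
    and opens_ideal: "U \<in> opens G \<Longrightarrow> dg_ideal G U"
    and opens_finite_codim: "U \<in> opens G \<Longrightarrow> finite_codim G U"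
    and opens_nilpotent: "U \<in> opens G \<Longrightarrow> nilpotent_quotient G U"
    and separated: "\<lbrakk>x \<in> gr G n; \<And>U. U \<in> opens G \<Longrightarrow> x \<in> U n\<rbrakk> \<Longrightarrow> x = 0"
    and complete: "\<lbrakk>\<And>U. U \<in> opens G \<Longrightarrow> c U \<in> gr G n;
          \<And>U V. \<lbrakk>U \<in> opens G; V \<in> opens G; V \<le> U\<rbrakk> \<Longrightarrow> c V - c U \<in> U n\<rbrakk> \<Longrightarrow>
          \<exists>x \<in> gr G n. \<forall>U \<in> opens G. x - c U \<in> U n"

definition cont_map ::
    "('k::field_char_0, 'a::ab_group_add) cdgla_data \<Rightarrow> ('k, 'b::ab_group_add) cdgla_data \<Rightarrow>
      (int \<Rightarrow> 'a \<Rightarrow> 'b) \<Rightarrow> bool"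
  where "cont_map G H f \<longleftrightarrow>
    (\<forall>n. \<forall>x \<in> gr G n. f n x \<in> gr H n) \<and>
    (\<forall>n. \<forall>x \<in> gr G n. \<forall>y \<in> gr G n. f n (x + y) = f n x + f n y) \<and>
    (\<forall>n c. \<forall>x \<in> gr G n. f n (smul G c x) = smul H c (f n x)) \<and>
    (\<forall>m n. \<forall>x \<in> gr G m. \<forall>y \<in> gr G n. f (m + n) (brk G m n x y) = brk H m n (f m x) (f n y)) \<and>
    (\<forall>n. \<forall>x \<in> gr G n. f (n - 1) (dif G n x) = dif H n (f n x)) \<and>
    (\<forall>V \<in> opens H. \<exists>U \<in> opens G. \<forall>n. f n ` U n \<subseteq> V n)"

definition eq_maps ::
    "('k, 'a) cdgla_data \<Rightarrow> (int \<Rightarrow> 'a \<Rightarrow> 'b) \<Rightarrow> (int \<Rightarrow> 'a \<Rightarrow> 'b) \<Rightarrow> bool"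
  where "eq_maps G f f' \<longleftrightarrow> (\<forall>n. \<forall>x \<in> gr G n. f n x = f' n x)"

definition cdgla_iso ::
    "('k::field_char_0, 'a::ab_group_add) cdgla_data \<Rightarrow> ('k, 'b::ab_group_add) cdgla_data \<Rightarrow> bool"
  where "cdgla_iso G H \<longleftrightarrow> (\<exists>f f'. cont_map G H f \<and> cont_map H G f' \<and>
    eq_maps G (\<lambda>n. f' n \<circ> f n) (\<lambda>n. id) \<and> eq_maps H (\<lambda>n. f n \<circ> f' n) (\<lambda>n. id))"

definition is_copairing ::
    "('k::field_char_0, 'a::ab_group_add) cdgla_data \<Rightarrow> ('k, 'b::ab_group_add) cdgla_data \<Rightarrow>
      ('k, 'c::ab_group_add) cdgla_data \<Rightarrow> (int \<Rightarrow> 'a \<Rightarrow> 'c) \<Rightarrow> (int \<Rightarrow> 'b \<Rightarrow> 'c) \<Rightarrow>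
      ('k, 'd::ab_group_add) cdgla_data \<Rightarrow> (int \<Rightarrow> 'a \<Rightarrow> 'd) \<Rightarrow> (int \<Rightarrow> 'b \<Rightarrow> 'd) \<Rightarrow>
      (int \<Rightarrow> 'c \<Rightarrow> 'd) \<Rightarrow> bool"
  where "is_copairing G H P i j T f g h \<longleftrightarrow>
    cont_map P T h \<and> eq_maps G (\<lambda>n. h n \<circ> i n) f \<and> eq_maps H (\<lambda>n. h n \<circ> j n) g"

text \<open>
  \<open>P\<close>, with the injections \<open>i\<close> and \<open>j\<close>, is a coproduct of \<open>G\<close> and \<open>H\<close> in the category of
  complete dglas.  A formula cannot quantify over the carrier types of the test objects \<open>T\<close>; the
  type \<open>nat \<Rightarrow> 'k\<close> is large enough to carry every finite-dimensional dgla, and as every complete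
  dgla is a limit of such dglas, the universal property for test objects of this type
  implies the one for test objects of any type: see \<open>is_coproduct_universal\<close>.
\<close>

definition is_coproduct ::
    "('k::field_char_0, 'a::ab_group_add) cdgla_data \<Rightarrow> ('k, 'b::ab_group_add) cdgla_data \<Rightarrow>
      ('k, 'c::ab_group_add) cdgla_data \<Rightarrow> (int \<Rightarrow> 'a \<Rightarrow> 'c) \<Rightarrow> (int \<Rightarrow> 'b \<Rightarrow> 'c) \<Rightarrow> bool"
  where "is_coproduct G H P i j \<longleftrightarrow>
    complete_dgla P \<and> cont_map G P i \<and> cont_map H P j \<and>
    (\<forall>(T :: ('k, nat \<Rightarrow> 'k) cdgla_data) f g.
      complete_dgla T \<and> cont_map G T f \<and> cont_map H T g \<longrightarrow>
      (\<exists>h. is_copairing G H P i j T f g h \<and>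
        (\<forall>h'. is_copairing G H P i j T f g h' \<longrightarrow> eq_maps P h' h)))"

lemma linear_with_kernel:
  fixes s :: "'k::field \<Rightarrow> 'd::ab_group_add \<Rightarrow> 'd"
  assumes "vector_space s" and U: "module.subspace s U" and G: "module.subspace s G"
    and "U \<subseteq> G" "finite B" "B \<subseteq> G" and GB: "G \<subseteq> module.span s (B \<union> U)"
  shows "\<exists>q :: 'd \<Rightarrow> nat \<Rightarrow> 'k. (\<forall>x y. q (x + y) = q x + q y) \<and>
    (\<forall>c x. q (s c x) = (\<lambda>k. c * q x k)) \<and> (\<forall>x \<in> G. q x = 0 \<longleftrightarrow> x \<in> U)"
proof -
  interpret vector_space s by fact
  obtain C where C: "C \<subseteq> U" "independent C" "U \<subseteq> span C"
    by (rule maximal_independent_subset[of U])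
  obtain D where D: "C \<subseteq> D" "D \<subseteq> C \<union> B" "independent D" "C \<union> B \<subseteq> span D"
    using maximal_independent_subset_extend[of C "C \<union> B"] C by auto
  define E where "E = extend_basis D"
  have E: "D \<subseteq> E" "independent E" "span E = UNIV"
    using D extend_basis_superset independent_extend_basis span_extend_basis by (auto simp: E_def)
  have spC: "span C = U" using C U by (simp add: span_subspace)
  have "U \<subseteq> span D" using span_mono[OF D(1)] spC by simp
  then have spD: "G \<subseteq> span D"
    using GB D(4) span_minimal[of "B \<union> U" "span D"] by auto
  have fin: "finite (D - C)" using D assms(5) by (meson Diff_subset_conv finite_subset)
  then obtain e where e: "bij_betw e {..<card (D - C)} (D - C)"
    using ex_bij_betw_nat_finite[of "D - C"] by (auto simp: atLeast0LessThan)
  define q where "q x = (\<lambda>k. if k < card (D - C) then representation E x (e k) else 0)" for x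
  have 1: "q (x + y) = q x + q y" for x y
    using E by (auto simp: q_def fun_eq_iff representation_add)
  have 2: "q (s c x) = (\<lambda>k. c * q x k)" for c x
    using E by (auto simp: q_def fun_eq_iff representation_scale)
  have 3: "q x = 0 \<longleftrightarrow> x \<in> U" if x: "x \<in> G" for x
  proof
    assume "q x = 0"
    then have "representation E x b = 0" if "b \<in> D - C" for b
      using that e unfolding q_def fun_eq_iff bij_betw_def
      by (metis (no_types, lifting) imageE lessThan_iff zero_fun_apply)
    moreover have xD: "x \<in> span D" using x spD by auto
    have "representation E x = representation D x"
      by (rule representation_extend[OF E(2) xD E(1)])
    ultimately have "representation D x b = 0" if "b \<notin> C" for b
      using that representation_ne_zero[of D x b] by auto
    then have "(\<Sum>b | representation D x b \<noteq> 0. s (representation D x b) b) \<in> span C"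
      by (intro span_sum span_scale span_base) auto
    then show "x \<in> U" using sum_nonzero_representation_eq[OF D(3) xD] spC by simp
  next
    assume "x \<in> U"
    then have "representation E x = representation C x"
      using representation_extend[OF E(2)] spC D E by blast
    then have "representation E x b = 0" if "b \<notin> C" for b
      using that representation_ne_zero[of C x b] by auto
    then show "q x = 0"
      using e by (auto simp: q_def fun_eq_iff bij_betw_def)
  qed
  show ?thesis using 1 2 3 by blast
qed

lemma (in dgla) gr_closed:
  "0 \<in> gr G n"
  "\<lbrakk>x \<in> gr G n; y \<in> gr G n\<rbrakk> \<Longrightarrow> x + y \<in> gr G n"
  "\<lbrakk>x \<in> gr G n; y \<in> gr G n\<rbrakk> \<Longrightarrow> x - y \<in> gr G n"
  "x \<in> gr G n \<Longrightarrow> smul G c x \<in> gr G n"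
  using subspace_gr[of n] by (auto simp: subspace_0 subspace_add subspace_diff subspace_scale)

lemma (in dgla) brk_add_right:
  assumes "x \<in> gr G m" "y \<in> gr G n" "y' \<in> gr G n"
  shows "brk G m n x (y + y') = brk G m n x y + brk G m n x y'"
  using assms by (simp add: brk_antisym[of x m] gr_closed brk_add_left scale_right_distrib)

lemma (in dgla) brk_smul_right:
  assumes "x \<in> gr G m" "y \<in> gr G n"
  shows "brk G m n x (smul G c y) = smul G c (brk G m n x y)"
  using assms by (simp add: brk_antisym[of x m] gr_closed brk_smul_left mult.commute)

lemma (in dgla) brk_diff_left:
  assumes "x \<in> gr G m" "x' \<in> gr G m" "y \<in> gr G n"
  shows "brk G m n (x - x') y = brk G m n x y - brk G m n x' y"
  using brk_add_left[of "x - x'" m x' y n] assms by (simp add: gr_closed)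

lemma (in dgla) brk_diff_right:
  assumes "x \<in> gr G m" "y \<in> gr G n" "y' \<in> gr G n"
  shows "brk G m n x (y - y') = brk G m n x y - brk G m n x y'"
  using brk_add_right[of x m "y - y'" n y'] assms by (simp add: gr_closed)

lemma (in dgla) dif_diff:
  assumes "x \<in> gr G n" "y \<in> gr G n"
  shows "dif G n (x - y) = dif G n x - dif G n y"
  using dif_add[of "x - y" n y] assms by (simp add: gr_closed)

text \<open>Every finite-dimensional nilpotent quotient has a copy carried by \<open>nat \<Rightarrow> 'k\<close>.\<close>

lemma (in dgla) quotient_model:
  assumes I: "dg_ideal G U" and fc: "finite_codim G U" and nq: "nilpotent_quotient G U"
  shows "\<exists>(Q :: ('k, nat \<Rightarrow> 'k) cdgla_data) q. complete_dgla Q \<and> opens Q = {\<lambda>n. {0}} \<and>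
    (\<forall>n. gr Q n = q n ` gr G n) \<and>
    (\<forall>n. \<forall>x \<in> gr G n. q n x = 0 \<longleftrightarrow> x \<in> U n) \<and>
    (\<forall>n x y. q n (x + y) = q n x + q n y) \<and>
    (\<forall>n c x. q n (smul G c x) = smul Q c (q n x)) \<and>
    (\<forall>m n. \<forall>x \<in> gr G m. \<forall>y \<in> gr G n. q (m + n) (brk G m n x y) = brk Q m n (q m x) (q n y)) \<and>
    (\<forall>n. \<forall>x \<in> gr G n. q (n - 1) (dif G n x) = dif Q n (q n x))"
proof -
  have U: "subspace (U n)" "U n \<subseteq> gr G n" for n using I by (auto simp: dg_ideal_def)
  have "\<exists>q :: 'a \<Rightarrow> nat \<Rightarrow> 'k. (\<forall>x y. q (x + y) = q x + q y) \<and>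
    (\<forall>c x. q (smul G c x) = (\<lambda>k. c * q x k)) \<and> (\<forall>x \<in> gr G n. q x = 0 \<longleftrightarrow> x \<in> U n)" for n
  proof -
    obtain B where "finite B" "B \<subseteq> gr G n" "gr G n \<subseteq> span (B \<union> U n)"
      using fc unfolding finite_codim_def by blast
    then show ?thesis
      by (intro linear_with_kernel[OF vector_space_axioms U(1) subspace_gr U(2)])
  qed
  then obtain q :: "int \<Rightarrow> 'a \<Rightarrow> nat \<Rightarrow> 'k" where
    q_add: "\<And>n x y. q n (x + y) = q n x + q n y" and
    q_sm: "\<And>n c x. q n (smul G c x) = (\<lambda>k. c * q n x k)" and
    q_ker: "\<And>n x. x \<in> gr G n \<Longrightarrow> q n x = 0 \<longleftrightarrow> x \<in> U n"
    by metis
  have q0: "q n 0 = 0" for n using q_add[of n 0 0] by simp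
  have q_diff: "q n (x - y) = q n x - q n y" for n x y
    using q_add[of n "x - y" y] by (simp add: algebra_simps)
  have q_eq: "q n x = q n y \<longleftrightarrow> x - y \<in> U n" if "x \<in> gr G n" "y \<in> gr G n" for n x y
    using q_ker[of "x - y" n] that gr_closed by (simp add: q_diff)
  define \<sigma> where "\<sigma> n a = (SOME x. x \<in> gr G n \<and> q n x = a)" for n a
  have \<sigma>: "\<sigma> n (q n x) \<in> gr G n" "q n (\<sigma> n (q n x)) = q n x" if "x \<in> gr G n" for n x
    using someI[of "\<lambda>z. z \<in> gr G n \<and> q n z = q n x" x] that by (auto simp: \<sigma>_def)
  define Q :: "('k, nat \<Rightarrow> 'k) cdgla_data" where "Q = \<lparr>
    smul = (\<lambda>c a k. c * a k),
    gr = (\<lambda>n. q n ` gr G n),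
    brk = (\<lambda>m n a b. q (m + n) (brk G m n (\<sigma> m a) (\<sigma> n b))),
    dif = (\<lambda>n a. q (n - 1) (dif G n (\<sigma> n a))),
    opens = {\<lambda>n. {0}}\<rparr>"
  have idl: "brk G m n x u \<in> U (m + n)" "brk G n m u x \<in> U (n + m)" if "x \<in> gr G m" "u \<in> U n" for m n x u
  proof -
    show 1: "brk G m n x u \<in> U (m + n)" using that I by (auto simp: dg_ideal_def)
    have "brk G n m u x = smul G (- ksign (n * m)) (brk G m n x u)"
      using that U(2) by (intro brk_antisym) auto
    then show "brk G n m u x \<in> U (n + m)"
      using subspace_scale[OF U(1) 1] by (metis add.commute)
  qed
  have Qb: "brk Q m n (q m x) (q n y) = q (m + n) (brk G m n x y)"
    if xy: "x \<in> gr G m" "y \<in> gr G n" for m n x y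
  proof -
    let ?x = "\<sigma> m (q m x)" and ?y = "\<sigma> n (q n y)"
    have x: "?x \<in> gr G m" "?x - x \<in> U m" and y: "?y \<in> gr G n" "?y - y \<in> U n"
      using \<sigma> xy q_eq by blast+
    have "brk G m n ?x ?y - brk G m n x y = brk G m n (?x - x) ?y + brk G m n x (?y - y)"
      using x y xy by (simp add: brk_diff_left brk_diff_right)
    also have "\<dots> \<in> U (m + n)"
      using x y xy idl by (intro subspace_add[OF U(1)]) auto
    finally show ?thesis
      using q_eq[of "brk G m n ?x ?y" "m + n" "brk G m n x y"] x y xy brk_closed by (simp add: Q_def)
  qed
  have Qd: "dif Q n (q n x) = q (n - 1) (dif G n x)" if "x \<in> gr G n" for n x
  proof -
    let ?x = "\<sigma> n (q n x)"
    have x: "?x \<in> gr G n" "?x - x \<in> U n" using \<sigma> that q_eq by blast+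
    then have "dif G n ?x - dif G n x \<in> U (n - 1)"
      using I that by (simp add: dif_diff[symmetric] dg_ideal_def)
    then show ?thesis
      using q_eq[of "dif G n ?x" "n - 1" "dif G n x"] x that dif_closed by (simp add: Q_def)
  qed
  have sm: "smul Q c (q n x) = q n (smul G c x)" for c n x by (simp add: Q_def q_sm)
  have grQ: "gr Q n = q n ` gr G n" for n by (simp add: Q_def)
  have vs: "vector_space (smul Q)"
    by unfold_locales (auto simp: Q_def fun_eq_iff algebra_simps)
  interpret Q: vector_space "smul Q" by (rule vs)
  have sub_im: "Q.subspace (q n ` S)" if "subspace S" for n S
    using that unfolding Q.subspace_def subspace_def
    apply (auto simp: sm simp flip: q_add)
     apply (metis image_eqI q0)
    done
  have sp_im: "q n ` span S \<subseteq> Q.span (q n ` S)" for n S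
  proof clarify
    fix x assume "x \<in> span S"
    then show "q n x \<in> Q.span (q n ` S)"
    proof (induction rule: span_induct_alt)
      case base
      show ?case unfolding q0 by (rule Q.span_zero)
    next
      case (step c x y)
      then show ?case unfolding q_add sm[symmetric]
        by (intro Q.span_add Q.span_scale) (auto intro: Q.span_base)
    qed
  qed
  have dQ: "dgla Q"
  proof (unfold_locales, goal_cases)
    case (1 n) show ?case using sub_im[OF subspace_gr] by (simp add: grQ)
  next
    case (2 x m y n) then show ?case using brk_closed by (auto simp: grQ Qb)
  next
    case (3 x m x' y n) then show ?case
      by (auto simp: grQ Qb gr_closed brk_add_left simp flip: q_add)
  next
    case (4 x m y n c) then show ?case
      by (auto simp: grQ Qb sm gr_closed brk_smul_left)
  next
    case (5 x m y n) then obtain x0 y0 where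
      *: "x = q m x0" "y = q n y0" "x0 \<in> gr G m" "y0 \<in> gr G n"
      by (auto simp: grQ)
    have "q (m + n) (brk G m n x0 y0) = q (n + m) (smul G (- ksign (m * n)) (brk G n m y0 x0))"
      using brk_antisym[OF *(3-4)] by (simp only: add.commute)
    then show ?case using * by (simp only: Qb sm)
  next
    case (6 x l y m z n) then obtain x0 y0 z0 where
      *: "x = q l x0" "y = q m y0" "z = q n z0" "x0 \<in> gr G l" "y0 \<in> gr G m" "z0 \<in> gr G n"
      by (auto simp: grQ)
    have "m + (l + n) = l + (m + n)" "l + m + n = l + (m + n)" by auto
    then show ?case using brk_Jacobi[OF *(4-6)] *(4-6)
      by (simp only: * Qb sm brk_closed q_add[symmetric])
  next
    case (7 x n) then show ?case using dif_closed by (auto simp: grQ Qd)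
  next
    case (8 x n x') then show ?case by (auto simp: grQ Qd gr_closed dif_add simp flip: q_add)
  next
    case (9 x n c) then show ?case by (auto simp: grQ Qd gr_closed dif_smul sm)
  next
    case (10 x n) then show ?case using dif_closed by (auto simp: grQ Qd dif_dif q0)
  next
    case (11 x m y n) then obtain x0 y0 where
      *: "x = q m x0" "y = q n y0" "x0 \<in> gr G m" "y0 \<in> gr G n"
      by (auto simp: grQ)
    have "m - 1 + n = m + n - 1" "m + (n - 1) = m + n - 1" by auto
    then show ?case using dif_brk[OF *(3-4)] *(3-4)
      by (simp only: * Qb Qd sm brk_closed dif_closed q_add[symmetric])
  qed
  interpret Q: dgla Q by (rule dQ)
  have lc: "lower_central Q k n \<subseteq> q n ` lower_central G k n \<and> lower_central G k n \<subseteq> gr G n" for k n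
  proof (induction k arbitrary: n)
    case 0 then show ?case by (simp add: grQ)
  next
    case (Suc k)
    let ?S = "{brk G i (n - i) x y | i x y. x \<in> gr G i \<and> y \<in> lower_central G k (n - i)}"
    have "brk G i (n - i) x y \<in> gr G n" if "x \<in> gr G i" "y \<in> lower_central G k (n - i)" for i x y
      using brk_closed[of x i y "n - i"] that Suc.IH[of "n - i"] by auto
    then have "?S \<subseteq> gr G n" by auto
    then have 1: "span ?S \<subseteq> gr G n" by (rule span_minimal[OF _ subspace_gr])
    have "{brk Q i (n - i) x y | i x y. x \<in> gr Q i \<and> y \<in> lower_central Q k (n - i)} \<subseteq> q n ` span ?S"
    proof clarify
      fix i x y assume x: "x \<in> gr Q i" and y: "y \<in> lower_central Q k (n - i)"
      obtain x0 where x0: "x = q i x0" "x0 \<in> gr G i" using x by (auto simp: grQ)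
      obtain y0 where y0: "y = q (n - i) y0" "y0 \<in> lower_central G k (n - i)" "y0 \<in> gr G (n - i)"
        using y Suc.IH[of "n - i"] by auto
      have "brk Q i (n - i) x y = q n (brk G i (n - i) x0 y0)"
        using Qb[OF x0(2) y0(3)] x0 y0 by simp
      moreover have "brk G i (n - i) x0 y0 \<in> span ?S"
        using x0 y0 by (intro span_base) blast
      ultimately show "brk Q i (n - i) x y \<in> q n ` span ?S" by blast
    qed
    then have "Q.span {brk Q i (n - i) x y | i x y. x \<in> gr Q i \<and> y \<in> lower_central Q k (n - i)}
        \<subseteq> q n ` span ?S"
      by (rule Q.span_minimal[OF _ sub_im[OF subspace_span]])
    with 1 show ?case by simp
  qed
  have opQ: "opens Q = {\<lambda>n. {0}}" by (simp add: Q_def)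
  have "complete_dgla Q"
  proof (unfold_locales, goal_cases)
    case (3 V)
    have "brk Q m n x 0 = 0" if "x \<in> gr Q m" for m n x
      using Q.brk_diff_right[OF that Q.gr_closed(1) Q.gr_closed(1)] by simp
    moreover have "dif Q n 0 = 0" for n
      using Q.dif_diff[OF Q.gr_closed(1) Q.gr_closed(1)] by simp
    ultimately show ?case using 3 opQ Q.gr_closed(1) by (auto simp: dg_ideal_def)
  next
    case (4 V)
    have "q n ` gr G n = {0}" if "U n = gr G n" for n
      using q_ker[of _ n] that q0[of n] gr_closed(1)[of n] by auto
    then have "{n. {0} \<noteq> gr Q n} \<subseteq> {n. U n \<noteq> gr G n}" by (auto simp: grQ)
    then have "finite {n. {0} \<noteq> gr Q n}"
      using fc by (auto simp: finite_codim_def intro: finite_subset)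
    moreover have "\<exists>B. finite B \<and> B \<subseteq> gr Q n \<and> gr Q n \<subseteq> Q.span (B \<union> {0})" for n
    proof -
      obtain B where B: "finite B" "B \<subseteq> gr G n" "gr G n \<subseteq> span (B \<union> U n)"
        using fc unfolding finite_codim_def by blast
      have "q n ` U n \<subseteq> {0}" using q_ker U(2)[of n] by auto
      then have "q n ` (B \<union> U n) \<subseteq> q n ` B \<union> {0}" by auto
      then have "Q.span (q n ` (B \<union> U n)) \<subseteq> Q.span (q n ` B \<union> {0})" by (rule Q.span_mono)
      then have "gr Q n \<subseteq> Q.span (q n ` B \<union> {0})"
        using sp_im[of n "B \<union> U n"] B(3) by (auto simp: grQ)
      then show ?thesis using B by (intro exI[of _ "q n ` B"]) (auto simp: grQ)
    qed
    ultimately show ?case using 4 opQ by (auto simp: finite_codim_def)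
  next
    case (5 V)
    obtain k where k: "\<And>n. lower_central G k n \<subseteq> U n" using nq by (auto simp: nilpotent_quotient_def)
    have "lower_central Q k n \<subseteq> {0}" for n
    proof -
      have "q n y = 0" if "y \<in> lower_central G k n" for y
        using that lc[of k n] k[of n] q_ker[of y n] by blast
      then show ?thesis using lc[of k n] by blast
    qed
    then show ?case using 5 opQ by (auto simp: nilpotent_quotient_def)
  next
    case (7 c n) then show ?case using opQ by auto
  qed (use opQ in auto)
  then show ?thesis using opQ grQ q_ker q_add Qb Qd sm
    by (intro exI[of _ Q] exI[of _ q]) auto
qed

lemma cont_mapD:
  assumes "cont_map G H f"
  shows "x \<in> gr G n \<Longrightarrow> f n x \<in> gr H n"
    and "\<lbrakk>x \<in> gr G n; y \<in> gr G n\<rbrakk> \<Longrightarrow> f n (x + y) = f n x + f n y"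
    and "x \<in> gr G n \<Longrightarrow> f n (smul G c x) = smul H c (f n x)"
    and "\<lbrakk>x \<in> gr G m; y \<in> gr G n\<rbrakk> \<Longrightarrow> f (m + n) (brk G m n x y) = brk H m n (f m x) (f n y)"
    and "x \<in> gr G n \<Longrightarrow> f (n - 1) (dif G n x) = dif H n (f n x)"
    and "V \<in> opens H \<Longrightarrow> \<exists>U \<in> opens G. \<forall>n. f n ` U n \<subseteq> V n"
  using assms by (simp_all add: cont_map_def)

lemma cont_map_comp:
  assumes "cont_map G H f" "cont_map H K g"
  shows "cont_map G K (\<lambda>n. g n \<circ> f n)"
proof -
  have "\<exists>U \<in> opens G. \<forall>n. (g n \<circ> f n) ` U n \<subseteq> W n" if W: "W \<in> opens K" for W
  proof -
    obtain V where V: "V \<in> opens H" "\<And>n. g n ` V n \<subseteq> W n"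
      using cont_mapD(6)[OF assms(2) W] by blast
    obtain U where U: "U \<in> opens G" "\<And>n. f n ` U n \<subseteq> V n"
      using cont_mapD(6)[OF assms(1) V(1)] by blast
    then have "(g n \<circ> f n) ` U n \<subseteq> W n" for n using V(2)[of n] U(2)[of n] by fastforce
    with U(1) show ?thesis by blast
  qed
  then show ?thesis using assms unfolding cont_map_def by simp
qed

theorem is_coproduct_universal:
  fixes T :: "('k::field_char_0, 'd::ab_group_add) cdgla_data"
  assumes P: "is_coproduct G H P i j" and T: "complete_dgla T"
    and f: "cont_map G T f" and g: "cont_map H T g"
  shows "\<exists>h. is_copairing G H P i j T f g h \<and>
    (\<forall>h'. is_copairing G H P i j T f g h' \<longrightarrow> eq_maps P h' h)"
proof -
  interpret T: complete_dgla T by (rule T)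
  interpret P: complete_dgla P using P by (simp add: is_coproduct_def)
  have ci: "cont_map G P i" and cj: "cont_map H P j" using P by (simp_all add: is_coproduct_def)
  have up: "\<exists>h. is_copairing G H P i j Q f g h \<and>
        (\<forall>h'. is_copairing G H P i j Q f g h' \<longrightarrow> eq_maps P h' h)"
    if "complete_dgla Q" "cont_map G Q f" "cont_map H Q g" for Q :: "('k, nat \<Rightarrow> 'k) cdgla_data" and f g
    using P[unfolded is_coproduct_def, THEN conjunct2, THEN conjunct2, THEN conjunct2,
        THEN spec[of _ Q], THEN spec[of _ f], THEN spec[of _ g], THEN mp, OF conjI[OF that(1) conjI[OF that(2,3)]]] .
  have ex: "\<exists>h. cont_map P Q h \<and> eq_maps G (\<lambda>n. h n \<circ> i n) f \<and> eq_maps H (\<lambda>n. h n \<circ> j n) g"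
    if *: "complete_dgla Q" "cont_map G Q f" "cont_map H Q g" for Q :: "('k, nat \<Rightarrow> 'k) cdgla_data" and f g
  proof -
    obtain h where "is_copairing G H P i j Q f g h" using up[OF *] by (elim exE conjE)
    then show ?thesis unfolding is_copairing_def by (intro exI[of _ h])
  qed
  have un: "eq_maps P h h'"
    if *: "complete_dgla Q" "cont_map G Q f" "cont_map H Q g"
      and **: "cont_map P Q h" "eq_maps G (\<lambda>n. h n \<circ> i n) f" "eq_maps H (\<lambda>n. h n \<circ> j n) g"
      "cont_map P Q h'" "eq_maps G (\<lambda>n. h' n \<circ> i n) f" "eq_maps H (\<lambda>n. h' n \<circ> j n) g"
    for Q :: "('k, nat \<Rightarrow> 'k) cdgla_data" and f g h h'
  proof -
    obtain h0 where "\<forall>h'. is_copairing G H P i j Q f g h' \<longrightarrow> eq_maps P h' h0"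
      using up[OF *] by (elim exE conjE)
    then have "eq_maps P h h0" "eq_maps P h' h0" using ** by (simp_all add: is_copairing_def)
    then show ?thesis by (simp add: eq_maps_def)
  qed
  define M where "M U Q q \<longleftrightarrow> complete_dgla Q \<and> opens Q = {\<lambda>n. {0}} \<and>
    (\<forall>n. gr Q n = q n ` gr T n) \<and>
    (\<forall>n. \<forall>x \<in> gr T n. q n x = 0 \<longleftrightarrow> x \<in> U n) \<and>
    (\<forall>n x y. q n (x + y) = q n x + q n y) \<and>
    (\<forall>n c x. q n (smul T c x) = smul Q c (q n x)) \<and>
    (\<forall>m n. \<forall>x \<in> gr T m. \<forall>y \<in> gr T n. q (m + n) (brk T m n x y) = brk Q m n (q m x) (q n y)) \<and>
    (\<forall>n. \<forall>x \<in> gr T n. q (n - 1) (dif T n x) = dif Q n (q n x))"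
    for U and Q :: "('k, nat \<Rightarrow> 'k) cdgla_data" and q
  have "\<exists>Q q. M U Q q" if "U \<in> opens T" for U
    unfolding M_def
    by (intro T.quotient_model T.opens_ideal T.opens_finite_codim T.opens_nilpotent that)
  then obtain Q q where QM: "\<And>U. U \<in> opens T \<Longrightarrow> M U (Q U) (q U)" by metis
  have Qc: "complete_dgla (Q U)" and Qo: "opens (Q U) = {\<lambda>n. {0}}"
    and Qg: "gr (Q U) n = q U n ` gr T n"
    and q_ker: "x \<in> gr T n \<Longrightarrow> q U n x = 0 \<longleftrightarrow> x \<in> U n"
    and q_add: "q U n (x + y) = q U n x + q U n y"
    and q_sm: "q U n (smul T c x) = smul (Q U) c (q U n x)"
    and q_brk: "\<lbrakk>x \<in> gr T m; y \<in> gr T n\<rbrakk> \<Longrightarrow> q U (m + n) (brk T m n x y) = brk (Q U) m n (q U m x) (q U n y)"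
    and q_dif: "x \<in> gr T n \<Longrightarrow> q U (n - 1) (dif T n x) = dif (Q U) n (q U n x)"
    if "U \<in> opens T" for U m n x y c
    using QM[OF that] unfolding M_def by simp_all
  have q_diff: "q U n (x - y) = q U n x - q U n y" if "U \<in> opens T" for U n x y
    using q_add[OF that, of n "x - y" y] by (simp add: algebra_simps)
  have q_eq: "q U n x = q U n y \<longleftrightarrow> x - y \<in> U n"
    if "U \<in> opens T" "x \<in> gr T n" "y \<in> gr T n" for U n x y
    using q_ker[of U "x - y" n] that T.gr_closed by (simp add: q_diff)
  have sep: "x = y" if "x \<in> gr T n" "y \<in> gr T n" "\<And>U. U \<in> opens T \<Longrightarrow> q U n x = q U n y" for n x y
    using T.separated[of "x - y" n] that q_eq T.gr_closed by simp
  have Uc: "U n \<subseteq> gr T n" if "U \<in> opens T" for U n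
    using T.opens_ideal[OF that] by (simp add: dg_ideal_def)
  have PUc: "U n \<subseteq> gr P n" if "U \<in> opens P" for U n
    using P.opens_ideal[OF that] by (simp add: dg_ideal_def)
  have qc: "cont_map T (Q U) (q U)" if U: "U \<in> opens T" for U
  proof -
    have "q U n ` U n \<subseteq> {0}" for n using q_ker[OF U] Uc[OF U, of n] by auto
    then show ?thesis using U unfolding cont_map_def
      by (auto simp: Qg Qo q_add q_sm q_brk q_dif)
  qed
  have fU: "cont_map G (Q U) (\<lambda>n. q U n \<circ> f n)" and gU: "cont_map H (Q U) (\<lambda>n. q U n \<circ> g n)"
    if "U \<in> opens T" for U using cont_map_comp f g qc that by blast+
  have "\<forall>U \<in> opens T. \<exists>h. cont_map P (Q U) h \<and> eq_maps G (\<lambda>n. h n \<circ> i n) (\<lambda>n. q U n \<circ> f n) \<and>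
      eq_maps H (\<lambda>n. h n \<circ> j n) (\<lambda>n. q U n \<circ> g n)"
    using ex Qc fU gU by blast
  then obtain k where kc: "\<And>U. U \<in> opens T \<Longrightarrow> cont_map P (Q U) (k U)"
    and kf: "\<And>U. U \<in> opens T \<Longrightarrow> eq_maps G (\<lambda>n. k U n \<circ> i n) (\<lambda>n. q U n \<circ> f n)"
    and kg: "\<And>U. U \<in> opens T \<Longrightarrow> eq_maps H (\<lambda>n. k U n \<circ> j n) (\<lambda>n. q U n \<circ> g n)"
    unfolding bchoice_iff by blast
  have k_un: "eq_maps P h (k U)" if "U \<in> opens T" "cont_map P (Q U) h"
    "eq_maps G (\<lambda>n. h n \<circ> i n) (\<lambda>n. q U n \<circ> f n)" "eq_maps H (\<lambda>n. h n \<circ> j n) (\<lambda>n. q U n \<circ> g n)" for U h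
    using un[OF Qc fU gU that(2-4) kc kf kg] that(1) by blast
  define c where "c n p U = (SOME t. t \<in> gr T n \<and> q U n t = k U n p)" for n p U
  have c: "c n p U \<in> gr T n" "q U n (c n p U) = k U n p" if "U \<in> opens T" "p \<in> gr P n" for n p U
  proof -
    have "k U n p \<in> q U n ` gr T n"
      using cont_mapD(1)[OF kc] that by (simp flip: Qg)
    then have "\<exists>t. t \<in> gr T n \<and> q U n t = k U n p" by auto
    from someI_ex[OF this] show "c n p U \<in> gr T n" "q U n (c n p U) = k U n p"
      unfolding c_def by simp_all
  qed
  have compat: "q U n t = k U n p"
    if U: "U \<in> opens T" and V: "V \<in> opens T" and "V \<le> U" and p: "p \<in> gr P n"
      and t: "t \<in> gr T n" "q V n t = k V n p" for U V n t p
  proof -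
    define r where "r n a = q U n (SOME t. t \<in> gr T n \<and> q V n t = a)" for n a
    have r: "r n (q V n t) = q U n t" if "t \<in> gr T n" for n t
    proof -
      let ?s = "SOME s. s \<in> gr T n \<and> q V n s = q V n t"
      have s: "?s \<in> gr T n" "q V n ?s = q V n t"
        using someI[of "\<lambda>s. s \<in> gr T n \<and> q V n s = q V n t" t] that by auto
      then have "?s - t \<in> V n" using q_eq V that by blast
      then have "?s - t \<in> U n" using \<open>V \<le> U\<close> by (auto simp: le_fun_def)
      then show ?thesis using q_eq[OF U s(1) that] by (simp add: r_def)
    qed
    have r0: "r n 0 = 0" for n
      using r[OF T.gr_closed(1), of n] q_add[OF U, of n 0 0] q_add[OF V, of n 0 0] by simp
    have rc: "cont_map (Q V) (Q U) r"
      unfolding cont_map_def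
      apply (intro conjI)
      subgoal by (auto simp: Qg U V r)
      subgoal by (auto simp: Qg U V r T.gr_closed simp flip: q_add)
      subgoal by (auto simp: Qg U V r T.gr_closed simp flip: q_sm)
      subgoal by (auto simp: Qg U V r T.brk_closed simp flip: q_brk)
      subgoal by (auto simp: Qg U V r T.dif_closed simp flip: q_dif)
      subgoal by (auto simp: Qo U V r0)
      done
    have "eq_maps P (\<lambda>n. r n \<circ> k V n) (k U)"
    proof (rule k_un[OF U cont_map_comp[OF kc[OF V] rc]])
      show "eq_maps G (\<lambda>n. (r n \<circ> k V n) \<circ> i n) (\<lambda>n. q U n \<circ> f n)"
        using kf[OF V] cont_mapD(1)[OF f] r by (simp add: eq_maps_def)
      show "eq_maps H (\<lambda>n. (r n \<circ> k V n) \<circ> j n) (\<lambda>n. q U n \<circ> g n)"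
        using kg[OF V] cont_mapD(1)[OF g] r by (simp add: eq_maps_def)
    qed
    then show ?thesis using p t r[OF t(1)] by (simp add: eq_maps_def)
  qed
  have "\<exists>x \<in> gr T n. \<forall>U \<in> opens T. q U n x = k U n p" if p: "p \<in> gr P n" for n p
  proof -
    have "\<exists>x \<in> gr T n. \<forall>U \<in> opens T. x - c n p U \<in> U n"
    proof (rule T.complete)
      fix U V assume UV: "U \<in> opens T" "V \<in> opens T" "V \<le> U"
      have "q U n (c n p V) = k U n p"
        using compat[OF UV p] c[OF UV(2) p] by simp
      then have "q U n (c n p V) = q U n (c n p U)" using c[OF UV(1) p] by simp
      then show "c n p V - c n p U \<in> U n"
        using q_eq[OF UV(1) c(1)[OF UV(2) p] c(1)[OF UV(1) p]] by simp
    qed (use c p in simp)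
    then obtain x where x: "x \<in> gr T n" "\<And>U. U \<in> opens T \<Longrightarrow> x - c n p U \<in> U n" by blast
    then have "q U n x = k U n p" if "U \<in> opens T" for U
      using q_eq[OF that x(1) c(1)[OF that p]] c(2)[OF that p] x(2)[OF that] by simp
    with x(1) show ?thesis by blast
  qed
  then have "\<forall>n p. \<exists>x. p \<in> gr P n \<longrightarrow> x \<in> gr T n \<and> (\<forall>U \<in> opens T. q U n x = k U n p)" by blast
  then obtain h where hT: "\<And>n p. p \<in> gr P n \<Longrightarrow> h n p \<in> gr T n"
    and hq: "\<And>n p U. p \<in> gr P n \<Longrightarrow> U \<in> opens T \<Longrightarrow> q U n (h n p) = k U n p"
    by metis
  have k_add: "k U n (x + y) = k U n x + k U n y"
    and k_sm: "k U n (smul P a x) = smul (Q U) a (k U n x)"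
    and k_dif: "k U (n - 1) (dif P n x) = dif (Q U) n (k U n x)"
    if "U \<in> opens T" "x \<in> gr P n" "y \<in> gr P n" for U n x y a
    using cont_mapD[OF kc] that by simp_all
  have k_brk: "k U (m + n) (brk P m n x y) = brk (Q U) m n (k U m x) (k U n y)"
    if "U \<in> opens T" "x \<in> gr P m" "y \<in> gr P n" for U m n x y
    using cont_mapD[OF kc] that by simp
  have "cont_map P T h"
    unfolding cont_map_def
  proof (intro conjI allI ballI)
    fix n x y assume "x \<in> gr P n" "y \<in> gr P n"
    then show "h n (x + y) = h n x + h n y"
      by (intro sep[of _ n]) (auto simp: hT T.gr_closed P.gr_closed hq q_add k_add)
  next
    fix n a x assume "x \<in> gr P n"
    then show "h n (smul P a x) = smul T a (h n x)"
      by (intro sep[of _ n]) (auto simp: hT T.gr_closed P.gr_closed hq q_sm k_sm)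
  next
    fix m n x y assume "x \<in> gr P m" "y \<in> gr P n"
    then show "h (m + n) (brk P m n x y) = brk T m n (h m x) (h n y)"
      by (intro sep[of _ "m + n"]) (auto simp: hT T.brk_closed P.brk_closed hq q_brk k_brk)
  next
    fix n x assume "x \<in> gr P n"
    then show "h (n - 1) (dif P n x) = dif T n (h n x)"
      by (intro sep[of _ "n - 1"]) (auto simp: hT T.dif_closed P.dif_closed hq q_dif k_dif)
  next
    fix V assume V: "V \<in> opens T"
    obtain W where W: "W \<in> opens P" "\<And>n. k V n ` W n \<subseteq> {0}"
      using cont_mapD(6)[OF kc[OF V]] by (auto simp: Qo V)
    have "h n w \<in> V n" if w: "w \<in> W n" for n w
    proof -
      have "w \<in> gr P n" using PUc[OF W(1)] w by auto
      moreover have "k V n w = 0" using W(2) w by auto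
      ultimately show ?thesis using q_ker[OF V hT] hq V by simp
    qed
    then show "\<exists>W \<in> opens P. \<forall>n. h n ` W n \<subseteq> V n" using W(1) by blast
  qed (rule hT)
  moreover have "eq_maps G (\<lambda>n. h n \<circ> i n) f"
    unfolding eq_maps_def
  proof (intro allI ballI)
    fix n x assume x: "x \<in> gr G n"
    then have "i n x \<in> gr P n" "f n x \<in> gr T n" using cont_mapD(1)[OF ci] cont_mapD(1)[OF f] by auto
    then show "(h n \<circ> i n) x = f n x"
      using kf x by (intro sep[of _ n]) (auto simp: hT hq eq_maps_def)
  qed
  moreover have "eq_maps H (\<lambda>n. h n \<circ> j n) g"
    unfolding eq_maps_def
  proof (intro allI ballI)
    fix n x assume x: "x \<in> gr H n"
    then have "j n x \<in> gr P n" "g n x \<in> gr T n" using cont_mapD(1)[OF cj] cont_mapD(1)[OF g] by auto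
    then show "(h n \<circ> j n) x = g n x"
      using kg x by (intro sep[of _ n]) (auto simp: hT hq eq_maps_def)
  qed
  moreover have "eq_maps P h' h" if h': "cont_map P T h'"
    "eq_maps G (\<lambda>n. h' n \<circ> i n) f" "eq_maps H (\<lambda>n. h' n \<circ> j n) g" for h'
    unfolding eq_maps_def
  proof (intro allI ballI)
    fix n x assume x: "x \<in> gr P n"
    have "q U n (h' n x) = k U n x" if U: "U \<in> opens T" for U
      using k_un[OF U cont_map_comp[OF h'(1) qc[OF U]]] h'(2,3) x by (simp add: eq_maps_def)
    then show "h' n x = h n x"
      using cont_mapD(1)[OF h'(1)] x by (intro sep[of _ n]) (auto simp: hT hq)
  qed
  ultimately show ?thesis unfolding is_copairing_def by blast
qed

section \<open>The disjoint product\<close>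

text \<open>The dgla with basis \<open>x = (1, 0)\<close> in degree \<open>-1\<close> and \<open>[x, x] = (0, 1)\<close> in degree \<open>-2\<close>.\<close>

definition sdgla :: "('k::field_char_0, 'k \<times> 'k) cdgla_data"
  where "sdgla = \<lparr>
    smul = (\<lambda>c (a, b). (c * a, c * b)),
    gr = (\<lambda>n. if n = - 1 then UNIV \<times> {0} else if n = - 2 then {0} \<times> UNIV else {0}),
    brk = (\<lambda>m n (a, b) (a', b'). if m = - 1 \<and> n = - 1 then (0, a * a') else 0),
    dif = (\<lambda>n (a, b). if n = - 1 then (0, - a / 2) else 0),
    opens = {\<lambda>n. {0}}\<rparr>"

lemma vector_space_sdgla: "vector_space (smul (sdgla :: ('k::field_char_0, 'k\<times>'k) cdgla_data))"
  by unfold_locales (auto simp: sdgla_def algebra_simps)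

lemma dgla_sdgla: "dgla (sdgla :: ('k::field_char_0, 'k\<times>'k) cdgla_data)"
proof -
  interpret vector_space "smul (sdgla :: ('k, 'k\<times>'k) cdgla_data)" by (rule vector_space_sdgla)
  show ?thesis
  proof (unfold_locales, goal_cases)
    case (1 n) show ?case by (auto simp: subspace_def) (auto simp: sdgla_def zero_prod_def split: if_splits)
  qed (auto simp: sdgla_def zero_prod_def ksign_def algebra_simps add_divide_distrib split: if_splits)
qed

lemma lower_central_sdgla: "lower_central (sdgla :: ('k::field_char_0, 'k\<times>'k) cdgla_data) (Suc (Suc 0)) n \<subseteq> {0}"
proof -
  let ?s = "sdgla :: ('k, 'k\<times>'k) cdgla_data"
  interpret vector_space "smul ?s" by (rule vector_space_sdgla)
  have a: "lower_central ?s (Suc 0) n \<subseteq> (if n = -2 then UNIV else {0})" for n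
    unfolding lower_central.simps
    apply (cases "n = -2", simp) unfolding if_not_P
    apply (rule order_trans[OF span_mono[of _ "{0}"]])
    subgoal by (auto simp: sdgla_def zero_prod_def split: if_splits)
    subgoal using span_insert_0[of "{}"] by simp
    done
  show ?thesis
    unfolding lower_central.simps(2)[of _ "Suc 0"]
    apply (rule order_trans[OF span_mono[of _ "{0}"]])
    subgoal
    proof (intro subsetI, elim CollectE exE conjE, simp only:)
      fix i x y assume x: "x \<in> gr ?s i" and y: "y \<in> lower_central ?s (Suc 0) (n - i)"
      show "brk ?s i (n-i) x y \<in> {0}"
        using x subsetD[OF a y] by (auto simp: sdgla_def zero_prod_def split: if_splits prod.splits)
    qed
    apply simp
    done
qed

lemma complete_dgla_sdgla: "complete_dgla (sdgla :: ('k::field_char_0, 'k\<times>'k) cdgla_data)"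
proof -
  let ?s = "sdgla :: ('k, 'k\<times>'k) cdgla_data"
  interpret dgla ?s by (rule dgla_sdgla)
  have o: "opens ?s = {\<lambda>n. {0}}" by (simp add: sdgla_def)
  show ?thesis
  proof (unfold_locales, goal_cases)
    case (3 U) then show ?case using o subspace_gr by (auto simp: dg_ideal_def subspace_0) 
       (auto simp: sdgla_def zero_prod_def)
  next
    case (4 U)
    have e: "finite {n. {0} \<noteq> gr ?s n}"
      by (rule finite_subset[of _ "{-1,-2}"]) (auto simp: sdgla_def)
    have "\<exists>B. finite B \<and> B \<subseteq> gr ?s n \<and> gr ?s n \<subseteq> span (B \<union> {0})" for n
    proof -
      let ?B = "if n = -1 then {(1,0)} else if n = -2 then {(0,1)} else {}"
      have "x \<in> span (?B \<union> {0})" if "x \<in> gr ?s n" for x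
      proof -
        have "\<exists>c. \<exists>b \<in> ?B \<union> {0}. x = smul ?s c b"
          using that by (cases x) (auto simp: sdgla_def zero_prod_def split: if_splits)
        then obtain c b where "b \<in> ?B \<union> {0}" "x = smul ?s c b" by blast
        then show ?thesis by (metis span_scale span_base)
      qed
      moreover have "finite ?B" "?B \<subseteq> gr ?s n" by (auto simp: sdgla_def)
      ultimately show ?thesis by blast
    qed
    then show ?case using 4 o e by (auto simp: finite_codim_def)
  next
    case (5 U)
    then show ?case using o lower_central_sdgla by (auto simp: nilpotent_quotient_def simp del: lower_central.simps)
  next
    case (7 c n) then show ?case using o by auto
  qed (auto simp: o)
qed

definition is_disjoint_product ::
    "('k::field_char_0, 'c::ab_group_add) cdgla_data \<Rightarrow> ('k, 'c) cdgla_data \<Rightarrow>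
      ('k, 'c) cdgla_data \<Rightarrow> bool"
  where "is_disjoint_product G H P \<longleftrightarrow>
    (\<exists>(A :: ('k, 'c) cdgla_data) i j i' j'.
      is_coproduct G sdgla A i j \<and>
      is_coproduct (twist A (j (- 1) (1, 0))) H P i' j')"

text \<open>
  Iterated disjoint products of a nonempty list of complete dglas, with an arbitrary
  bracketing.  Like the coproduct they are only determined up to isomorphism.
\<close>

inductive is_iterated_disjoint_product ::
    "('k::field_char_0, 'a::ab_group_add) cdgla_data list \<Rightarrow>
      ('k, 'c::ab_group_add) cdgla_data \<Rightarrow> bool"
  where
    single: "\<lbrakk>complete_dgla P; cdgla_iso G P\<rbrakk> \<Longrightarrow> is_iterated_disjoint_product [G] P"
  | join: "\<lbrakk>is_iterated_disjoint_product Gs A; is_iterated_disjoint_product Hs B;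
      is_disjoint_product A B P\<rbrakk> \<Longrightarrow> is_iterated_disjoint_product (Gs @ Hs) P"

section \<open>Polynomial forms on simplices\<close>

text \<open>
  Eliminating \<open>t\<^sub>0 = 1 - t\<^sub>1 - \<dots> - t\<^sub>n\<close>, the algebra \<open>\<Omega>(\<Delta>\<^sup>n)\<close> is the free graded commutative algebra
  on \<open>t\<^sub>1, \<dots>, t\<^sub>n, dt\<^sub>1, \<dots>, dt\<^sub>n\<close>.  It has the basis \<open>t\<^sup>e dt\<^sub>S\<close>, encoded as \<open>(e, S)\<close>, where
  \<open>dt\<^sub>S\<close> is the product of the \<open>dt\<^sub>i\<close> with \<open>i \<in> S\<close> in increasing order.
\<close>

type_synonym form_basis = "(nat \<Rightarrow>\<^sub>0 nat) \<times> nat set"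
type_synonym 'k form = "form_basis \<Rightarrow>\<^sub>0 'k"

definition forms_basis :: "nat \<Rightarrow> form_basis set"
  where "forms_basis n = {(e, S). Poly_Mapping.keys e \<subseteq> {1..n} \<and> S \<subseteq> {1..n}}"

abbreviation form_deg :: "form_basis \<Rightarrow> int"
  where "form_deg b \<equiv> int (card (snd b))"

definition wedge_sign :: "nat set \<Rightarrow> nat set \<Rightarrow> 'k::ring_1"
  where "wedge_sign S T = (if S \<inter> T = {} then (- 1) ^ card {(i, j). i \<in> S \<and> j \<in> T \<and> j < i} else 0)"

definition wedge :: "'k::comm_ring_1 form \<Rightarrow> 'k form \<Rightarrow> 'k form"
  where "wedge \<omega> \<eta> = (\<Sum>a \<in> Poly_Mapping.keys \<omega>. \<Sum>b \<in> Poly_Mapping.keys \<eta>.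
    Poly_Mapping.single (fst a + fst b, snd a \<union> snd b)
      (wedge_sign (snd a) (snd b) * Poly_Mapping.lookup \<omega> a * Poly_Mapping.lookup \<eta> b))"

definition form_d :: "'k::comm_ring_1 form \<Rightarrow> 'k form"
  where "form_d \<omega> = (\<Sum>a \<in> Poly_Mapping.keys \<omega>. \<Sum>i \<in> Poly_Mapping.keys (fst a).
    Poly_Mapping.single (fst a - Poly_Mapping.single i 1, insert i (snd a))
      (of_nat (Poly_Mapping.lookup (fst a) i) * wedge_sign {i} (snd a) * Poly_Mapping.lookup \<omega> a))"

abbreviation basis_form :: "form_basis \<Rightarrow> 'k::comm_ring_1 form"
  where "basis_form b \<equiv> Poly_Mapping.single b 1"

definition form_one :: "'k::comm_ring_1 form"
  where "form_one = basis_form (0, {})"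

text \<open>The barycentric coordinate \<open>t\<^sub>i\<close>, for \<open>0 \<le> i \<le> n\<close>, as an element of \<open>\<Omega>(\<Delta>\<^sup>n)\<close>.\<close>

definition bary :: "nat \<Rightarrow> nat \<Rightarrow> 'k::comm_ring_1 form"
  where "bary n i =
    (if i = 0 then form_one - (\<Sum>j = 1..n. basis_form (Poly_Mapping.single j 1, {}))
     else basis_form (Poly_Mapping.single i 1, {}))"

text \<open>
  The map \<open>\<theta>\<^sup>* : \<Omega>(\<Delta>\<^sup>n) \<rightarrow> \<Omega>(\<Delta>\<^sup>m)\<close> induced by \<open>\<theta> : [m] \<rightarrow> [n]\<close> is the map of dg algebras with
  \<open>t\<^sub>i \<mapsto> \<Sum> {t\<^sub>j | \<theta> j = i}\<close>; \<open>form_pullback\<close> gives its values on basis elements.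
\<close>

definition bary_pullback :: "nat \<Rightarrow> (nat \<Rightarrow> nat) \<Rightarrow> nat \<Rightarrow> 'k::comm_ring_1 form"
  where "bary_pullback m \<theta> i = (\<Sum>j \<in> {j. j \<le> m \<and> \<theta> j = i}. bary m j)"

definition form_pullback :: "nat \<Rightarrow> nat \<Rightarrow> (nat \<Rightarrow> nat) \<Rightarrow> form_basis \<Rightarrow> 'k::comm_ring_1 form"
  where "form_pullback m n \<theta> b = foldr wedge
    (concat (map (\<lambda>i. replicate (Poly_Mapping.lookup (fst b) i) (bary_pullback m \<theta> i)) [1..<Suc n])
      @ map (\<lambda>i. form_d (bary_pullback m \<theta> i)) (sorted_list_of_set (snd b)))
    form_one"

section \<open>The simplicial Maurer--Cartan set\<close>

text \<open>
  For a finite-dimensional quotient \<open>G / U\<close>, an element of \<open>G / U \<otimes> \<Omega>(\<Delta>\<^sup>n)\<close> is a finitely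
  supported family of coefficients in \<open>G / U\<close>, indexed by the basis of \<open>\<Omega>(\<Delta>\<^sup>n)\<close>.  As
  \<open>G = lim G / U\<close>, the elements of \<open>G \<otimes> \<Omega>(\<Delta>\<^sup>n) = lim (G / U \<otimes> \<Omega>(\<Delta>\<^sup>n))\<close> are the families \<open>\<phi>\<close> of
  coefficients in \<open>G\<close> that are finitely supported modulo each \<open>U\<close>, thought of as
  \<open>\<Sum>b. \<phi> b \<otimes> b\<close>.  A form of degree \<open>p\<close> has homological degree \<open>-p\<close>.  The signs are those of
  \<open>[v \<otimes> \<omega>, w \<otimes> \<eta>] = (-1)\<^bsup>|\<omega>||w|\<^esup> [v, w] \<otimes> \<omega>\<eta>\<close> and
  \<open>d(v \<otimes> \<omega>) = dv \<otimes> \<omega> + (-1)\<^bsup>|v|\<^esup> v \<otimes> d\<omega>\<close>.  The index sets of the sums are finite, since a given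
  basis form occurs in only finitely many products and differentials of basis forms.
\<close>

definition tensor_forms ::
    "('k::field_char_0, 'a::ab_group_add) cdgla_data \<Rightarrow> nat \<Rightarrow> ('k, form_basis \<Rightarrow> 'a) dgla_data"
  where "tensor_forms G n = \<lparr>
    smul = (\<lambda>c \<phi> b. smul G c (\<phi> b)),
    gr = (\<lambda>N. {\<phi>. (\<forall>b. b \<notin> forms_basis n \<longrightarrow> \<phi> b = 0) \<and>
      (\<forall>b \<in> forms_basis n. \<phi> b \<in> gr G (N + form_deg b)) \<and>
      (\<forall>U \<in> opens G. finite {b \<in> forms_basis n. \<phi> b \<notin> U (N + form_deg b)})}),
    brk = (\<lambda>M N \<phi> \<psi> b.
      \<Sum>(a, c) \<in> {(a, c). a \<in> forms_basis n \<and> c \<in> forms_basis n \<and>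
          Poly_Mapping.lookup (wedge (basis_form a) (basis_form c)) b \<noteq> (0 :: 'k)}.
        smul G (ksign (form_deg a * (N + form_deg c)) *
            Poly_Mapping.lookup (wedge (basis_form a) (basis_form c)) b)
          (brk G (M + form_deg a) (N + form_deg c) (\<phi> a) (\<psi> c))),
    dif = (\<lambda>N \<phi> b. (if b \<in> forms_basis n then dif G (N + form_deg b) (\<phi> b) else 0) +
      (\<Sum>a \<in> {a \<in> forms_basis n. Poly_Mapping.lookup (form_d (basis_form a)) b \<noteq> (0 :: 'k)}.
        smul G (ksign (N + form_deg a) * Poly_Mapping.lookup (form_d (basis_form a)) b) (\<phi> a)))\<rparr>"

text \<open>
  The map \<open>id \<otimes> \<theta>\<^sup>* : G \<otimes> \<Omega>(\<Delta>\<^sup>n) \<rightarrow> G \<otimes> \<Omega>(\<Delta>\<^sup>m)\<close> in degree \<open>N\<close>.  A basis form may occur in infinitely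
  many \<open>\<theta>\<^sup>* a\<close>, so its coefficient is an infinite convergent sum; it is determined by being
  congruent modulo each \<open>U\<close> to the finite sum of the terms that do not vanish modulo \<open>U\<close>.
\<close>

definition tensor_pullback ::
    "('k::field_char_0, 'a::ab_group_add) cdgla_data \<Rightarrow> int \<Rightarrow> nat \<Rightarrow> nat \<Rightarrow> (nat \<Rightarrow> nat) \<Rightarrow>
      (form_basis \<Rightarrow> 'a) \<Rightarrow> form_basis \<Rightarrow> 'a"
  where "tensor_pullback G N m n \<theta> \<phi> b =
    (if b \<in> forms_basis m then
      (THE y. y \<in> gr G (N + form_deg b) \<and>
        (\<forall>U \<in> opens G.
          y - (\<Sum>a \<in> {a \<in> forms_basis n. \<phi> a \<notin> U (N + form_deg a)}.
                smul G (Poly_Mapping.lookup (form_pullback m n \<theta> a) b) (\<phi> a))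
          \<in> U (N + form_deg b)))
     else 0)"

text \<open>
  In a simplicial set \<open>X\<close>, \<open>act X m n \<theta>\<close> is the map from \<open>n\<close>-simplices to \<open>m\<close>-simplices induced
  by a monotone \<open>\<theta> : [m] \<rightarrow> [n]\<close>.
\<close>

record 'x sset_data =
  simplices :: "nat \<Rightarrow> 'x set"
  act :: "nat \<Rightarrow> nat \<Rightarrow> (nat \<Rightarrow> nat) \<Rightarrow> 'x \<Rightarrow> 'x"

definition coface :: "nat \<Rightarrow> nat \<Rightarrow> nat"
  where "coface i j = (if j < i then j else Suc j)"

definition pi0 :: "'x sset_data \<Rightarrow> 'x set set"
  where "pi0 X =
    (let E = {(act X 0 1 (coface 1) e, act X 0 1 (coface 0) e) | e. e \<in> simplices X 1}
     in simplices X 0 // ((E \<union> E\<inverse>)\<^sup>* \<inter> simplices X 0 \<times> simplices X 0))"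

definition MC_sset ::
    "('k::field_char_0, 'a::ab_group_add) cdgla_data \<Rightarrow> (form_basis \<Rightarrow> 'a) sset_data"
  where "MC_sset G = \<lparr>
    simplices = (\<lambda>n. MC (tensor_forms G n)),
    act = (\<lambda>m n \<theta>. tensor_pullback G (- 1) m n \<theta>)\<rparr>"

definition MC_moduli ::
    "('k::field_char_0, 'a::ab_group_add) cdgla_data \<Rightarrow> (form_basis \<Rightarrow> 'a) set set"
  where "MC_moduli G = pi0 (MC_sset G)"

end

theory Submission
  imports Defs
begin

text \<open>
  The disjoint product \<open>P = (G * s)\<^sup>x * H\<close> retracts onto \<open>H\<close>, its twist by \<open>- x\<close> retracts onto \<open>G\<close>, and
  killing \<open>G\<close> and \<open>H\<close> maps \<open>P\<close> to the dgla \<open>s\<^sup>x\<close>, which has nothing in degree \<open>0\<close>.  Hence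
  \<open>\<xi> \<mapsto> \<xi> - x\<close> on \<open>G\<close> and \<open>\<xi> \<mapsto> \<xi>\<close> on \<open>H\<close> induce an injection from the disjoint union of the moduli sets
  of \<open>G\<close> and \<open>H\<close> to that of \<open>P\<close>.

  For surjectivity, the coefficient of \<open>x\<close> in a Maurer--Cartan element \<open>\<zeta>\<close> of \<open>P\<close> is \<open>0\<close> or \<open>- 1\<close>, and the two
  cases are exchanged by twisting with \<open>- x\<close> and swapping \<open>G\<close> and \<open>H\<close>.  If the coefficient vanishes, an explicit path
  joins \<open>\<zeta>\<close> to an element of \<open>H\<close>.  It is built from a contraction \<open>s\<close> of \<open>P\<close> onto \<open>H\<close>, and \<open>s\<close> is obtained from
  the universal property alone: a Fox derivative \<open>\<sigma>\<close> on \<open>P\<close> with \<open>x \<mapsto> y\<close> and \<open>G, H \<mapsto> 0\<close> takes values in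
  functions \<open>U P \<rightarrow> P\<close>, where \<open>y\<close> is the Eulerian idempotent \<open>U P \<rightarrow> P\<close>, and \<open>s\<close> is its value at \<open>1\<close>.
  Evaluating \<open>\<sigma>\<close> on elements of \<open>P\<close> also measures the failure of \<open>s\<close> to be a derivation.
\<close>

text \<open>The disjoint product is known only through maps out of it, so a statement about all of
  \<open>P\<close> has to be the existence of a map into some complete dgla, or a minimality
  argument (closed sub-dgla, least filtration). A contraction is neither a dgla map nor a
  derivation; it becomes a component of a dgla map once the target contains a module that also
  records its defect. That target must be an inverse limit of finite-dimensional nilpotent dglas,
  which is why the functions in the module are required to respect filtrations.

  The path is a gauge flow along \<open>s z\<close>. With \<kappa> = z - e z, for the projection e
  onto H, the flow of a Maurer--Cartan element gives \<kappa>' = - \<kappa> + (1 - e) Q \<kappa>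
  \<kappa>, so \<kappa> decays like exp(- \<tau>) without reaching 0. In the time t with 1 - t =
  exp(- \<tau>) and for \<kappa> = (1 - t) m the equation becomes m' = (1 - e) Q m m, which is
  regular, and the retract is reached at t = 1. Convergence there comes from a weight filtration in
  which the coefficient of t^k has weight at least k.\<close>

lemma ksign_add: "ksign (m + n) = ksign m * ksign n"
  and ksign_diff: "ksign (m - n) = ksign m * ksign n"
  and ksign_uminus: "ksign (- n) = ksign n"
  and ksign_square: "ksign n * ksign n = 1"
  by (auto simp: ksign_def)

section \<open>Functions on words\<close>

context dgla
begin

lemma gr_zero: "0 \<in> gr G n" by (rule gr_closed)
lemma gr_add: "\<lbrakk>x \<in> gr G n; y \<in> gr G n\<rbrakk> \<Longrightarrow> x + y \<in> gr G n" by (rule gr_closed)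
lemma gr_diff: "\<lbrakk>x \<in> gr G n; y \<in> gr G n\<rbrakk> \<Longrightarrow> x - y \<in> gr G n" by (rule gr_closed)
lemma gr_smul: "x \<in> gr G n \<Longrightarrow> smul G c x \<in> gr G n" by (rule gr_closed)
lemma gr_uminus: "x \<in> gr G n \<Longrightarrow> - x \<in> gr G n" using gr_diff[OF gr_zero] by simp
lemma gr_sum: "(\<And>i. i \<in> A \<Longrightarrow> f i \<in> gr G n) \<Longrightarrow> sum f A \<in> gr G n"
  by (induction A rule: infinite_finite_induct) (auto intro: gr_zero gr_add)

lemma brk_zero_left: "y \<in> gr G n \<Longrightarrow> brk G m n 0 y = 0"
  using brk_diff_left[of 0 m 0 y n] gr_zero by simp
lemma brk_zero_right: "x \<in> gr G m \<Longrightarrow> brk G m n x 0 = 0"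
  using brk_diff_right[of x m 0 n 0] gr_zero by simp
lemma brk_uminus_left: "\<lbrakk>x \<in> gr G m; y \<in> gr G n\<rbrakk> \<Longrightarrow> brk G m n (- x) y = - brk G m n x y"
  using brk_diff_left[of 0 m x y n] gr_zero brk_zero_left by simp
lemma brk_uminus_right: "\<lbrakk>x \<in> gr G m; y \<in> gr G n\<rbrakk> \<Longrightarrow> brk G m n x (- y) = - brk G m n x y"
  using brk_diff_right[of x m 0 n y] gr_zero brk_zero_right by simp
lemma dif_zero: "dif G n 0 = 0"
  using dif_diff[of 0 n 0] gr_zero by simp
lemma dif_uminus: "x \<in> gr G n \<Longrightarrow> dif G n (- x) = - dif G n x"
  using dif_diff[of 0 n x] gr_zero dif_zero by simp
lemma brk_sum_right:
  assumes "x \<in> gr G m" "\<And>i. i \<in> A \<Longrightarrow> f i \<in> gr G n"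
  shows "brk G m n x (sum f A) = (\<Sum>i\<in>A. brk G m n x (f i))"
  using assms(2) by (induction A rule: infinite_finite_induct)
    (auto simp: brk_zero_right assms(1) brk_add_right gr_sum)
lemma brk_sum_left:
  assumes "\<And>i. i \<in> A \<Longrightarrow> f i \<in> gr G m" "y \<in> gr G n"
  shows "brk G m n (sum f A) y = (\<Sum>i\<in>A. brk G m n (f i) y)"
  using assms(1) by (induction A rule: infinite_finite_induct)
    (auto simp: brk_zero_left assms(2) brk_add_left gr_sum)
lemma dif_sum: "(\<And>i. i \<in> A \<Longrightarrow> f i \<in> gr G n) \<Longrightarrow> dif G n (sum f A) = (\<Sum>i\<in>A. dif G n (f i))"
  by (induction A rule: infinite_finite_induct) (auto simp: dif_zero dif_add gr_sum)

definition homog :: "(int \<times> 'a) list \<Rightarrow> bool"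
  where "homog w \<longleftrightarrow> (\<forall>(d, a) \<in> set w. a \<in> gr G d)"

definition wdeg :: "(int \<times> 'a) list \<Rightarrow> int"
  where "wdeg w = sum_list (map fst w)"

text \<open>Letters carry their degrees because the grading of \<open>G\<close> is external.
  Functions are 0 on words that are not homogeneous, so that identities between functions of degree
  \<open>N\<close> are plain equations.\<close>

definition LF :: "int \<Rightarrow> ((int \<times> 'a) list \<Rightarrow> 'a) set"
  where "LF N = {F. \<forall>w. if homog w then F w \<in> gr G (N + wdeg w) else F w = 0}"

text \<open>With the word \<open>a1 ... an\<close> read as the product \<open>an ... a1\<close>,
  prefixing \<open>a\<close> is the right translation \<open>u \<mapsto> u a\<close>; on functions
  on U G the shifts thus form a left module structure.\<close>

definition shift :: "int \<Rightarrow> 'a \<Rightarrow> ((int \<times> 'a) list \<Rightarrow> 'a) \<Rightarrow> (int \<times> 'a) list \<Rightarrow> 'a"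
  where "shift d a F = (\<lambda>w. F ((d, a) # w))"

definition scl :: "'k \<Rightarrow> ((int \<times> 'a) list \<Rightarrow> 'a) \<Rightarrow> (int \<times> 'a) list \<Rightarrow> 'a"
  where "scl c F = (\<lambda>w. smul G c (F w))"

text \<open>The bracket of functions on words makes all shift operators graded derivations: it is the
  convolution bracket for the unshuffle coproduct, given by its Leibniz recursion.\<close>

fun br :: "int \<Rightarrow> int \<Rightarrow> ((int \<times> 'a) list \<Rightarrow> 'a) \<Rightarrow> ((int \<times> 'a) list \<Rightarrow> 'a) \<Rightarrow> (int \<times> 'a) list \<Rightarrow> 'a"
  where
    "br N M F H [] = brk G N M (F []) (H [])"
  | "br N M F H ((d, a) # w) = br (N + d) M (shift d a F) H w +
       smul G (ksign (d * N)) (br N (M + d) F (shift d a H) w)"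

text \<open>Makes all bracket lemmas of \<open>dgla\<close> available for functions on words. The
  differential is set to 0 because derivations of \<open>G\<close>, including \<open>dif G\<close>,
  act on functions separately through \<open>dl\<close>.\<close>

definition LL :: "('k, (int \<times> 'a) list \<Rightarrow> 'a) dgla_data"
  where "LL = \<lparr>smul = scl, gr = LF, brk = br, dif = \<lambda>N F. 0\<rparr>"

lemma homog_simps [simp]: "homog []" "homog ((d, a) # w) \<longleftrightarrow> a \<in> gr G d \<and> homog w"
  "homog (u @ w) \<longleftrightarrow> homog u \<and> homog w"
  by (auto simp: homog_def)

lemma wdeg_simps [simp]: "wdeg [] = 0" "wdeg ((d, a) # w) = d + wdeg w"
  "wdeg (u @ w) = wdeg u + wdeg w"
  by (auto simp: wdeg_def)

lemma LF_shift: "F \<in> LF N \<Longrightarrow> shift d a F \<in> LF (N + d)"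
  unfolding LF_def shift_def mem_Collect_eq
proof
  fix w assume "\<forall>w. if homog w then F w \<in> gr G (N + wdeg w) else F w = 0"
  from spec[OF this, of "(d, a) # w"]
  show "if homog w then F ((d, a) # w) \<in> gr G (N + d + wdeg w) else F ((d, a) # w) = 0"
    using gr_zero by (auto simp: add.assoc split: if_splits)
qed

lemma LF_shift_invalid: "F \<in> LF N \<Longrightarrow> a \<notin> gr G d \<Longrightarrow> shift d a F = 0"
  unfolding LF_def shift_def by (auto simp: fun_eq_iff dest: spec[of _ "(d, a) # w" for w])

lemma LF_Nil: "F \<in> LF N \<Longrightarrow> F [] \<in> gr G N"
  unfolding LF_def by (auto dest: spec[of _ "[]"])

lemma LF_gr: "F \<in> LF N \<Longrightarrow> homog w \<Longrightarrow> F w \<in> gr G (N + wdeg w)"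
  unfolding LF_def by (auto dest: spec[of _ w])

lemma LF_0: "F \<in> LF N \<Longrightarrow> \<not> homog w \<Longrightarrow> F w = 0"
  unfolding LF_def by (auto dest: spec[of _ w])

lemma LF_I:
  assumes "F [] \<in> gr G N" "\<And>d a. a \<in> gr G d \<Longrightarrow> shift d a F \<in> LF (N + d)"
    "\<And>d a. a \<notin> gr G d \<Longrightarrow> shift d a F = 0"
  shows "F \<in> LF N"
  unfolding LF_def
proof (intro CollectI allI)
  fix w show "if homog w then F w \<in> gr G (N + wdeg w) else F w = 0"
  proof (cases w)
    case Nil then show ?thesis using assms by simp
  next
    case (Cons p w')
    obtain d a where p: "p = (d, a)" by force
    have e: "F w = shift d a F w'" by (simp add: Cons p shift_def)
    show ?thesis
      using LF_gr[OF assms(2)[of a d], of w'] LF_0[OF assms(2)[of a d], of w'] assms(3)[of a d]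
      unfolding e by (cases "a \<in> gr G d") (auto simp: Cons p algebra_simps)
  qed
qed

lemma LF_zero: "0 \<in> LF N" and LF_add: "F \<in> LF N \<Longrightarrow> H \<in> LF N \<Longrightarrow> F + H \<in> LF N"
  and LF_diff: "F \<in> LF N \<Longrightarrow> H \<in> LF N \<Longrightarrow> F - H \<in> LF N"
  and LF_scl: "F \<in> LF N \<Longrightarrow> scl c F \<in> LF N"
  unfolding LF_def scl_def by (auto simp: gr_closed)

lemma scl_simps [simp]: "scl 1 F = F" "scl (-1) F = - F" "scl (- c) F = - scl c F" "scl c (scl c' F) = scl (c * c') F" "scl 0 F = 0" "scl c 0 = 0"
  by (auto simp: scl_def fun_eq_iff)

lemma scl_distrib: "scl c (F + H) = scl c F + scl c H" "scl c (F - H) = scl c F - scl c H" "scl c (- F) = - scl c F"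
  "scl (c + c') F = scl c F + scl c' F"
  by (auto simp: scl_def fun_eq_iff algebra_simps)

lemma shift_simps [simp]: "shift d a (F + H) = shift d a F + shift d a H"
  "shift d a (F - H) = shift d a F - shift d a H" "shift d a (- F) = - shift d a F"
  "shift d a (scl c F) = scl c (shift d a F)" "shift d a 0 = 0"
  by (auto simp: shift_def scl_def fun_eq_iff)

lemma shift_eta [simp]: "shift d a (\<lambda>w. F w + H w) = (\<lambda>w. shift d a F w + shift d a H w)"
  "shift d a (\<lambda>w. F w - H w) = (\<lambda>w. shift d a F w - shift d a H w)"
  "shift d a (\<lambda>w. 0) = (\<lambda>w. 0)" "shift d a (\<lambda>w. smul G c (F w)) = (\<lambda>w. smul G c (shift d a F w))"
  by (auto simp: shift_def fun_eq_iff)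

lemma Cons_shift: "F ((d, a) # w) = shift d a F w" by (simp add: shift_def)

lemma shift_br: "shift d a (br N M F H) =
    br (N + d) M (shift d a F) H + scl (ksign (d * N)) (br N (M + d) F (shift d a H))"
  by (auto simp: fun_eq_iff shift_def scl_def)

lemma br_zero_left': "H \<in> LF M \<Longrightarrow> br N M 0 H w = 0"
proof (induction w arbitrary: N M H)
  case Nil then show ?case by (simp add: brk_zero_left LF_Nil)
next
  case (Cons p w) then show ?case by (cases p) (simp add: LF_shift)
qed

lemma br_zero_right': "F \<in> LF N \<Longrightarrow> br N M F 0 w = 0"
proof (induction w arbitrary: N M F)
  case Nil then show ?case by (simp add: brk_zero_right LF_Nil)
next
  case (Cons p w) then show ?case by (cases p) (simp add: LF_shift)
qed

lemma br_zero: "H \<in> LF M \<Longrightarrow> br N M 0 H = 0" "F \<in> LF N \<Longrightarrow> br N M F 0 = 0"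
  using br_zero_left' br_zero_right' by (auto simp: fun_eq_iff)

lemma br_closed: 
  assumes "F \<in> LF N" "H \<in> LF M" shows "br N M F H \<in> LF (N + M)"
proof -
  have "if homog w then br N M F H w \<in> gr G (N + M + wdeg w) else br N M F H w = 0" for w
    using assms
  proof (induction w arbitrary: N M F H)
    case Nil then show ?case by (simp add: brk_closed LF_Nil)
  next
    case (Cons p w)
    obtain d a where p: "p = (d, a)" by force
    show ?case
    proof (cases "a \<in> gr G d")
      case True
      show ?thesis using Cons.IH[of "shift d a F" "N + d" H M] Cons.IH[of F N "shift d a H" "M + d"] Cons.prems
        by (auto simp: p LF_shift True gr_smul gr_add algebra_simps)
    next
      case False
      then show ?thesis using Cons.prems by (simp add: p LF_shift_invalid br_zero)
    qed
  qed
  then show ?thesis by (auto simp: LF_def)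
qed

lemma br_add_left:
  assumes "F \<in> LF N" "F' \<in> LF N" "H \<in> LF M"
  shows "br N M (F + F') H = br N M F H + br N M F' H"
proof
  fix w show "br N M (F + F') H w = (br N M F H + br N M F' H) w"
    using assms
  proof (induction w arbitrary: N M F F' H)
    case Nil then show ?case by (simp add: brk_add_left LF_Nil)
  next
    case (Cons p w)
    obtain d a where p: "p = (d, a)" by force
    show ?case using Cons by (simp add: p LF_shift algebra_simps)
  qed
qed

lemma br_scl_left:
  assumes "F \<in> LF N" "H \<in> LF M"
  shows "br N M (scl c F) H = scl c (br N M F H)"
proof
  fix w show "br N M (scl c F) H w = scl c (br N M F H) w"
    using assms
  proof (induction w arbitrary: N M F H)
    case Nil then show ?case by (simp add: brk_smul_left LF_Nil scl_def)
  next
    case (Cons p w)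
    obtain d a where p: "p = (d, a)" by force
    show ?case using Cons by (simp add: p LF_shift scl_def algebra_simps)
  qed
qed

lemma br_antisym:
  assumes "F \<in> LF N" "H \<in> LF M"
  shows "br N M F H = scl (- ksign (N * M)) (br M N H F)"
proof
  fix w show "br N M F H w = scl (- ksign (N * M)) (br M N H F) w"
    using assms
  proof (induction w arbitrary: N M F H)
    case Nil then show ?case using brk_antisym[of "F []" N "H []" M] by (simp add: LF_Nil scl_def)
  next
    case (Cons p w)
    obtain d a where p: "p = (d, a)" by force
    show ?case using Cons.IH[of "shift d a F" "N + d" H M] Cons.IH[of F N "shift d a H" "M + d"] Cons.prems
      by (cases "even d"; cases "even N"; cases "even M")
        (simp_all add: p LF_shift scl_def ksign_def add.commute)
  qed
qed

lemma br_add_right: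
  assumes "F \<in> LF N" "H \<in> LF M" "H' \<in> LF M"
  shows "br N M F (H + H') = br N M F H + br N M F H'"
  using assms by (simp add: br_antisym[of F N] LF_add br_add_left scl_distrib)

lemma br_scl_right:
  assumes "F \<in> LF N" "H \<in> LF M"
  shows "br N M F (scl c H) = scl c (br N M F H)"
  using assms by (simp add: br_antisym[of F N] LF_scl br_scl_left mult.commute scl_distrib)

text \<open>At a letter \<open>a\<close> the Leibniz recursion turns the identity into a signed sum
  of three Jacobi identities, with \<open>a\<close> shifted into \<open>F\<close>, \<open>H\<close>
  or \<open>K\<close>; on the empty word it is the Jacobi identity of \<open>G\<close>.\<close>

lemma br_Jacobi:
  assumes "F \<in> LF l" "H \<in> LF m" "K \<in> LF n"
  shows "br l (m + n) F (br m n H K) =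
    br (l + m) n (br l m F H) K + scl (ksign (l * m)) (br m (l + n) H (br l n F K))"
proof
  fix w show "br l (m + n) F (br m n H K) w =
    (br (l + m) n (br l m F H) K + scl (ksign (l * m)) (br m (l + n) H (br l n F K))) w"
    using assms
  proof (induction w arbitrary: l m n F H K)
    case Nil
    then show ?case using brk_Jacobi[of "F []" l "H []" m "K []" n] by (simp add: LF_Nil scl_def)
  next
    case (Cons p w)
    obtain d a where p: "p = (d, a)" by force
    note sh = LF_shift[OF Cons.prems(1), of d a] LF_shift[OF Cons.prems(2), of d a] LF_shift[OF Cons.prems(3), of d a]
    note IH = Cons.IH[OF sh(1) Cons.prems(2,3)] Cons.IH[OF Cons.prems(1) sh(2) Cons.prems(3)]
      Cons.IH[OF Cons.prems(1,2) sh(3)]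
    have c: "br m (n + d) H (shift d a K) \<in> LF (m + n + d)" "br (m + d) n (shift d a H) K \<in> LF (m + n + d)"
      "br l (n + d) F (shift d a K) \<in> LF (l + n + d)" "br (l + d) n (shift d a F) K \<in> LF (l + n + d)"
      "br l (m + d) F (shift d a H) \<in> LF (l + m + d)" "br (l + d) m (shift d a F) H \<in> LF (l + m + d)"
      using br_closed[OF Cons.prems(2) sh(3)] br_closed[OF sh(2) Cons.prems(3)]
        br_closed[OF Cons.prems(1) sh(3)] br_closed[OF sh(1) Cons.prems(3)]
        br_closed[OF Cons.prems(1) sh(2)] br_closed[OF sh(1) Cons.prems(2)]
      by (simp_all add: algebra_simps)
    \<comment> \<open>\<open>L\<close>, \<open>A\<close>, \<open>B\<close> stand for the three
      double brackets of the identity, the index for the argument that receives the letter.\<close>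
    define L1 L2 L3 A1 A2 A3 B1 B2 B3 where
      "L1 = br (l + d) (m + n) (shift d a F) (br m n H K) w" and
      "L2 = br l (m + n + d) F (br (m + d) n (shift d a H) K) w" and
      "L3 = br l (m + n + d) F (br m (n + d) H (shift d a K)) w" and
      "A1 = br (l + m + d) n (br (l + d) m (shift d a F) H) K w" and
      "A2 = br (l + m + d) n (br l (m + d) F (shift d a H)) K w" and
      "A3 = br (l + m) (n + d) (br l m F H) (shift d a K) w" and
      "B1 = br m (l + n + d) H (br (l + d) n (shift d a F) K) w" and
      "B2 = br (m + d) (l + n) (shift d a H) (br l n F K) w" and
      "B3 = br m (l + n + d) H (br l (n + d) F (shift d a K)) w"
    note defs = L1_def L2_def L3_def A1_def A2_def A3_def B1_def B2_def B3_def
    have e: "l + d + m = l + m + d" "l + d + n = l + n + d" "l + (m + d) = l + m + d"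
      "m + d + n = m + n + d" "m + (n + d) = m + n + d" "l + (n + d) = l + n + d" by auto
    have IH': "L1 = A1 + smul G (ksign ((l + d) * m)) B1" "L2 = A2 + smul G (ksign (l * (m + d))) B2"
      "L3 = A3 + smul G (ksign (l * m)) B3"
      using IH unfolding defs plus_fun_def scl_def e by simp_all
    have 1: "br l (m + n) F (br m n H K) (p # w) =
        L1 + smul G (ksign (d * l)) (L2 + smul G (ksign (d * m)) L3)"
      using c Cons.prems by (simp add: p shift_br br_add_right br_scl_right LF_scl defs)
        (simp add: scl_def)
    have 2: "br (l + m) n (br l m F H) K (p # w) =
        A1 + smul G (ksign (d * l)) A2 + smul G (ksign (d * (l + m))) A3"
      using c Cons.prems by (simp add: p shift_br br_add_left br_scl_left LF_scl defs)
        (simp add: scl_def)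
    have 3: "br m (l + n) H (br l n F K) (p # w) =
        B2 + smul G (ksign (d * m)) (B1 + smul G (ksign (d * l)) B3)"
      using c Cons.prems by (simp add: p shift_br br_add_right br_scl_right LF_scl defs)
        (simp add: scl_def)
    have 4: "(F1 + scl r F2) v = F1 v + smul G r (F2 v)" for F1 r F2 v
      by (simp add: scl_def)
    show ?case unfolding 4 1 2 3 IH'
      by (cases "even d"; cases "even l"; cases "even m"; cases "even n")
        (simp_all add: ksign_def algebra_simps)
  qed
qed

end

section \<open>The series \<psi>(z) = (1 - e^-z) / z and powers of ad y\<close>

definition ecoef :: "nat \<Rightarrow> 'k::field_char_0"
  where "ecoef k = (- 1) ^ k / fact (Suc k)"

lemma ecoef_0 [simp]: "ecoef 0 = 1" by (simp add: ecoef_def)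

text \<open>\<open>ecoef k\<close> is the coefficient of z^k in \<psi>(z) = (1 - e^-z) / z. The
  identity turns the binomial coefficients of \<open>adp_binomial\<close> into the Cauchy product -
  \<psi>(P) \<psi>(Q).\<close>

lemma ecoef_binomial:
  assumes "p \<le> k"
  shows "ecoef (Suc k) * of_nat (Suc (Suc k) choose Suc p) = - (ecoef p * (ecoef (k - p) :: 'k::field_char_0))"
proof -
  have "of_nat (Suc (Suc k) choose Suc p) = (fact (Suc (Suc k)) / (fact (Suc p) * fact (Suc (k - p))) :: 'k)"
    using assms by (subst binomial_fact) (auto simp: Suc_diff_le)
  moreover have "(- 1 :: 'k) ^ k = (- 1) ^ p * (- 1) ^ (k - p)"
    using assms by (simp flip: power_add)
  ultimately show ?thesis
    by (simp add: ecoef_def del: fact_Suc)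
qed

context dgla
begin

definition adp :: "'a \<Rightarrow> int \<Rightarrow> nat \<Rightarrow> 'a \<Rightarrow> 'a"
  where "adp y n k x = ((\<lambda>x. brk G 0 n y x) ^^ k) x"

lemma adp_0 [simp]: "adp y n 0 x = x" and adp_Suc: "adp y n (Suc k) x = brk G 0 n y (adp y n k x)"
  by (auto simp: adp_def)

lemma ad_closed: "y \<in> gr G 0 \<Longrightarrow> x \<in> gr G n \<Longrightarrow> brk G 0 n y x \<in> gr G n"
  using brk_closed[of y 0 x n] by simp

lemma adp_closed: "y \<in> gr G 0 \<Longrightarrow> x \<in> gr G n \<Longrightarrow> adp y n k x \<in> gr G n"
  by (induction k) (auto simp: adp_Suc ad_closed)

lemma adp_add: "\<lbrakk>y \<in> gr G 0; x \<in> gr G n; x' \<in> gr G n\<rbrakk> \<Longrightarrow> adp y n k (x + x') = adp y n k x + adp y n k x'"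
  by (induction k) (auto simp: adp_Suc brk_add_right adp_closed)

lemma adp_smul: "\<lbrakk>y \<in> gr G 0; x \<in> gr G n\<rbrakk> \<Longrightarrow> adp y n k (smul G c x) = smul G c (adp y n k x)"
  by (induction k) (auto simp: adp_Suc brk_smul_right adp_closed)

lemma adp_diff: "\<lbrakk>y \<in> gr G 0; x \<in> gr G n; x' \<in> gr G n\<rbrakk> \<Longrightarrow> adp y n k (x - x') = adp y n k x - adp y n k x'"
  by (induction k) (auto simp: adp_Suc brk_diff_right adp_closed)

lemma adp_uminus: "\<lbrakk>y \<in> gr G 0; x \<in> gr G n\<rbrakk> \<Longrightarrow> adp y n k (- x) = - adp y n k x"
  using adp_smul[of y x n k "- 1"] by simp

lemma ad_brk:
  assumes "y \<in> gr G 0" "u \<in> gr G m" "v \<in> gr G n"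
  shows "brk G 0 (m + n) y (brk G m n u v) = brk G m n (brk G 0 m y u) v + brk G m n u (brk G 0 n y v)"
  using brk_Jacobi[OF assms] by (simp add: ksign_def)

text \<open>Only the Leibniz rule against \<open>y\<close> is assumed, with \<open>z\<close> in the
  role of \<Delta> y; this covers both shifts and the operators \<open>dl\<close>. No sign appears
  since \<open>y\<close> has degree 0.\<close>

lemma adp_derivation:
  assumes y: "y \<in> gr G 0" and z: "z \<in> gr G r" and F: "F \<in> gr G n"
    and \<Delta>: "\<And>F. F \<in> gr G n \<Longrightarrow> \<Delta> F \<in> gr G (r + n)"
      "\<And>F. F \<in> gr G n \<Longrightarrow> \<Delta> (brk G 0 n y F) = brk G r n z F + brk G 0 (r + n) y (\<Delta> F)"
  shows "\<Delta> (adp y n k F) = adp y (r + n) k (\<Delta> F) +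
    (\<Sum>i<k. adp y (r + n) i (brk G r n z (adp y n (k - Suc i) F)))"
proof (induction k)
  case (Suc k)
  have "\<Delta> (adp y n (Suc k) F) = brk G r n z (adp y n k F) + brk G 0 (r + n) y (\<Delta> (adp y n k F))"
    by (simp add: adp_Suc \<Delta> adp_closed y F)
  also have "brk G 0 (r + n) y (\<Delta> (adp y n k F)) = adp y (r + n) (Suc k) (\<Delta> F) +
      (\<Sum>i<k. adp y (r + n) (Suc i) (brk G r n z (adp y n (k - Suc i) F)))"
    using F y z unfolding Suc.IH adp_Suc
    by (subst brk_add_right) (auto simp: \<Delta> adp_closed brk_closed gr_sum brk_sum_right)
  finally show ?case
    by (simp add: sum.lessThan_Suc_shift algebra_simps del: sum.lessThan_Suc)
qed simp

text \<open>The generating function identity behind this is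
  \<open>(\<psi>(P + Q) - \<psi>(Q)) / P + (\<psi>(P + Q) - \<psi>(P)) / Q = - \<psi>(P) \<psi>(Q)\<close> for \<open>\<psi>(z) = (1 - e\<^sup>-\<^sup>z) / z\<close>.\<close>

lemma adp_binomial:
  assumes y: "y \<in> gr G 0" and A: "A \<in> gr G m" and B: "B \<in> gr G n"
  shows "(\<Sum>i<Suc k. adp y (m + n) i (brk G m n A (adp y n (k - i) B) + brk G m n (adp y m (k - i) A) B)) =
    (\<Sum>p\<le>k. smul G (of_nat (Suc (Suc k) choose Suc p)) (brk G m n (adp y m p A) (adp y n (k - p) B)))"
proof (induction k)
  case 0
  have "smul G 2 v = v + v" for v using scale_left_distrib[of 1 1 v] by simp
  then show ?case by (simp add: numeral_2_eq_2)
next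
  case (Suc k)
  \<comment> \<open>With P and Q for ad y acting on the first and second argument,
    \<open>f p q\<close> is P^p Q^q [A, B], and ad y acts on it as P + Q.\<close>
  define f where "f p q = brk G m n (adp y m p A) (adp y n q B)" for p q
  have fgr: "f p q \<in> gr G (m + n)" for p q unfolding f_def using assms by (intro brk_closed adp_closed)
  have adf: "brk G 0 (m + n) y (f p q) = f (Suc p) q + f p (Suc q)" for p q
    using ad_brk[OF y adp_closed[OF y A] adp_closed[OF y B]] by (simp add: f_def adp_Suc)
  have "(\<Sum>i<Suc (Suc k). adp y (m + n) i (f 0 (Suc k - i) + f (Suc k - i) 0)) =
      f 0 (Suc k) + f (Suc k) 0 + brk G 0 (m + n) y (\<Sum>i<Suc k. adp y (m + n) i (f 0 (k - i) + f (k - i) 0))"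
    using y fgr by (subst sum.lessThan_Suc_shift, subst brk_sum_right)
      (auto simp: adp_Suc gr_add adp_closed simp del: sum.lessThan_Suc)
  also have "(\<Sum>i<Suc k. adp y (m + n) i (f 0 (k - i) + f (k - i) 0)) =
      (\<Sum>p\<le>k. smul G (of_nat (Suc (Suc k) choose Suc p)) (f p (k - p)))"
    using Suc.IH by (simp add: f_def)
  also have "brk G 0 (m + n) y \<dots> =
      (\<Sum>p\<le>k. smul G (of_nat (Suc (Suc k) choose Suc p)) (f (Suc p) (k - p) + f p (Suc (k - p))))"
    using y fgr by (subst brk_sum_right) (auto simp: gr_smul brk_smul_right adf)
  also have "f 0 (Suc k) + f (Suc k) 0 + \<dots> =
      (smul G (of_nat (Suc (Suc k) choose 0)) (f 0 (Suc k)) +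
        (\<Sum>p\<le>k. smul G (of_nat (Suc (Suc k) choose Suc p)) (f (Suc p) (Suc k - Suc p)))) +
      ((\<Sum>p\<le>k. smul G (of_nat (Suc (Suc k) choose Suc p)) (f p (Suc k - p))) +
        smul G (of_nat (Suc (Suc k) choose Suc (Suc k))) (f (Suc k) 0))"
    by (simp add: scale_right_distrib sum.distrib Suc_diff_le del: binomial_Suc_Suc cong: sum.cong_simp)
  \<comment> \<open>The two boundary terms complete the sums, which Pascal's rule then
    merges.\<close>
  also have "\<dots> = (\<Sum>p\<le>Suc k. smul G (of_nat (Suc (Suc k) choose p)) (f p (Suc k - p))) +
      (\<Sum>p\<le>Suc k. smul G (of_nat (Suc (Suc k) choose Suc p)) (f p (Suc k - p)))"
    unfolding sum.atMost_Suc_shift[of "\<lambda>p. smul G (of_nat (Suc (Suc k) choose p)) (f p (Suc k - p))"]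
    by (simp add: Suc_diff_le del: binomial_Suc_Suc cong: sum.cong_simp)
  also have "\<dots> = (\<Sum>p\<le>Suc k. smul G (of_nat (Suc (Suc (Suc k)) choose Suc p)) (f p (Suc k - p)))"
    by (simp only: binomial_Suc_Suc[of "Suc (Suc k)"] of_nat_add scale_left_distrib sum.distrib)
  finally show ?case by (simp add: f_def)
qed

text \<open>With \<open>ecoef_binomial\<close> the generating function identity takes the form in
  which it is applied, truncated at total degree \<open>N\<close> in ad y.\<close>

lemma adp_ecoef:
  assumes y: "y \<in> gr G 0" and A: "A \<in> gr G m" and B: "B \<in> gr G n"
  shows "(\<Sum>k\<le>N. smul G (ecoef (Suc k))
      (\<Sum>i<Suc k. adp y (m + n) i (brk G m n A (adp y n (k - i) B) + brk G m n (adp y m (k - i) A) B))) =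
    - (\<Sum>k\<le>N. \<Sum>p\<le>k. smul G (ecoef p * ecoef (k - p)) (brk G m n (adp y m p A) (adp y n (k - p) B)))"
  unfolding adp_binomial[OF assms]
  by (simp add: scale_sum_right ecoef_binomial sum_negf del: binomial_Suc_Suc cong: sum.cong_simp)

lemma dgla_LL: "dgla LL"
proof -
  have LL: "smul LL = scl" "gr LL = LF" "brk LL = br" "dif LL = (\<lambda>N F. 0)" by (simp_all add: LL_def)
  interpret vs: vector_space "smul LL"
    by unfold_locales (auto simp: LL scl_distrib)
  show ?thesis
  proof (unfold_locales, unfold LL, goal_cases)
    case (1 n) show ?case
      using LF_zero LF_add LF_scl by (simp add: vs.subspace_def[unfolded LL])
  next
    case 5 then show ?case by (rule br_antisym)
  next
    case 6 then show ?case by (rule br_Jacobi)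
  qed (simp_all add: LF_zero br_closed br_add_left br_scl_left scl_distrib LF_add LF_scl br_zero)
qed

end

section \<open>Derivations extended to functions on words\<close>

context dgla
begin

interpretation LL: dgla LL
  rewrites "smul LL = scl" and "gr LL = LF" and "brk LL = br"
  by (rule dgla_LL) (simp_all add: LL_def)

definition derivation :: "(int \<Rightarrow> 'a \<Rightarrow> 'a) \<Rightarrow> int \<Rightarrow> bool"
  where "derivation D r \<longleftrightarrow>
    (\<forall>n. \<forall>x \<in> gr G n. D n x \<in> gr G (r + n)) \<and>
    (\<forall>n. \<forall>x \<in> gr G n. \<forall>y \<in> gr G n. D n (x + y) = D n x + D n y) \<and>
    (\<forall>n c. \<forall>x \<in> gr G n. D n (smul G c x) = smul G c (D n x)) \<and>
    (\<forall>m n. \<forall>x \<in> gr G m. \<forall>y \<in> gr G n. D (m + n) (brk G m n x y) =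
      brk G (r + m) n (D m x) y + smul G (ksign (r * m)) (brk G m (r + n) x (D n y)))"

lemma derivationD:
  assumes "derivation D r"
  shows "x \<in> gr G n \<Longrightarrow> D n x \<in> gr G (r + n)"
    and "x \<in> gr G n \<Longrightarrow> y \<in> gr G n \<Longrightarrow> D n (x + y) = D n x + D n y"
    and "x \<in> gr G n \<Longrightarrow> D n (smul G c x) = smul G c (D n x)"
    and "x \<in> gr G m \<Longrightarrow> y \<in> gr G n \<Longrightarrow> D (m + n) (brk G m n x y) =
      brk G (r + m) n (D m x) y + smul G (ksign (r * m)) (brk G m (r + n) x (D n y))"
    and "D n 0 = 0"
proof -
  show "D n 0 = 0"
    using assms gr_zero unfolding derivation_def by (metis scale_zero_left)
qed (use assms in \<open>auto simp: derivation_def\<close>)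

lemma derivation_ad: "b \<in> gr G r \<Longrightarrow> derivation (\<lambda>n. brk G r n b) r"
  unfolding derivation_def
  using brk_Jacobi[of b r] by (auto simp: brk_closed brk_add_right brk_smul_right)

lemma derivation_dif: "derivation (dif G) (- 1)"
  unfolding derivation_def
  using dif_closed dif_add dif_smul dif_brk by (auto simp: ksign_uminus)

text \<open>The operator \<open>dl D r N\<close> is the canonical extension of the derivation \<open>D\<close> of degree \<open>r\<close> to
  functions of degree \<open>N\<close>: \<open>D F - \<Sum>\<^sub>i \<plusminus> F(\<dots>, D a\<^sub>i, \<dots>)\<close>.\<close>

fun dl :: "(int \<Rightarrow> 'a \<Rightarrow> 'a) \<Rightarrow> int \<Rightarrow> int \<Rightarrow> ((int \<times> 'a) list \<Rightarrow> 'a) \<Rightarrow> (int \<times> 'a) list \<Rightarrow> 'a"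
  where
    "dl D r N F [] = D N (F [])"
  | "dl D r N F ((d, a) # w) = (if a \<in> gr G d
       then smul G (ksign (r * d)) (dl D r (N + d) (shift d a F) w - F ((r + d, D d a) # w)) else 0)"

lemma shift_dl: "a \<in> gr G d \<Longrightarrow> shift d a (dl D r N F) =
    scl (ksign (r * d)) (dl D r (N + d) (shift d a F) - shift (r + d) (D d a) F)"
  and shift_dl_invalid: "a \<notin> gr G d \<Longrightarrow> shift d a (dl D r N F) = 0"
  by (auto simp: shift_def scl_def fun_eq_iff)

lemma dl_shift:
  assumes "a \<in> gr G d"
  shows "dl D r (N + d) (shift d a F) =
    scl (ksign (r * d)) (shift d a (dl D r N F)) + shift (r + d) (D d a) F"
  using assms by (simp add: shift_dl ksign_square)

lemma dl_closed:
  assumes D: "derivation D r" and F: "F \<in> LF N"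
  shows "dl D r N F \<in> LF (r + N)"
proof -
  have "if homog w then dl D r N F w \<in> gr G (r + N + wdeg w) else dl D r N F w = 0" for w
    using F
  proof (induction w arbitrary: N F)
    case Nil then show ?case by (simp add: derivationD[OF D] LF_Nil)
  next
    case (Cons p w)
    obtain d a where p: "p = (d, a)" by force
    note 1 = Cons.IH[OF LF_shift[OF Cons.prems, of d a]]
    show ?case
      using 1 LF_gr[OF Cons.prems, of "(r + d, D d a) # w"] LF_0[OF Cons.prems, of "(r + d, D d a) # w"]
        derivationD(1)[OF D, of a d]
      by (auto simp: p algebra_simps intro!: gr_smul gr_diff split: if_splits)
  qed
  then show ?thesis by (auto simp: LF_def)
qed

lemma dl_add:
  assumes D: "derivation D r" and "F \<in> LF N" "H \<in> LF N"
  shows "dl D r N (F + H) = dl D r N F + dl D r N H"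
proof
  fix w show "dl D r N (F + H) w = (dl D r N F + dl D r N H) w"
    using assms(2,3)
  proof (induction w arbitrary: N F H)
    case Nil then show ?case by (simp add: derivationD[OF D] LF_Nil)
  next
    case (Cons p w)
    obtain d a where p: "p = (d, a)" by force
    show ?case using Cons.IH[of "shift d a F" "N + d" "shift d a H"] Cons.prems
      by (simp add: p LF_shift plus_fun_def algebra_simps)
  qed
qed

lemma dl_scl:
  assumes D: "derivation D r" and "F \<in> LF N"
  shows "dl D r N (scl c F) = scl c (dl D r N F)"
proof
  fix w show "dl D r N (scl c F) w = scl c (dl D r N F) w"
    using assms(2)
  proof (induction w arbitrary: N F)
    case Nil then show ?case by (simp add: derivationD[OF D] LF_Nil scl_def)
  next
    case (Cons p w)
    obtain d a where p: "p = (d, a)" by force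
    show ?case using Cons.IH[of "shift d a F" "N + d"] Cons.prems
      by (simp add: p LF_shift scl_def algebra_simps)
  qed
qed

lemma dl_diff:
  assumes D: "derivation D r" and "F \<in> LF N" "H \<in> LF N"
  shows "dl D r N (F - H) = dl D r N F - dl D r N H"
  using dl_add[OF D, of "F - H" N H] assms by (simp add: LF_diff algebra_simps)

text \<open>Induction on the word: shifts are derivations of \<open>br\<close>, and their
  commutators with \<open>dl\<close> are shifts again. The terms \<open>C1\<close> and
  \<open>C2\<close> come from the letter \<open>D d a\<close>.\<close>

lemma dl_br:
  assumes D: "derivation D r" and "F \<in> LF N" "H \<in> LF M"
  shows "dl D r (N + M) (br N M F H) =
    br (r + N) M (dl D r N F) H + scl (ksign (r * N)) (br N (r + M) F (dl D r M H))"
proof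
  fix w show "dl D r (N + M) (br N M F H) w =
    (br (r + N) M (dl D r N F) H + scl (ksign (r * N)) (br N (r + M) F (dl D r M H))) w"
    using assms(2,3)
  proof (induction w arbitrary: N M F H)
    case Nil then show ?case using derivationD[OF D] by (simp add: LF_Nil scl_def)
  next
    case (Cons p w)
    obtain d a where p: "p = (d, a)" by force
    note F = Cons.prems(1) and H = Cons.prems(2)
    show ?case
    proof (cases "a \<in> gr G d")
      case False
      then show ?thesis using F H
        by (simp add: p LF_shift_invalid shift_dl_invalid br_zero dl_closed[OF D] scl_def)
    next
      case True
      let ?F = "shift d a F" and ?H = "shift d a H"
        and ?F' = "shift (r + d) (D d a) F" and ?H' = "shift (r + d) (D d a) H"
      have sF: "?F \<in> LF (N + d)" "?F' \<in> LF (r + N + d)" and sH: "?H \<in> LF (M + d)" "?H' \<in> LF (r + M + d)"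
        using LF_shift[OF F, of d] LF_shift[OF H, of d] LF_shift[OF F, of "r + d"] LF_shift[OF H, of "r + d"]
        by (simp_all add: algebra_simps)
      have dF: "dl D r N F \<in> LF (r + N)" "dl D r (N + d) ?F \<in> LF (r + N + d)"
        and dH: "dl D r M H \<in> LF (r + M)" "dl D r (M + d) ?H \<in> LF (r + M + d)"
        using dl_closed[OF D F] dl_closed[OF D sF(1)] dl_closed[OF D H] dl_closed[OF D sH(1)]
        by (simp_all add: algebra_simps)
      have c: "br (N + d) M ?F H \<in> LF (N + M + d)" "br N (M + d) F ?H \<in> LF (N + M + d)"
        using br_closed[OF sF(1) H] br_closed[OF F sH(1)] by (simp_all add: algebra_simps)
      define A1 A2 B1 B2 C1 C2 where
        "A1 = br (r + N + d) M (dl D r (N + d) ?F) H w" and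
        "A2 = br (N + d) (r + M) ?F (dl D r M H) w" and
        "B1 = br (r + N) (M + d) (dl D r N F) ?H w" and
        "B2 = br N (r + M + d) F (dl D r (M + d) ?H) w" and
        "C1 = br (r + N + d) M ?F' H w" and
        "C2 = br N (r + M + d) F ?H' w"
      note defs = A1_def A2_def B1_def B2_def C1_def C2_def
      have e: "N + d + M = N + M + d" "N + (M + d) = N + M + d" "r + (N + d) = r + N + d"
        "r + (M + d) = r + M + d" "N + (r + d) = r + N + d" "M + (r + d) = r + M + d" by auto
      have IH: "dl D r (N + M + d) (br (N + d) M ?F H) w = A1 + smul G (ksign (r * (N + d))) A2"
        "dl D r (N + M + d) (br N (M + d) F ?H) w = B1 + smul G (ksign (r * N)) B2"
        using Cons.IH[OF sF(1) H] Cons.IH[OF F sH(1)] unfolding plus_fun_def scl_def e defs by simp_all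
      have 1: "dl D r (N + M) (br N M F H) (p # w) = smul G (ksign (r * d))
          (A1 + smul G (ksign (r * (N + d))) A2 + smul G (ksign (d * N)) (B1 + smul G (ksign (r * N)) B2)
           - (C1 + smul G (ksign ((r + d) * N)) C2))"
        using True c by (simp add: p shift_br dl_add[OF D] dl_scl[OF D] LF_scl)
          (simp add: IH scl_def e defs)
      have 2: "br (r + N) M (dl D r N F) H (p # w) = smul G (ksign (r * d)) (A1 - C1)
          + smul G (ksign (d * (r + N))) B1"
        using True sF sH dF dH F H by (simp add: p shift_dl br_scl_left LL.brk_diff_left LF_diff defs)
          (simp add: scl_def scale_right_diff_distrib)
      have 3: "br N (r + M) F (dl D r M H) (p # w) = A2 + smul G (ksign (d * N)) (smul G (ksign (r * d)) (B2 - C2))"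
        using True sF sH dF dH F H by (simp add: p shift_dl br_scl_right LL.brk_diff_right LF_diff defs)
          (simp add: scl_def scale_right_diff_distrib)
      have 4: "(F1 + scl r F2) v = F1 v + smul G r (F2 v)" for F1 r F2 v
        by (simp add: scl_def)
      show ?thesis unfolding 4 1 2 3
        by (cases "even d"; cases "even N"; cases "even r") (simp_all add: ksign_def algebra_simps)
    qed
  qed
qed

section \<open>Multilinear functions on words\<close>

definition lin1 :: "((int \<times> 'a) list \<Rightarrow> 'a) \<Rightarrow> bool"
  where "lin1 F \<longleftrightarrow>
    (\<forall>d. \<forall>a \<in> gr G d. \<forall>b \<in> gr G d. shift d (a + b) F = shift d a F + shift d b F) \<and>
    (\<forall>d c. \<forall>a \<in> gr G d. shift d (smul G c a) F = scl c (shift d a F))"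

fun lin :: "nat \<Rightarrow> ((int \<times> 'a) list \<Rightarrow> 'a) \<Rightarrow> bool"
  where "lin 0 F = True"
  | "lin (Suc n) F \<longleftrightarrow> lin1 F \<and> (\<forall>d. \<forall>a \<in> gr G d. lin n (shift d a F))"

definition multilinear :: "((int \<times> 'a) list \<Rightarrow> 'a) \<Rightarrow> bool"
  where "multilinear F \<longleftrightarrow> (\<forall>n. lin n F)"

lemma lin1_add: "lin1 F \<Longrightarrow> lin1 H \<Longrightarrow> lin1 (F + H)"
  and lin1_diff: "lin1 F \<Longrightarrow> lin1 H \<Longrightarrow> lin1 (F - H)"
  and lin1_scl: "lin1 F \<Longrightarrow> lin1 (scl c F)" and lin1_zero: "lin1 0"
  unfolding lin1_def by (simp_all add: scl_distrib mult.commute)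

lemma lin1_diff_arg: "lin1 F \<Longrightarrow> a \<in> gr G d \<Longrightarrow> b \<in> gr G d \<Longrightarrow> shift d (a - b) F = shift d a F - shift d b F"
  unfolding lin1_def using gr_diff[of a d b] by (metis add_diff_cancel diff_add_cancel)

lemma lin_add: "lin n F \<Longrightarrow> lin n H \<Longrightarrow> lin n (F + H)"
  by (induction n arbitrary: F H) (auto simp: lin1_add)
lemma lin_diff: "lin n F \<Longrightarrow> lin n H \<Longrightarrow> lin n (F - H)"
  by (induction n arbitrary: F H) (auto simp: lin1_diff)
lemma lin_scl: "lin n F \<Longrightarrow> lin n (scl c F)"
  by (induction n arbitrary: F) (auto simp: lin1_scl)
lemma lin_zero: "lin n 0"
  by (induction n) (use lin1_zero in \<open>auto simp: zero_fun_def\<close>)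
lemma lin_Suc: "lin (Suc n) F \<Longrightarrow> lin n F"
  by (induction n arbitrary: F) auto
lemma lin_sum: "(\<And>i. i \<in> A \<Longrightarrow> lin n (f i)) \<Longrightarrow> lin n (sum f A)"
  by (induction A rule: infinite_finite_induct) (auto intro: lin_zero lin_add)

lemma multilinear_shift: "multilinear F \<Longrightarrow> a \<in> gr G d \<Longrightarrow> multilinear (shift d a F)"
  unfolding multilinear_def by (metis lin.simps(2))

lemma multilinear_lin1: "multilinear F \<Longrightarrow> lin1 F"
  unfolding multilinear_def by (metis lin.simps(2))

lemma lin_br: "lin n F \<Longrightarrow> lin n H \<Longrightarrow> F \<in> LF N \<Longrightarrow> H \<in> LF M \<Longrightarrow> lin n (br N M F H)"
proof (induction n arbitrary: F H N M)
  case (Suc n)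
  note F = Suc.prems(3) and H = Suc.prems(4)
  have s: "lin n F" "lin n H" using Suc.prems lin_Suc by blast+
  have "lin1 (br N M F H)"
    unfolding lin1_def
  proof (intro conjI allI ballI)
    fix d a b assume ab: "a \<in> gr G d" "b \<in> gr G d"
    then have "shift d (a + b) F = shift d a F + shift d b F" "shift d (a + b) H = shift d a H + shift d b H"
      using Suc.prems by (auto simp: lin1_def)
    then show "shift d (a + b) (br N M F H) = shift d a (br N M F H) + shift d b (br N M F H)"
      by (simp add: shift_br LF_shift[OF F] LF_shift[OF H] F H br_add_left br_add_right scl_distrib)
  next
    fix d c a assume a: "a \<in> gr G d"
    then have "shift d (smul G c a) F = scl c (shift d a F)" "shift d (smul G c a) H = scl c (shift d a H)"
      using Suc.prems by (auto simp: lin1_def)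
    then show "shift d (smul G c a) (br N M F H) = scl c (shift d a (br N M F H))"
      by (simp add: shift_br LF_shift[OF F] LF_shift[OF H] F H br_scl_left br_scl_right scl_distrib mult.commute)
  qed
  moreover have "lin n (shift d a (br N M F H))" if "a \<in> gr G d" for d a
    using Suc.prems that s F H unfolding shift_br
    by (intro lin_add lin_scl Suc.IH) (auto simp: LF_shift)
  ultimately show ?case by simp
qed simp

lemma lin_dl:
  assumes D: "derivation D r"
  shows "lin (Suc n) F \<Longrightarrow> F \<in> LF N \<Longrightarrow> lin n (dl D r N F)"
proof (induction n arbitrary: F N)
  case (Suc n)
  note F = Suc.prems(2)
  have sF: "shift (r + d) b F \<in> LF (r + N + d)" for d b using LF_shift[OF F, of "r + d" b] by (simp add: algebra_simps)
  have "lin1 (dl D r N F)"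
    unfolding lin1_def
  proof (intro conjI allI ballI)
    fix d a b assume ab: "a \<in> gr G d" "b \<in> gr G d"
    then have "shift d (a + b) F = shift d a F + shift d b F"
      "shift (r + d) (D d a + D d b) F = shift (r + d) (D d a) F + shift (r + d) (D d b) F"
      using Suc.prems derivationD(1)[OF D] by (auto simp: lin1_def)
    then show "shift d (a + b) (dl D r N F) = shift d a (dl D r N F) + shift d b (dl D r N F)"
      using ab by (simp add: shift_dl gr_add derivationD(2)[OF D] dl_add[OF D] LF_shift[OF F] scl_distrib)
  next
    fix d c a assume a: "a \<in> gr G d"
    then have "shift d (smul G c a) F = scl c (shift d a F)"
      "shift (r + d) (smul G c (D d a)) F = scl c (shift (r + d) (D d a) F)"
      using Suc.prems derivationD(1)[OF D] by (auto simp: lin1_def)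
    then show "shift d (smul G c a) (dl D r N F) = scl c (shift d a (dl D r N F))"
      using a by (simp add: shift_dl gr_smul derivationD(3)[OF D] dl_scl[OF D] LF_shift[OF F] scl_distrib mult.commute)
  qed
  moreover have "lin n (shift d a (dl D r N F))" if a: "a \<in> gr G d" for d a
  proof -
    have "lin n (shift (r + d) (D d a) F)" using Suc.prems derivationD(1)[OF D a] lin_Suc by auto
    moreover have "lin n (dl D r (N + d) (shift d a F))"
      using Suc.prems a by (intro Suc.IH LF_shift) auto
    ultimately show ?thesis using a by (simp add: shift_dl lin_scl lin_diff)
  qed
  ultimately show ?case by simp
qed simp

text \<open>Extension to functions preserves commutators. Multilinearity is needed because the
  letter \<open>D3 d a\<close> is a difference, on which \<open>F\<close> has to split.\<close>

lemma dl_commutator: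
  assumes D1: "derivation D1 r1" and D2: "derivation D2 r2"
    and D3: "\<And>n x. x \<in> gr G n \<Longrightarrow>
      D1 (r2 + n) (D2 n x) - smul G (ksign (r1 * r2)) (D2 (r1 + n) (D1 n x)) = D3 n x"
    and F: "F \<in> LF N" and lin: "multilinear F"
  shows "dl D1 r1 (r2 + N) (dl D2 r2 N F) - scl (ksign (r1 * r2)) (dl D2 r2 (r1 + N) (dl D1 r1 N F)) =
    dl D3 (r1 + r2) N F"
proof
  fix w show "(dl D1 r1 (r2 + N) (dl D2 r2 N F) - scl (ksign (r1 * r2)) (dl D2 r2 (r1 + N) (dl D1 r1 N F))) w =
    dl D3 (r1 + r2) N F w"
    using F lin
  proof (induction w arbitrary: N F)
    case Nil then show ?case using D3 by (simp add: LF_Nil scl_def)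
  next
    case (Cons p w)
    obtain d a where p: "p = (d, a)" by force
    note F = Cons.prems(1)
    show ?case
    proof (cases "a \<in> gr G d")
      case False
      then show ?thesis by (simp add: p scl_def)
    next
      case True
      have a: "D1 d a \<in> gr G (r1 + d)" "D2 d a \<in> gr G (r2 + d)" 
        using True derivationD(1)[OF D1] derivationD(1)[OF D2] by auto
      let ?F = "shift d a F"
      have sF: "?F \<in> LF (N + d)" by (rule LF_shift[OF F])
      have s1: "shift (r1 + d) (D1 d a) F \<in> LF (r1 + (N + d))"
        and s2: "shift (r2 + d) (D2 d a) F \<in> LF (r2 + (N + d))"
        using LF_shift[OF F, of "r1 + d"] LF_shift[OF F, of "r2 + d"] by (simp_all add: algebra_simps)
      have d1: "dl D1 r1 (N + d) ?F \<in> LF (r1 + (N + d))" and d2: "dl D2 r2 (N + d) ?F \<in> LF (r2 + (N + d))"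
        using dl_closed[OF D1 sF] dl_closed[OF D2 sF] .
      have e: "r1 + N + d = r1 + (N + d)" "r2 + N + d = r2 + (N + d)"
        "N + (r1 + d) = r1 + (N + d)" "N + (r2 + d) = r2 + (N + d)" by auto
      define A B C1 C2 where "A = dl D1 r1 (r2 + (N + d)) (dl D2 r2 (N + d) ?F) w"
        and "B = dl D2 r2 (r1 + (N + d)) (dl D1 r1 (N + d) ?F) w"
        and "C1 = dl D1 r1 (r2 + (N + d)) (shift (r2 + d) (D2 d a) F) w"
        and "C2 = dl D2 r2 (r1 + (N + d)) (shift (r1 + d) (D1 d a) F) w"
      define x1 x2 where "x1 = D1 (r2 + d) (D2 d a)" and "x2 = D2 (r1 + d) (D1 d a)"
      have x: "x1 \<in> gr G (r1 + r2 + d)" "x2 \<in> gr G (r1 + r2 + d)"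
        using derivationD(1)[OF D1 a(2)] derivationD(1)[OF D2 a(1)] by (simp_all add: x1_def x2_def algebra_simps)
      define U1 U2 where "U1 = shift (r1 + r2 + d) x1 F w" and "U2 = shift (r1 + r2 + d) x2 F w"
      have 1: "dl D1 r1 (r2 + N) (dl D2 r2 N F) (p # w) = smul G (ksign (r1 * d))
          (smul G (ksign (r2 * d)) (A - C1) - smul G (ksign (r2 * (r1 + d))) (C2 - U2))"
        using True a s2 d2 by (simp add: p e shift_dl dl_scl[OF D1] dl_diff[OF D1] LF_diff Cons_shift)
          (simp add: scl_def A_def C1_def C2_def U2_def x2_def e add.commute add.left_commute)
      have 2: "dl D2 r2 (r1 + N) (dl D1 r1 N F) (p # w) = smul G (ksign (r2 * d))
          (smul G (ksign (r1 * d)) (B - C2) - smul G (ksign (r1 * (r2 + d))) (C1 - U1))"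
        using True a s1 d1 by (simp add: p e shift_dl dl_scl[OF D2] dl_diff[OF D2] LF_diff Cons_shift)
          (simp add: scl_def B_def C1_def C2_def U1_def x1_def e add.commute add.left_commute)
      have IH: "dl D3 (r1 + r2) (N + d) ?F w = A - smul G (ksign (r1 * r2)) B"
        using Cons.IH[OF sF multilinear_shift[OF Cons.prems(2) True]] by (simp add: A_def B_def scl_def)
      have "shift (r1 + r2 + d) (x1 - smul G (ksign (r1 * r2)) x2) F =
          shift (r1 + r2 + d) x1 F - scl (ksign (r1 * r2)) (shift (r1 + r2 + d) x2 F)"
        using multilinear_lin1[OF Cons.prems(2)] x by (simp add: lin1_diff_arg gr_smul) (simp add: lin1_def)
      then have 3: "dl D3 (r1 + r2) N F (p # w) = smul G (ksign ((r1 + r2) * d))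
          (A - smul G (ksign (r1 * r2)) B - (U1 - smul G (ksign (r1 * r2)) U2))"
        using True unfolding D3[OF True, symmetric] x1_def[symmetric] x2_def[symmetric] 
        by (simp add: p IH U1_def U2_def Cons_shift[of F] D3[OF True, symmetric] x1_def[symmetric] x2_def[symmetric] scl_def)
      have 4: "(F1 - scl r F2) v = F1 v - smul G r (F2 v)" for F1 r F2 v
        by (simp add: scl_def)
      show ?thesis unfolding 4 1 2 3
        by (cases "even d"; cases "even r1"; cases "even r2") (simp_all add: ksign_def algebra_simps)
    qed
  qed
qed

end

section \<open>The Eulerian idempotent\<close>

context dgla
begin

interpretation LL: dgla LL
  rewrites "smul LL = scl" and "gr LL = LF" and "brk LL = br"
  by (rule dgla_LL) (simp_all add: LL_def)

text \<open>The filtration by word length. For \<open>y\<close> in \<open>vanish 1\<close> each ad y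
  gains one order, so power series in ad y are finite sums modulo every step.\<close>

definition vanish :: "nat \<Rightarrow> ((int \<times> 'a) list \<Rightarrow> 'a) set"
  where "vanish s = {F. \<forall>w. length w < s \<longrightarrow> F w = 0}"

lemma vanish_0 [simp]: "F \<in> vanish 0" by (simp add: vanish_def)
lemma vanish_zero: "0 \<in> vanish s" by (simp add: vanish_def)
lemma vanish_add: "F \<in> vanish s \<Longrightarrow> H \<in> vanish s \<Longrightarrow> F + H \<in> vanish s" by (simp add: vanish_def)
lemma vanish_diff: "F \<in> vanish s \<Longrightarrow> H \<in> vanish s \<Longrightarrow> F - H \<in> vanish s" by (simp add: vanish_def)
lemma vanish_scl: "F \<in> vanish s \<Longrightarrow> scl c F \<in> vanish s" by (simp add: vanish_def scl_def)
lemma vanish_uminus: "F \<in> vanish s \<Longrightarrow> - F \<in> vanish s" by (simp add: vanish_def)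
lemma vanish_sum: "(\<And>i. i \<in> A \<Longrightarrow> f i \<in> vanish s) \<Longrightarrow> sum f A \<in> vanish s"
  by (induction A rule: infinite_finite_induct) (auto intro: vanish_add vanish_zero)
lemma vanish_mono: "F \<in> vanish s \<Longrightarrow> t \<le> s \<Longrightarrow> F \<in> vanish t" by (simp add: vanish_def)
lemma vanish_shift: "F \<in> vanish s \<Longrightarrow> shift d a F \<in> vanish (s - 1)" by (auto simp: vanish_def shift_def)
lemma vanish_all: "(\<And>s. F \<in> vanish s) \<Longrightarrow> F = 0"
  unfolding vanish_def fun_eq_iff by (metis (mono_tags, lifting) lessI mem_Collect_eq zero_fun_apply)

lemma vanish_SucI:
  assumes "F \<in> LF N" "F [] = 0" "\<And>d a. a \<in> gr G d \<Longrightarrow> shift d a F \<in> vanish s"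
  shows "F \<in> vanish (Suc s)"
  unfolding vanish_def
proof (intro CollectI allI impI)
  fix w :: "(int \<times> 'a) list" assume w: "length w < Suc s"
  show "F w = 0"
  proof (cases w)
    case Nil with assms show ?thesis by simp
  next
    case (Cons p w')
    obtain d a where p: "p = (d, a)" by force
    show ?thesis
    proof (cases "a \<in> gr G d")
      case True
      then show ?thesis using assms(3)[OF True] w by (auto simp: vanish_def Cons p shift_def)
    next
      case False
      then show ?thesis using assms(1) by (simp add: LF_0 Cons p)
    qed
  qed
qed

text \<open>The bracket distributes the letters of a word over its two arguments; with fewer than
  \<open>s + t\<close> letters, one argument receives too few.\<close>

lemma vanish_br:
  assumes "F \<in> LF N" "H \<in> LF M" "F \<in> vanish s" "H \<in> vanish t"
  shows "br N M F H \<in> vanish (s + t)"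
proof -
  have "br N M F H w = 0" if "length w < s + t" for w
    using assms that
  proof (induction w arbitrary: N M F H s t)
    case Nil
    then have "F [] = 0 \<or> H [] = 0" by (auto simp: vanish_def)
    then show ?case using Nil by (auto simp: brk_zero_left brk_zero_right LF_Nil)
  next
    case (Cons p w)
    obtain d a where p: "p = (d, a)" by force
    note sF = LF_shift[OF Cons.prems(1), of d a] and sH = LF_shift[OF Cons.prems(2), of d a]
    \<comment> \<open>For \<open>s = 0\<close> truncated subtraction gives no gain on the left, so
      the bound \<open>t\<close> on the right is lowered instead.\<close>
    have "br (N + d) M (shift d a F) H w = 0"
      using Cons.IH[OF sF Cons.prems(2) vanish_shift[OF Cons.prems(3)] Cons.prems(4)] 
        Cons.IH[OF sF Cons.prems(2) vanish_0 vanish_mono[OF Cons.prems(4), of "t - 1"]] Cons.prems(5)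
      by (cases "s = 0") auto
    moreover have "br N (M + d) F (shift d a H) w = 0"
      using Cons.IH[OF Cons.prems(1) sH Cons.prems(3) vanish_shift[OF Cons.prems(4)]] 
        Cons.IH[OF Cons.prems(1) sH vanish_mono[OF Cons.prems(3), of "s - 1"] vanish_0] Cons.prems(5)
      by (cases "t = 0") auto
    ultimately show ?case by (simp add: p)
  qed
  then show ?thesis by (simp add: vanish_def)
qed

lemma vanish_dl:
  assumes D: "derivation D r" and "F \<in> vanish s"
  shows "dl D r N F \<in> vanish s"
proof -
  have "dl D r N F w = 0" if "length w < s" for w
    using that assms(2)
  proof (induction w arbitrary: N F s)
    case Nil then show ?case by (simp add: vanish_def derivationD(5)[OF D])
  next
    case (Cons p w)
    obtain d a where p: "p = (d, a)" by force
    have "dl D r (N + d) (shift d a F) w = 0"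
      using Cons.prems by (intro Cons.IH[of "s - 1"] vanish_shift) auto
    then show ?case using Cons.prems by (simp add: p vanish_def)
  qed
  then show ?thesis by (simp add: vanish_def)
qed

lemma vanish_adp:
  assumes "y \<in> LF 0" "y \<in> vanish 1" "F \<in> LF m" "F \<in> vanish s"
  shows "LL.adp y m k F \<in> vanish (s + k)"
proof (induction k)
  case (Suc k)
  show ?case using vanish_br[OF assms(1) LL.adp_closed[OF assms(1,3)] assms(2) Suc]
    by (simp add: LL.adp_Suc)
qed (use assms in simp)

text \<open>The counit times \<open>a\<close>: the constant function \<open>a\<close> on the formal
  group, hence killed by every shift.\<close>

definition Kf :: "'a \<Rightarrow> (int \<times> 'a) list \<Rightarrow> 'a"
  where "Kf a = (\<lambda>w. if w = [] then a else 0)"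

lemma shift_Kf [simp]: "shift d b (Kf a) = 0" by (auto simp: shift_def Kf_def fun_eq_iff)

lemma Kf_closed: "a \<in> gr G m \<Longrightarrow> Kf a \<in> LF m"
  by (rule LF_I) (simp_all add: LF_zero, simp add: Kf_def)

lemma br_Kf: "a \<in> gr G m \<Longrightarrow> b \<in> gr G n \<Longrightarrow> br m n (Kf a) (Kf b) = Kf (brk G m n a b)"
proof -
  assume ab: "a \<in> gr G m" "b \<in> gr G n"
  have "br m n (Kf a) (Kf b) (p # w) = 0" for p w
    using ab by (cases p) (simp add: Kf_closed br_zero)
  then show ?thesis by (auto simp: fun_eq_iff Kf_def neq_Nil_conv)
qed

lemma dl_Kf: "a \<in> gr G m \<Longrightarrow> derivation D r \<Longrightarrow> dl D r m (Kf a) = Kf (D m a)"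
proof -
  assume a: "a \<in> gr G m" and D: "derivation D r"
  have z: "dl D r N 0 = 0" for N using dl_scl[OF D LF_zero, of N 0] by simp
  have "dl D r m (Kf a) (p # w) = 0" for p w
  proof (cases p)
    case (Pair d b)
    have "dl D r (m + d) (shift d b (Kf a)) w = 0" unfolding shift_Kf z by simp
    then show ?thesis by (simp add: Pair) (simp add: Kf_def)
  qed
  then show ?thesis by (auto simp: fun_eq_iff Kf_def neq_Nil_conv)
qed

text \<open>The truncation of \<psi>(ad y) at order \<open>n\<close>.\<close>

definition Psi :: "((int \<times> 'a) list \<Rightarrow> 'a) \<Rightarrow> int \<Rightarrow> nat \<Rightarrow> ((int \<times> 'a) list \<Rightarrow> 'a) \<Rightarrow> (int \<times> 'a) list \<Rightarrow> 'a"
  where "Psi y m n F = (\<Sum>k\<le>n. scl (ecoef k) (LL.adp y m k F))"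

lemma Psi_closed: "y \<in> LF 0 \<Longrightarrow> F \<in> LF m \<Longrightarrow> Psi y m n F \<in> LF m"
  unfolding Psi_def by (intro LL.gr_sum LF_scl LL.adp_closed)

lemma Psi_add: "y \<in> LF 0 \<Longrightarrow> F \<in> LF m \<Longrightarrow> H \<in> LF m \<Longrightarrow> Psi y m n (F + H) = Psi y m n F + Psi y m n H"
  by (simp add: Psi_def LL.adp_add scl_distrib sum.distrib)
lemma Psi_diff: "y \<in> LF 0 \<Longrightarrow> F \<in> LF m \<Longrightarrow> H \<in> LF m \<Longrightarrow> Psi y m n (F - H) = Psi y m n F - Psi y m n H"
  by (simp add: Psi_def LL.adp_diff scl_distrib sum_subtractf)
lemma Psi_scl: "y \<in> LF 0 \<Longrightarrow> F \<in> LF m \<Longrightarrow> Psi y m n (scl c F) = scl c (Psi y m n F)"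
  by (simp add: Psi_def LL.adp_smul LL.scale_sum_right mult.commute)

lemma Psi_Suc: "Psi y m (Suc n) F = Psi y m n F + scl (ecoef (Suc n)) (LL.adp y m (Suc n) F)"
  by (simp add: Psi_def)

text \<open>\<psi>(ad y) is the identity plus terms that gain an order of vanishing, hence
  unipotent.\<close>

lemma Psi_inject:
  assumes y: "y \<in> LF 0" "y \<in> vanish 1" and F: "F \<in> LF m" and P: "Psi y m n F \<in> vanish (Suc n)"
  shows "F \<in> vanish (Suc n)"
proof -
  have "F \<in> vanish s" if "s \<le> Suc n" for s
    using that
  proof (induction s)
    case (Suc s)
    then have Fs: "F \<in> vanish s" by simp
    have e: "F = Psi y m n F - (\<Sum>k\<in>{1..n}. scl (ecoef k) (LL.adp y m k F))"
    proof -
      have "{..n} = insert 0 {1..n}" by auto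
      then show ?thesis by (simp add: Psi_def)
    qed
    have "(\<Sum>k\<in>{1..n}. scl (ecoef k) (LL.adp y m k F)) \<in> vanish (Suc s)"
      by (intro vanish_sum vanish_scl vanish_mono[OF vanish_adp[OF y F Fs]]) auto
    then show ?case using vanish_mono[OF P Suc.prems] by (subst e) (rule vanish_diff)
  qed simp
  then show ?thesis by simp
qed

text \<open>The Eulerian idempotent, read as a function on words: it is the solution \<open>y\<close> with \<open>y [] = 0\<close> of
  \<open>\<psi>(ad y) (shift a y) = a\<close> for all \<open>a\<close>, where \<open>\<psi>(z) = (1 - e\<^sup>-\<^sup>z) / z\<close>.  In the exponential coordinates
  \<open>y\<close> of the formal group this says that the shift by \<open>a\<close> is an invariant vector field.\<close>

definition ystep :: "nat \<Rightarrow> ((int \<times> 'a) list \<Rightarrow> 'a) \<Rightarrow> (int \<times> 'a) list \<Rightarrow> 'a"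
  where "ystep n Y w = (case w of [] \<Rightarrow> 0 | p # w' \<Rightarrow> if snd p \<in> gr G (fst p)
    then (Kf (snd p) - (\<Sum>k\<in>{1..n}. scl (ecoef k) (LL.adp Y (fst p) k (shift (fst p) (snd p) Y)))) w' else 0)"

text \<open>Successive approximation: the terms with \<open>k \<ge> 1\<close> gain an order, so
  \<open>ystep\<close> turns a function that is correct up to length \<open>n\<close> into one that
  is correct up to length \<open>n + 1\<close>; \<open>eul\<close> reads off the stable
  values.\<close>

primrec yapp :: "nat \<Rightarrow> (int \<times> 'a) list \<Rightarrow> 'a"
  where "yapp 0 = 0" | "yapp (Suc n) = ystep n (yapp n)"

definition eul :: "(int \<times> 'a) list \<Rightarrow> 'a"
  where "eul w = yapp (length w) w"

lemma ystep_Nil [simp]: "ystep n Y [] = 0" by (simp add: ystep_def)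

lemma shift_ystep: "a \<in> gr G d \<Longrightarrow> shift d a (ystep n Y) =
    Kf a - (\<Sum>k\<in>{1..n}. scl (ecoef k) (LL.adp Y d k (shift d a Y)))"
  and shift_ystep_invalid: "a \<notin> gr G d \<Longrightarrow> shift d a (ystep n Y) = 0"
  by (auto simp: shift_def ystep_def fun_eq_iff)

lemma yapp_Nil [simp]: "yapp n [] = 0" by (cases n) auto

lemma yapp_vanish: "yapp n \<in> vanish 1" by (simp add: vanish_def)

lemma LF_shift': "F \<in> LF 0 \<Longrightarrow> shift d a F \<in> LF d" using LF_shift[of F 0 d a] by simp

lemma yapp_LF: "yapp n \<in> LF 0"
proof (induction n)
  case 0 show ?case unfolding yapp.simps by (rule LF_zero)
next
  case (Suc n)
  show ?case
  proof (rule LF_I)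
    fix d a assume a: "a \<in> gr G d"
    show "shift d a (yapp (Suc n)) \<in> LF (0 + d)"
      using a Suc by (auto simp: shift_ystep intro!: LF_diff Kf_closed LL.gr_sum LF_scl LL.adp_closed LF_shift')
  qed (auto simp: shift_ystep_invalid gr_zero)
qed

text \<open>The contraction estimate of the iteration: one application of ad gains an order, which
  makes up for the weaker agreement of \<open>F\<close> and \<open>F'\<close>.\<close>

lemma adp_congruent:
  assumes "y \<in> LF 0" "y' \<in> LF 0" "y' \<in> vanish 1" "y - y' \<in> vanish (Suc n)"
    and F: "F \<in> LF m" "F' \<in> LF m" "F - F' \<in> vanish n"
  shows "LL.adp y m (Suc k) F - LL.adp y' m (Suc k) F' \<in> vanish (Suc n)"
proof -
  have step: "br 0 m y F - br 0 m y' F' \<in> vanish (Suc n)"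
    if F: "F \<in> LF m" "F' \<in> LF m" "F - F' \<in> vanish n" for F F'
  proof -
    have "br 0 m y F - br 0 m y' F' = br 0 m (y - y') F + br 0 m y' (F - F')"
      using assms F by (simp add: LL.brk_diff_left LL.brk_diff_right)
    moreover have "br 0 m (y - y') F \<in> vanish (Suc n)"
      using vanish_br[of "y - y'" 0 F m "Suc n" 0] assms F by (simp add: LF_diff)
    moreover have "br 0 m y' (F - F') \<in> vanish (Suc n)"
      using vanish_br[of y' 0 "F - F'" m 1 n] assms F by (simp add: LF_diff)
    ultimately show ?thesis by (simp add: vanish_add)
  qed
  show ?thesis
  proof (induction k)
    case 0 show ?case using step[OF F] by (simp add: LL.adp_Suc fun_diff_def)
  next
    case (Suc k)
    show ?case unfolding LL.adp_Suc[of _ _ "Suc k"]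
      by (intro step LL.adp_closed assms vanish_mono[OF Suc]) auto
  qed
qed

lemma yapp_Suc: "yapp (Suc n) - yapp n \<in> vanish (Suc n)"
proof (induction n)
  case (Suc n)
  show ?case
  proof (rule vanish_SucI)
    show "yapp (Suc (Suc n)) - yapp (Suc n) \<in> LF 0" by (intro LF_diff yapp_LF)
  next
    fix d a assume a: "a \<in> gr G d"
    define F where "F i = shift d a (yapp i)" for i
    have F: "F i \<in> LF d" for i by (simp add: F_def LF_shift' yapp_LF)
    have F': "F (Suc n) - F n \<in> vanish n" using vanish_shift[OF Suc, of d a] by (simp add: F_def fun_diff_def del: yapp.simps)
    have 1: "LL.adp (yapp (Suc n)) d k (F (Suc n)) - LL.adp (yapp n) d k (F n) \<in> vanish (Suc n)"
      if "k \<in> {1..n}" for k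
      using adp_congruent[OF yapp_LF yapp_LF yapp_vanish Suc F F F', of "k - 1"] that by (auto simp del: yapp.simps)
    have 2: "LL.adp (yapp (Suc n)) d (Suc n) (F (Suc n)) \<in> vanish (Suc n)"
      using vanish_adp[OF yapp_LF[of "Suc n"] yapp_vanish F[of "Suc n"] vanish_0, of "Suc n"] by simp
    have 3: "{1..Suc n} = insert (Suc n) {1..n}" by auto
    have "shift d a (yapp (Suc (Suc n)) - yapp (Suc n)) =
        - (\<Sum>k\<in>{1..n}. scl (ecoef k) (LL.adp (yapp (Suc n)) d k (F (Suc n)) - LL.adp (yapp n) d k (F n)))
        - scl (ecoef (Suc n)) (LL.adp (yapp (Suc n)) d (Suc n) (F (Suc n)))"
    proof -
      have "shift d a (yapp (Suc (Suc n))) = Kf a - (\<Sum>k\<in>{1..Suc n}. scl (ecoef k) (LL.adp (yapp (Suc n)) d k (F (Suc n))))"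
        "shift d a (yapp (Suc n)) = Kf a - (\<Sum>k\<in>{1..n}. scl (ecoef k) (LL.adp (yapp n) d k (F n)))"
        unfolding F_def by (simp_all only: yapp.simps(2)[of "Suc n"] yapp.simps(2)[of n] shift_ystep[OF a])
      then show ?thesis unfolding shift_simps 3 by (simp add: sum_subtractf scl_distrib del: yapp.simps)
    qed
    also have "\<dots> \<in> vanish (Suc n)"
      by (intro vanish_diff vanish_uminus vanish_sum vanish_scl 1 2)
    finally show "shift d a (yapp (Suc (Suc n)) - yapp (Suc n)) \<in> vanish (Suc n)" .
  qed auto
qed (auto simp: vanish_def)

lemma yapp_diff: "n \<le> m \<Longrightarrow> yapp m - yapp n \<in> vanish (Suc n)"
proof (induction m rule: dec_induct)
  case (step m)
  have "(yapp (Suc m) - yapp m) + (yapp m - yapp n) \<in> vanish (Suc n)"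
    by (intro vanish_add vanish_mono[OF yapp_Suc[of m]] step.IH) (use step in simp)
  then show ?case by (simp add: fun_diff_def plus_fun_def del: yapp.simps)
qed (simp add: vanish_def)

lemma eul_yapp: "eul - yapp n \<in> vanish (Suc n)"
proof -
  have "yapp n w = yapp (length w) w" if "length w < Suc n" for w
    using yapp_diff[of "length w" n] that by (auto simp: vanish_def)
  then show ?thesis by (auto simp: vanish_def eul_def)
qed

lemma eul_Nil [simp]: "eul [] = 0" by (simp add: eul_def)
lemma eul_vanish: "eul \<in> vanish 1" by (simp add: vanish_def)

lemma eul_LF: "eul \<in> LF 0"
  unfolding LF_def eul_def using yapp_LF LF_gr LF_0 by fastforce

lemma eul_shift_LF: "shift d a eul \<in> LF d" by (rule LF_shift'[OF eul_LF])

lemma eul_equation_approx: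
  assumes a: "a \<in> gr G d"
  shows "shift d a eul - (Kf a - (\<Sum>k\<in>{1..n}. scl (ecoef k) (LL.adp eul d k (shift d a eul)))) \<in> vanish (Suc n)"
proof -
  have e: "shift d a eul - shift d a (yapp n) \<in> vanish n" 
    using vanish_shift[OF eul_yapp[of n], of d a] by simp
  have 1: "LL.adp eul d k (shift d a eul) - LL.adp (yapp n) d k (shift d a (yapp n)) \<in> vanish (Suc n)"
    if "k \<in> {1..n}" for k
    using adp_congruent[OF eul_LF yapp_LF yapp_vanish eul_yapp LF_shift'[OF eul_LF] LF_shift'[OF yapp_LF] e, of "k - 1"] that by auto
  have "shift d a eul - shift d a (yapp (Suc n)) \<in> vanish (Suc n)"
    using vanish_shift[OF eul_yapp[of "Suc n"], of d a] by simp
  then have "(shift d a eul - shift d a (yapp (Suc n))) + 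
    (\<Sum>k\<in>{1..n}. scl (ecoef k) (LL.adp eul d k (shift d a eul) - LL.adp (yapp n) d k (shift d a (yapp n)))) \<in> vanish (Suc n)"
    by (intro vanish_add vanish_sum vanish_scl 1)
  then show ?thesis by (simp add: shift_ystep[OF a] sum_subtractf scl_distrib algebra_simps)
qed

lemma eul_equation:
  assumes a: "a \<in> gr G d"
  shows "Psi eul d n (shift d a eul) - Kf a \<in> vanish (Suc n)"
proof -
  have "{..n} = insert 0 {1..n}" by auto
  then have e: "Psi eul d n (shift d a eul) - Kf a =
    shift d a eul - (Kf a - (\<Sum>k\<in>{1..n}. scl (ecoef k) (LL.adp eul d k (shift d a eul))))"
    by (simp add: Psi_def)
  show ?thesis unfolding e by (rule eul_equation_approx[OF a])
qed

lemma eul_single: "a \<in> gr G d \<Longrightarrow> eul [(d, a)] = a"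
  using eul_equation[of a d 0] by (simp add: Psi_def vanish_def shift_def Kf_def)

text \<open>Applied to the defining equation of \<open>eul\<close> with \<Delta> a shift, for the
  commutation relation, and with \<Delta> an operator \<open>dl D\<close>, for naturality. The last
  sum collects the terms where \<Delta> hits a factor \<open>eul\<close>.\<close>

lemma eul_equation_derivation:
  assumes a: "a \<in> gr G d" and \<Delta>: "\<And>F. F \<in> LF d \<Longrightarrow> \<Delta> F \<in> LF (r + d)"
      "\<And>F. F \<in> LF d \<Longrightarrow> \<Delta> (br 0 d eul F) = br r d z F + br 0 (r + d) eul (\<Delta> F)"
    and lin: "\<And>F H. F \<in> LF d \<Longrightarrow> H \<in> LF d \<Longrightarrow> \<Delta> (F + H) = \<Delta> F + \<Delta> H"
      "\<And>F c. F \<in> LF d \<Longrightarrow> \<Delta> (scl c F) = scl c (\<Delta> F)"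
    and z: "z \<in> LF r"
  shows "\<Delta> (Psi eul d (Suc n) (shift d a eul)) = Psi eul (r + d) (Suc n) (\<Delta> (shift d a eul)) +
    (\<Sum>k\<le>n. scl (ecoef (Suc k)) (\<Sum>i<Suc k. LL.adp eul (r + d) i (br r d z (LL.adp eul d (k - i) (shift d a eul)))))"
proof -
  let ?A = "shift d a eul"
  have sum: "\<Delta> (sum f A) = (\<Sum>i\<in>A. \<Delta> (f i))" if "\<And>i. i \<in> A \<Longrightarrow> f i \<in> LF d" for f :: "nat \<Rightarrow> _" and A
  proof -
    have "\<Delta> 0 = 0" using lin(2)[OF LF_zero, of 0] by simp
    then show ?thesis
      using that by (induction A rule: infinite_finite_induct) (auto simp: lin LL.gr_sum)
  qed
  have "\<Delta> (Psi eul d (Suc n) ?A) = (\<Sum>k\<le>Suc n. scl (ecoef k) (\<Delta> (LL.adp eul d k ?A)))"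
    unfolding Psi_def using eul_LF eul_shift_LF by (subst sum) (auto intro!: LF_scl LL.adp_closed simp: lin LL.adp_closed simp del: sum.atMost_Suc)
  also have "\<dots> = (\<Sum>k\<le>Suc n. scl (ecoef k) (LL.adp eul (r + d) k (\<Delta> ?A)) +
      scl (ecoef k) (\<Sum>i<k. LL.adp eul (r + d) i (br r d z (LL.adp eul d (k - Suc i) ?A))))"
    using LL.adp_derivation[OF eul_LF z eul_shift_LF \<Delta>] by (simp add: scl_distrib del: sum.atMost_Suc)
  also have "\<dots> = Psi eul (r + d) (Suc n) (\<Delta> ?A) + (\<Sum>k\<le>Suc n.
      scl (ecoef k) (\<Sum>i<k. LL.adp eul (r + d) i (br r d z (LL.adp eul d (k - Suc i) ?A))))"
    by (simp add: Psi_def sum.distrib del: sum.atMost_Suc)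
  also have "(\<Sum>k\<le>Suc n. scl (ecoef k) (\<Sum>i<k. LL.adp eul (r + d) i (br r d z (LL.adp eul d (k - Suc i) ?A)))) =
     (\<Sum>k\<le>n. scl (ecoef (Suc k)) (\<Sum>i<Suc k. LL.adp eul (r + d) i (br r d z (LL.adp eul d (k - i) ?A))))"
    by (subst sum.atMost_Suc_shift) simp
  finally show ?thesis .
qed


lemma shift_br_eul: "F \<in> LF n \<Longrightarrow> shift d a (br 0 n eul F) = br d n (shift d a eul) F + br 0 (d + n) eul (shift d a F)"
  by (simp add: shift_br ksign_def add.commute)

text \<open>The structure equation of invariant vector fields. Shifting the defining equation for
  \<open>b\<close> by \<open>a\<close> kills the constant \<open>b\<close>; antisymmetrized, with y
  = \<open>eul\<close>, this becomes \<psi>(ad y) R = [\<psi>(ad y) A, \<psi>(ad y) B] = [a, b] =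
  \<psi>(ad y) C, and \<psi>(ad y) is injective.\<close>

lemma eul_commutator:
  assumes a: "a \<in> gr G m" and b: "b \<in> gr G n"
  shows "shift m a (shift n b eul) - scl (ksign (m * n)) (shift n b (shift m a eul)) =
    shift (m + n) (brk G m n a b) eul"
proof -
  let ?A = "shift m a eul" and ?B = "shift n b eul" and ?C = "shift (m + n) (brk G m n a b) eul"
  let ?R = "shift m a ?B - scl (ksign (m * n)) (shift n b ?A)"
  note A = eul_shift_LF[of m a] and B = eul_shift_LF[of n b]
  have AB: "shift m a ?B \<in> LF (m + n)" "shift n b ?A \<in> LF (m + n)"
    using LF_shift[OF B, of m a] LF_shift[OF A, of n b] by (simp_all add: add.commute)
  have R: "?R \<in> LF (m + n)" by (intro LF_diff LF_scl AB)
  have "?R - ?C \<in> vanish (Suc N)" for N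
  proof (rule Psi_inject[OF eul_LF eul_vanish LF_diff[OF R eul_shift_LF]])
    define S1 where "S1 = (\<Sum>k\<le>N. scl (ecoef (Suc k))
      (\<Sum>i<Suc k. LL.adp eul (m + n) i (br m n ?A (LL.adp eul n (k - i) ?B))))"
    define S2 where "S2 = (\<Sum>k\<le>N. scl (ecoef (Suc k))
      (\<Sum>i<Suc k. LL.adp eul (n + m) i (br n m ?B (LL.adp eul m (k - i) ?A))))"
    define S3 where "S3 = (\<Sum>k\<le>N. scl (ecoef (Suc k))
      (\<Sum>i<Suc k. LL.adp eul (m + n) i (br m n (LL.adp eul m (k - i) ?A) ?B)))"
    have E1: "shift m a (Psi eul n (Suc N) ?B) = Psi eul (m + n) (Suc N) (shift m a ?B) + S1"
      unfolding S1_def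
      by (rule eul_equation_derivation[OF b _ shift_br_eul])
        (auto simp: A add.commute dest: LF_shift[of _ _ m a])
    have E2: "shift n b (Psi eul m (Suc N) ?A) = Psi eul (n + m) (Suc N) (shift n b ?A) + S2"
      unfolding S2_def
      by (rule eul_equation_derivation[OF a _ shift_br_eul])
        (auto simp: B add.commute dest: LF_shift[of _ _ n b])
    have sgn: "br n m ?B H = scl (- ksign (m * n)) (br m n H ?B)" if "H \<in> LF m" for H
      using br_antisym[OF B that] by (simp add: mult.commute)
    have S2: "scl (ksign (m * n)) S2 = - S3"
    proof -
      have "S2 = scl (- ksign (m * n)) S3"
        using A B unfolding S2_def S3_def LL.scale_sum_right
        by (intro sum.cong refl)
          (simp add: sgn LL.adp_closed eul_LF LL.adp_smul LL.adp_uminus LF_scl br_closed LL.scale_sum_right add.commute[of n m]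
            mult.commute[of "ecoef _"] del: scl_simps(3))
      then show ?thesis by (simp add: ksign_square)
    qed
    \<comment> \<open>\<open>T\<close> is [\<psi>(ad y) A, \<psi>(ad y) B] cut off at total degree
      \<open>N\<close> in ad y; by \<open>adp_ecoef\<close> the correction terms add up to its
      negative.\<close>
    define T where "T = (\<Sum>k\<le>N. \<Sum>p\<le>k. scl (ecoef p * ecoef (k - p)) (br m n (LL.adp eul m p ?A) (LL.adp eul n (k - p) ?B)))"
    have S13: "S1 + S3 = - T"
      using LL.adp_ecoef[OF eul_LF A B, of N]
      by (simp add: S1_def S3_def T_def LL.adp_add[OF eul_LF] br_closed LL.adp_closed A B eul_LF scl_distrib sum.distrib)
    have T: "T = - (S1 + S3)" using S13 by simp
    have "shift m a (Psi eul n (Suc N) ?B - Kf b) \<in> vanish (Suc N)"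
      "shift n b (Psi eul m (Suc N) ?A - Kf a) \<in> vanish (Suc N)"
      using vanish_shift[OF eul_equation[OF b, of "Suc N"], of m a]
        vanish_shift[OF eul_equation[OF a, of "Suc N"], of n b] by simp_all
    then have "shift m a (Psi eul n (Suc N) ?B) - scl (ksign (m * n)) (shift n b (Psi eul m (Suc N) ?A)) \<in> vanish (Suc N)"
      by (intro vanish_diff vanish_scl) simp_all
    also have "shift m a (Psi eul n (Suc N) ?B) - scl (ksign (m * n)) (shift n b (Psi eul m (Suc N) ?A)) =
        Psi eul (m + n) (Suc N) ?R - T"
      unfolding E1 E2 scl_distrib S2
      by (simp add: T Psi_diff[OF eul_LF] Psi_scl[OF eul_LF] AB LF_scl add.commute[of n m] algebra_simps)
    finally have 1: "Psi eul (m + n) (Suc N) ?R - T \<in> vanish (Suc N)" .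
    \<comment> \<open>Cutting off each factor at \<open>N\<close> gives a square of index pairs
      instead of the triangle in \<open>T\<close>. The difference has order above \<open>N\<close>,
      and each factor agrees with the constant \<open>a\<close> or \<open>b\<close> to the same
      order.\<close>
    have 2: "T - Kf (brk G m n a b) \<in> vanish (Suc N)"
    proof -
      define g where "g p q = scl (ecoef p * ecoef q) (br m n (LL.adp eul m p ?A) (LL.adp eul n q ?B))" for p q
      have gv: "g p q \<in> vanish (p + q)" for p q
        unfolding g_def using vanish_adp[OF eul_LF eul_vanish A vanish_0] vanish_adp[OF eul_LF eul_vanish B vanish_0]
        by (intro vanish_scl vanish_br LL.adp_closed eul_LF A B) auto
      have PA: "Psi eul m N ?A \<in> LF m" and PB: "Psi eul n N ?B \<in> LF n"
        using Psi_closed eul_LF A B by auto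
      have "br m n (Psi eul m N ?A) (Psi eul n N ?B) = (\<Sum>p\<le>N. \<Sum>q\<le>N. g p q)"
        unfolding Psi_def g_def using A B eul_LF
        by (subst LL.brk_sum_left, force intro: LF_scl LL.adp_closed, force intro!: LL.gr_sum LF_scl LL.adp_closed,
          subst LL.brk_sum_right) (auto intro!: LF_scl LL.adp_closed simp: br_scl_left br_scl_right LF_scl LL.adp_closed mult.commute)
      also have "\<dots> = (\<Sum>(p, q)\<in>{..N} \<times> {..N}. g p q)" by (simp add: sum.cartesian_product)
      also have "\<dots> = (\<Sum>(p, q)\<in>{(p, q). p + q \<le> N}. g p q) + (\<Sum>(p, q)\<in>{..N} \<times> {..N} - {(p, q). p + q \<le> N}. g p q)"
        by (subst sum.subset_diff[of "{(p, q). p + q \<le> N}"]) (auto simp: add.commute)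
      also have "(\<Sum>(p, q)\<in>{(p, q). p + q \<le> N}. g p q) = T"
        unfolding T_def sum.triangle_reindex_eq by (simp add: g_def)
      finally have e: "br m n (Psi eul m N ?A) (Psi eul n N ?B) - T = (\<Sum>(p, q)\<in>{..N} \<times> {..N} - {(p, q). p + q \<le> N}. g p q)"
        by (simp only: add_diff_cancel_left')
      have 1: "br m n (Psi eul m N ?A) (Psi eul n N ?B) - T \<in> vanish (Suc N)"
        unfolding e by (rule vanish_sum) (auto intro: vanish_mono[OF gv])
      have e2: "br m n (Psi eul m N ?A) (Psi eul n N ?B) - br m n (Kf a) (Kf b) =
          br m n (Psi eul m N ?A - Kf a) (Psi eul n N ?B) + br m n (Kf a) (Psi eul n N ?B - Kf b)"
        using PA PB Kf_closed[OF a] Kf_closed[OF b] by (simp add: LL.brk_diff_left LL.brk_diff_right)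
      have 2: "br m n (Psi eul m N ?A) (Psi eul n N ?B) - br m n (Kf a) (Kf b) \<in> vanish (Suc N)"
        unfolding e2
        using vanish_br[OF LF_diff[OF PA Kf_closed[OF a]] PB eul_equation[OF a] vanish_0]
          vanish_br[OF Kf_closed[OF a] LF_diff[OF PB Kf_closed[OF b]] vanish_0 eul_equation[OF b]]
        by (intro vanish_add) simp_all
      have "(br m n (Psi eul m N ?A) (Psi eul n N ?B) - br m n (Kf a) (Kf b)) -
          (br m n (Psi eul m N ?A) (Psi eul n N ?B) - T) \<in> vanish (Suc N)"
        by (rule vanish_diff[OF 2 1])
      then show ?thesis by (simp add: br_Kf[OF a b])
    qed
    have 3: "Psi eul (m + n) N ?C - Kf (brk G m n a b) \<in> vanish (Suc N)"
      by (rule eul_equation[OF brk_closed[OF a b]])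
    have 4: "scl (ecoef (Suc N)) (LL.adp eul (m + n) (Suc N) ?R) \<in> vanish (Suc N)"
      using vanish_adp[OF eul_LF eul_vanish R vanish_0, of "Suc N"] by (intro vanish_scl) simp
    have e: "Psi eul (m + n) N (?R - ?C) = (Psi eul (m + n) (Suc N) ?R - T) + (T - Kf (brk G m n a b)) - 
        (Psi eul (m + n) N ?C - Kf (brk G m n a b)) - scl (ecoef (Suc N)) (LL.adp eul (m + n) (Suc N) ?R)"
      unfolding Psi_Suc Psi_diff[OF eul_LF R eul_shift_LF] by simp
    show "Psi eul (m + n) N (?R - ?C) \<in> vanish (Suc N)"
      unfolding e by (intro vanish_diff vanish_add 1 2 3 4)
  qed
  then have "?R - ?C \<in> vanish s" for s by (rule vanish_mono[of _ "Suc s"]) simp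
  then have "?R - ?C = 0" by (rule vanish_all)
  then show ?thesis by simp
qed

text \<open>Naturality of the Eulerian idempotent. Suppose z = \<open>dl D r 0 eul\<close> vanishes
  to some order. Applying \<open>dl D\<close> to the defining equation for \<open>a\<close> and
  subtracting the equation for \<open>D a\<close> shows that \<psi>(ad eul) (shift a z) vanishes to
  the same order; the letter \<open>a\<close> then adds one.\<close>

lemma dl_eul:
  assumes D: "derivation D r"
  shows "dl D r 0 eul = 0"
proof -
  let ?z = "dl D r 0 eul"
  have z: "?z \<in> LF r" using dl_closed[OF D eul_LF] by simp
  have z0: "?z [] = 0" using derivationD(5)[OF D] by simp
  have "?z \<in> vanish (Suc s)" for s
  proof (induction s)
    case 0 show ?case using z0 by (simp add: vanish_def)
  next
    case (Suc s)
    show ?case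
    proof (rule vanish_SucI[OF z z0])
      fix d a assume a: "a \<in> gr G d"
      let ?A = "shift d a eul"
      note A = eul_shift_LF[of d a]
      have Da: "D d a \<in> gr G (r + d)" by (rule derivationD(1)[OF D a])
      have dA: "dl D r d ?A \<in> LF (r + d)" by (rule dl_closed[OF D A])
      have lb: "dl D r d (br 0 d eul F) = br r d ?z F + br 0 (r + d) eul (dl D r d F)" if "F \<in> LF d" for F
        using dl_br[OF D eul_LF that] by (simp add: ksign_def)
      have e: "dl D r d (Psi eul d (Suc s) ?A) = Psi eul (r + d) (Suc s) (dl D r d ?A) +
        (\<Sum>k\<le>s. scl (ecoef (Suc k)) (\<Sum>i<Suc k. LL.adp eul (r + d) i (br r d ?z (LL.adp eul d (k - i) ?A))))"
        by (rule eul_equation_derivation[OF a dl_closed[OF D] lb dl_add[OF D] dl_scl[OF D] z])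
      have s: "(\<Sum>k\<le>s. scl (ecoef (Suc k)) (\<Sum>i<Suc k. LL.adp eul (r + d) i (br r d ?z (LL.adp eul d (k - i) ?A)))) \<in> vanish (Suc s)"
        (is "?S \<in> _")
      proof (intro vanish_sum vanish_scl)
        fix k i
        have "br r d ?z (LL.adp eul d (k - i) ?A) \<in> vanish (Suc s + 0)"
          by (intro vanish_br z Suc LL.adp_closed eul_LF A) simp
        then show "LL.adp eul (r + d) i (br r d ?z (LL.adp eul d (k - i) ?A)) \<in> vanish (Suc s)"
          by (intro vanish_mono[OF vanish_adp[OF eul_LF eul_vanish, of _ _ "Suc s"]])
            (auto intro!: br_closed z LL.adp_closed eul_LF A)
      qed
      have 1: "dl D r d (Psi eul d (Suc s) ?A - Kf a) \<in> vanish (Suc s)"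
        using eul_equation[OF a, of "Suc s"] by (intro vanish_dl[OF D]) (auto intro: vanish_mono)
      have 2: "dl D r d (Psi eul d (Suc s) ?A - Kf a) = Psi eul (r + d) (Suc s) (dl D r d ?A) + ?S - Kf (D d a)"
        using a by (simp add: dl_diff[OF D] Psi_closed eul_LF A Kf_closed dl_Kf D e)
      have 3: "dl D r d ?A = scl (ksign (r * d)) (shift d a ?z) + shift (r + d) (D d a) eul"
        using dl_shift[OF a, of D r 0 eul] by simp
      have sz: "shift d a ?z \<in> LF (r + d)" by (rule LF_shift[OF z])
      have 4: "Psi eul (r + d) (Suc s) (dl D r d ?A) = scl (ksign (r * d)) (Psi eul (r + d) (Suc s) (shift d a ?z)) +
          Psi eul (r + d) (Suc s) (shift (r + d) (D d a) eul)"
        unfolding 3 by (simp add: Psi_add Psi_scl eul_LF sz LF_scl eul_shift_LF)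
      have 5: "Psi eul (r + d) (Suc s) (shift (r + d) (D d a) eul) - Kf (D d a) \<in> vanish (Suc s)"
        by (rule vanish_mono[OF eul_equation[OF Da]]) simp
      have "scl (ksign (r * d)) ((Psi eul (r + d) (Suc s) (dl D r d ?A) + ?S - Kf (D d a)) - ?S - 
         (Psi eul (r + d) (Suc s) (shift (r + d) (D d a) eul) - Kf (D d a))) = Psi eul (r + d) (Suc s) (shift d a ?z)"
        unfolding 4 by (simp add: scl_distrib ksign_square)
      then have "Psi eul (r + d) (Suc s) (shift d a ?z) \<in> vanish (Suc s)"
        using vanish_scl[OF vanish_diff[OF vanish_diff[OF 1[unfolded 2] s] 5], of "ksign (r * d)"] by simp
      moreover have "scl (ecoef (Suc s)) (LL.adp eul (r + d) (Suc s) (shift d a ?z)) \<in> vanish (Suc s)"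
        using vanish_adp[OF eul_LF eul_vanish sz vanish_0, of "Suc s"] by (intro vanish_scl) simp
      ultimately have "Psi eul (r + d) (Suc s) (shift d a ?z) - 
        scl (ecoef (Suc s)) (LL.adp eul (r + d) (Suc s) (shift d a ?z)) \<in> vanish (Suc s)"
        by (rule vanish_diff)
      then have "Psi eul (r + d) s (shift d a ?z) \<in> vanish (Suc s)"
        by (simp only: Psi_Suc add_diff_cancel_right')
      then show "shift d a ?z \<in> vanish (Suc s)" by (rule Psi_inject[OF eul_LF eul_vanish sz])
    qed
  qed
  then have "?z \<in> vanish s" for s by (rule vanish_mono[of _ "Suc s"]) simp
  then show ?thesis by (rule vanish_all)
qed

end

section \<open>Multilinearity and the relations of the enveloping algebra\<close>

context dgla
begin

interpretation LL: dgla LL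
  rewrites "smul LL = scl" and "gr LL = LF" and "brk LL = br"
  by (rule dgla_LL) (simp_all add: LL_def)

lemma lin_Kf: "lin n (Kf a)"
  by (induction n) (use lin_zero lin1_zero in \<open>auto simp: lin1_def\<close>)

lemma lin_adp: "lin n Y \<Longrightarrow> lin n F \<Longrightarrow> Y \<in> LF 0 \<Longrightarrow> F \<in> LF m \<Longrightarrow> lin n (LL.adp Y m k F)"
  by (induction k) (auto simp: LL.adp_Suc LL.adp_closed intro!: lin_br)

lemma lin_yapp: "lin n (yapp k)"
proof (induction k arbitrary: n)
  case 0
  show ?case unfolding yapp.simps by (rule lin_zero)
next
  case (Suc k)
  show ?case
  proof (cases n)
    case n: (Suc n')
    let ?Y = "yapp k"
    have L: "lin1 ?Y" "\<And>d a. a \<in> gr G d \<Longrightarrow> lin n' (shift d a ?Y)" using Suc[of "Suc n'"] by auto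
    have 1: "lin1 (ystep k ?Y)"
      unfolding lin1_def
    proof (intro conjI allI ballI)
      fix d a b assume ab: "a \<in> gr G d" "b \<in> gr G d"
      have e: "shift d (a + b) ?Y = shift d a ?Y + shift d b ?Y" using L ab by (auto simp: lin1_def)
      have "Kf (a + b) = Kf a + Kf b" by (auto simp: Kf_def fun_eq_iff)
      then show "shift d (a + b) (ystep k ?Y) = shift d a (ystep k ?Y) + shift d b (ystep k ?Y)"
        using ab unfolding shift_ystep[OF ab(1)] shift_ystep[OF ab(2)] shift_ystep[OF gr_add[OF ab]] e
        by (simp add: LL.adp_add yapp_LF LF_shift' scl_distrib sum.distrib)
    next
      fix d c a assume a: "a \<in> gr G d"
      have e: "shift d (smul G c a) ?Y = scl c (shift d a ?Y)" using L a by (auto simp: lin1_def)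
      have "Kf (smul G c a) = scl c (Kf a)" by (auto simp: Kf_def scl_def fun_eq_iff)
      then show "shift d (smul G c a) (ystep k ?Y) = scl c (shift d a (ystep k ?Y))"
        using a unfolding shift_ystep[OF a] shift_ystep[OF gr_smul[OF a]] e
        by (simp add: LL.adp_smul yapp_LF LF_shift' scl_distrib LL.scale_sum_right mult.commute)
    qed
    have 2: "lin n' (shift d a (ystep k ?Y))" if a: "a \<in> gr G d" for d a
      unfolding shift_ystep[OF a]
      by (intro lin_diff lin_sum lin_scl lin_adp lin_Kf Suc L a yapp_LF LF_shift')
    show ?thesis using 1 2 by (simp add: n)
  qed simp
qed

text \<open>Each instance of linearity compares values on words of one fixed length, so
  approximation to a higher order decides it.\<close>

lemma lin_limit:
  assumes "\<And>k. \<exists>F'. lin n F' \<and> F - F' \<in> vanish (Suc k)"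
  shows "lin n F"
  using assms
proof (induction n arbitrary: F)
  case (Suc n)
  have "lin1 F"
    unfolding lin1_def fun_eq_iff
  proof (intro conjI allI ballI)
    fix d a b and w :: "(int \<times> 'a) list" assume ab: "a \<in> gr G d" "b \<in> gr G d"
    obtain F' where F': "lin (Suc n) F'" "F - F' \<in> vanish (Suc (Suc (length w)))"
      using Suc.prems by blast
    have "F ((e, c) # w) = F' ((e, c) # w)" for e c using F'(2) by (simp add: vanish_def)
    moreover have "shift d (a + b) F' w = (shift d a F' + shift d b F') w"
      using F'(1) ab by (simp add: lin1_def)
    ultimately show "shift d (a + b) F w = (shift d a F + shift d b F) w" by (simp add: shift_def)
  next
    fix d c a and w :: "(int \<times> 'a) list" assume a: "a \<in> gr G d"
    obtain F' where F': "lin (Suc n) F'" "F - F' \<in> vanish (Suc (Suc (length w)))"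
      using Suc.prems by blast
    have "F ((e, c) # w) = F' ((e, c) # w)" for e c using F'(2) by (simp add: vanish_def)
    moreover have "shift d (smul G c a) F' w = (scl c (shift d a F')) w"
      using F'(1) a by (simp add: lin1_def)
    ultimately show "shift d (smul G c a) F w = (scl c (shift d a F)) w" by (simp add: shift_def scl_def)
  qed
  moreover have "lin n (shift d a F)" if a: "a \<in> gr G d" for d a
  proof (rule Suc.IH)
    fix k
    obtain F' where F': "lin (Suc n) F'" "F - F' \<in> vanish (Suc (Suc k))" using Suc.prems by blast
    have "shift d a F - shift d a F' \<in> vanish (Suc k)"
      using vanish_shift[OF F'(2), of d a] by simp
    then show "\<exists>F'. lin n F' \<and> shift d a F - F' \<in> vanish (Suc k)" using F'(1) a by auto
  qed
  ultimately show ?case by simp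
qed simp

lemma eul_multilinear: "multilinear eul"
  unfolding multilinear_def using lin_limit lin_yapp eul_yapp by blast

definition rop :: "int \<Rightarrow> 'a \<Rightarrow> int \<Rightarrow> 'a \<Rightarrow> ((int \<times> 'a) list \<Rightarrow> 'a) \<Rightarrow> (int \<times> 'a) list \<Rightarrow> 'a"
  where "rop m a k b F = shift m a (shift k b F) - scl (ksign (m * k)) (shift k b (shift m a F)) -
    shift (m + k) (brk G m k a b) F"

text \<open>\<open>relv n F\<close>: on words of length at most \<open>n\<close>, and at every position, \<open>F\<close> satisfies the
  relations of the universal enveloping algebra.\<close>

fun relv :: "nat \<Rightarrow> ((int \<times> 'a) list \<Rightarrow> 'a) \<Rightarrow> bool"
  where "relv 0 F = True"
  | "relv (Suc n) F \<longleftrightarrow> (\<forall>m k. \<forall>a \<in> gr G m. \<forall>b \<in> gr G k. rop m a k b F \<in> vanish n) \<and>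
      (\<forall>d. \<forall>a \<in> gr G d. relv n (shift d a F))"

definition enveloping :: "((int \<times> 'a) list \<Rightarrow> 'a) \<Rightarrow> bool"
  where "enveloping F \<longleftrightarrow> (\<forall>n. relv n F)"

lemma rop_add: "rop m a k b (F + H) = rop m a k b F + rop m a k b H"
  and rop_diff: "rop m a k b (F - H) = rop m a k b F - rop m a k b H"
  and rop_scl: "rop m a k b (scl c F) = scl c (rop m a k b F)"
  and rop_zero: "rop m a k b 0 = 0"
  by (simp_all add: rop_def scl_distrib mult.commute algebra_simps)

lemma rop_closed: "F \<in> LF N \<Longrightarrow> rop m a k b F \<in> LF (m + k + N)"
  unfolding rop_def
  using LF_shift[OF LF_shift[of F N k b], of m a] LF_shift[OF LF_shift[of F N m a], of k b]
    LF_shift[of F N "m + k" "brk G m k a b"]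
  by (intro LF_diff LF_scl) (simp_all add: algebra_simps)

lemma relv_add: "relv n F \<Longrightarrow> relv n H \<Longrightarrow> relv n (F + H)"
  by (induction n arbitrary: F H) (auto simp: rop_add vanish_add)
lemma relv_diff: "relv n F \<Longrightarrow> relv n H \<Longrightarrow> relv n (F - H)"
  by (induction n arbitrary: F H) (auto simp: rop_diff vanish_diff)
lemma relv_scl: "relv n F \<Longrightarrow> relv n (scl c F)"
  by (induction n arbitrary: F) (auto simp: rop_scl vanish_scl)
lemma relv_Suc: "relv (Suc n) F \<Longrightarrow> relv n F"
proof (induction n arbitrary: F)
  case (Suc n)
  have "rop m a k b F \<in> vanish n" if "a \<in> gr G m" "b \<in> gr G k" for m a k b
    by (rule vanish_mono[of _ "Suc n"]) (use Suc.prems that in auto)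
  then show ?case using Suc by auto
qed simp
lemma relv_mono: "relv n F \<Longrightarrow> m \<le> n \<Longrightarrow> relv m F"
  by (induction n) (auto simp: le_Suc_eq simp del: relv.simps dest: relv_Suc)
lemma vanish_relv: "F \<in> vanish (Suc n) \<Longrightarrow> relv n F"
proof (induction n arbitrary: F)
  case (Suc n)
  have "rop m a k b F \<in> vanish n" for m a k b
    unfolding rop_def
    using vanish_shift[OF vanish_shift[OF Suc.prems, of k b], of m a]
      vanish_shift[OF vanish_shift[OF Suc.prems, of m a], of k b]
      vanish_mono[OF vanish_shift[OF Suc.prems, of "m + k" "brk G m k a b"], of n]
    by (intro vanish_diff vanish_scl) simp_all
  moreover have "relv n (shift d a F)" for d a
    using Suc.IH[of "shift d a F"] vanish_shift[OF Suc.prems, of d a] by simp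
  ultimately show ?case by simp
qed simp
lemma relv_zero: "relv n 0" by (rule vanish_relv[OF vanish_zero])
lemma relv_sum: "(\<And>i. i \<in> A \<Longrightarrow> relv n (f i)) \<Longrightarrow> relv n (sum f A)"
  by (induction A rule: infinite_finite_induct) (auto intro: relv_zero relv_add)

lemma relv_Kf: "relv n (Kf a)"
proof (induction n)
  case (Suc n)
  have "rop m b k c (Kf a) = 0" for m b k c by (simp add: rop_def)
  then show ?case using relv_zero[of n] vanish_zero[of n] unfolding relv.simps shift_Kf by simp
qed simp

lemma enveloping_rop: "enveloping F \<Longrightarrow> a \<in> gr G m \<Longrightarrow> b \<in> gr G k \<Longrightarrow> rop m a k b F = 0"
  by (rule vanish_all) (metis enveloping_def relv.simps(2))

lemma enveloping_shift: "enveloping F \<Longrightarrow> a \<in> gr G d \<Longrightarrow> enveloping (shift d a F)"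
  by (metis enveloping_def relv.simps(2))

lemma enveloping_commutator:
  assumes "enveloping F" "a \<in> gr G m" "b \<in> gr G k"
  shows "shift m a (shift k b F) - scl (ksign (m * k)) (shift k b (shift m a F)) = shift (m + k) (brk G m k a b) F"
  using enveloping_rop[OF assms] by (simp add: rop_def)

text \<open>\<open>rop\<close> is the commutator of two derivations of \<open>br\<close> minus a
  third one, hence again a derivation. The mixed terms \<open>W1\<close> and \<open>W2\<close>
  cancel in the commutator.\<close>

lemma rop_br:
  assumes F: "F \<in> LF N" and H: "H \<in> LF M"
  shows "rop m a k b (br N M F H) = br (m + k + N) M (rop m a k b F) H +
    scl (ksign ((m + k) * N)) (br N (m + k + M) F (rop m a k b H))"
proof -
  note sF = LF_shift[OF F] and sH = LF_shift[OF H]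
  note ssF = LF_shift[OF sF] and ssH = LF_shift[OF sH]
  have e: "N + k + m = m + k + N" "N + m + k = m + k + N" "N + (m + k) = m + k + N"
    "M + k + m = m + k + M" "M + m + k = m + k + M" "M + (m + k) = m + k + M" by auto
  note f = sF[of k b] sF[of m a] sH[of k b] sH[of m a] sF[of "m + k" "brk G m k a b", unfolded e]
    sH[of "m + k" "brk G m k a b", unfolded e] ssF[of k b m a, unfolded e] ssF[of m a k b, unfolded e]
    ssH[of k b m a, unfolded e] ssH[of m a k b, unfolded e]
  define U1 U2 U3 V1 V2 V3 W1 W2 where
    "U1 = br (m + k + N) M (shift m a (shift k b F)) H" and
    "U2 = br (m + k + N) M (shift k b (shift m a F)) H" and
    "U3 = br (m + k + N) M (shift (m + k) (brk G m k a b) F) H" and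
    "V1 = br N (m + k + M) F (shift m a (shift k b H))" and
    "V2 = br N (m + k + M) F (shift k b (shift m a H))" and
    "V3 = br N (m + k + M) F (shift (m + k) (brk G m k a b) H)" and
    "W1 = br (N + k) (M + m) (shift k b F) (shift m a H)" and
    "W2 = br (N + m) (M + k) (shift m a F) (shift k b H)"
  note defs = U1_def U2_def U3_def V1_def V2_def V3_def W1_def W2_def
  have 1: "shift m a (shift k b (br N M F H)) = (U1 + scl (ksign (m * (N + k))) W1) +
      scl (ksign (k * N)) (W2 + scl (ksign (m * N)) V1)"
    by (simp add: shift_br e defs)
  have 2: "shift k b (shift m a (br N M F H)) = (U2 + scl (ksign (k * (N + m))) W2) +
      scl (ksign (m * N)) (W1 + scl (ksign (k * N)) V2)"
    by (simp add: shift_br e defs)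
  have 3: "shift (m + k) (brk G m k a b) (br N M F H) = U3 + scl (ksign ((m + k) * N)) V3"
    by (simp add: shift_br e defs)
  have 4: "br (m + k + N) M (rop m a k b F) H = U1 - scl (ksign (m * k)) U2 - U3"
    using f H by (simp add: rop_def LL.brk_diff_left LF_diff LF_scl br_scl_left defs)
  have 5: "br N (m + k + M) F (rop m a k b H) = V1 - scl (ksign (m * k)) V2 - V3"
    using f F by (simp add: rop_def LL.brk_diff_right LF_diff LF_scl br_scl_right defs)
  show ?thesis
    unfolding 4 5 unfolding rop_def 1 2 3
    by (cases "even m"; cases "even k"; cases "even N") (simp_all add: ksign_def algebra_simps)
qed

text \<open>At least \<open>s\<close> letters must go into \<open>F\<close>, so \<open>H\<close> has
  to satisfy the relations only up to length \<open>n - s\<close>. With \<open>s = 1\<close> this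
  regains in \<open>eul_relv\<close> the letter that is lost by a shift.\<close>

lemma relv_br:
  assumes "F \<in> LF N" "H \<in> LF M" "relv n F" "F \<in> vanish s" "s \<le> n" "relv (n - s) H"
  shows "relv n (br N M F H)"
  using assms
proof (induction n arbitrary: F H N M s)
  case (Suc n)
  note F = Suc.prems(1) and H = Suc.prems(2)
  have "rop m a k b (br N M F H) \<in> vanish n" if ab: "a \<in> gr G m" "b \<in> gr G k" for m a k b
    unfolding rop_br[OF F H]
  proof (intro vanish_add vanish_scl)
    have "rop m a k b F \<in> vanish n" using Suc.prems(3) ab by simp
    then show "br (m + k + N) M (rop m a k b F) H \<in> vanish n"
      using vanish_br[OF rop_closed[OF F] H _ vanish_0] by auto
    show "br N (m + k + M) F (rop m a k b H) \<in> vanish n"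
    proof (cases "s = Suc n")
      case True
      then show ?thesis
        using vanish_mono[OF vanish_br[OF F rop_closed[OF H] Suc.prems(4) vanish_0], of n m k a b] by simp
    next
      case False
      then have "Suc n - s = Suc (n - s)" using Suc.prems(5) by auto
      then have "rop m a k b H \<in> vanish (n - s)" using Suc.prems(6) ab by simp
      then show ?thesis using vanish_br[OF F rop_closed[OF H] Suc.prems(4)] False Suc.prems(5) by fastforce
    qed
  qed
  moreover have "relv n (shift d a (br N M F H))" if a: "a \<in> gr G d" for d a
    unfolding shift_br
  proof (intro relv_add relv_scl)
    show "relv n (br (N + d) M (shift d a F) H)"
      using Suc.prems a
      by (intro Suc.IH[of _ _ _ _ "s - 1"] LF_shift vanish_shift) (auto elim: relv_mono)
    show "relv n (br N (M + d) F (shift d a H))"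
    proof (cases "s = Suc n")
      case True
      then show ?thesis
        using vanish_br[OF F LF_shift[OF H] Suc.prems(4) vanish_0] by (intro vanish_relv) auto
    next
      case False
      then have "Suc n - s = Suc (n - s)" using Suc.prems(5) by auto
      then show ?thesis
        using Suc.prems a False relv_Suc[OF Suc.prems(3)] by (intro Suc.IH[of _ _ _ _ s] LF_shift) auto
    qed
  qed
  ultimately show ?case by simp
qed simp

text \<open>\<open>eul_commutator\<close> gives the relation for the first two letters. For later
  positions the defining equation expresses \<open>shift d a eul\<close> through brackets with
  \<open>eul\<close>, to which the induction hypothesis applies.\<close>

lemma eul_relv: "relv n eul"
proof (induction n)
  case (Suc n)
  have "rop m a k b eul = 0" if "a \<in> gr G m" "b \<in> gr G k" for m a k b
    using eul_commutator[OF that] by (simp add: rop_def)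
  moreover have "relv n (shift d a eul)" if a: "a \<in> gr G d" for d a
  proof -
    let ?A = "shift d a eul"
    let ?S = "\<Sum>k\<in>{1..n}. scl (ecoef k) (LL.adp eul d k ?A)"
    have A: "relv (n - 1) ?A"
    proof (cases n)
      case (Suc n') then show ?thesis using Suc.IH a by simp
    qed simp
    have step: "relv n (LL.adp eul d (Suc k) ?A)" if "1 \<le> n" for k
    proof (induction k)
      case 0 show ?case unfolding LL.adp_Suc LL.adp_0 using that A
        by (intro relv_br[OF eul_LF eul_shift_LF Suc.IH eul_vanish]) auto
    next
      case (Suc k)
      show ?case unfolding LL.adp_Suc[of _ _ "Suc k"] using that Suc.IH
        by (intro relv_br[OF eul_LF LL.adp_closed[OF eul_LF eul_shift_LF] \<open>relv n eul\<close> eul_vanish])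
          (auto elim: relv_mono)
    qed
    have "relv n (LL.adp eul d k ?A)" if "k \<in> {1..n}" for k
      using step[of "k - 1"] that by auto
    then have "relv n (Kf a - ?S)"
      by (intro relv_diff relv_sum relv_scl relv_Kf)
    moreover have "relv n (?A - (Kf a - ?S))"
      by (rule vanish_relv[OF eul_equation_approx[OF a]])
    ultimately have "relv n ((?A - (Kf a - ?S)) + (Kf a - ?S))" by (intro relv_add)
    then show ?thesis by (simp only: diff_add_cancel)
  qed
  ultimately show ?case using vanish_zero by simp
qed simp

lemma eul_enveloping: "enveloping eul" by (simp add: enveloping_def eul_relv)

text \<open>Commuting \<open>dl D\<close> past the relation applies \<open>D\<close> to one of its
  two letters; linearity splits the letter \<open>D [a, b]\<close> accordingly.\<close>

lemma rop_dl:
  assumes D: "derivation D r" and F: "F \<in> LF N" and lin: "lin1 F"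
    and a: "a \<in> gr G m" and b: "b \<in> gr G k"
  shows "rop m a k b (dl D r N F) = scl (ksign (r * (m + k)))
    (dl D r (m + k + N) (rop m a k b F) - rop (r + m) (D m a) k b F - scl (ksign (r * m)) (rop m a (r + k) (D k b) F))"
proof -
  have Da: "D m a \<in> gr G (r + m)" and Db: "D k b \<in> gr G (r + k)" using derivationD(1)[OF D] a b by auto
  have ab: "brk G m k a b \<in> gr G (m + k)" by (rule brk_closed[OF a b])
  note sF = LF_shift[OF F]
  note ssF = LF_shift[OF sF]
  have e: "N + k + m = m + k + N" "N + m + k = m + k + N" "N + (m + k) = m + k + N" by auto
  define U1 U2 U3 where "U1 = dl D r (m + k + N) (shift m a (shift k b F))"
    and "U2 = dl D r (m + k + N) (shift k b (shift m a F))"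
    and "U3 = dl D r (m + k + N) (shift (m + k) (brk G m k a b) F)"
  define V1 V2 W1 W2 where "V1 = shift (r + m) (D m a) (shift k b F)"
    and "V2 = shift k b (shift (r + m) (D m a) F)"
    and "W1 = shift m a (shift (r + k) (D k b) F)"
    and "W2 = shift (r + k) (D k b) (shift m a F)"
  define X1 X2 where "X1 = shift (r + m + k) (brk G (r + m) k (D m a) b) F"
    and "X2 = shift (r + m + k) (brk G m (r + k) a (D k b)) F"
  have 1: "shift m a (shift k b (dl D r N F)) = scl (ksign (r * k)) (scl (ksign (r * m)) (U1 - V1) - W1)"
    using a b by (simp add: shift_dl e U1_def V1_def W1_def)
  have 2: "shift k b (shift m a (dl D r N F)) = scl (ksign (r * m)) (scl (ksign (r * k)) (U2 - W2) - V2)"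
    using a b by (simp add: shift_dl e U2_def V2_def W2_def)
  have x: "brk G (r + m) k (D m a) b \<in> gr G (r + m + k)" "brk G m (r + k) a (D k b) \<in> gr G (r + m + k)"
    using brk_closed[OF Da b] brk_closed[OF a Db] by (simp_all add: algebra_simps)
  have "shift (r + (m + k)) (D (m + k) (brk G m k a b)) F = X1 + scl (ksign (r * m)) X2"
    using lin x gr_smul[OF x(2)] unfolding derivationD(4)[OF D a b] X1_def X2_def lin1_def by (simp add: add.assoc)
  then have 3: "shift (m + k) (brk G m k a b) (dl D r N F) = scl (ksign (r * (m + k))) (U3 - (X1 + scl (ksign (r * m)) X2))"
    using ab by (simp add: shift_dl e U3_def)
  have 4: "dl D r (m + k + N) (rop m a k b F) = U1 - scl (ksign (m * k)) U2 - U3"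
    using ssF[of k b m a, unfolded e] ssF[of m a k b, unfolded e] sF[of "m + k" "brk G m k a b", unfolded e]
    by (simp add: rop_def dl_diff[OF D] dl_scl[OF D] LF_diff LF_scl U1_def U2_def U3_def)
  have 5: "rop (r + m) (D m a) k b F = V1 - scl (ksign ((r + m) * k)) V2 - X1"
    by (simp add: rop_def V1_def V2_def X1_def)
  have 6: "rop m a (r + k) (D k b) F = W1 - scl (ksign (m * (r + k))) W2 - X2"
    by (simp add: rop_def W1_def W2_def X2_def algebra_simps)
  show ?thesis
    unfolding 4 5 6 unfolding rop_def 1 2 3
    by (cases "even m"; cases "even k"; cases "even r") (simp_all add: ksign_def algebra_simps)
qed

lemma relv_dl:
  assumes D: "derivation D r"
  shows "relv n F \<Longrightarrow> F \<in> LF N \<Longrightarrow> multilinear F \<Longrightarrow> relv n (dl D r N F)"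
proof (induction n arbitrary: F N)
  case (Suc n)
  have "rop m a k b (dl D r N F) \<in> vanish n" if ab: "a \<in> gr G m" "b \<in> gr G k" for m a k b
  proof -
    have "D m a \<in> gr G (r + m)" "D k b \<in> gr G (r + k)" using derivationD(1)[OF D] ab by auto
    then show ?thesis using Suc.prems(1) ab
      unfolding rop_dl[OF D Suc.prems(2) multilinear_lin1[OF Suc.prems(3)] ab]
      by (intro vanish_scl vanish_diff vanish_dl[OF D]) auto
  qed
  moreover have "relv n (shift d a (dl D r N F))" if a: "a \<in> gr G d" for d a
    unfolding shift_dl[OF a] using Suc.prems a derivationD(1)[OF D a]
    by (intro relv_scl relv_diff Suc.IH LF_shift multilinear_shift) auto
  ultimately show ?case by simp
qed simp

section \<open>Filtrations\<close>

definition mfilt :: "(nat \<Rightarrow> int \<Rightarrow> 'a set) \<Rightarrow> bool"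
  where "mfilt \<Phi> \<longleftrightarrow> (\<forall>p n. subspace (\<Phi> p n)) \<and> (\<forall>n. \<Phi> 0 n = gr G n) \<and> (\<forall>p n. \<Phi> (Suc p) n \<subseteq> \<Phi> p n) \<and>
    (\<forall>p q m n. \<forall>x \<in> \<Phi> p m. \<forall>y \<in> \<Phi> q n. brk G m n x y \<in> \<Phi> (p + q) (m + n)) \<and>
    (\<forall>p n. \<forall>x \<in> \<Phi> p n. dif G n x \<in> \<Phi> p (n - 1))"

lemma mfilt_mono: "mfilt \<Phi> \<Longrightarrow> p \<le> q \<Longrightarrow> \<Phi> q n \<subseteq> \<Phi> p n"
proof (induction q)
  case (Suc q)
  have "\<Phi> (Suc q) n \<subseteq> \<Phi> q n" using Suc.prems(1) by (simp add: mfilt_def)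
  then show ?case using Suc by (cases "p = Suc q") auto
qed simp

lemma mfilt_gr: "mfilt \<Phi> \<Longrightarrow> \<Phi> q n \<subseteq> gr G n"
  using mfilt_mono[of \<Phi> 0 q n] by (simp add: mfilt_def)

lemma mfilt_simps:
  assumes "mfilt \<Phi>"
  shows "0 \<in> \<Phi> p n" "x \<in> \<Phi> p n \<Longrightarrow> y \<in> \<Phi> p n \<Longrightarrow> x + y \<in> \<Phi> p n"
    "x \<in> \<Phi> p n \<Longrightarrow> y \<in> \<Phi> p n \<Longrightarrow> x - y \<in> \<Phi> p n" "x \<in> \<Phi> p n \<Longrightarrow> smul G c x \<in> \<Phi> p n"
    "x \<in> \<Phi> p n \<Longrightarrow> - x \<in> \<Phi> p n"
    "x \<in> \<Phi> p m \<Longrightarrow> y \<in> \<Phi> q n \<Longrightarrow> brk G m n x y \<in> \<Phi> (p + q) (m + n)"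
    "x \<in> \<Phi> p n \<Longrightarrow> dif G n x \<in> \<Phi> p (n - 1)"
  using assms unfolding mfilt_def
  by (auto intro: subspace_0 subspace_add subspace_diff subspace_scale subspace_neg)

text \<open>\<open>raises \<Phi> j\<close> says that letters of weights \<open>p1, ..., pk\<close>
  give a value of weight \<open>j + p1 + ... + pk\<close>; \<open>dep\<close> is this condition for
  at most \<open>n\<close> letters.\<close>

fun dep :: "(nat \<Rightarrow> int \<Rightarrow> 'a set) \<Rightarrow> nat \<Rightarrow> nat \<Rightarrow> int \<Rightarrow> ((int \<times> 'a) list \<Rightarrow> 'a) \<Rightarrow> bool"
  where "dep \<Phi> 0 j N F \<longleftrightarrow> F [] \<in> \<Phi> j N"
  | "dep \<Phi> (Suc n) j N F \<longleftrightarrow> F [] \<in> \<Phi> j N \<and> (\<forall>p d. \<forall>a \<in> \<Phi> p d. dep \<Phi> n (j + p) (N + d) (shift d a F))"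

definition raises :: "(nat \<Rightarrow> int \<Rightarrow> 'a set) \<Rightarrow> nat \<Rightarrow> int \<Rightarrow> ((int \<times> 'a) list \<Rightarrow> 'a) \<Rightarrow> bool"
  where "raises \<Phi> j N F \<longleftrightarrow> (\<forall>n. dep \<Phi> n j N F)"

lemma scl_Nil: "scl c F [] = smul G c (F [])" by (simp add: scl_def)

lemma dep_Nil: "dep \<Phi> n j N F \<Longrightarrow> F [] \<in> \<Phi> j N" by (cases n) auto

lemma dep_Suc: "dep \<Phi> (Suc n) j N F \<Longrightarrow> dep \<Phi> n j N F"
  by (induction n arbitrary: j N F) auto

context
  fixes \<Phi> assumes \<Phi>: "mfilt \<Phi>"
begin

lemma dep_add: "dep \<Phi> n j N F \<Longrightarrow> dep \<Phi> n j N H \<Longrightarrow> dep \<Phi> n j N (F + H)"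
  by (induction n arbitrary: j N F H) (auto intro: mfilt_simps(2)[OF \<Phi>])
lemma dep_diff: "dep \<Phi> n j N F \<Longrightarrow> dep \<Phi> n j N H \<Longrightarrow> dep \<Phi> n j N (F - H)"
  by (induction n arbitrary: j N F H) (auto intro: mfilt_simps(3)[OF \<Phi>])
lemma dep_scl: "dep \<Phi> n j N F \<Longrightarrow> dep \<Phi> n j N (scl c F)"
  by (induction n arbitrary: j N F) (auto simp: scl_Nil intro: mfilt_simps(4)[OF \<Phi>])
lemma vanish_dep: "F \<in> vanish (Suc n) \<Longrightarrow> dep \<Phi> n j N F"
proof (induction n arbitrary: j N F)
  case 0 then show ?case by (simp add: vanish_def mfilt_simps(1)[OF \<Phi>])
next
  case (Suc n)
  then have "dep \<Phi> n j' N' (shift d a F)" for j' N' d a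
    using vanish_shift[OF Suc.prems, of d a] by simp
  then show ?case using Suc.prems by (simp add: vanish_def mfilt_simps(1)[OF \<Phi>])
qed
lemma dep_zero: "dep \<Phi> n j N 0" by (rule vanish_dep[OF vanish_zero])
lemma dep_sum: "(\<And>i. i \<in> A \<Longrightarrow> dep \<Phi> n j N (f i)) \<Longrightarrow> dep \<Phi> n j N (sum f A)"
  by (induction A rule: infinite_finite_induct) (auto intro: dep_zero dep_add)
lemma dep_mono: "dep \<Phi> n j N F \<Longrightarrow> i \<le> j \<Longrightarrow> dep \<Phi> n i N F"
proof (induction n arbitrary: i j N F)
  case 0
  then show ?case by (metis dep.simps(1) mfilt_mono[OF \<Phi>] subsetD)
next
  case (Suc n)
  have "dep \<Phi> n (i + p) (N + d) (shift d a F)" if "a \<in> \<Phi> p d" for p d a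
    by (rule Suc.IH[of "j + p"]) (use Suc.prems that in auto)
  moreover have "F [] \<in> \<Phi> i N" using Suc.prems(1) mfilt_mono[OF \<Phi> Suc.prems(2), of N] using dep_Nil by blast
  ultimately show ?case by simp
qed
lemma dep_Kf: "a \<in> \<Phi> j N \<Longrightarrow> dep \<Phi> n j N (Kf a)"
proof (cases n)
  case (Suc n')
  assume "a \<in> \<Phi> j N"
  then show ?thesis unfolding Suc dep.simps shift_Kf using dep_zero by (simp add: Kf_def)
qed (simp add: Kf_def)

lemma dep_br:
  "F \<in> LF N \<Longrightarrow> H \<in> LF M \<Longrightarrow> dep \<Phi> n i N F \<Longrightarrow> dep \<Phi> n j M H \<Longrightarrow> dep \<Phi> n (i + j) (N + M) (br N M F H)"
proof (induction n arbitrary: F H N M i j)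
  case 0 then show ?case using mfilt_simps(6)[OF \<Phi>] by simp
next
  case (Suc n)
  have "dep \<Phi> n (i + j + p) (N + M + d) (shift d a (br N M F H))" if a: "a \<in> \<Phi> p d" for p d a
  proof -
    have 1: "dep \<Phi> n ((i + p) + j) ((N + d) + M) (br (N + d) M (shift d a F) H)"
      using Suc.prems a dep_Suc[OF Suc.prems(4)] by (intro Suc.IH LF_shift) auto
    have 2: "dep \<Phi> n (i + (j + p)) (N + (M + d)) (br N (M + d) F (shift d a H))"
      using Suc.prems a dep_Suc[OF Suc.prems(3)] by (intro Suc.IH LF_shift) auto
    have e: "i + p + j = i + j + p" "i + (j + p) = i + j + p" "N + d + M = N + M + d" "N + (M + d) = N + M + d"
      by auto
    show ?thesis unfolding shift_br using 1 2 unfolding e by (intro dep_add dep_scl)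
  qed
  then show ?case using Suc.prems mfilt_simps(6)[OF \<Phi>] by simp
qed

lemma dep_dl:
  assumes D: "derivation D r" and q: "\<And>p n x. x \<in> \<Phi> p n \<Longrightarrow> D n x \<in> \<Phi> (p + q) (r + n)"
  shows "dep \<Phi> n j N F \<Longrightarrow> dep \<Phi> n (j + q) (r + N) (dl D r N F)"
proof (induction n arbitrary: F N j)
  case 0 then show ?case by (simp add: q)
next
  case (Suc n)
  have "dep \<Phi> n (j + q + p) (r + N + d) (shift d a (dl D r N F))" if a: "a \<in> \<Phi> p d" for p d a
  proof -
    have 1: "dep \<Phi> n (j + p + q) (r + (N + d)) (dl D r (N + d) (shift d a F))"
      using Suc.prems a by (intro Suc.IH) auto
    have 2: "dep \<Phi> n (j + (p + q)) (N + (r + d)) (shift (r + d) (D d a) F)"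
      using Suc.prems q[OF a] by (auto dest: dep_Suc)
    have e: "j + p + q = j + q + p" "j + (p + q) = j + q + p" "r + (N + d) = r + N + d" "N + (r + d) = r + N + d"
      by auto
    have "a \<in> gr G d" using a mfilt_gr[OF \<Phi>] by auto
    then show ?thesis using 1 2 unfolding e by (simp add: shift_dl dep_scl dep_diff)
  qed
  then show ?case using Suc.prems by (simp add: q)
qed

text \<open>The approximations are built from the letters by brackets and linear combinations, so
  they respect every multiplicative filtration.\<close>

lemma dep_yapp: "dep \<Phi> n 0 0 (yapp k)"
proof (induction k arbitrary: n)
  case 0
  show ?case unfolding yapp.simps by (rule dep_zero)
next
  case (Suc k)
  have 1: "dep \<Phi> n p d (shift d a (yapp (Suc k)))" if a: "a \<in> \<Phi> p d" for n p d a
  proof -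
    have a': "a \<in> gr G d" using a mfilt_gr[OF \<Phi>] by auto
    have s: "dep \<Phi> n p d (shift d a (yapp k))" using Suc[of "Suc n"] a by fastforce
    have "dep \<Phi> n p d (LL.adp (yapp k) d i (shift d a (yapp k)))" for i
    proof (induction i)
      case (Suc i)
      show ?case unfolding LL.adp_Suc
        using dep_br[OF yapp_LF LL.adp_closed[OF yapp_LF LF_shift'[OF yapp_LF]] \<open>dep \<Phi> n 0 0 (yapp k)\<close> Suc.IH]
        by simp
    qed (simp add: s)
    then show ?thesis unfolding yapp.simps shift_ystep[OF a']
      by (intro dep_diff dep_Kf a dep_sum dep_scl)
  qed
  show ?case
    using 1 mfilt_simps(1)[OF \<Phi>] by (cases n) (simp_all del: yapp.simps)
qed

lemma dep_eul: "dep \<Phi> n 0 0 eul"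
proof -
  have "dep \<Phi> n 0 0 ((eul - yapp n) + yapp n)"
    by (intro dep_add vanish_dep eul_yapp dep_yapp)
  then show ?thesis by (simp only: diff_add_cancel)
qed

end

end

section \<open>Complete dglas\<close>

lemma finite_codim_preimage1:
  fixes s :: "'k::field \<Rightarrow> 'd::ab_group_add \<Rightarrow> 'd" and s' :: "'k \<Rightarrow> 'e::ab_group_add \<Rightarrow> 'e"
  assumes vs: "vector_space s" and vs': "vector_space s'" and X: "module.subspace s X"
    and f: "\<And>x y. x \<in> X \<Longrightarrow> y \<in> X \<Longrightarrow> f (x + y) = f x + f y" "\<And>c x. x \<in> X \<Longrightarrow> f (s c x) = s' c (f x)"
      "\<And>x. x \<in> X \<Longrightarrow> f x \<in> W"
    and W: "module.subspace s' W" and V: "module.subspace s' V" "V \<subseteq> W"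
    and B: "finite B" "B \<subseteq> W" "W \<subseteq> module.span s' (B \<union> V)"
  shows "\<exists>C. finite C \<and> C \<subseteq> X \<and> X \<subseteq> module.span s (C \<union> {x \<in> X. f x \<in> V})"
proof -
  interpret vector_space s by fact
  interpret s': vector_space s' by fact
  let ?t = "\<lambda>(c :: 'k) (a :: nat \<Rightarrow> 'k) k. c * a k"
  interpret t: vector_space ?t by unfold_locales (auto simp: fun_eq_iff algebra_simps)
  \<comment> \<open>\<open>V\<close> becomes the kernel of \<open>q\<close>, so \<open>X\<close>
    modulo the preimage embeds into a finite-dimensional space; a basis of the image is lifted to
    obtain the finite set.\<close>
  obtain q :: "'e \<Rightarrow> nat \<Rightarrow> 'k" where q: "\<And>x y. q (x + y) = q x + q y" "\<And>c x. q (s' c x) = ?t c (q x)"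
    "\<And>x. x \<in> W \<Longrightarrow> q x = 0 \<longleftrightarrow> x \<in> V"
    using linear_with_kernel[OF vs' V(1) W V(2) B] by blast
  define g where "g x = q (f x)" for x
  have g: "g (x + y) = g x + g y" "g (s c x) = ?t c (g x)" if "x \<in> X" "y \<in> X" for x y c
    using that by (simp_all add: g_def f q)
  have q0: "q 0 = 0" using q(1)[of 0 0] by simp
  have g_span: "g x \<in> t.span (q ` B)" if "x \<in> X" for x
  proof -
    have "f x \<in> s'.span (B \<union> V)" using f(3)[OF that] B(3) by auto
    then show ?thesis unfolding g_def
    proof (induction rule: s'.span_induct_alt)
      case base show ?case unfolding q0 by (rule t.span_zero)
    next
      case (step c x y)
      have "q x \<in> t.span (q ` B)"
      proof (cases "x \<in> B")
        case False
        then have "q x = 0" using step V(2) q(3) by auto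
        then show ?thesis using t.span_zero by (simp only:)
      qed (auto intro: t.span_base)
      then show ?case unfolding q by (intro t.span_add t.span_scale step)
    qed
  qed
  obtain D where D: "D \<subseteq> g ` X" "t.independent D" "g ` X \<subseteq> t.span D"
    by (rule t.maximal_independent_subset[of "g ` X"])
  have "D \<subseteq> t.span (q ` B)" using D(1) g_span by auto
  then have finD: "finite D" using t.independent_span_bound[of "q ` B" D] B(1) D(2) by auto
  have "\<forall>d \<in> D. \<exists>x \<in> X. g x = d" using D(1) by auto
  then obtain p where p: "\<And>d. d \<in> D \<Longrightarrow> p d \<in> X \<and> g (p d) = d" by metis
  have lift: "\<exists>x \<in> X. x \<in> span (p ` D) \<and> g x = v" if "v \<in> t.span D" for v
    using that
  proof (induction rule: t.span_induct_alt)
    case base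
    have "g 0 = 0" using g(2)[of 0 0 0] subspace_0[OF X] by (simp add: fun_eq_iff)
    then show ?case using subspace_0[OF X] span_zero by (intro bexI[of _ 0]) auto
  next
    case (step c d v)
    then obtain x where x: "x \<in> X" "x \<in> span (p ` D)" "g x = v" by blast
    have "s c (p d) \<in> X" using p[OF step(1)] X by (auto intro: subspace_scale)
    moreover have "s c (p d) \<in> span (p ` D)" using step(1) by (intro span_scale span_base) auto
    ultimately show ?case using x p[OF step(1)] X
      by (intro bexI[of _ "s c (p d) + x"]) (auto simp: g span_add subspace_add)
  qed
  show ?thesis
  proof (intro exI[of _ "p ` D"] conjI)
    show "X \<subseteq> span (p ` D \<union> {x \<in> X. f x \<in> V})"
    proof
      fix x assume x: "x \<in> X"
      obtain y where y: "y \<in> X" "y \<in> span (p ` D)" "g y = g x"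
        using lift[of "g x"] D(3) x by auto
      have xy: "x - y \<in> X" using x y X by (auto intro: subspace_diff)
      have "g x = g (x - y) + g y" using g(1)[OF xy y(1)] by simp
      then have "q (f (x - y)) = 0" using y(3) by (simp add: g_def)
      then have "x - y \<in> {x \<in> X. f x \<in> V}" using q(3)[OF f(3)[OF xy]] xy by simp
      then have "(x - y) + y \<in> span (p ` D \<union> {x \<in> X. f x \<in> V})"
        using y(2) span_mono[of "p ` D" "p ` D \<union> {x \<in> X. f x \<in> V}"] by (intro span_add) (auto intro: span_base)
      then show "x \<in> span (p ` D \<union> {x \<in> X. f x \<in> V})" by simp
    qed
  qed (use p finD in auto)
qed

lemma finite_codim_preimage:
  fixes s :: "'k::field \<Rightarrow> 'd::ab_group_add \<Rightarrow> 'd" and s' :: "'k \<Rightarrow> 'e::ab_group_add \<Rightarrow> 'e"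
  assumes vs: "vector_space s" and vs': "vector_space s'" and X: "module.subspace s X" and I: "finite I"
    and f: "\<And>i x y. i \<in> I \<Longrightarrow> x \<in> X \<Longrightarrow> y \<in> X \<Longrightarrow> f i (x + y) = f i x + f i y"
      "\<And>i c x. i \<in> I \<Longrightarrow> x \<in> X \<Longrightarrow> f i (s c x) = s' c (f i x)"
      "\<And>i x. i \<in> I \<Longrightarrow> x \<in> X \<Longrightarrow> f i x \<in> W i"
    and W: "\<And>i. i \<in> I \<Longrightarrow> module.subspace s' (W i)" "\<And>i. i \<in> I \<Longrightarrow> module.subspace s' (V i)"
      "\<And>i. i \<in> I \<Longrightarrow> V i \<subseteq> W i"
      "\<And>i. i \<in> I \<Longrightarrow> \<exists>B. finite B \<and> B \<subseteq> W i \<and> W i \<subseteq> module.span s' (B \<union> V i)"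
  shows "\<exists>C. finite C \<and> C \<subseteq> X \<and> X \<subseteq> module.span s (C \<union> {x \<in> X. \<forall>i \<in> I. f i x \<in> V i})"
proof -
  interpret vector_space s by fact
  interpret s': vector_space s' by fact
  show ?thesis
    using I f W
  proof (induction I)
    case empty
    show ?case by (intro exI[of _ "{}"]) (auto intro: span_base)
  next
    case (insert i I)
    let ?X = "{x \<in> X. \<forall>i \<in> I. f i x \<in> V i}"
    obtain C where C: "finite C" "C \<subseteq> X" "X \<subseteq> span (C \<union> ?X)"
    proof -
      have "\<exists>C. finite C \<and> C \<subseteq> X \<and> X \<subseteq> span (C \<union> ?X)"
        by (rule insert.IH; (rule insert.prems[OF insertI2]; assumption))
      then show ?thesis using that by blast
    qed
    have f0: "f j 0 = 0" if "j \<in> insert i I" for j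
      using insert.prems(2)[OF that subspace_0[OF X], of 0] by simp
    have sX: "subspace ?X"
    proof (rule subspaceI)
      show "0 \<in> ?X" using subspace_0[OF X] f0 s'.subspace_0[OF insert.prems(5)] by auto
      show "x + y \<in> ?X" if "x \<in> ?X" "y \<in> ?X" for x y
        using that insert.prems(1) subspace_add[OF X] s'.subspace_add[OF insert.prems(5)] by simp
      show "s c x \<in> ?X" if "x \<in> ?X" for c x
        using that insert.prems(2) subspace_scale[OF X] s'.subspace_scale[OF insert.prems(5)] by simp
    qed
    obtain B where B: "finite B" "B \<subseteq> W i" "W i \<subseteq> s'.span (B \<union> V i)" using insert.prems(7)[of i] by blast
    \<comment> \<open>The next condition is imposed on the subspace cut out by the previous
      ones.\<close>
    obtain C' where C': "finite C'" "C' \<subseteq> ?X" "?X \<subseteq> span (C' \<union> {x \<in> ?X. f i x \<in> V i})"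
      using finite_codim_preimage1[OF vs vs' sX _ _ _ insert.prems(4,5,6) B, of "f i"] insert.prems
      by (metis (no_types, lifting) insertI1 mem_Collect_eq)
    have e: "{x \<in> ?X. f i x \<in> V i} = {x \<in> X. \<forall>i \<in> insert i I. f i x \<in> V i}" by auto
    let ?Y = "{x \<in> X. \<forall>i \<in> insert i I. f i x \<in> V i}"
    have "?X \<subseteq> span (C \<union> C' \<union> ?Y)"
      using C'(3) span_mono[of "C' \<union> ?Y" "C \<union> C' \<union> ?Y"] unfolding e by blast
    then have "C \<union> ?X \<subseteq> span (C \<union> C' \<union> ?Y)" by (auto intro: span_base)
    then have "X \<subseteq> span (C \<union> C' \<union> ?Y)" using C(3) span_minimal[OF _ subspace_span] by blast
    then show ?case using C C' by (intro exI[of _ "C \<union> C'"]) auto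
  qed
qed

section \<open>Twisted differentials\<close>

lemma twist_simps [simp]: "smul (twist G \<xi>) = smul G" "gr (twist G \<xi>) = gr G" "brk (twist G \<xi>) = brk G"
  "dif (twist G \<xi>) = (\<lambda>n y. dif G n y + brk G (- 1) n \<xi> y)"
  by (simp_all add: twist_def)

lemma twist_opens [simp]: "opens (twist G \<xi>) = opens G" by (simp add: twist_def)

context dgla
begin

lemma MC_dif: "\<xi> \<in> MC G \<Longrightarrow> \<xi> \<in> gr G (- 1)"
  "\<xi> \<in> MC G \<Longrightarrow> dif G (- 1) \<xi> = smul G (- (1 / 2)) (brk G (- 1) (- 1) \<xi> \<xi>)"
  by (auto simp: MC_def eq_neg_iff_add_eq_0)

text \<open>For odd \<xi> the Jacobi identity reads u = [[\<xi>, \<xi>], y] - u, where u is the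
  left-hand side.\<close>

lemma brk_brk_odd:
  assumes "\<xi> \<in> gr G (- 1)" "y \<in> gr G n"
  shows "brk G (- 1) (n - 1) \<xi> (brk G (- 1) n \<xi> y) = smul G (1 / 2) (brk G (- 2) n (brk G (- 1) (- 1) \<xi> \<xi>) y)"
proof -
  let ?u = "brk G (- 1) (n - 1) \<xi> (brk G (- 1) n \<xi> y)"
  have "?u = brk G (- 2) n (brk G (- 1) (- 1) \<xi> \<xi>) y - ?u"
    using brk_Jacobi[OF assms(1,1,2)] by (simp add: ksign_def)
  then have "brk G (- 2) n (brk G (- 1) (- 1) \<xi> \<xi>) y = smul G 2 ?u"
    using scale_left_distrib[of 1 1 ?u] by (simp add: algebra_simps)
  then show ?thesis by simp
qed

lemma dgla_twist:
  assumes \<xi>: "\<xi> \<in> MC G"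
  shows "dgla (twist G \<xi>)"
proof -
  note x = MC_dif(1)[OF \<xi>] and dx = MC_dif(2)[OF \<xi>]
  have bx: "brk G (- 1) n \<xi> y \<in> gr G (n - 1)" if "y \<in> gr G n" for n y
    using brk_closed[OF x that] by simp
  have xx: "brk G (- 1) (- 1) \<xi> \<xi> \<in> gr G (- 2)" using brk_closed[OF x x] by simp
  interpret t: vector_space "smul (twist G \<xi>)" using vector_space_axioms by simp
  show ?thesis
  proof (unfold_locales, unfold twist_simps, goal_cases)
    case (5 x m y n) then show ?case by (rule brk_antisym)
  next
    case (6 x l y m z n) then show ?case by (rule brk_Jacobi)
  next
    case (10 y n)
    have "dif G (n - 1) (brk G (- 1) n \<xi> y) = smul G (- (1 / 2)) (brk G (- 2) n (brk G (- 1) (- 1) \<xi> \<xi>) y)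
        - brk G (- 1) (n - 1) \<xi> (dif G n y)"
      using dif_brk[OF x 10] xx by (simp add: dx ksign_def brk_smul_left brk_uminus_left gr_smul 10)
    then show ?case using 10 x
      by (simp add: dif_add dif_closed bx dif_dif brk_add_right brk_brk_odd)
  next
    case (11 a m b n)
    have e: "- 1 + m = m - 1" "- 1 + n = n - 1" by auto
    have "brk G (- 1) (m + n) \<xi> (brk G m n a b) = brk G (m - 1) n (brk G (- 1) m \<xi> a) b +
       smul G (ksign m) (brk G m (n - 1) a (brk G (- 1) n \<xi> b))"
      using brk_Jacobi[OF x 11] by (simp add: e ksign_uminus)
    then show ?case using 11
      by (simp add: dif_brk brk_add_left brk_add_right dif_closed bx scale_right_distrib)
  qed (simp_all add: subspace_gr brk_closed brk_add_left brk_smul_left dif_closed bx gr_add dif_add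
      brk_add_right x brk_smul_right dif_smul scale_right_distrib)
qed

end

lemma lower_central_twist: "lower_central (twist G \<xi>) k n = lower_central G k n"
  by (induction k arbitrary: n) auto

text \<open>The open ideals are stable under brackets with \<xi>, and neither the lower central
  series nor the limit condition involves the differential.\<close>

lemma (in complete_dgla) complete_dgla_twist:
  assumes \<xi>: "\<xi> \<in> MC G"
  shows "complete_dgla (twist G \<xi>)"
proof -
  interpret t: dgla "twist G \<xi>" by (rule dgla_twist[OF \<xi>])
  show ?thesis
  proof (unfold_locales, unfold twist_simps twist_opens, goal_cases)
    case 1 show ?case by (rule opens_nonempty)
  next
    case 2 then show ?case by (rule opens_directed)
  next
    case (3 U)
    have "brk G (- 1) n \<xi> u \<in> U (n - 1)" if "u \<in> U n" for n u
      using opens_ideal[OF 3] MC_dif(1)[OF \<xi>] that unfolding dg_ideal_def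
      by (metis add.commute uminus_add_conv_diff)
    then show ?case using opens_ideal[OF 3] unfolding dg_ideal_def by (auto intro: subspace_add)
  next
    case (4 U) then show ?case using opens_finite_codim by (simp add: finite_codim_def)
  next
    case (5 U) then show ?case using opens_nilpotent by (simp add: nilpotent_quotient_def lower_central_twist)
  next
    case 6 then show ?case by (rule separated)
  next
    case 7 then show ?case by (rule complete)
  qed
qed

context complete_dgla
begin

lemma openD:
  assumes "U \<in> opens G"
  shows "subspace (U n)" "U n \<subseteq> gr G n" "x \<in> gr G m \<Longrightarrow> u \<in> U n \<Longrightarrow> brk G m n x u \<in> U (m + n)"
    "u \<in> U n \<Longrightarrow> dif G n u \<in> U (n - 1)" "x \<in> gr G m \<Longrightarrow> u \<in> U n \<Longrightarrow> brk G n m u x \<in> U (n + m)"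
proof -
  show 1: "subspace (U n)" "U n \<subseteq> gr G n" "x \<in> gr G m \<Longrightarrow> u \<in> U n \<Longrightarrow> brk G m n x u \<in> U (m + n)"
    "u \<in> U n \<Longrightarrow> dif G n u \<in> U (n - 1)" for m n x u
    using opens_ideal[OF assms] by (auto simp: dg_ideal_def)
  assume x: "x \<in> gr G m" "u \<in> U n"
  have "brk G n m u x = smul G (- ksign (n * m)) (brk G m n x u)"
    using x 1(2) by (intro brk_antisym) auto
  then show "brk G n m u x \<in> U (n + m)"
    using subspace_scale[OF 1(1) 1(3)[OF x]] by (metis add.commute)
qed

lemma open_simps:
  assumes "U \<in> opens G"
  shows "0 \<in> U n" "x \<in> U n \<Longrightarrow> y \<in> U n \<Longrightarrow> x + y \<in> U n" "x \<in> U n \<Longrightarrow> y \<in> U n \<Longrightarrow> x - y \<in> U n"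
    "x \<in> U n \<Longrightarrow> smul G c x \<in> U n" "x \<in> U n \<Longrightarrow> - x \<in> U n"
    "(\<And>i. i \<in> A \<Longrightarrow> f i \<in> U n) \<Longrightarrow> sum f A \<in> U n"
  using openD(1)[OF assms]
  by (auto intro: subspace_0 subspace_add subspace_diff subspace_scale subspace_neg subspace_sum)

end

section \<open>Closed sub-dglas\<close>

definition closed_subdgla :: "('k::field_char_0, 'a::ab_group_add) cdgla_data \<Rightarrow> (int \<Rightarrow> 'a set) \<Rightarrow> bool"
  where "closed_subdgla P R \<longleftrightarrow>
    (\<forall>n. module.subspace (smul P) (R n) \<and> R n \<subseteq> gr P n) \<and>
    (\<forall>m n. \<forall>x \<in> R m. \<forall>y \<in> R n. brk P m n x y \<in> R (m + n)) \<and>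
    (\<forall>n. \<forall>x \<in> R n. dif P n x \<in> R (n - 1)) \<and>
    (\<forall>n. \<forall>z \<in> gr P n. (\<forall>U \<in> opens P. \<exists>r \<in> R n. z - r \<in> U n) \<longrightarrow> z \<in> R n)"

definition subdgla :: "('k, 'a) cdgla_data \<Rightarrow> (int \<Rightarrow> 'a set) \<Rightarrow> ('k, 'a) cdgla_data"
  where "subdgla P R = P\<lparr>gr := R, opens := (\<lambda>U n. U n \<inter> R n) ` opens P\<rparr>"

lemma subdgla_simps [simp]: "smul (subdgla P R) = smul P" "gr (subdgla P R) = R" "brk (subdgla P R) = brk P"
  "dif (subdgla P R) = dif P" "opens (subdgla P R) = (\<lambda>U n. U n \<inter> R n) ` opens P"
  by (simp_all add: subdgla_def)

text \<open>For minimality arguments: a closed sub-dgla is again an admissible test object of a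
  universal property. Finite codimension of the traces is \<open>finite_codim_preimage1\<close> for
  the inclusion.\<close>

lemma complete_subdgla:
  assumes P: "complete_dgla P" and R: "closed_subdgla P R"
  shows "complete_dgla (subdgla P R)"
proof -
  interpret complete_dgla P by (rule P)
  have sub: "subspace (R n)" "R n \<subseteq> gr P n" for n using R by (auto simp: closed_subdgla_def)
  have brkR: "x \<in> R m \<Longrightarrow> y \<in> R n \<Longrightarrow> brk P m n x y \<in> R (m + n)" 
    and difR: "x \<in> R n \<Longrightarrow> dif P n x \<in> R (n - 1)" 
    and clR: "z \<in> gr P n \<Longrightarrow> (\<And>U. U \<in> opens P \<Longrightarrow> \<exists>r \<in> R n. z - r \<in> U n) \<Longrightarrow> z \<in> R n" for x y z m n
    using R by (auto simp: closed_subdgla_def)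
  have inR: "x \<in> R n \<Longrightarrow> x \<in> gr P n" for x n using sub by auto
  interpret t: vector_space "smul (subdgla P R)" using vector_space_axioms by simp
  interpret s: dgla "subdgla P R"
  proof (unfold_locales, unfold subdgla_simps, goal_cases)
    case (5 x m y n) then show ?case using brk_antisym inR by blast
  next
    case (6 x l y m z n) then show ?case using brk_Jacobi inR by blast
  qed (auto simp: sub scale_right_distrib scale_left_distrib brkR difR inR brk_add_left brk_smul_left dif_add dif_smul dif_dif dif_brk)
  have lc: "lower_central (subdgla P R) k n \<subseteq> lower_central P k n" for k n
  proof (induction k arbitrary: n)
    case 0 then show ?case using sub by simp
  next
    case (Suc k)
    show ?case unfolding lower_central.simps subdgla_simps
      by (rule span_mono) (use Suc inR in blast)
  qed
  show ?thesis
  proof (unfold_locales, unfold subdgla_simps, goal_cases)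
    case 1 show ?case using opens_nonempty by simp
  next
    case (2 U V)
    then obtain U' V' where U': "U' \<in> opens P" "U = (\<lambda>n. U' n \<inter> R n)" and V': "V' \<in> opens P" "V = (\<lambda>n. V' n \<inter> R n)"
      by auto
    obtain W where "W \<in> opens P" "W \<le> U'" "W \<le> V'" using opens_directed U' V' by blast
    then show ?case using U' V' by (intro bexI[of _ "\<lambda>n. W n \<inter> R n"]) (auto simp: le_fun_def)
  next
    case (3 U)
    then obtain U' where U': "U' \<in> opens P" "U = (\<lambda>n. U' n \<inter> R n)" by auto
    show ?case using openD[OF U'(1)] sub inR brkR difR unfolding dg_ideal_def U' subdgla_simps
      by (auto intro: subspace_inter)
  next
    case (4 U)
    then obtain U' where U': "U' \<in> opens P" "U = (\<lambda>n. U' n \<inter> R n)" by auto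
    have fc: "finite_codim P U'" by (rule opens_finite_codim[OF U'(1)])
    have "U n = R n" if "U' n = gr P n" for n using that sub by (auto simp: U')
    then have "{n. U n \<noteq> R n} \<subseteq> {n. U' n \<noteq> gr P n}" by auto
    then have 1: "finite {n. U n \<noteq> R n}" using fc by (auto simp: finite_codim_def intro: finite_subset)
    have 2: "\<exists>B. finite B \<and> B \<subseteq> R n \<and> R n \<subseteq> span (B \<union> U n)" for n
    proof -
      obtain B where B: "finite B" "B \<subseteq> gr P n" "gr P n \<subseteq> span (B \<union> U' n)"
        using fc unfolding finite_codim_def by blast
      have "\<exists>C. finite C \<and> C \<subseteq> R n \<and> R n \<subseteq> span (C \<union> {x \<in> R n. x \<in> U' n})"
        by (rule finite_codim_preimage1[OF vector_space_axioms vector_space_axioms sub(1) _ _ _ subspace_gr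
          openD(1,2)[OF U'(1)] B]) (auto simp: inR)
      moreover have "{x \<in> R n. x \<in> U' n} = U n" by (auto simp: U')
      ultimately show ?thesis by simp
    qed
    show ?case using 1 2 unfolding finite_codim_def subdgla_simps by blast
  next
    case (5 U)
    then obtain U' where U': "U' \<in> opens P" "U = (\<lambda>n. U' n \<inter> R n)" by auto
    obtain k where k: "\<And>n. lower_central P k n \<subseteq> U' n"
      using opens_nilpotent[OF U'(1)] by (auto simp: nilpotent_quotient_def)
    have "lower_central (subdgla P R) k n \<subseteq> R n" for k n
    proof (induction k arbitrary: n)
      case (Suc k)
      have "brk P i (n - i) x y \<in> R n" if "x \<in> R i" "y \<in> lower_central (subdgla P R) k (n - i)" for i x y
        using brkR[of x i y "n - i"] that Suc[of "n - i"] by auto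
      then show ?case unfolding lower_central.simps subdgla_simps
        by (intro span_minimal sub) auto
    qed simp
    then show ?case using k lc unfolding nilpotent_quotient_def U' by blast
  next
    case (6 x n) then show ?case by (intro separated[of x n]) (auto simp: inR)
  next
    case (7 c n)
    \<comment> \<open>Different open ideals may have the same trace on \<open>R\<close>, so the
      family is pulled back to the open ideals of \<open>P\<close>; closedness puts its limit into
      \<open>R\<close>.\<close>
    let ?r = "\<lambda>U n. U n \<inter> R n"
    have cR: "c (?r U) \<in> R n" if "U \<in> opens P" for U using 7(1) that by auto
    have "\<exists>x \<in> gr P n. \<forall>U \<in> opens P. x - c (?r U) \<in> U n"
    proof (rule complete)
      fix U V assume "U \<in> opens P" "V \<in> opens P" "V \<le> U"
      then have "c (?r V) - c (?r U) \<in> ?r U n" by (intro 7(2)) (auto simp: le_fun_def)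
      then show "c (?r V) - c (?r U) \<in> U n" by simp
    qed (use cR inR in auto)
    then obtain x where x: "x \<in> gr P n" "\<And>U. U \<in> opens P \<Longrightarrow> x - c (?r U) \<in> U n" by blast
    have xR: "x \<in> R n" by (rule clR[OF x(1)]) (use x(2) cR in blast)
    show ?case using x(2) xR cR sub by (intro bexI[of _ x]) (auto intro: subspace_diff)
  qed
qed

section \<open>Fox derivatives\<close>

definition prod_dgla :: "('k, 'a, 'm) dgla_data_scheme \<Rightarrow> ('k, 'b, 'n) dgla_data_scheme \<Rightarrow> ('k, 'a \<times> 'b) dgla_data"
  where "prod_dgla A B = \<lparr>
    smul = (\<lambda>c (a, b). (smul A c a, smul B c b)),
    gr = (\<lambda>n. gr A n \<times> gr B n),
    brk = (\<lambda>m n (a, b) (a', b'). (brk A m n a a', brk B m n b b')),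
    dif = (\<lambda>n (a, b). (dif A n a, dif B n b))\<rparr>"

text \<open>The semidirect product of a dgla \<open>A\<close> with the desuspension of a dg module: module elements of
  degree \<open>n + 1\<close> sit in degree \<open>n\<close>.\<close>

definition semidirect :: "('k::field_char_0, 'a::ab_group_add) dgla_data \<Rightarrow> ('k \<Rightarrow> 'b::ab_group_add \<Rightarrow> 'b) \<Rightarrow> (int \<Rightarrow> 'b set) \<Rightarrow>
    (int \<Rightarrow> int \<Rightarrow> 'a \<Rightarrow> 'b \<Rightarrow> 'b) \<Rightarrow> (int \<Rightarrow> 'b \<Rightarrow> 'b) \<Rightarrow> ('k, 'a \<times> 'b) dgla_data"
  where "semidirect A sm M ac dM = \<lparr>
    smul = (\<lambda>c (x, F). (smul A c x, sm c F)),
    gr = (\<lambda>n. gr A n \<times> M (n + 1)),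
    brk = (\<lambda>m n (x, F) (x', F'). (brk A m n x x',
      sm (ksign m) (ac m (n + 1) x F') - sm (ksign (m * n) * ksign n) (ac n (m + 1) x' F))),
    dif = (\<lambda>n (x, F). (dif A n x, - dM (n + 1) F))\<rparr>"

lemma vector_space_prod:
  assumes "vector_space s" "vector_space t"
  shows "vector_space (\<lambda>c (a, b). (s c a, t c b))"
proof -
  interpret s: vector_space s by fact
  interpret t: vector_space t by fact
  show ?thesis
    by unfold_locales (auto simp: s.scale_right_distrib s.scale_left_distrib t.scale_right_distrib t.scale_left_distrib)
qed

lemma subspace_prod:
  assumes "vector_space s" "vector_space t" "module.subspace s S" "module.subspace t T"
  shows "module.subspace (\<lambda>c (a, b). (s c a, t c b)) (S \<times> T)"
proof -
  interpret s: vector_space s by fact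
  interpret t: vector_space t by fact
  interpret v: vector_space "\<lambda>c (a, b). (s c a, t c b)" by (rule vector_space_prod) fact+
  show ?thesis
    using assms(3,4) by (auto simp: v.subspace_def s.subspace_def t.subspace_def zero_prod_def)
qed

lemma dgla_prod:
  assumes "dgla A" "dgla B"
  shows "dgla (prod_dgla A B)"
proof -
  interpret A: dgla A by fact
  interpret B: dgla B by fact
  have s: "smul (prod_dgla A B) = (\<lambda>c (a, b). (smul A c a, smul B c b))" by (simp add: prod_dgla_def)
  interpret v: vector_space "smul (prod_dgla A B)"
    unfolding s by (rule vector_space_prod) unfold_locales
  show ?thesis
  proof (unfold_locales, goal_cases)
    case (1 n) show ?case
      unfolding s by (simp add: prod_dgla_def subspace_prod A.vector_space_axioms B.vector_space_axioms A.subspace_gr B.subspace_gr)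
  next
    case (5 x m y n) then show ?case
      using A.brk_antisym[of "fst x" m "fst y" n] B.brk_antisym[of "snd x" m "snd y" n]
      by (cases x; cases y) (simp add: prod_dgla_def)
  next
    case (6 x l y m z n) then show ?case
      using A.brk_Jacobi[of "fst x" l "fst y" m "fst z" n] B.brk_Jacobi[of "snd x" l "snd y" m "snd z" n]
      by (cases x; cases y; cases z) (simp add: prod_dgla_def)
  next
    case (2 x m y n) then show ?case by (cases x; cases y) (simp add: prod_dgla_def A.brk_closed B.brk_closed)
  next
    case (3 x m x' y n) then show ?case
      by (cases x; cases x'; cases y) (simp add: prod_dgla_def A.brk_add_left B.brk_add_left)
  next
    case (4 x m y n c) then show ?case
      by (cases x; cases y) (simp add: prod_dgla_def A.brk_smul_left B.brk_smul_left)
  next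
    case (7 x n) then show ?case by (cases x) (simp add: prod_dgla_def A.dif_closed B.dif_closed)
  next
    case (8 x n y) then show ?case by (cases x; cases y) (simp add: prod_dgla_def A.dif_add B.dif_add)
  next
    case (9 x n c) then show ?case by (cases x) (simp add: prod_dgla_def A.dif_smul B.dif_smul)
  next
    case (10 x n) then show ?case by (cases x) (simp add: prod_dgla_def A.dif_dif B.dif_dif zero_prod_def)
  next
    case (11 x m y n) then show ?case
      by (cases x; cases y) (simp add: prod_dgla_def A.dif_brk B.dif_brk)
  qed
qed

text \<open>In the module component the Jacobi identity comes from the action axiom for the three
  pairs among \<open>x\<close>, \<open>y\<close>, \<open>z\<close>, and compatibility with the
  differential from the last axiom. The additional signs are those of the desuspension.\<close>

lemma dgla_semidirect:
  assumes "dgla A" "vector_space sm"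
    and M: "\<And>n. module.subspace sm (M n)"
    and ac: "\<And>m N x F. x \<in> gr A m \<Longrightarrow> F \<in> M N \<Longrightarrow> ac m N x F \<in> M (m + N)"
      "\<And>m N x x' F. x \<in> gr A m \<Longrightarrow> x' \<in> gr A m \<Longrightarrow> F \<in> M N \<Longrightarrow> ac m N (x + x') F = ac m N x F + ac m N x' F"
      "\<And>m N x F F'. x \<in> gr A m \<Longrightarrow> F \<in> M N \<Longrightarrow> F' \<in> M N \<Longrightarrow> ac m N x (F + F') = ac m N x F + ac m N x F'"
      "\<And>m N x c F. x \<in> gr A m \<Longrightarrow> F \<in> M N \<Longrightarrow> ac m N (smul A c x) F = sm c (ac m N x F)"
      "\<And>m N x c F. x \<in> gr A m \<Longrightarrow> F \<in> M N \<Longrightarrow> ac m N x (sm c F) = sm c (ac m N x F)"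
      "\<And>m n N x y F. x \<in> gr A m \<Longrightarrow> y \<in> gr A n \<Longrightarrow> F \<in> M N \<Longrightarrow>
        ac m (n + N) x (ac n N y F) = ac (m + n) N (brk A m n x y) F + sm (ksign (m * n)) (ac n (m + N) y (ac m N x F))"
    and dM: "\<And>N F. F \<in> M N \<Longrightarrow> dM N F \<in> M (N - 1)"
      "\<And>N F F'. F \<in> M N \<Longrightarrow> F' \<in> M N \<Longrightarrow> dM N (F + F') = dM N F + dM N F'"
      "\<And>N c F. F \<in> M N \<Longrightarrow> dM N (sm c F) = sm c (dM N F)"
      "\<And>N F. F \<in> M N \<Longrightarrow> dM (N - 1) (dM N F) = 0"
      "\<And>m N x F. x \<in> gr A m \<Longrightarrow> F \<in> M N \<Longrightarrow>
        dM (m + N) (ac m N x F) = ac (m - 1) N (dif A m x) F + sm (ksign m) (ac m (N - 1) x (dM N F))"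
  shows "dgla (semidirect A sm M ac dM)"
proof -
  interpret A: dgla A by fact
  interpret v: vector_space sm by fact
  let ?S = "semidirect A sm M ac dM"
  have s: "smul ?S = (\<lambda>c (a, b). (smul A c a, sm c b))" by (simp add: semidirect_def)
  interpret w: vector_space "smul ?S"
    unfolding s by (rule vector_space_prod) unfold_locales
  note Mc = v.subspace_0[OF M] v.subspace_add[OF M] v.subspace_diff[OF M] v.subspace_scale[OF M] v.subspace_neg[OF M]
  have act_diff: "ac m N x (F - F') = ac m N x F - ac m N x F'" if "x \<in> gr A m" "F \<in> M N" "F' \<in> M N" for m N x F F'
    using ac(3)[OF that(1) Mc(3)[OF that(2,3)] that(3)] by simp
  have dM_diff: "dM N (F - F') = dM N F - dM N F'" if "F \<in> M N" "F' \<in> M N" for N F F'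
    using dM(2)[OF Mc(3)[OF that] that(2)] by simp
  have act_neg: "ac m N x (- F) = - ac m N x F" if "x \<in> gr A m" "F \<in> M N" for m N x F
    using ac(5)[OF that, of "- 1"] by simp
  have dM_neg: "dM N (- F) = - dM N F" if "F \<in> M N" for N F
    using dM(3)[OF that, of "- 1"] by simp
  note cl = Mc ac(1) dM(1)
  define b2 where "b2 m n x F x' F' = sm (ksign m) (ac m (n + 1) x F') - sm (ksign (m * n) * ksign n) (ac n (m + 1) x' F)"
    for m n x F x' F'
  have b2_closed: "b2 m n x F x' F' \<in> M (m + n + 1)"
    if "x \<in> gr A m" "F \<in> M (m + 1)" "x' \<in> gr A n" "F' \<in> M (n + 1)" for m n x F x' F'
    using ac(1)[OF that(1,4)] ac(1)[OF that(3,2)] unfolding b2_def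
    by (intro cl) (simp_all add: algebra_simps)
  have S: "smul ?S c (x, F) = (smul A c x, sm c F)" "(x, F) \<in> gr ?S n \<longleftrightarrow> x \<in> gr A n \<and> F \<in> M (n + 1)"
    "brk ?S m n (x, F) (x', F') = (brk A m n x x', b2 m n x F x' F')" "dif ?S n (x, F) = (dif A n x, - dM (n + 1) F)"
    for c x F n m x' F'
    by (simp_all add: semidirect_def b2_def)
  have Jac: "b2 l (m + n) x F (brk A m n y z) (b2 m n y H z K) =
      b2 (l + m) n (brk A l m x y) (b2 l m x F y H) z K +
      sm (ksign (l * m)) (b2 m (l + n) y H (brk A l n x z) (b2 l n x F z K))"
    if x: "x \<in> gr A l" "F \<in> M (l + 1)" and y: "y \<in> gr A m" "H \<in> M (m + 1)" and z: "z \<in> gr A n" "K \<in> M (n + 1)"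
    for l m n x y z F H K
  proof -
    define P1 P2 P3 P4 P5 P6 Q1 Q2 Q3 where
      "P1 = ac l (m + (n + 1)) x (ac m (n + 1) y K)" and
      "P2 = ac l (n + (m + 1)) x (ac n (m + 1) z H)" and
      "P3 = ac n (l + (m + 1)) z (ac l (m + 1) x H)" and
      "P4 = ac n (m + (l + 1)) z (ac m (l + 1) y F)" and
      "P5 = ac m (l + (n + 1)) y (ac l (n + 1) x K)" and
      "P6 = ac m (n + (l + 1)) y (ac n (l + 1) z F)" and
      "Q1 = ac (l + m) (n + 1) (brk A l m x y) K" and
      "Q2 = ac (l + n) (m + 1) (brk A l n x z) H" and
      "Q3 = ac (m + n) (l + 1) (brk A m n y z) F"
    note defs = P1_def P2_def P3_def P4_def P5_def P6_def Q1_def Q2_def Q3_def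
    \<comment> \<open>Degrees occur as arguments of \<open>ac\<close>, so their different sums have
      to be matched before the axioms apply.\<close>
    have e: "m + n + 1 = m + (n + 1)" "l + m + 1 = l + (m + 1)" "l + n + 1 = l + (n + 1)"
      and e': "m + (n + 1) = n + (m + 1)" "l + (m + 1) = m + (l + 1)" "l + (n + 1) = n + (l + 1)" by auto
    have c: "ac m (n + 1) y K \<in> M (m + (n + 1))" "ac n (m + 1) z H \<in> M (n + (m + 1))"
      "ac l (m + 1) x H \<in> M (l + (m + 1))" "ac m (l + 1) y F \<in> M (m + (l + 1))"
      "ac l (n + 1) x K \<in> M (l + (n + 1))" "ac n (l + 1) z F \<in> M (n + (l + 1))"
      by (intro ac(1) x y z)+
    have R: "P1 = Q1 + sm (ksign (l * m)) P5" "P2 = Q2 + sm (ksign (l * n)) P3" "P6 = Q3 + sm (ksign (m * n)) P4"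
      unfolding defs by (rule ac(6)[OF x(1) y(1) z(2)], rule ac(6)[OF x(1) z(1) y(2)], rule ac(6)[OF y(1) z(1) x(2)])
    have X: "ac l (m + n + 1) x (b2 m n y H z K) = sm (ksign m) P1 - sm (ksign (m * n) * ksign n) P2"
    proof -
      have "ac l (m + n + 1) x (b2 m n y H z K) = ac l (m + n + 1) x (sm (ksign m) (ac m (n + 1) y K)) - 
          ac l (m + n + 1) x (sm (ksign (m * n) * ksign n) (ac n (m + 1) z H))"
        unfolding b2_def by (rule act_diff[OF x(1)]; rule Mc(4); use c(1,2) in \<open>simp only: e e'(1)\<close>)
      then show ?thesis unfolding defs
        using ac(5)[OF x(1) c(1)] ac(5)[OF x(1) c(2)] by (simp only: e e'(1))
    qed
    have Y: "ac n (l + m + 1) z (b2 l m x F y H) = sm (ksign l) P3 - sm (ksign (l * m) * ksign m) P4"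
    proof -
      have "ac n (l + m + 1) z (b2 l m x F y H) = ac n (l + m + 1) z (sm (ksign l) (ac l (m + 1) x H)) - 
          ac n (l + m + 1) z (sm (ksign (l * m) * ksign m) (ac m (l + 1) y F))"
        unfolding b2_def by (rule act_diff[OF z(1)]; rule Mc(4); use c(3,4) in \<open>simp only: e e'(2)\<close>)
      then show ?thesis unfolding defs
        using ac(5)[OF z(1) c(3)] ac(5)[OF z(1) c(4)] by (simp only: e e'(2))
    qed
    have Z: "ac m (l + n + 1) y (b2 l n x F z K) = sm (ksign l) P5 - sm (ksign (l * n) * ksign n) P6"
    proof -
      have "ac m (l + n + 1) y (b2 l n x F z K) = ac m (l + n + 1) y (sm (ksign l) (ac l (n + 1) x K)) - 
          ac m (l + n + 1) y (sm (ksign (l * n) * ksign n) (ac n (l + 1) z F))"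
        unfolding b2_def by (rule act_diff[OF y(1)]; rule Mc(4); use c(5,6) in \<open>simp only: e e'(3)\<close>)
      then show ?thesis unfolding defs
        using ac(5)[OF y(1) c(5)] ac(5)[OF y(1) c(6)] by (simp only: e e'(3))
    qed
    have 1: "b2 l (m + n) x F (brk A m n y z) (b2 m n y H z K) =
        sm (ksign l) (sm (ksign m) P1 - sm (ksign (m * n) * ksign n) P2) - sm (ksign (l * (m + n)) * ksign (m + n)) Q3"
      unfolding b2_def[of l "m + n"] X Q3_def ..
    have 2: "b2 (l + m) n (brk A l m x y) (b2 l m x F y H) z K =
        sm (ksign (l + m)) Q1 - sm (ksign ((l + m) * n) * ksign n) (sm (ksign l) P3 - sm (ksign (l * m) * ksign m) P4)"
      unfolding b2_def[of "l + m" n] Y Q1_def ..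
    have 3: "b2 m (l + n) y H (brk A l n x z) (b2 l n x F z K) =
        sm (ksign m) (sm (ksign l) P5 - sm (ksign (l * n) * ksign n) P6) - sm (ksign (m * (l + n)) * ksign (l + n)) Q2"
      unfolding b2_def[of m "l + n"] Z Q2_def ..
    show ?thesis unfolding 1 2 3 R
      by (cases "even l"; cases "even m"; cases "even n") (simp_all add: ksign_def algebra_simps)
  qed
  have db: "- dM (m + n + 1) (b2 m n x F y H) = b2 (m - 1) n (dif A m x) (- dM (m + 1) F) y H +
      sm (ksign m) (b2 m (n - 1) x F (dif A n y) (- dM (n + 1) H))"
    if x: "x \<in> gr A m" "F \<in> M (m + 1)" and y: "y \<in> gr A n" "H \<in> M (n + 1)" for m n x y F H
  proof -
    define P1 P2 P3 P4 where
      "P1 = ac (m - 1) (n + 1) (dif A m x) H" and "P2 = ac n (m + 1 - 1) y (dM (m + 1) F)" and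
      "P3 = ac m (n + 1 - 1) x (dM (n + 1) H)" and "P4 = ac (n - 1) (m + 1) (dif A n y) F"
    note defs = P1_def P2_def P3_def P4_def
    have e: "m + n + 1 = m + (n + 1)" "m + (n + 1) = n + (m + 1)" "m - 1 + 1 = m + 1 - 1" "n - 1 + 1 = n + 1 - 1" by auto
    have c: "ac m (n + 1) x H \<in> M (m + (n + 1))" "ac n (m + 1) y F \<in> M (n + (m + 1))"
      "dM (m + 1) F \<in> M (m + 1 - 1)" "dM (n + 1) H \<in> M (n + 1 - 1)"
      by (intro ac(1) dM(1) x y)+
    have "dM (m + n + 1) (b2 m n x F y H) = dM (m + n + 1) (sm (ksign m) (ac m (n + 1) x H)) -
        dM (m + n + 1) (sm (ksign (m * n) * ksign n) (ac n (m + 1) y F))"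
      unfolding b2_def by (rule dM_diff; rule Mc(4); use c(1,2) in \<open>simp only: e(1,2)\<close>)
    also have "\<dots> = sm (ksign m) (dM (m + (n + 1)) (ac m (n + 1) x H)) -
        sm (ksign (m * n) * ksign n) (dM (n + (m + 1)) (ac n (m + 1) y F))"
      using dM(3)[OF c(1)] dM(3)[OF c(2)] unfolding e(1) by (simp add: e(2))
    also have "\<dots> = sm (ksign m) (P1 + sm (ksign m) P3) - sm (ksign (m * n) * ksign n) (P4 + sm (ksign n) P2)"
      unfolding dM(5)[OF x(1) y(2)] dM(5)[OF y(1) x(2)] defs ..
    finally have 1: "dM (m + n + 1) (b2 m n x F y H) = \<dots>" .
    have 2: "b2 (m - 1) n (dif A m x) (- dM (m + 1) F) y H = sm (ksign (m - 1)) P1 + sm (ksign ((m - 1) * n) * ksign n) P2"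
      unfolding b2_def e(3) act_neg[OF y(1) c(3)] defs by simp
    have 3: "b2 m (n - 1) x F (dif A n y) (- dM (n + 1) H) = - sm (ksign m) P3 - sm (ksign (m * (n - 1)) * ksign (n - 1)) P4"
      unfolding b2_def e(4) act_neg[OF x(1) c(4)] defs by simp
    show ?thesis unfolding 1 2 3
      by (cases "even m"; cases "even n") (simp_all add: ksign_def algebra_simps)
  qed
  show ?thesis
  proof (unfold_locales, goal_cases)
    case (1 n) show ?case
      unfolding s using subspace_prod[OF A.vector_space_axioms v.vector_space_axioms A.subspace_gr[of n] M[of "n + 1"]] by (simp add: semidirect_def)
  next
    case (2 x m y n) then show ?case
      by (cases x; cases y) (simp add: S A.brk_closed b2_closed)
  next
    case (3 x m x' y n) then show ?case
      by (cases x; cases x'; cases y) (simp add: S A.brk_add_left b2_def ac v.scale_right_distrib)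
  next
    case (4 x m y n c) then show ?case
      by (cases x; cases y) (simp add: S A.brk_smul_left b2_def ac v.scale_right_diff_distrib mult.commute)
  next
    case (5 x m y n)
    have "b2 m n a F b H = sm (- ksign (m * n)) (b2 n m b H a F)" for a F b H
      unfolding b2_def by (cases "even m"; cases "even n") (simp_all add: ksign_def)
    note b2_antisym = this
    obtain a F b H where p: "x = (a, F)" "y = (b, H)" by (cases x; cases y) auto
    have "a \<in> gr A m" "b \<in> gr A n" using 5 by (simp_all add: p S)
    then show ?case unfolding p S by (intro arg_cong2[of _ _ _ _ Pair] A.brk_antisym b2_antisym)
  next
    case (6 x l y m z n)
    obtain a F b H c K where p: "x = (a, F)" "y = (b, H)" "z = (c, K)" by (cases x; cases y; cases z) auto
    have g: "a \<in> gr A l" "F \<in> M (l + 1)" "b \<in> gr A m" "H \<in> M (m + 1)" "c \<in> gr A n" "K \<in> M (n + 1)"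
      using 6 by (simp_all add: p S)
    show ?case unfolding p S add_Pair
      by (rule arg_cong2[of _ _ _ _ Pair, OF A.brk_Jacobi[OF g(1,3,5)] Jac[OF g]])
  next
    case (7 x n) then show ?case using dM(1)[of "snd x" "n + 1"] by (cases x) (simp add: S A.dif_closed Mc)
  next
    case (8 x n y) then show ?case by (cases x; cases y) (simp add: S A.dif_add dM(2))
  next
    case (9 x n c) then show ?case by (cases x) (simp add: S A.dif_smul dM(3))
  next
    case (10 x n) then show ?case
      using dM(4)[of "snd x" "n + 1"] dM_neg[OF dM(1)[of "snd x" "n + 1"]] by (cases x) (simp add: S A.dif_dif zero_prod_def)
  next
    case (11 x m y n) then show ?case by (cases x; cases y) (simp add: S A.dif_brk db)
  qed
qed

section \<open>Lower central series, and functions on the enveloping algebra\<close>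

context dgla
begin

lemma lower_central_subspace: "subspace (lower_central G k n)"
  by (cases k) (simp_all add: subspace_gr)

lemma lower_central_gr: "lower_central G k n \<subseteq> gr G n"
proof (induction k arbitrary: n)
  case (Suc k)
  show ?case unfolding lower_central.simps
  proof (rule span_minimal[OF _ subspace_gr], clarify)
    fix i x y assume "x \<in> gr G i" "y \<in> lower_central G k (n - i)"
    then show "brk G i (n - i) x y \<in> gr G n" using brk_closed[of x i y "n - i"] Suc[of "n - i"] by auto
  qed
qed simp

lemma lower_central_brk1: "x \<in> gr G m \<Longrightarrow> y \<in> lower_central G k n \<Longrightarrow> brk G m n x y \<in> lower_central G (Suc k) (m + n)"
  unfolding lower_central.simps by (rule span_base) (force intro: exI[of _ m])

lemma lower_central_Suc: "lower_central G (Suc k) n \<subseteq> lower_central G k n"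
proof (induction k arbitrary: n)
  case 0 show ?case using lower_central_gr[of "Suc 0"] by simp
next
  case (Suc k)
  show ?case unfolding lower_central.simps(2)[of G "Suc k"] lower_central.simps(2)[of G k n]
  proof (rule span_mono, clarify)
    fix i x y assume "x \<in> gr G i" "y \<in> lower_central G (Suc k) (n - i)"
    then show "\<exists>i' x' y'. brk G i (n - i) x y = brk G i' (n - i') x' y' \<and> x' \<in> gr G i' \<and> y' \<in> lower_central G k (n - i')"
      by (rule_tac exI[of _ i], rule_tac exI[of _ x], rule_tac exI[of _ y]) (intro conjI refl subsetD[OF Suc])
  qed
qed

lemma lower_central_induct_span:
  assumes "z \<in> lower_central G (Suc k) n" "subspace S"
    "\<And>i x y. x \<in> gr G i \<Longrightarrow> y \<in> lower_central G k (n - i) \<Longrightarrow> brk G i (n - i) x y \<in> S"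
  shows "z \<in> S"
proof -
  have "{brk G i (n - i) x y | i x y. x \<in> gr G i \<and> y \<in> lower_central G k (n - i)} \<subseteq> S"
    using assms(3) by auto
  from span_minimal[OF this assms(2)] show ?thesis using assms(1) by auto
qed

text \<open>\<open>lower_central G k\<close> is term k + 1 in the usual numbering, whence the
  successor. If the left factor is itself a bracket, the Jacobi identity reduces to smaller
  \<open>i\<close>.\<close>

lemma lower_central_brk:
  "x \<in> lower_central G i m \<Longrightarrow> y \<in> lower_central G j n \<Longrightarrow> brk G m n x y \<in> lower_central G (Suc (i + j)) (m + n)"
proof (induction i arbitrary: x y j m n)
  case 0 then show ?case using lower_central_brk1 by simp
next
  case (Suc i)
  note y = Suc.prems(2)
  have ygr: "y \<in> gr G n" using y lower_central_gr by blast
  let ?S = "{x \<in> gr G m. brk G m n x y \<in> lower_central G (Suc (Suc i + j)) (m + n)}"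
  have "x \<in> ?S"
  proof (rule lower_central_induct_span[OF Suc.prems(1)])
    show "subspace ?S"
      using lower_central_subspace[of "Suc (Suc i + j)" "m + n"] ygr
      by (intro subspaceI) (auto simp: gr_closed brk_add_left brk_smul_left brk_zero_left subspace_0 subspace_add subspace_scale
        simp del: lower_central.simps)
    fix l a b assume a: "a \<in> gr G l" and b: "b \<in> lower_central G i (m - l)"
    have bgr: "b \<in> gr G (m - l)" using b lower_central_gr by blast
    have "brk G l ((m - l) + n) a (brk G (m - l) n b y) \<in> lower_central G (Suc (Suc (i + j))) (l + ((m - l) + n))"
      by (intro lower_central_brk1 a Suc.IH b y)
    moreover have "brk G (m - l) (l + n) b (brk G l n a y) \<in> lower_central G (Suc (i + Suc j)) ((m - l) + (l + n))"
      by (intro Suc.IH b lower_central_brk1 a y)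
    ultimately have 1: "brk G l (m - l + n) a (brk G (m - l) n b y) -
      smul G (ksign (l * (m - l))) (brk G (m - l) (l + n) b (brk G l n a y)) \<in> lower_central G (Suc (Suc i + j)) (m + n)"
      using lower_central_subspace[of "Suc (Suc i + j)" "m + n"]
      by (intro subspace_diff subspace_scale) (simp_all del: lower_central.simps add: algebra_simps)
    have 2: "brk G m n (brk G l (m - l) a b) y = brk G l (m - l + n) a (brk G (m - l) n b y) -
      smul G (ksign (l * (m - l))) (brk G (m - l) (l + n) b (brk G l n a y))"
      using brk_Jacobi[OF a bgr ygr] by simp
    have "brk G l (m - l) a b \<in> gr G m" using brk_closed[OF a bgr] by simp
    then show "brk G l (m - l) a b \<in> ?S" using 1 2 by simp
  qed
  then show ?case by simp
qed

lemma lower_central_dif: "x \<in> lower_central G k n \<Longrightarrow> dif G n x \<in> lower_central G k (n - 1)"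
proof (induction k arbitrary: x n)
  case 0 then show ?case by (simp add: dif_closed)
next
  case (Suc k)
  let ?S = "{x \<in> gr G n. dif G n x \<in> lower_central G (Suc k) (n - 1)}"
  have "x \<in> ?S"
  proof (rule lower_central_induct_span[OF Suc.prems])
    show "subspace ?S"
      using lower_central_subspace[of "Suc k" "n - 1"]
      by (intro subspaceI) (auto simp: gr_closed dif_add dif_smul dif_zero subspace_0 subspace_add subspace_scale
        simp del: lower_central.simps)
    fix i a b assume a: "a \<in> gr G i" and b: "b \<in> lower_central G k (n - i)"
    have bgr: "b \<in> gr G (n - i)" using b lower_central_gr by blast
    have "brk G (i - 1) (n - i) (dif G i a) b \<in> lower_central G (Suc k) ((i - 1) + (n - i))"
      by (intro lower_central_brk1 dif_closed a b)
    moreover have "brk G i (n - i - 1) a (dif G (n - i) b) \<in> lower_central G (Suc k) (i + (n - i - 1))"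
      by (intro lower_central_brk1 a Suc.IH b)
    ultimately have "dif G n (brk G i (n - i) a b) \<in> lower_central G (Suc k) (n - 1)"
      using dif_brk[OF a bgr] lower_central_subspace[of "Suc k" "n - 1"]
      by (simp del: lower_central.simps add: subspace_add subspace_scale)
    then show "brk G i (n - i) a b \<in> ?S" using brk_closed[OF a bgr] by simp
  qed
  then show ?case by simp
qed

lemma raises_shift: "raises \<Phi> j N F \<Longrightarrow> a \<in> \<Phi> p d \<Longrightarrow> raises \<Phi> (j + p) (N + d) (shift d a F)"
  by (metis raises_def dep.simps(2))

lemma raises_Nil: "raises \<Phi> j N F \<Longrightarrow> F [] \<in> \<Phi> j N"
  unfolding raises_def using dep_Nil by blast

lemma raises_word:
  "mfilt \<Phi> \<Longrightarrow> raises \<Phi> j N F \<Longrightarrow> homog w \<Longrightarrow> F w \<in> \<Phi> j (N + wdeg w)"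
proof (induction w arbitrary: N F)
  case (Cons p w)
  obtain d a where p: "p = (d, a)" by force
  have "a \<in> \<Phi> 0 d" using Cons.prems by (simp add: p mfilt_def)
  then have "raises \<Phi> j (N + d) (shift d a F)" using raises_shift[OF Cons.prems(2)] by fastforce
  from Cons.IH[OF Cons.prems(1) this] show ?case using Cons.prems by (simp add: p shift_def add.assoc)
qed (simp add: raises_Nil)

lemma raises_slot:
  assumes \<Phi>: "mfilt \<Phi>" and "v \<in> \<Phi> p d" "homog w"
  shows "raises \<Phi> 0 N F \<Longrightarrow> homog u \<Longrightarrow> F (u @ (d, v) # w) \<in> \<Phi> p (N + wdeg (u @ (d, v) # w))"
proof (induction u arbitrary: N F)
  case Nil
  have "raises \<Phi> p (N + d) (shift d v F)" using raises_shift[OF Nil(1) assms(2)] by simp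
  from raises_word[OF \<Phi> this assms(3)] show ?case by (simp add: shift_def add.assoc)
next
  case (Cons q u)
  obtain e a where q: "q = (e, a)" by force
  have "a \<in> \<Phi> 0 e" using Cons.prems \<Phi> by (simp add: q mfilt_def)
  then have "raises \<Phi> 0 (N + e) (shift e a F)" using raises_shift[OF Cons.prems(1)] by fastforce
  from Cons.IH[OF this] show ?case using Cons.prems by (simp add: q shift_def add.assoc)
qed

text \<open>Up to signs \<open>(a, b)\<close> sends \<open>F : U G \<rightarrow> G\<close> to \<open>u \<mapsto> [b, F u] - F (b u) + F (u a)\<close>, where the word \<open>a\<^sub>1 \<dots> a\<^sub>n\<close>
  stands for the product \<open>a\<^sub>n \<dots> a\<^sub>1\<close>.\<close>

definition cact :: "int \<Rightarrow> int \<Rightarrow> 'a \<times> 'a \<Rightarrow> ((int \<times> 'a) list \<Rightarrow> 'a) \<Rightarrow> (int \<times> 'a) list \<Rightarrow> 'a"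
  where "cact m N u F = dl (\<lambda>n. brk G m n (snd u)) m N F + shift m (fst u - snd u) F"

text \<open>Homogeneous linear maps U G -> G without forming U G: multilinear functions on words
  that respect its relations.\<close>

definition envlin :: "int \<Rightarrow> ((int \<times> 'a) list \<Rightarrow> 'a) set"
  where "envlin N = {F \<in> LF N. multilinear F \<and> enveloping F}"

lemma eul_envlin: "eul \<in> envlin 0"
  by (simp add: envlin_def eul_LF eul_multilinear eul_enveloping)

lemma envlin_shift: "F \<in> envlin N \<Longrightarrow> a \<in> gr G d \<Longrightarrow> shift d a F \<in> envlin (N + d)"
  by (simp add: envlin_def LF_shift multilinear_shift enveloping_shift)

lemma envlin_dl: "derivation D r \<Longrightarrow> F \<in> envlin N \<Longrightarrow> dl D r N F \<in> envlin (r + N)"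
  unfolding envlin_def multilinear_def enveloping_def
  using dl_closed lin_dl[of D r _ F N] relv_dl[of D r _ F N] by (auto simp: multilinear_def simp del: lin.simps)

lemma envlin_zero: "0 \<in> envlin N" and envlin_add: "F \<in> envlin N \<Longrightarrow> H \<in> envlin N \<Longrightarrow> F + H \<in> envlin N"
  and envlin_scl: "F \<in> envlin N \<Longrightarrow> scl c F \<in> envlin N"
  unfolding envlin_def multilinear_def enveloping_def
  using LF_zero lin_zero relv_zero by (auto intro: LF_add LF_scl lin_add lin_scl relv_add relv_scl)

lemma envlin_LF: "F \<in> envlin N \<Longrightarrow> F \<in> LF N" by (simp add: envlin_def)
lemma envlin_lin: "F \<in> envlin N \<Longrightarrow> a \<in> gr G d \<Longrightarrow> b \<in> gr G d \<Longrightarrow> shift d (a + b) F = shift d a F + shift d b F"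
  "F \<in> envlin N \<Longrightarrow> a \<in> gr G d \<Longrightarrow> shift d (smul G c a) F = scl c (shift d a F)"
  "F \<in> envlin N \<Longrightarrow> a \<in> gr G d \<Longrightarrow> b \<in> gr G d \<Longrightarrow> shift d (a - b) F = shift d a F - shift d b F"
  using multilinear_lin1[of F] lin1_diff_arg[of F] by (auto simp: envlin_def lin1_def)

text \<open>\<open>b\<close> enters through the value and through letters [b, a], so multilinearity
  of \<open>F\<close> makes \<open>dl\<close> linear in \<open>b\<close>.\<close>

lemma dl_ad_linear:
  assumes F: "F \<in> envlin N" and b: "b \<in> gr G m" "b' \<in> gr G m"
  shows "dl (\<lambda>n. brk G m n (b + b')) m N F = dl (\<lambda>n. brk G m n b) m N F + dl (\<lambda>n. brk G m n b') m N F"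
    and "dl (\<lambda>n. brk G m n (smul G c b)) m N F = scl c (dl (\<lambda>n. brk G m n b) m N F)"
proof -
  show "dl (\<lambda>n. brk G m n (b + b')) m N F = dl (\<lambda>n. brk G m n b) m N F + dl (\<lambda>n. brk G m n b') m N F"
  proof
    fix w show "dl (\<lambda>n. brk G m n (b + b')) m N F w = (dl (\<lambda>n. brk G m n b) m N F + dl (\<lambda>n. brk G m n b') m N F) w"
      using F
    proof (induction w arbitrary: N F)
      case Nil then show ?case using b by (simp add: brk_add_left LF_Nil envlin_LF)
    next
      case (Cons p w)
      obtain d a where p: "p = (d, a)" by force
      show ?case
      proof (cases "a \<in> gr G d")
        case True
        have "shift (m + d) (brk G m d (b + b') a) F = shift (m + d) (brk G m d b a) F + shift (m + d) (brk G m d b' a) F"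
          using b True by (simp add: brk_add_left envlin_lin(1)[OF Cons.prems] brk_closed)
        then show ?thesis using Cons.IH[OF envlin_shift[OF Cons.prems True]]
          by (simp add: p Cons_shift[of F] scale_right_distrib scale_right_diff_distrib)
      qed (simp add: p)
    qed
  qed
  show "dl (\<lambda>n. brk G m n (smul G c b)) m N F = scl c (dl (\<lambda>n. brk G m n b) m N F)"
  proof
    fix w show "dl (\<lambda>n. brk G m n (smul G c b)) m N F w = scl c (dl (\<lambda>n. brk G m n b) m N F) w"
      using F
    proof (induction w arbitrary: N F)
      case Nil then show ?case using b by (simp add: brk_smul_left LF_Nil envlin_LF scl_def)
    next
      case (Cons p w)
      obtain d a where p: "p = (d, a)" by force
      show ?case
      proof (cases "a \<in> gr G d")
        case True
        have "shift (m + d) (brk G m d (smul G c b) a) F = scl c (shift (m + d) (brk G m d b a) F)"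
          using b True by (simp add: brk_smul_left envlin_lin(2)[OF Cons.prems] brk_closed)
        then show ?thesis using Cons.IH[OF envlin_shift[OF Cons.prems True]] True
          by (simp add: p Cons_shift[of F] scl_def scale_right_diff_distrib mult.commute)
      qed (simp add: p scl_def)
    qed
  qed
qed

lemma cact_closed: "a \<in> gr G m \<Longrightarrow> b \<in> gr G m \<Longrightarrow> F \<in> envlin N \<Longrightarrow> cact m N (a, b) F \<in> envlin (m + N)"
  unfolding cact_def using envlin_dl[OF derivation_ad, of b m F N] envlin_shift[of F N "a - b" m]
  by (simp add: envlin_add gr_diff add.commute)

lemma cact_add_left: "a \<in> gr G m \<Longrightarrow> b \<in> gr G m \<Longrightarrow> a' \<in> gr G m \<Longrightarrow> b' \<in> gr G m \<Longrightarrow> F \<in> envlin N \<Longrightarrow>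
   cact m N ((a, b) + (a', b')) F = cact m N (a, b) F + cact m N (a', b') F"
  using envlin_lin(1)[of F N "a - b" m "a' - b'"]
  by (simp add: cact_def dl_ad_linear gr_diff add_diff_add)

lemma cact_smul_left: "a \<in> gr G m \<Longrightarrow> b \<in> gr G m \<Longrightarrow> F \<in> envlin N \<Longrightarrow>
   cact m N (smul G c a, smul G c b) F = scl c (cact m N (a, b) F)"
  using envlin_lin(2)[of F N "a - b" m c]
  by (simp add: cact_def dl_ad_linear gr_diff scale_right_diff_distrib scl_distrib)

lemma cact_add_right: "a \<in> gr G m \<Longrightarrow> b \<in> gr G m \<Longrightarrow> F \<in> envlin N \<Longrightarrow> F' \<in> envlin N \<Longrightarrow>
   cact m N (a, b) (F + F') = cact m N (a, b) F + cact m N (a, b) F'"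
  by (simp add: cact_def dl_add derivation_ad envlin_LF)

lemma cact_scl_right: "a \<in> gr G m \<Longrightarrow> b \<in> gr G m \<Longrightarrow> F \<in> envlin N \<Longrightarrow>
   cact m N (a, b) (scl c F) = scl c (cact m N (a, b) F)"
  by (simp add: cact_def dl_scl derivation_ad envlin_LF scl_distrib)

text \<open>With k = a - b and k' = a' - b' the action is dl b + shift k. The parts have the
  commutators [dl b, dl b'] = dl [b, b'], [dl b, shift k'] = shift [b, k'] and, by the enveloping
  relations, [shift k, shift k'] = shift [k, k']. It remains that [a, a'] - [b, b'] = [b, k'] +
  [k, b'] + [k, k'].\<close>

lemma cact_commutator:
  assumes a: "a \<in> gr G m" "b \<in> gr G m" and a': "a' \<in> gr G n" "b' \<in> gr G n" and F: "F \<in> envlin N"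
  shows "cact m (n + N) (a, b) (cact n N (a', b') F) =
    cact (m + n) N (brk G m n a a', brk G m n b b') F + scl (ksign (m * n)) (cact n (m + N) (a', b') (cact m N (a, b) F))"
proof -
  let ?d = "dl (\<lambda>n. brk G m n b) m" and ?d' = "dl (\<lambda>k. brk G n k b') n"
  define k k' where "k = a - b" and "k' = a' - b'"
  have k: "k \<in> gr G m" "k' \<in> gr G n" using a a' by (auto simp: k_def k'_def gr_diff)
  have sF: "shift m k F \<in> LF (N + m)" "shift n k' F \<in> LF (N + n)" using LF_shift[OF envlin_LF[OF F]] by auto
  have dF: "?d N F \<in> LF (m + N)" "?d' N F \<in> LF (n + N)"
    using dl_closed[OF derivation_ad[OF a(2)] envlin_LF[OF F]] dl_closed[OF derivation_ad[OF a'(2)] envlin_LF[OF F]] .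
  have 1: "?d (n + N) (?d' N F) - scl (ksign (m * n)) (?d' (m + N) (?d N F)) =
      dl (\<lambda>k. brk G (m + n) k (brk G m n b b')) (m + n) N F"
  proof (rule dl_commutator[OF derivation_ad[OF a(2)] derivation_ad[OF a'(2)]])
    fix l x assume x: "x \<in> gr G l"
    show "brk G m (n + l) b (brk G n l b' x) - smul G (ksign (m * n)) (brk G n (m + l) b' (brk G m l b x)) =
        brk G (m + n) l (brk G m n b b') x"
      using brk_Jacobi[OF a(2) a'(2) x] by simp
  qed (use F in \<open>simp_all add: envlin_def\<close>)
  have 2: "?d (n + N) (shift n k' F) = scl (ksign (m * n)) (shift n k' (?d N F)) + shift (m + n) (brk G m n b k') F"
    using dl_shift[OF k(2), of "\<lambda>n. brk G m n b" m N F] by (simp add: add.commute)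
  have 3: "?d' (m + N) (shift m k F) = scl (ksign (n * m)) (shift m k (?d' N F)) + shift (n + m) (brk G n m b' k) F"
    using dl_shift[OF k(1), of "\<lambda>m. brk G n m b'" n N F] by (simp add: add.commute)
  have 4: "shift m k (shift n k' F) - scl (ksign (m * n)) (shift n k' (shift m k F)) = shift (m + n) (brk G m n k k') F"
    using F k by (intro enveloping_commutator) (auto simp: envlin_def)
  have 5: "shift (n + m) (brk G n m b' k) F = scl (- ksign (m * n)) (shift (m + n) (brk G m n k b') F)"
  proof -
    have "brk G n m b' k = smul G (- ksign (m * n)) (brk G m n k b')"
      using brk_antisym[OF a'(2) k(1)] by (simp add: mult.commute)
    then show ?thesis using envlin_lin(2)[OF F brk_closed[OF k(1) a'(2)]] by (simp only: add.commute[of n m])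
  qed
  have "shift (m + n) (brk G m n a a' - brk G m n b b') F =
    shift (m + n) (brk G m n b k') F + shift (m + n) (brk G m n k b') F + shift (m + n) (brk G m n k k') F"
  proof -
    have "brk G m n a a' - brk G m n b b' = brk G m n b k' + brk G m n k b' + brk G m n k k'"
      using a a' by (simp add: k_def k'_def brk_diff_left brk_diff_right gr_diff)
    then show ?thesis using a a' k by (simp add: envlin_lin(1)[OF F] brk_closed gr_add)
  qed
  note 6 = this
  have L: "cact m (n + N) (a, b) (cact n N (a', b') F) = ?d (n + N) (?d' N F) + ?d (n + N) (shift n k' F) +
      (shift m k (?d' N F) + shift m k (shift n k' F))"
    using sF dF by (simp add: cact_def dl_add[OF derivation_ad[OF a(2)]] k_def k'_def add.commute)
  have R: "cact n (m + N) (a', b') (cact m N (a, b) F) = ?d' (m + N) (?d N F) + ?d' (m + N) (shift m k F) +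
      (shift n k' (?d N F) + shift n k' (shift m k F))"
    using sF dF by (simp add: cact_def dl_add[OF derivation_ad[OF a'(2)]] k_def k'_def add.commute)
  have C: "cact (m + n) N (brk G m n a a', brk G m n b b') F = dl (\<lambda>k. brk G (m + n) k (brk G m n b b')) (m + n) N F +
    (shift (m + n) (brk G m n b k') F + shift (m + n) (brk G m n k b') F + shift (m + n) (brk G m n k k') F)"
    by (simp add: cact_def 6)
  show ?thesis unfolding L R C unfolding 1[symmetric] 2 3 4[symmetric] 5
    by (simp add: scl_distrib ksign_square mult.commute[of n m] algebra_simps)
qed

text \<open>Twice the square is the graded commutator of \<open>dl (dif G)\<close> with itself, that
  is, the extension of the zero derivation. The latter is zero because multilinear functions vanish
  at the letter 0.\<close>

lemma dl_dif_square:
  assumes F: "F \<in> envlin N"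
  shows "dl (dif G) (- 1) (N - 1) (dl (dif G) (- 1) N F) = 0"
proof -
  have "dl (\<lambda>n x. 0) r N F w = 0" for r w
    using F
  proof (induction w arbitrary: N F)
    case (Cons p w)
    obtain d a where p: "p = (d, a)" by force
    show ?case
    proof (cases "a \<in> gr G d")
      case True
      have "shift (r + d) (smul G 0 0) F = scl 0 (shift (r + d) 0 F)" by (rule envlin_lin(2)[OF Cons.prems gr_zero])
      then have "shift (r + d) 0 F w = 0" by simp
      then show ?thesis using Cons.IH[OF envlin_shift[OF Cons.prems True]] by (simp add: p Cons_shift[of F])
    qed (simp add: p)
  qed simp
  then have z: "dl (\<lambda>n x. 0) r N F = 0" for r by (simp add: fun_eq_iff)
  have "dl (dif G) (- 1) (- 1 + N) (dl (dif G) (- 1) N F) - scl (ksign (- 1 * - 1)) (dl (dif G) (- 1) (- 1 + N) (dl (dif G) (- 1) N F)) =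
      dl (\<lambda>n x. 0) (- 1 + - 1) N F"
  proof (rule dl_commutator[OF derivation_dif derivation_dif])
    fix n x assume "x \<in> gr G n"
    then show "dif G (- 1 + n) (dif G n x) - smul G (ksign (- 1 * - 1)) (dif G (- 1 + n) (dif G n x)) = 0"
      using dif_dif[of x n] by simp
  qed (use F in \<open>simp_all add: envlin_def\<close>)
  then have "dl (dif G) (- 1) (- 1 + N) (dl (dif G) (- 1) N F) + dl (dif G) (- 1) (- 1 + N) (dl (dif G) (- 1) N F) = 0"
    unfolding z by (simp add: ksign_def)
  then have "scl (1 + 1) (dl (dif G) (- 1) (- 1 + N) (dl (dif G) (- 1) N F)) = 0" unfolding scl_distrib by simp
  then have "scl (1 / 2) (scl (1 + 1) (dl (dif G) (- 1) (- 1 + N) (dl (dif G) (- 1) N F))) = 0" by simp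
  then show ?thesis by simp
qed

lemma dl_dif_cact:
  assumes a: "a \<in> gr G m" "b \<in> gr G m" and F: "F \<in> envlin N"
  shows "dl (dif G) (- 1) (m + N) (cact m N (a, b) F) =
    cact (m - 1) N (dif G m a, dif G m b) F + scl (ksign m) (cact m (N - 1) (a, b) (dl (dif G) (- 1) N F))"
proof -
  let ?D = "dl (dif G) (- 1)" and ?d = "dl (\<lambda>n. brk G m n b) m"
  have k: "a - b \<in> gr G m" using a by (simp add: gr_diff)
  have 1: "?D (m + N) (?d N F) - scl (ksign (- 1 * m)) (?d (- 1 + N) (?D N F)) = dl (\<lambda>k. brk G (m - 1) k (dif G m b)) (- 1 + m) N F"
  proof (rule dl_commutator[OF derivation_dif derivation_ad[OF a(2)]])
    fix l x assume x: "x \<in> gr G l"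
    show "dif G (m + l) (brk G m l b x) - smul G (ksign (- 1 * m)) (brk G m (- 1 + l) b (dif G l x)) =
        brk G (m - 1) l (dif G m b) x"
      using dif_brk[OF a(2) x] by (simp add: ksign_uminus)
  qed (use F in \<open>simp_all add: envlin_def\<close>)
  have 2: "?D (m + N) (shift m (a - b) F) = scl (ksign m) (shift m (a - b) (?D N F)) + shift (m - 1) (dif G m a - dif G m b) F"
    using dl_shift[OF k, of "dif G" "- 1" N F] a by (simp add: add.commute ksign_uminus dif_diff)
  have "?d N F \<in> LF (m + N)" "shift m (a - b) F \<in> LF (m + N)"
    using dl_closed[OF derivation_ad[OF a(2)] envlin_LF[OF F]] LF_shift[OF envlin_LF[OF F], of m "a - b"] by (simp_all add: add.commute)
  then have "?D (m + N) (cact m N (a, b) F) = ?D (m + N) (?d N F) + ?D (m + N) (shift m (a - b) F)"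
    by (simp add: cact_def dl_add[OF derivation_dif])
  moreover have "?D (m + N) (?d N F) = dl (\<lambda>k. brk G (m - 1) k (dif G m b)) (m - 1) N F + scl (ksign m) (?d (N - 1) (?D N F))"
    using 1 by (simp add: ksign_uminus algebra_simps)
  ultimately show ?thesis unfolding 2 by (simp add: cact_def scl_distrib algebra_simps)
qed

lemma raises_cact:
  assumes \<Phi>: "mfilt \<Phi>" and a: "a \<in> \<Phi> i m" "b \<in> \<Phi> i m" and F: "raises \<Phi> j N F"
  shows "raises \<Phi> (i + j) (m + N) (cact m N (a, b) F)"
  unfolding raises_def
proof
  fix n
  have g: "a \<in> gr G m" "b \<in> gr G m" using a mfilt_gr[OF \<Phi>] by auto
  have 1: "dep \<Phi> n (j + i) (m + N) (dl (\<lambda>n. brk G m n b) m N F)"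
  proof (rule dep_dl[OF \<Phi> derivation_ad[OF g(2)]])
    show "brk G m n b x \<in> \<Phi> (p + i) (m + n)" if "x \<in> \<Phi> p n" for p n x
      using mfilt_simps(6)[OF \<Phi> a(2) that] by (simp add: add.commute)
  qed (use F in \<open>simp add: raises_def\<close>)
  have 2: "dep \<Phi> n (j + i) (N + m) (shift m (a - b) F)"
    using raises_shift[OF F mfilt_simps(3)[OF \<Phi> a]] by (simp add: raises_def)
  show "dep \<Phi> n (i + j) (m + N) (cact m N (a, b) F)"
    unfolding cact_def using dep_add[OF \<Phi> 1, of "shift m (a - b) F"] 2 by (simp add: add.commute)
qed

lemma raises_dif: "mfilt \<Phi> \<Longrightarrow> raises \<Phi> j N F \<Longrightarrow> raises \<Phi> j (N - 1) (dl (dif G) (- 1) N F)"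
  using dep_dl[OF _ derivation_dif, of \<Phi> 0 _ j N F] mfilt_simps(7)[of \<Phi>] by (simp add: raises_def)

end

context dgla
begin

lemma vector_space_scl: "vector_space scl"
  by unfold_locales (auto simp: scl_distrib)

lemma raises_add: "mfilt \<Phi> \<Longrightarrow> raises \<Phi> j N F \<Longrightarrow> raises \<Phi> j N H \<Longrightarrow> raises \<Phi> j N (F + H)"
  and raises_diff: "mfilt \<Phi> \<Longrightarrow> raises \<Phi> j N F \<Longrightarrow> raises \<Phi> j N H \<Longrightarrow> raises \<Phi> j N (F - H)"
  and raises_scl: "mfilt \<Phi> \<Longrightarrow> raises \<Phi> j N F \<Longrightarrow> raises \<Phi> j N (scl c F)"
  and raises_zero: "mfilt \<Phi> \<Longrightarrow> raises \<Phi> j N 0"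
  and raises_mono: "mfilt \<Phi> \<Longrightarrow> raises \<Phi> j N F \<Longrightarrow> i \<le> j \<Longrightarrow> raises \<Phi> i N F"
  and raises_eul: "mfilt \<Phi> \<Longrightarrow> raises \<Phi> 0 0 eul"
  unfolding raises_def by (auto intro: dep_add dep_diff dep_scl dep_zero dep_mono dep_eul)

text \<open>If all letters have weight one, the weight of a value grows with the length of the word;
  for \<open>nilfilt U\<close> this sends long words into \<open>U\<close>.\<close>

lemma raises_length:
  "mfilt \<Phi> \<Longrightarrow> (\<And>n. \<Phi> 1 n = gr G n) \<Longrightarrow> raises \<Phi> j N F \<Longrightarrow> homog w \<Longrightarrow> F w \<in> \<Phi> (j + length w) (N + wdeg w)"
proof (induction w arbitrary: N F j)
  case (Cons p w)
  obtain d a where p: "p = (d, a)" by force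
  have "raises \<Phi> (j + 1) (N + d) (shift d a F)" using raises_shift[OF Cons.prems(3), of a 1 d] Cons.prems by (simp add: p)
  from Cons.IH[OF Cons.prems(1,2) this] show ?case using Cons.prems by (simp add: p shift_def add.assoc)
qed (simp add: raises_Nil)

lemma envlin_word:
  assumes "F \<in> envlin N" "homog u" "a \<in> gr G d" "b \<in> gr G d"
  shows "F (u @ (d, a + b) # w) = F (u @ (d, a) # w) + F (u @ (d, b) # w)"
    and "F (u @ (d, smul G c a) # w) = smul G c (F (u @ (d, a) # w))"
proof -
  have "F (u @ (d, a + b) # w) = F (u @ (d, a) # w) + F (u @ (d, b) # w) \<and>
      F (u @ (d, smul G c a) # w) = smul G c (F (u @ (d, a) # w))"
    using assms(1,2)
  proof (induction u arbitrary: N F)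
    case Nil then show ?case
      using fun_cong[OF envlin_lin(1)[OF Nil(1) assms(3,4)], of w] fun_cong[OF envlin_lin(2)[OF Nil(1) assms(3), of c], of w]
      by (simp add: shift_def scl_def)
  next
    case (Cons p u)
    obtain e x where p: "p = (e, x)" by force
    have "homog u" "x \<in> gr G e" using Cons.prems by (simp_all add: p)
    from Cons.IH[OF envlin_shift[OF Cons.prems(1) this(2)] this(1)] show ?case by (simp add: p shift_def)
  qed
  then show "F (u @ (d, a + b) # w) = F (u @ (d, a) # w) + F (u @ (d, b) # w)"
    "F (u @ (d, smul G c a) # w) = smul G c (F (u @ (d, a) # w))" by auto
qed

end

lemma dgla_cong:
  assumes "dgla A" "smul B = smul A" "gr B = gr A" "brk B = brk A" "dif B = dif A"
  shows "dgla B"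
proof -
  interpret A: dgla A by fact
  interpret vector_space "smul B" unfolding assms(2) by (rule A.vector_space_axioms)
  show ?thesis
    by (unfold_locales; unfold assms(2-5); (rule A.subspace_gr A.brk_closed A.brk_add_left A.brk_smul_left
      A.brk_antisym A.brk_Jacobi A.dif_closed A.dif_add A.dif_smul A.dif_dif A.dif_brk; assumption?))
qed

section \<open>Closed filtrations and the module of admissible functions\<close>

context complete_dgla
begin

text \<open>Closed levels are required so that weight conditions survive limits of
  functions.\<close>

definition cfilt :: "(nat \<Rightarrow> int \<Rightarrow> 'a set) \<Rightarrow> bool"
  where "cfilt \<Phi> \<longleftrightarrow> mfilt \<Phi> \<and> (\<forall>p n. \<forall>z \<in> gr G n. (\<forall>U \<in> opens G. \<exists>l \<in> \<Phi> p n. z - l \<in> U n) \<longrightarrow> z \<in> \<Phi> p n)"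

text \<open>Respecting this two-step filtration means that one letter in \<open>U\<close> forces the
  value into \<open>U\<close>.\<close>

definition openfilt :: "(int \<Rightarrow> 'a set) \<Rightarrow> nat \<Rightarrow> int \<Rightarrow> 'a set"
  where "openfilt U p n = (if p = 0 then gr G n else U n)"

text \<open>Indexed so that levels 0 and 1 are everything for open \<open>U\<close>: every letter
  has weight one, and high levels are contained in \<open>U\<close> by nilpotency.\<close>

definition nilfilt :: "(int \<Rightarrow> 'a set) \<Rightarrow> nat \<Rightarrow> int \<Rightarrow> 'a set"
  where "nilfilt U p n = (if p = 0 then gr G n else {u + l | u l. u \<in> U n \<and> l \<in> lower_central G (p - 1) n})"

lemma cfilt_mfilt: "cfilt \<Phi> \<Longrightarrow> mfilt \<Phi>" by (simp add: cfilt_def)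

lemma cfilt_closed: "cfilt \<Phi> \<Longrightarrow> z \<in> gr G n \<Longrightarrow> (\<And>U. U \<in> opens G \<Longrightarrow> \<exists>l \<in> \<Phi> p n. z - l \<in> U n) \<Longrightarrow> z \<in> \<Phi> p n"
  by (simp add: cfilt_def)

lemma cfilt_openfilt:
  assumes U: "U \<in> opens G"
  shows "cfilt (openfilt U)"
  unfolding cfilt_def mfilt_def
proof (intro conjI allI ballI impI)
  fix p n z assume "z \<in> gr G n" and h: "\<forall>V \<in> opens G. \<exists>l \<in> openfilt U p n. z - l \<in> V n"
  then obtain l where "l \<in> openfilt U p n" "z - l \<in> U n" using U by blast
  then show "z \<in> openfilt U p n"
    using open_simps(2)[OF U, of "z - l" n l] gr_add[of "z - l" n l] openD(2)[OF U, of n]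
    by (auto simp: openfilt_def split: if_splits)
next
  fix p q m n x y assume "x \<in> openfilt U p m" "y \<in> openfilt U q n"
  then show "brk G m n x y \<in> openfilt U (p + q) (m + n)"
    using openD(3,5)[OF U] subsetD[OF openD(2)[OF U, of m]] subsetD[OF openD(2)[OF U, of n]]
    by (auto simp: openfilt_def brk_closed split: if_splits)
qed (use openD[OF U] in \<open>auto simp: openfilt_def subspace_gr dif_closed split: if_splits\<close>)

lemma nilfilt_Suc: "nilfilt U (Suc k) n = {u + l | u l. u \<in> U n \<and> l \<in> lower_central G k n}"
  by (simp add: nilfilt_def)

lemma nilfilt_1:
  assumes U: "U \<in> opens G" shows "nilfilt U 1 n = gr G n"
proof -
  have "0 \<in> U n" using open_simps(1)[OF U] .
  then have "x \<in> {u + l | u l. u \<in> U n \<and> l \<in> gr G n}" if "x \<in> gr G n" for x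
    using that by (intro CollectI exI[of _ 0] exI[of _ x]) simp
  moreover have "u + l \<in> gr G n" if "u \<in> U n" "l \<in> gr G n" for u l
    using that openD(2)[OF U, of n] by (auto intro: gr_add)
  ultimately show ?thesis unfolding One_nat_def nilfilt_Suc by auto
qed

text \<open>The index shift in \<open>nilfilt\<close> absorbs the successor in
  \<open>lower_central_brk\<close>, which makes the filtration multiplicative.\<close>

lemma cfilt_nilfilt:
  assumes U: "U \<in> opens G"
  shows "cfilt (nilfilt U)"
proof -
  have sub: "nilfilt U p n \<subseteq> gr G n" for p n
    using openD(2)[OF U, of n] lower_central_gr[of "p - 1" n] by (auto simp: nilfilt_def intro!: gr_add)
  have sp: "subspace (nilfilt U p n)" for p n
  proof (cases p)
    case 0 then show ?thesis by (simp add: nilfilt_def subspace_gr)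
  next
    case (Suc k)
    have "nilfilt U p n = {x + y |x y. x \<in> U n \<and> y \<in> lower_central G k n}" by (simp add: Suc nilfilt_Suc)
    then show ?thesis using subspace_sums[OF openD(1)[OF U] lower_central_subspace] by simp
  qed
  have I: "u \<in> U n \<Longrightarrow> l \<in> lower_central G k n \<Longrightarrow> u + l \<in> nilfilt U (Suc k) n" for u l k n
    unfolding nilfilt_Suc by blast
  have IU: "u \<in> U n \<Longrightarrow> u \<in> nilfilt U p n" for u n p
  proof (cases p)
    case (Suc k)
    assume "u \<in> U n"
    then show ?thesis using I[of u n 0 k] subspace_0[OF lower_central_subspace] by (simp add: Suc)
  qed (use openD(2)[OF U] in \<open>auto simp: nilfilt_def\<close>)
  have IL: "l \<in> lower_central G k n \<Longrightarrow> l \<in> nilfilt U (Suc k) n" for l k n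
    using I[of 0 n l k] open_simps(1)[OF U] by simp
  have dec: "nilfilt U (Suc p) n \<subseteq> nilfilt U p n" for p n
  proof (cases p)
    case 0 then show ?thesis using sub[of 1 n] by (simp add: nilfilt_def)
  next
    case (Suc k)
    then show ?thesis using lower_central_Suc[of k n] unfolding nilfilt_Suc Suc by blast
  qed
  have br: "brk G m n x y \<in> nilfilt U (p + q) (m + n)" if x: "x \<in> nilfilt U p m" and y: "y \<in> nilfilt U q n" for p q m n x y
  proof (cases "p = 0")
    case True
    show ?thesis
    proof (cases q)
      case 0 then show ?thesis using x y True by (simp add: nilfilt_def brk_closed)
    next
      case (Suc j)
      obtain u l where ul: "u \<in> U n" "l \<in> lower_central G j n" "y = u + l" using y unfolding Suc nilfilt_Suc by blast
      have g: "x \<in> gr G m" "u \<in> gr G n" "l \<in> gr G n" using x ul sub openD(2)[OF U] lower_central_gr by blast+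
      have "brk G m n x l \<in> lower_central G j (m + n)"
        using lower_central_brk1[OF g(1) ul(2)] lower_central_Suc by blast
      then have "brk G m n x u + brk G m n x l \<in> nilfilt U (Suc j) (m + n)"
        by (intro I openD(3)[OF U] g ul)
      then show ?thesis using g by (simp add: True Suc ul brk_add_right)
    qed
  next
    case False
    then obtain i where p: "p = Suc i" by (cases p) auto
    obtain u l where ul: "u \<in> U m" "l \<in> lower_central G i m" "x = u + l" using x unfolding p nilfilt_Suc by blast
    have g: "u \<in> gr G m" "l \<in> gr G m" "y \<in> gr G n" using y ul sub openD(2)[OF U] lower_central_gr by blast+
    have 1: "brk G m n u y \<in> U (m + n)" by (rule openD(5)[OF U g(3) ul(1)])
    show ?thesis
    proof (cases q)
      case 0
      have "brk G m n l y \<in> lower_central G i (m + n)"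
        using lower_central_brk[OF ul(2), of y 0 n] g lower_central_Suc[of i "m + n"] by auto
      then have "brk G m n u y + brk G m n l y \<in> nilfilt U (Suc i) (m + n)" by (intro I 1)
      then show ?thesis using g by (simp add: p 0 ul brk_add_left)
    next
      case (Suc j)
      obtain v k where vk: "v \<in> U n" "k \<in> lower_central G j n" "y = v + k" using y unfolding Suc nilfilt_Suc by blast
      have g': "v \<in> gr G n" "k \<in> gr G n" using vk openD(2)[OF U] lower_central_gr by blast+
      have "brk G m n l v \<in> U (m + n)" by (rule openD(3)[OF U g(2) vk(1)])
      then have "(brk G m n u y + brk G m n l v) + brk G m n l k \<in> nilfilt U (Suc (Suc (i + j))) (m + n)"
        using 1 by (intro I open_simps(2)[OF U] lower_central_brk ul vk)
      moreover have "brk G m n x y = (brk G m n u y + brk G m n l v) + brk G m n l k"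
        using g g' by (simp add: ul(3) brk_add_left) (simp add: vk(3) brk_add_right)
      ultimately show ?thesis by (simp add: p Suc)
    qed
  qed
  have df: "dif G n x \<in> nilfilt U p (n - 1)" if x: "x \<in> nilfilt U p n" for p n x
  proof (cases p)
    case 0 then show ?thesis using x by (simp add: nilfilt_def dif_closed)
  next
    case (Suc k)
    obtain u l where ul: "u \<in> U n" "l \<in> lower_central G k n" "x = u + l" using x unfolding Suc nilfilt_Suc by blast
    have g: "u \<in> gr G n" "l \<in> gr G n" using ul openD(2)[OF U] lower_central_gr by blast+
    have "dif G n u + dif G n l \<in> nilfilt U (Suc k) (n - 1)" by (intro I openD(4)[OF U] lower_central_dif ul)
    then show ?thesis using g by (simp add: Suc ul(3) dif_add)
  qed
  have cl: "z \<in> nilfilt U p n" if z: "\<forall>V \<in> opens G. \<exists>l \<in> nilfilt U p n. z - l \<in> V n" for p n z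
  proof -
    obtain l where l: "l \<in> nilfilt U p n" "z - l \<in> U n" using z U by blast
    have "(z - l) + l \<in> nilfilt U p n" by (rule subspace_add[OF sp IU[OF l(2)] l(1)])
    then show ?thesis by simp
  qed
  show ?thesis unfolding cfilt_def mfilt_def
    using sp dec br df cl by (simp add: nilfilt_def[of U 0])
qed

lemma nilfilt_open:
  assumes "U \<in> opens G" "\<And>n. lower_central G k n \<subseteq> U n"
  shows "nilfilt U (Suc k) n \<subseteq> U n"
  using assms(2)[of n] open_simps(2)[OF assms(1)] unfolding nilfilt_Suc by blast

lemma raises_openfilt:
  assumes U: "U \<in> opens G" and F: "F \<in> LF N"
  shows "raises (openfilt U) (Suc j) N F \<longleftrightarrow> (\<forall>w. homog w \<longrightarrow> F w \<in> U (N + wdeg w))"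
proof
  assume "raises (openfilt U) (Suc j) N F"
  then show "\<forall>w. homog w \<longrightarrow> F w \<in> U (N + wdeg w)"
    using raises_word[OF cfilt_mfilt[OF cfilt_openfilt[OF U]]] by (fastforce simp: openfilt_def)
next
  assume h: "\<forall>w. homog w \<longrightarrow> F w \<in> U (N + wdeg w)"
  have "dep (openfilt U) n (Suc j) N F" for n
    using h
  proof (induction n arbitrary: j N F)
    case 0 then show ?case by (auto simp: openfilt_def dest: spec[of _ "[]"])
  next
    case (Suc n)
    have "dep (openfilt U) n (Suc j + p) (N + d) (shift d a F)" if a: "a \<in> openfilt U p d" for p d a
    proof -
      have a: "a \<in> gr G d" using a openD(2)[OF U] by (auto simp: openfilt_def split: if_splits)
      have "F ((d, a) # w) \<in> U (N + d + wdeg w)" if "homog w" for w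
        using Suc.prems[rule_format, of "(d, a) # w"] that a by (simp add: add.assoc)
      then have "\<forall>w. homog w \<longrightarrow> shift d a F w \<in> U (N + d + wdeg w)" by (simp add: shift_def)
      from Suc.IH[OF this, of "j + p"] show ?thesis by simp
    qed
    moreover have "F [] \<in> openfilt U (Suc j) N" using Suc.prems[rule_format, of "[]"] by (simp add: openfilt_def)
    ultimately show ?case by simp
  qed
  then show "raises (openfilt U) (Suc j) N F" by (simp add: raises_def)
qed

text \<open>The values of Fox derivatives. All closed filtrations impose a condition:
  \<open>openfilt\<close> and \<open>nilfilt\<close> make the quotients of \<open>fox\<close>
  finite-dimensional and nilpotent, and the filtration \<open>fil\<close> of a disjoint product
  enters in \<open>fil_stable\<close>.\<close>

definition modf :: "int \<Rightarrow> ((int \<times> 'a) list \<Rightarrow> 'a) set"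
  where "modf N = {F \<in> envlin N. \<forall>\<Phi>. cfilt \<Phi> \<longrightarrow> raises \<Phi> 0 N F}"

lemma modf_envlin: "F \<in> modf N \<Longrightarrow> F \<in> envlin N" and modf_LF: "F \<in> modf N \<Longrightarrow> F \<in> LF N"
  and modf_raises: "F \<in> modf N \<Longrightarrow> cfilt \<Phi> \<Longrightarrow> raises \<Phi> 0 N F"
  by (auto simp: modf_def envlin_LF)

lemma modf_zero: "0 \<in> modf N" and modf_add: "F \<in> modf N \<Longrightarrow> H \<in> modf N \<Longrightarrow> F + H \<in> modf N"
  and modf_scl: "F \<in> modf N \<Longrightarrow> scl c F \<in> modf N"
  unfolding modf_def using envlin_zero by (auto intro: envlin_add envlin_scl raises_add raises_scl raises_zero cfilt_mfilt)

lemma eul_modf: "eul \<in> modf 0"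
  by (simp add: modf_def eul_envlin raises_eul cfilt_mfilt)

lemma modf_cact:
  assumes "a \<in> gr G m" "b \<in> gr G m" "F \<in> modf N" shows "cact m N (a, b) F \<in> modf (m + N)"
proof -
  have "raises \<Phi> 0 (m + N) (cact m N (a, b) F)" if "cfilt \<Phi>" for \<Phi>
    using raises_cact[OF cfilt_mfilt[OF that] _ _ modf_raises[OF assms(3) that], of a 0 m b] assms that
    by (simp add: cfilt_def mfilt_def)
  then show ?thesis using assms by (simp add: modf_def cact_closed)
qed

lemma modf_dif:
  assumes "F \<in> modf N" shows "dl (dif G) (- 1) N F \<in> modf (N - 1)"
  using assms envlin_dl[OF derivation_dif, of F N] by (simp add: modf_def raises_dif cfilt_mfilt)

definition near :: "int \<Rightarrow> ((int \<times> 'a) list \<Rightarrow> 'a) \<Rightarrow> (int \<Rightarrow> 'a set) \<Rightarrow> ((int \<times> 'a) list \<Rightarrow> 'a) \<Rightarrow> bool"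
  where "near N F U F' \<longleftrightarrow> F' \<in> LF N \<and> (\<forall>w. homog w \<longrightarrow> F w - F' w \<in> U (N + wdeg w))"

lemma near_shift:
  assumes "near N F U F'" "a \<in> gr G d"
  shows "near (N + d) (shift d a F) U (shift d a F')"
  unfolding near_def
proof (intro conjI allI impI)
  show "shift d a F' \<in> LF (N + d)" using assms by (simp add: near_def LF_shift)
  fix w assume "homog w"
  then have "F ((d, a) # w) - F' ((d, a) # w) \<in> U (N + wdeg ((d, a) # w))"
    using assms unfolding near_def by (metis homog_simps(2))
  then show "shift d a F w - shift d a F' w \<in> U (N + d + wdeg w)" by (simp add: shift_def add.assoc)
qed

lemma dep_limit:
  assumes \<Phi>: "cfilt \<Phi>" and "F \<in> LF N" "\<And>U. U \<in> opens G \<Longrightarrow> \<exists>F'. dep \<Phi> n j N F' \<and> near N F U F'"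
  shows "dep \<Phi> n j N F"
  using assms(2,3)
proof (induction n arbitrary: j F N)
  case (0 j F N)
  have "F [] \<in> \<Phi> j N"
  proof (rule cfilt_closed[OF \<Phi> LF_Nil[OF 0(1)]])
    fix U assume "U \<in> opens G"
    then obtain F' where "dep \<Phi> 0 j N F'" "near N F U F'" using 0(2) by blast
    then show "\<exists>l\<in>\<Phi> j N. F [] - l \<in> U N"
      by (intro bexI[of _ "F' []"]) (auto simp: near_def dest: spec[of _ "[]"])
  qed
  then show ?case by simp
next
  case (Suc n j F N)
  have "F [] \<in> \<Phi> j N"
  proof (rule cfilt_closed[OF \<Phi> LF_Nil[OF Suc.prems(1)]])
    fix U assume "U \<in> opens G"
    then obtain F' where "dep \<Phi> (Suc n) j N F'" "near N F U F'" using Suc.prems(2) by blast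
    then show "\<exists>l\<in>\<Phi> j N. F [] - l \<in> U N"
      by (intro bexI[of _ "F' []"]) (auto simp: near_def dest: spec[of _ "[]"])
  qed
  moreover have "dep \<Phi> n (j + p) (N + d) (shift d a F)" if a: "a \<in> \<Phi> p d" for p d a
  proof (rule Suc.IH[OF LF_shift[OF Suc.prems(1)]])
    fix U assume U: "U \<in> opens G"
    obtain F' where F': "dep \<Phi> (Suc n) j N F'" "near N F U F'" using Suc.prems(2)[OF U] by blast
    have "a \<in> gr G d" using a mfilt_gr[OF cfilt_mfilt[OF \<Phi>]] by auto
    then show "\<exists>F'. dep \<Phi> n (j + p) (N + d) F' \<and> near (N + d) (shift d a F) U F'"
      using near_shift[OF F'(2)] F'(1) a by (intro exI[of _ "shift d a F'"]) auto
  qed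
  ultimately show ?case by simp
qed

text \<open>Every condition in \<open>modf\<close> is an equation between values or a closed weight
  condition. The former pass to limits modulo the open ideals by separatedness, the latter by
  closedness.\<close>

lemma modf_limit:
  assumes F: "F \<in> LF N"
    and lim: "\<And>U. U \<in> opens G \<Longrightarrow> \<exists>F' \<in> modf N. \<forall>w. homog w \<longrightarrow> F w - F' w \<in> U (N + wdeg w)"
  shows "F \<in> modf N"
proof -
  have zero: "x = 0" if "x \<in> gr G n" "\<And>U. U \<in> opens G \<Longrightarrow> x \<in> U n" for x n using separated that by blast
  have lin: "lin n F" if "F \<in> LF N" "\<And>U. U \<in> opens G \<Longrightarrow> \<exists>F'. lin n F' \<and> near N F U F'" for n F N
    using that
  proof (induction n arbitrary: F N)
    case (Suc n)
    note F = Suc.prems(1)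
    have "lin1 F"
      unfolding lin1_def fun_eq_iff
    proof (intro conjI allI ballI)
      fix d a b and w :: "(int \<times> 'a) list" assume ab: "a \<in> gr G d" "b \<in> gr G d"
      show "shift d (a + b) F w = (shift d a F + shift d b F) w"
      proof (cases "homog w")
        case True
        have "F ((d, a + b) # w) - (F ((d, a) # w) + F ((d, b) # w)) = 0"
        proof (rule zero[of _ "N + d + wdeg w"])
          show "F ((d, a + b) # w) - (F ((d, a) # w) + F ((d, b) # w)) \<in> gr G (N + d + wdeg w)"
            using LF_gr[OF F] True ab gr_add[OF ab]
            by (intro gr_diff gr_add) (metis (no_types, lifting) add.assoc homog_simps(2) wdeg_simps(2))+
          fix U assume U: "U \<in> opens G"
          obtain F' where F': "lin (Suc n) F'" "near N F U F'" using Suc.prems(2)[OF U] by blast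
          have d: "F ((d, c) # w) - F' ((d, c) # w) \<in> U (N + d + wdeg w)" if "c \<in> gr G d" for c
            using near_shift[OF F'(2) that] True by (simp add: near_def shift_def)
          have "shift d (a + b) F' = shift d a F' + shift d b F'" using F'(1) ab by (simp add: lin1_def)
          then have "F' ((d, a + b) # w) = F' ((d, a) # w) + F' ((d, b) # w)" by (simp add: shift_def fun_eq_iff)
          then have "F ((d, a + b) # w) - (F ((d, a) # w) + F ((d, b) # w)) = (F ((d, a + b) # w) - F' ((d, a + b) # w))
             - ((F ((d, a) # w) - F' ((d, a) # w)) + (F ((d, b) # w) - F' ((d, b) # w)))" by simp
          also have "\<dots> \<in> U (N + d + wdeg w)"
            by (intro open_simps(2,3)[OF U] d ab gr_add[OF ab])
          finally show "F ((d, a + b) # w) - (F ((d, a) # w) + F ((d, b) # w)) \<in> U (N + d + wdeg w)" .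
        qed
        then show ?thesis by (simp add: shift_def)
      next
        case False
        then show ?thesis using LF_0[OF F] by (simp add: shift_def)
      qed
    next
      fix d c a and w :: "(int \<times> 'a) list" assume a: "a \<in> gr G d"
      show "shift d (smul G c a) F w = scl c (shift d a F) w"
      proof (cases "homog w")
        case True
        have "F ((d, smul G c a) # w) - smul G c (F ((d, a) # w)) = 0"
        proof (rule zero[of _ "N + d + wdeg w"])
          show "F ((d, smul G c a) # w) - smul G c (F ((d, a) # w)) \<in> gr G (N + d + wdeg w)"
            using LF_gr[OF F] True a gr_smul[OF a]
            by (intro gr_diff gr_smul) (metis (no_types, lifting) add.assoc homog_simps(2) wdeg_simps(2))+
          fix U assume U: "U \<in> opens G"
          obtain F' where F': "lin (Suc n) F'" "near N F U F'" using Suc.prems(2)[OF U] by blast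
          have d: "F ((d, c) # w) - F' ((d, c) # w) \<in> U (N + d + wdeg w)" if "c \<in> gr G d" for c
            using near_shift[OF F'(2) that] True by (simp add: near_def shift_def)
          have "shift d (smul G c a) F' = scl c (shift d a F')" using F'(1) a by (simp add: lin1_def)
          then have "F' ((d, smul G c a) # w) = smul G c (F' ((d, a) # w))" by (simp add: shift_def scl_def fun_eq_iff)
          then have "F ((d, smul G c a) # w) - smul G c (F ((d, a) # w)) = (F ((d, smul G c a) # w) - F' ((d, smul G c a) # w))
             - smul G c (F ((d, a) # w) - F' ((d, a) # w))" by (simp add: scale_right_diff_distrib)
          also have "\<dots> \<in> U (N + d + wdeg w)"
            by (intro open_simps(3,4)[OF U] d a gr_smul[OF a])
          finally show "F ((d, smul G c a) # w) - smul G c (F ((d, a) # w)) \<in> U (N + d + wdeg w)" .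
        qed
        then show ?thesis by (simp add: shift_def scl_def)
      next
        case False
        then show ?thesis using LF_0[OF F] by (simp add: shift_def scl_def)
      qed
    qed
    moreover have "lin n (shift d a F)" if a: "a \<in> gr G d" for d a
    proof (rule Suc.IH[OF LF_shift[OF F]])
      fix U assume U: "U \<in> opens G"
      obtain F' where F': "lin (Suc n) F'" "near N F U F'" using Suc.prems(2)[OF U] by blast
      then show "\<exists>F'. lin n F' \<and> near (N + d) (shift d a F) U F'"
        using near_shift[OF F'(2) a] a by (intro exI[of _ "shift d a F'"]) auto
    qed
    ultimately show ?case by simp
  qed simp
  have rel: "relv n F" if "F \<in> LF N" "\<And>U. U \<in> opens G \<Longrightarrow> \<exists>F'. relv n F' \<and> near N F U F'" for n F N
    using that
  proof (induction n arbitrary: F N)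
    case (Suc n)
    note F = Suc.prems(1)
    have "rop m a k b F \<in> vanish n" if ab: "a \<in> gr G m" "b \<in> gr G k" for m a k b
      unfolding vanish_def
    proof (intro CollectI allI impI)
      fix w :: "(int \<times> 'a) list" assume w: "length w < n"
      show "rop m a k b F w = 0"
      proof (cases "homog w")
        case True
        show ?thesis
        proof (rule zero[OF LF_gr[OF rop_closed[OF F] True]])
          fix U assume U: "U \<in> opens G"
          obtain F' where F': "relv (Suc n) F'" "near N F U F'" using Suc.prems(2)[OF U] by blast
          note n1 = near_shift[OF F'(2) ab(2)] near_shift[OF F'(2) ab(1)]
          note n2 = near_shift[OF n1(1) ab(1)] near_shift[OF n1(2) ab(2)] near_shift[OF F'(2) brk_closed[OF ab]]
          have e: "N + k + m = m + k + N" "N + m + k = m + k + N" "N + (m + k) = m + k + N" by auto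
          have "rop m a k b F' w = 0" using F'(1) ab w by (simp add: vanish_def)
          then have "rop m a k b F w = rop m a k b F w - rop m a k b F' w" by simp
          also have "\<dots> = (shift m a (shift k b F) w - shift m a (shift k b F') w)
             - smul G (ksign (m * k)) (shift k b (shift m a F) w - shift k b (shift m a F') w)
             - (shift (m + k) (brk G m k a b) F w - shift (m + k) (brk G m k a b) F' w)"
            by (simp add: rop_def scl_def scale_right_diff_distrib)
          also have "\<dots> \<in> U (m + k + N + wdeg w)"
          proof -
            have d: "shift m a (shift k b F) w - shift m a (shift k b F') w \<in> U (m + k + N + wdeg w)"
              "shift k b (shift m a F) w - shift k b (shift m a F') w \<in> U (m + k + N + wdeg w)"
              "shift (m + k) (brk G m k a b) F w - shift (m + k) (brk G m k a b) F' w \<in> U (m + k + N + wdeg w)"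
              using n2 True unfolding near_def e by auto
            show ?thesis by (rule open_simps(3)[OF U open_simps(3)[OF U d(1) open_simps(4)[OF U d(2)]] d(3)])
          qed
          finally show "rop m a k b F w \<in> U (m + k + N + wdeg w)" .
        qed
      next
        case False
        then show ?thesis using LF_0[OF rop_closed[OF F]] by simp
      qed
    qed
    moreover have "relv n (shift d a F)" if a: "a \<in> gr G d" for d a
    proof (rule Suc.IH[OF LF_shift[OF F]])
      fix U assume U: "U \<in> opens G"
      obtain F' where F': "relv (Suc n) F'" "near N F U F'" using Suc.prems(2)[OF U] by blast
      then show "\<exists>F'. relv n F' \<and> near (N + d) (shift d a F) U F'"
        using near_shift[OF F'(2) a] a by (intro exI[of _ "shift d a F'"]) auto
    qed
    ultimately show ?case by simp
  qed simp
  have ex: "\<exists>F'. F' \<in> modf N \<and> near N F U F'" if "U \<in> opens G" for U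
    using lim[OF that] by (auto simp: near_def modf_LF)
  have "lin n F" for n
    using ex by (intro lin[OF F]) (auto simp: modf_def envlin_def multilinear_def, blast)
  moreover have "relv n F" for n
    using ex by (intro rel[OF F]) (auto simp: modf_def envlin_def enveloping_def, blast)
  moreover have "dep \<Phi> n 0 N F" if "cfilt \<Phi>" for \<Phi> n
    using ex modf_raises[OF _ that] by (intro dep_limit[OF that F]) (auto simp: raises_def, blast)
  ultimately show ?thesis
    by (simp add: modf_def envlin_def multilinear_def enveloping_def raises_def F)
qed

end

section \<open>The complete dgla of Fox derivatives\<close>

context complete_dgla
begin

text \<open>Maps into \<open>fox\<close> are Fox derivatives: triples of two maps \<open>f\<close>, \<open>g\<close> to \<open>G\<close> and an \<open>(f, g)\<close>-derivation
  with values in the desuspended module \<open>modf\<close>.\<close>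

definition fox0 :: "('k, ('a \<times> 'a) \<times> ((int \<times> 'a) list \<Rightarrow> 'a)) dgla_data"
  where "fox0 = semidirect (prod_dgla G G) scl modf cact (\<lambda>N. dl (dif G) (- 1) N)"

text \<open>The third component takes values in \<open>U\<close>; raising \<open>openfilt U\<close>
  by one is the form of this condition that combines directly with brackets and
  differentials.\<close>

definition foxopen :: "(int \<Rightarrow> 'a set) \<Rightarrow> int \<Rightarrow> (('a \<times> 'a) \<times> ((int \<times> 'a) list \<Rightarrow> 'a)) set"
  where "foxopen U n = {((a, b), F). a \<in> U n \<and> b \<in> U n \<and> F \<in> modf (n + 1) \<and> raises (openfilt U) 1 (n + 1) F}"

definition fox :: "('k, ('a \<times> 'a) \<times> ((int \<times> 'a) list \<Rightarrow> 'a)) cdgla_data"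
  where "fox = \<lparr>smul = smul fox0, gr = gr fox0, brk = brk fox0, dif = dif fox0, opens = foxopen ` opens G\<rparr>"

definition fox_brk :: "int \<Rightarrow> int \<Rightarrow> 'a \<times> 'a \<Rightarrow> 'a \<times> 'a \<Rightarrow> ((int \<times> 'a) list \<Rightarrow> 'a) \<Rightarrow> ((int \<times> 'a) list \<Rightarrow> 'a) \<Rightarrow> (int \<times> 'a) list \<Rightarrow> 'a"
  where "fox_brk m n u v F F' = scl (ksign m) (cact m (n + 1) u F') - scl (ksign (m * n) * ksign n) (cact n (m + 1) v F)"

lemma fox_simps:
  "smul fox c ((a, b), F) = ((smul G c a, smul G c b), scl c F)"
  "((a, b), F) \<in> gr fox n \<longleftrightarrow> a \<in> gr G n \<and> b \<in> gr G n \<and> F \<in> modf (n + 1)"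
  "brk fox m n ((a, b), F) ((a', b'), F') = ((brk G m n a a', brk G m n b b'), fox_brk m n (a, b) (a', b') F F')"
  "dif fox n ((a, b), F) = ((dif G n a, dif G n b), - dl (dif G) (- 1) (n + 1) F)"
  "opens fox = foxopen ` opens G"
  by (auto simp: fox_def fox0_def semidirect_def prod_dgla_def fox_brk_def)

lemma dgla_fox: "dgla fox"
proof -
  have pr: "(x \<in> gr (prod_dgla G G) m) \<longleftrightarrow> fst x \<in> gr G m \<and> snd x \<in> gr G m" for x m
    by (cases x) (simp add: prod_dgla_def)
  have "dgla fox0"
    unfolding fox0_def
  proof (rule dgla_semidirect[OF dgla_prod[OF dgla_axioms dgla_axioms] vector_space_scl], goal_cases)
    case (1 n)
    interpret v: vector_space scl by (rule vector_space_scl)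
    show ?case by (simp add: v.subspace_def modf_zero modf_add modf_scl)
  next
    case (2 m N x F) then show ?case unfolding pr using modf_cact[of "fst x" m "snd x" F N] by simp
  next
    case (3 m N x x' F) then show ?case unfolding pr
      using cact_add_left[of "fst x" m "snd x" "fst x'" "snd x'" F N] by (simp add: modf_envlin)
  next
    case (4 m N x F F') then show ?case unfolding pr
      using cact_add_right[of "fst x" m "snd x" F N F'] by (simp add: modf_envlin)
  next
    case (5 m N x c F) then show ?case unfolding pr
      using cact_smul_left[of "fst x" m "snd x" F N c] by (cases x) (simp add: modf_envlin prod_dgla_def)
  next
    case (6 m N x c F) then show ?case unfolding pr
      using cact_scl_right[of "fst x" m "snd x" F N c] by (simp add: modf_envlin)
  next
    case (7 m n N x y F)
    then show ?case unfolding pr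
      using cact_commutator[of "fst x" m "snd x" "fst y" n "snd y" F N]
      by (cases x; cases y) (simp only: fst_conv snd_conv modf_envlin prod_dgla_def dgla_data.simps prod.case)
  next
    case (8 N F) then show ?case by (rule modf_dif)
  next
    case (9 N F F') then show ?case by (simp add: dl_add[OF derivation_dif] modf_LF)
  next
    case (10 N c F) then show ?case by (simp add: dl_scl[OF derivation_dif] modf_LF)
  next
    case (11 N F) then show ?case by (simp add: dl_dif_square modf_envlin)
  next
    case (12 m N x F)
    then show ?case unfolding pr
      using dl_dif_cact[of "fst x" m "snd x" F N]
      by (cases x) (simp only: fst_conv snd_conv modf_envlin prod_dgla_def dgla_data.simps prod.case)
  qed
  then show ?thesis by (rule dgla_cong) (simp_all add: fox_def)
qed

lemma foxopen_iff:
  assumes U: "U \<in> opens G"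
  shows "((a, b), F) \<in> foxopen U n \<longleftrightarrow> a \<in> U n \<and> b \<in> U n \<and> F \<in> modf (n + 1) \<and>
    (\<forall>w. homog w \<longrightarrow> F w \<in> U (n + 1 + wdeg w))"
  using raises_openfilt[OF U, of F "n + 1" 0] by (auto simp: foxopen_def modf_LF)

lemma raises_fox_brk:
  assumes \<Phi>: "cfilt \<Phi>" and "a \<in> \<Phi> i m" "b \<in> \<Phi> i m" "a' \<in> \<Phi> j n" "b' \<in> \<Phi> j n"
    "raises \<Phi> k (m + 1) F" "raises \<Phi> l (n + 1) F'"
  shows "raises \<Phi> (min (i + l) (j + k)) (m + n + 1) (fox_brk m n (a, b) (a', b') F F')"
proof -
  have "raises \<Phi> (i + l) (m + (n + 1)) (cact m (n + 1) (a, b) F')"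
    "raises \<Phi> (j + k) (n + (m + 1)) (cact n (m + 1) (a', b') F)"
    using raises_cact[OF cfilt_mfilt[OF \<Phi>]] assms by auto
  then have "raises \<Phi> (min (i + l) (j + k)) (m + n + 1) (cact m (n + 1) (a, b) F')"
    "raises \<Phi> (min (i + l) (j + k)) (m + n + 1) (cact n (m + 1) (a', b') F)"
    using raises_mono[OF cfilt_mfilt[OF \<Phi>]] by (simp_all add: algebra_simps)
  then show ?thesis unfolding fox_brk_def
    by (intro raises_diff raises_scl cfilt_mfilt[OF \<Phi>])
qed

text \<open>Modulo \<open>U\<close> a function in \<open>modf\<close> is determined by short words
  in the letters from \<open>B\<close>: \<open>nilfilt\<close> disposes of long words,
  \<open>openfilt\<close> of letters in \<open>U\<close>, and multilinearity of the remaining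
  letters.\<close>

lemma fox_word_bound:
  assumes U: "U \<in> opens G" and c: "\<And>n. lower_central G c n \<subseteq> U n"
    and B: "\<And>n. B n \<subseteq> gr G n" "\<And>n. gr G n \<subseteq> span (B n \<union> U n)"
    and F: "F \<in> modf N"
    and basis: "\<And>w. set w \<subseteq> Sigma UNIV B \<Longrightarrow> length w \<le> c \<Longrightarrow> F w \<in> U (N + wdeg w)"
    and w: "homog w"
  shows "F w \<in> U (N + wdeg w)"
proof (cases "length w \<le> c")
  case False
  have nf: "mfilt (nilfilt U)" by (rule cfilt_mfilt[OF cfilt_nilfilt[OF U]])
  have "F w \<in> nilfilt U (0 + length w) (N + wdeg w)"
    by (rule raises_length[OF nf nilfilt_1[OF U] modf_raises[OF F cfilt_nilfilt[OF U]] w])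
  also have "\<dots> \<subseteq> nilfilt U (Suc c) (N + wdeg w)" using False by (intro mfilt_mono[OF nf]) auto
  also have "\<dots> \<subseteq> U (N + wdeg w)" by (rule nilfilt_open[OF U c])
  finally show ?thesis .
next
  case True
  \<comment> \<open>The letters of the arbitrary prefix \<open>u\<close> are traded for letters from
    \<open>B\<close>, beginning with the last one.\<close>
  have "F (u @ v) \<in> U (N + wdeg (u @ v))" if "homog u" "set v \<subseteq> Sigma UNIV B" "length (u @ v) \<le> c" for u v
    using that
  proof (induction u arbitrary: v rule: rev_induct)
    case Nil then show ?case using basis by simp
  next
    case (snoc p u)
    obtain d a where p: "p = (d, a)" by force
    have u: "homog u" and a: "a \<in> gr G d" using snoc.prems by (auto simp: p)
    have hv: "homog v" using snoc.prems(2) B(1) by (auto simp: homog_def)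
    let ?n = "N + wdeg (u @ (d, a) # v)"
    let ?S = "{x \<in> gr G d. F (u @ (d, x) # v) \<in> U ?n}"
    have sub: "subspace ?S"
    proof (rule subspaceI)
      have "F (u @ (d, smul G 0 0) # v) = smul G 0 (F (u @ (d, 0) # v))"
        by (rule envlin_word(2)[OF modf_envlin[OF F] u gr_zero gr_zero])
      then show "0 \<in> ?S" using open_simps(1)[OF U] gr_zero by simp
      show "x + y \<in> ?S" if "x \<in> ?S" "y \<in> ?S" for x y
        using that envlin_word(1)[OF modf_envlin[OF F] u, of x d y v] open_simps(2)[OF U] by (auto intro: gr_add)
      show "smul G r x \<in> ?S" if "x \<in> ?S" for r x
        using that envlin_word(2)[OF modf_envlin[OF F] u, of x d x r v] open_simps(4)[OF U] by (auto intro: gr_smul)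
    qed
    have "x \<in> ?S" if x: "x \<in> B d" for x
    proof -
      have "F (u @ (d, x) # v) \<in> U (N + wdeg (u @ (d, x) # v))"
        using snoc.prems x by (intro snoc.IH u) auto
      then show ?thesis using x B(1) by auto
    qed
    moreover have "x \<in> ?S" if x: "x \<in> U d" for x
    proof -
      have "F (u @ (d, x) # v) \<in> openfilt U 1 (N + wdeg (u @ (d, x) # v))"
        using x by (intro raises_slot[OF cfilt_mfilt[OF cfilt_openfilt[OF U]] _ hv modf_raises[OF F cfilt_openfilt[OF U]] u])
          (simp add: openfilt_def)
      then show ?thesis using x openD(2)[OF U] by (auto simp: openfilt_def)
    qed
    ultimately have "span (B d \<union> U d) \<subseteq> ?S" by (intro span_minimal sub) auto
    then have "a \<in> ?S" using B(2) a by blast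
    then show ?case by (simp add: p)
  qed
  from this[of w "[]"] show ?thesis using w True by simp
qed

lemma complete_fox: "complete_dgla fox"
proof -
  interpret T: dgla fox by (rule dgla_fox)
  have oI: "foxopen U \<in> opens fox" if "U \<in> opens G" for U using that by (simp add: fox_simps)
  have sub: "foxopen U n \<subseteq> gr fox n" if U: "U \<in> opens G" for U n
    using openD(2)[OF U, of n] by (auto simp: fox_simps foxopen_def)
  have sp: "T.subspace (foxopen U n)" if U: "U \<in> opens G" for U n
  proof (rule T.subspaceI)
    note r = cfilt_mfilt[OF cfilt_openfilt[OF U]]
    show "0 \<in> foxopen U n"
      using open_simps(1)[OF U] modf_zero raises_zero[OF r] by (simp add: foxopen_def zero_prod_def)
    show "x + y \<in> foxopen U n" if "x \<in> foxopen U n" "y \<in> foxopen U n" for x y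
      using that open_simps(2)[OF U] raises_add[OF r] by (auto simp: foxopen_def modf_add)
    show "smul fox c x \<in> foxopen U n" if "x \<in> foxopen U n" for c x
      using that open_simps(4)[OF U] raises_scl[OF r] by (auto simp: foxopen_def modf_scl fox_simps)
  qed
  show ?thesis
  proof (unfold_locales, goal_cases)
    case 1 show ?case using opens_nonempty by (simp add: fox_simps)
  next
    case (2 U V)
    then obtain U' V' where UV: "U' \<in> opens G" "U = foxopen U'" "V' \<in> opens G" "V = foxopen V'"
      by (auto simp: fox_simps)
    obtain W where W: "W \<in> opens G" "W \<le> U'" "W \<le> V'" using opens_directed UV by blast
    have "foxopen W \<le> U" "foxopen W \<le> V"
      using W unfolding le_fun_def UV by (force simp: foxopen_iff UV(1,3))+
    then show ?case using oI[OF W(1)] by blast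
  next
    case (3 V)
    then obtain U where U: "U \<in> opens G" and V: "V = foxopen U" by (auto simp: fox_simps)
    note r = cfilt_openfilt[OF U]
    have oU: "openfilt U 0 n = gr G n" "openfilt U 1 n = U n" "openfilt U (Suc 0) n = U n" for n by (auto simp: openfilt_def)
    have "brk fox m n x u \<in> foxopen U (m + n)" if x: "x \<in> gr fox m" and u: "u \<in> foxopen U n" for m n x u
    proof -
      obtain a b F a' b' F' where p: "x = ((a, b), F)" "u = ((a', b'), F')" by (cases x; cases u) auto
      have 1: "brk fox m n x u \<in> gr fox (m + n)" using T.brk_closed[OF x] u sub[OF U] by blast
      have "raises (openfilt U) (min (0 + 1) (1 + 0)) (m + n + 1) (fox_brk m n (a, b) (a', b') F F')"
        using x u by (intro raises_fox_brk[OF r]) (auto simp: p oU fox_simps foxopen_def intro: modf_raises[OF _ r])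
      then show ?thesis using 1 x u openD(3)[OF U]
        unfolding p by (auto simp: fox_simps foxopen_def)
    qed
    moreover have "dif fox n u \<in> foxopen U (n - 1)" if u: "u \<in> foxopen U n" for n u
    proof -
      obtain a b F where p: "u = ((a, b), F)" by (cases u) auto
      have 1: "dif fox n u \<in> gr fox (n - 1)" using T.dif_closed u sub[OF U] by blast
      have "raises (openfilt U) 1 (n + 1 - 1) (- dl (dif G) (- 1) (n + 1) F)"
        using u raises_scl[OF cfilt_mfilt[OF r], of 1 "n + 1 - 1" _ "- 1"] raises_dif[OF cfilt_mfilt[OF r], of 1 "n + 1" F]
        by (simp add: p foxopen_def)
      then show ?thesis using 1 u openD(4)[OF U]
        unfolding p by (auto simp: fox_simps foxopen_def)
    qed
    ultimately show ?case using sp[OF U] sub[OF U] unfolding dg_ideal_def V by auto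
  next
    case (4 V)
    then obtain U where U: "U \<in> opens G" and V: "V = foxopen U" by (auto simp: fox_simps)
    obtain c where c: "\<And>n. lower_central G c n \<subseteq> U n"
      using opens_nilpotent[OF U] by (auto simp: nilpotent_quotient_def)
    define S where "S = {n. U n \<noteq> gr G n}"
    have finS: "finite S" using opens_finite_codim[OF U] by (simp add: S_def finite_codim_def)
    have fcB: "\<exists>B. finite B \<and> B \<subseteq> gr G n \<and> gr G n \<subseteq> span (B \<union> U n)" for n
      using opens_finite_codim[OF U] by (simp add: finite_codim_def)
    then obtain B0 where B0: "\<And>n. finite (B0 n)" "\<And>n. B0 n \<subseteq> gr G n" "\<And>n. gr G n \<subseteq> span (B0 n \<union> U n)"
      by metis
    define B where "B n = (if n \<in> S then B0 n else {})" for n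
    have B: "B n \<subseteq> gr G n" "gr G n \<subseteq> span (B n \<union> U n)" for n
      using B0 by (auto simp: B_def S_def intro: span_base)
    \<comment> \<open>By \<open>fox_word_bound\<close> the values on this finite set of words decide
      membership in \<open>foxopen U\<close>.\<close>
    define W where "W = {w. set w \<subseteq> Sigma S B \<and> length w \<le> c}"
    have finW: "finite W"
      unfolding W_def using finS B0(1) by (intro finite_lists_length_le finite_SigmaI) (auto simp: B_def)
    have SB: "Sigma UNIV B = Sigma S B" by (auto simp: B_def split: if_splits)
    have hW: "homog w" if "w \<in> W" for w using that B(1) by (auto simp: W_def homog_def)
    have opn: "((a, b), F) \<in> foxopen U n \<longleftrightarrow> a \<in> U n \<and> b \<in> U n \<and> F \<in> modf (n + 1) \<and> (\<forall>w \<in> W. F w \<in> U (n + 1 + wdeg w))"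
      for a b F n
      unfolding foxopen_iff[OF U]
    proof (intro iffI; (elim conjE)?; intro conjI allI ballI impI)
      fix w assume h: "F \<in> modf (n + 1)" "\<forall>w \<in> W. F w \<in> U (n + 1 + wdeg w)" "homog w"
      show "F w \<in> U (n + 1 + wdeg w)"
        by (rule fox_word_bound[OF U c B h(1) _ h(3)]) (use h(2) in \<open>auto simp: W_def SB\<close>)
    qed (auto dest: hW)
    have "finite {n. foxopen U n \<noteq> gr fox n}"
    proof (rule finite_subset)
      \<comment> \<open>In degree \<open>n\<close> the quotient can be nonzero only if
        \<open>n\<close> or some \<open>n + 1 + wdeg w\<close> lies in the finite set
        \<open>S\<close>.\<close>
      show "{n. foxopen U n \<noteq> gr fox n} \<subseteq> S \<union> (\<lambda>(s, w). s - 1 - wdeg w) ` (S \<times> W)"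
      proof
        fix n assume n: "n \<in> {n. foxopen U n \<noteq> gr fox n}"
        show "n \<in> S \<union> (\<lambda>(s, w). s - 1 - wdeg w) ` (S \<times> W)"
        proof (rule ccontr)
          assume h: "n \<notin> S \<union> (\<lambda>(s, w). s - 1 - wdeg w) ` (S \<times> W)"
          have Un: "U n = gr G n" using h by (simp add: S_def)
          have Uw: "U (n + 1 + wdeg w) = gr G (n + 1 + wdeg w)" if "w \<in> W" for w
          proof (rule ccontr)
            assume "U (n + 1 + wdeg w) \<noteq> gr G (n + 1 + wdeg w)"
            then have "(n + 1 + wdeg w, w) \<in> S \<times> W" using that by (simp add: S_def)
            then have "n \<in> (\<lambda>(s, w). s - 1 - wdeg w) ` (S \<times> W)" by (force intro: rev_image_eqI)
            then show False using h by simp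
          qed
          have "x \<in> foxopen U n" if x: "x \<in> gr fox n" for x
          proof -
            obtain a b F where p: "x = ((a, b), F)" by (cases x) auto
            show ?thesis using x LF_gr[OF modf_LF, of F "n + 1"] hW unfolding p opn
              by (auto simp: fox_simps Un Uw)
          qed
          then show False using n sub[OF U, of n] by auto
        qed
      qed
      show "finite (S \<union> (\<lambda>(s, w). s - 1 - wdeg w) ` (S \<times> W))" using finS finW by simp
    qed
    moreover have "\<exists>C. finite C \<and> C \<subseteq> gr fox n \<and> gr fox n \<subseteq> T.span (C \<union> foxopen U n)" for n
    proof -
      \<comment> \<open>Coordinates modulo \<open>foxopen U\<close>: the two components in
        \<open>G\<close> and the values on the words in \<open>W\<close>.\<close>
      define f where "f i x = (case i of Inl True \<Rightarrow> fst (fst x) | Inl False \<Rightarrow> snd (fst x) | Inr w \<Rightarrow> snd x w)"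
        for i :: "bool + (int \<times> 'a) list" and x :: "('a \<times> 'a) \<times> ((int \<times> 'a) list \<Rightarrow> 'a)"
      define e where "e i = (case i of Inl b \<Rightarrow> n | Inr w \<Rightarrow> n + 1 + wdeg w)" for i :: "bool + (int \<times> 'a) list"
      define I where "I = Inl ` (UNIV :: bool set) \<union> Inr ` W"
      have fI: "finite I" using finW by (simp add: I_def)
      have "\<exists>C. finite C \<and> C \<subseteq> gr fox n \<and> gr fox n \<subseteq> T.span (C \<union> {x \<in> gr fox n. \<forall>i \<in> I. f i x \<in> U (e i)})"
      proof (rule finite_codim_preimage[OF T.vector_space_axioms vector_space_axioms T.subspace_gr fI])
        show "f i (x + y) = f i x + f i y" for i x y
          by (auto simp: f_def split: sum.split bool.split)
        show "f i (smul fox r x) = smul G r (f i x)" for i r x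
          by (cases x) (auto simp: f_def fox_simps scl_def split: sum.split bool.split)
        show "f i x \<in> gr G (e i)" if "i \<in> I" "x \<in> gr fox n" for i x
          using that hW LF_gr[OF modf_LF] by (cases x) (auto simp: f_def e_def I_def fox_simps split: bool.split)
      qed (simp_all add: subspace_gr openD[OF U] fcB)
      moreover have "{x \<in> gr fox n. \<forall>i \<in> I. f i x \<in> U (e i)} = foxopen U n"
      proof (intro set_eqI)
        fix x :: "('a \<times> 'a) \<times> ((int \<times> 'a) list \<Rightarrow> 'a)"
        obtain a b F where p: "x = ((a, b), F)" by (cases x) auto
        have "(\<forall>i \<in> I. f i x \<in> U (e i)) \<longleftrightarrow> a \<in> U n \<and> b \<in> U n \<and> (\<forall>w \<in> W. F w \<in> U (n + 1 + wdeg w))"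
          unfolding I_def by (auto simp: ball_Un f_def e_def p UNIV_bool)
        then show "x \<in> {x \<in> gr fox n. \<forall>i \<in> I. f i x \<in> U (e i)} \<longleftrightarrow> x \<in> foxopen U n"
          using openD(2)[OF U, of n] by (auto simp: p opn fox_simps)
      qed
      ultimately show ?thesis by simp
    qed
    ultimately show ?case unfolding finite_codim_def V by blast
  next
    case (5 V)
    then obtain U where U: "U \<in> opens G" and V: "V = foxopen U" by (auto simp: fox_simps)
    obtain c where c: "\<And>n. lower_central G c n \<subseteq> U n"
      using opens_nilpotent[OF U] by (auto simp: nilpotent_quotient_def)
    note r = cfilt_nilfilt[OF U] and r' = cfilt_mfilt[OF cfilt_nilfilt[OF U]]
    \<comment> \<open>The components in \<open>G\<close> start with weight one and the third
      component with weight zero; each further bracket adds one to both.\<close>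
    let ?N = "\<lambda>k n. {((a, b), F). a \<in> nilfilt U (Suc k) n \<and> b \<in> nilfilt U (Suc k) n \<and> F \<in> modf (n + 1) \<and> raises (nilfilt U) k (n + 1) F}"
    have Nsub: "T.subspace (?N k n)" for k n
    proof (rule T.subspaceI)
      show "0 \<in> ?N k n" using mfilt_simps(1)[OF r'] modf_zero raises_zero[OF r'] by (simp add: zero_prod_def)
      show "x + y \<in> ?N k n" if "x \<in> ?N k n" "y \<in> ?N k n" for x y
        using that mfilt_simps(2)[OF r'] raises_add[OF r'] by (auto simp: modf_add)
      show "smul fox c x \<in> ?N k n" if "x \<in> ?N k n" for c x
        using that mfilt_simps(4)[OF r'] raises_scl[OF r'] by (auto simp: modf_scl fox_simps)
    qed
    have lc: "lower_central fox k n \<subseteq> ?N k n" for k n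
    proof (induction k arbitrary: n)
      case 0
      show ?case using nilfilt_1[OF U] modf_raises[OF _ r] by (auto simp: fox_simps)
    next
      case (Suc k)
      show ?case
      proof
        fix z assume z: "z \<in> lower_central fox (Suc k) n"
        show "z \<in> ?N (Suc k) n"
        proof (rule T.lower_central_induct_span[OF z Nsub])
          fix i x y assume x: "x \<in> gr fox i" and "y \<in> lower_central fox k (n - i)"
          then have y: "y \<in> ?N k (n - i)" using Suc by blast
          obtain a b F a' b' F' where p: "x = ((a, b), F)" "y = ((a', b'), F')" by (cases x; cases y) auto
          have g: "a \<in> gr G i" "b \<in> gr G i" "a' \<in> gr G (n - i)" "b' \<in> gr G (n - i)"
            using x y mfilt_gr[OF r'] by (auto simp: p fox_simps)
          have "y \<in> gr fox (n - i)" using y g by (simp add: p fox_simps)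
          from T.brk_closed[OF x this] have 1: "brk fox i (n - i) x y \<in> gr fox n" by simp
          have 2: "raises (nilfilt U) (min (1 + k) (Suc k + 0)) (i + (n - i) + 1) (fox_brk i (n - i) (a, b) (a', b') F F')"
            using x y nilfilt_1[OF U] by (intro raises_fox_brk[OF r]) (auto simp: p fox_simps intro: modf_raises[OF _ r])
          have "brk G i (n - i) a a' \<in> nilfilt U (1 + Suc k) (i + (n - i))" "brk G i (n - i) b b' \<in> nilfilt U (1 + Suc k) (i + (n - i))"
            using mfilt_simps(6)[OF r', of _ 1 i _ "Suc k" "n - i"] g y unfolding nilfilt_1[OF U] by (auto simp: p)
          then show "brk fox i (n - i) x y \<in> ?N (Suc k) n"
            using 1 2 unfolding p by (simp add: fox_simps)
        qed
      qed
    qed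
    have "?N (Suc c) n \<subseteq> foxopen U n" for n
    proof clarify
      fix a b F assume h: "a \<in> nilfilt U (Suc (Suc c)) n" "b \<in> nilfilt U (Suc (Suc c)) n" "F \<in> modf (n + 1)" "raises (nilfilt U) (Suc c) (n + 1) F"
      have "nilfilt U (Suc (Suc c)) n \<subseteq> nilfilt U (Suc c) n" using r' by (simp add: mfilt_def)
      also have "\<dots> \<subseteq> U n" by (rule nilfilt_open[OF U c])
      finally have "nilfilt U (Suc (Suc c)) n \<subseteq> U n" .
      moreover have "F w \<in> U (n + 1 + wdeg w)" if "homog w" for w
        using raises_word[OF r' h(4) that] nilfilt_open[OF U c] by blast
      ultimately show "((a, b), F) \<in> foxopen U n" using h by (auto simp: foxopen_iff[OF U])
    qed
    then show ?case using lc unfolding nilpotent_quotient_def V by blast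
  next
    case (6 x n)
    obtain a b F where p: "x = ((a, b), F)" by (cases x) auto
    have h: "((a, b), F) \<in> foxopen U n" if "U \<in> opens G" for U using 6(2)[OF oI[OF that]] p by simp
    have F: "F \<in> modf (n + 1)" and ab: "a \<in> gr G n" "b \<in> gr G n" using 6(1) by (auto simp: p fox_simps)
    have "a = 0" "b = 0" using h ab separated[of a n] separated[of b n] by (auto simp: foxopen_def)
    moreover have "F w = 0" for w
    proof (cases "homog w")
      case True
      then show ?thesis using separated[OF LF_gr[OF modf_LF[OF F]]] h by (auto simp: foxopen_iff)
    qed (use LF_0[OF modf_LF[OF F]] in simp)
    ultimately show ?case by (simp add: p zero_prod_def fun_eq_iff)
  next
    case (7 c n)
    define a b F where "a U = fst (fst (c (foxopen U)))" and "b U = snd (fst (c (foxopen U)))" and "F U = snd (c (foxopen U))" for U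
    have cU: "c (foxopen U) = ((a U, b U), F U)" for U by (simp add: a_def b_def F_def)
    have g: "a U \<in> gr G n" "b U \<in> gr G n" "F U \<in> modf (n + 1)" if "U \<in> opens G" for U
      using 7(1)[OF oI[OF that]] by (auto simp: cU fox_simps)
    have mono: "foxopen V \<le> foxopen U" if "U \<in> opens G" "V \<in> opens G" "V \<le> U" for U V
      using that(3) unfolding le_fun_def by (force simp: foxopen_iff that)
    have d: "a V - a U \<in> U n" "b V - b U \<in> U n" "homog w \<Longrightarrow> F V w - F U w \<in> U (n + 1 + wdeg w)"
      if "U \<in> opens G" "V \<in> opens G" "V \<le> U" for U V w
      using 7(2)[OF oI[OF that(1)] oI[OF that(2)] mono[OF that]] by (auto simp: cU foxopen_iff[OF that(1)])
    obtain x where x: "x \<in> gr G n" "\<And>U. U \<in> opens G \<Longrightarrow> x - a U \<in> U n"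
      using complete[of a n] g d by metis
    obtain y where y: "y \<in> gr G n" "\<And>U. U \<in> opens G \<Longrightarrow> y - b U \<in> U n"
      using complete[of b n] g d by metis
    have "\<exists>z \<in> gr G (n + 1 + wdeg w). \<forall>U \<in> opens G. z - F U w \<in> U (n + 1 + wdeg w)" if "homog w" for w
      using d(3)[OF _ _ _ that] LF_gr[OF modf_LF[OF g(3)] that] by (intro complete) auto
    then obtain H0 where H0: "\<And>w. homog w \<Longrightarrow> H0 w \<in> gr G (n + 1 + wdeg w)"
      "\<And>w U. homog w \<Longrightarrow> U \<in> opens G \<Longrightarrow> H0 w - F U w \<in> U (n + 1 + wdeg w)" by metis
    define H where "H w = (if homog w then H0 w else 0)" for w
    have "H \<in> LF (n + 1)" using H0(1) by (simp add: LF_def H_def)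
    moreover have "\<forall>w. homog w \<longrightarrow> H w - F U w \<in> U (n + 1 + wdeg w)" if "U \<in> opens G" for U
      using H0(2) that by (simp add: H_def)
    ultimately have Hm: "H \<in> modf (n + 1)" using g(3) by (intro modf_limit) blast+
    have "((x, y), H) - c (foxopen U) \<in> foxopen U n" if U: "U \<in> opens G" for U
      using x(2)[OF U] y(2)[OF U] H0(2)[OF _ U] modf_add[OF Hm modf_scl[OF g(3)[OF U], of "- 1"]]
      by (auto simp: cU foxopen_iff[OF U] H_def)
    then show ?case using x(1) y(1) Hm by (intro bexI[of _ "((x, y), H)"]) (auto simp: fox_simps)
  qed
qed

text \<open>\<open>eul\<close> is a cycle by naturality, and its bracket with itself vanishes
  because the pair \<open>(0, 0)\<close> acts by zero. Desuspension puts it into degree - 1.\<close>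

lemma fox_MC: "((0, 0), eul) \<in> MC fox"
proof -
  have z: "((0, 0), eul) \<in> gr fox (- 1)" using eul_modf gr_zero by (simp add: fox_simps)
  have "cact m N (0, 0) F = 0" if "F \<in> modf N" for m N F
    using cact_smul_left[OF gr_zero gr_zero modf_envlin[OF that], of m 0] by simp
  from this[of eul 0 "- 1"] have "fox_brk (- 1) (- 1) (0, 0) (0, 0) eul eul = 0"
    using eul_modf by (simp add: fox_brk_def)
  then show ?thesis
    using z by (simp add: MC_def fox_simps dl_eul[OF derivation_dif] brk_zero_left gr_zero dif_zero zero_prod_def)
qed

lemma complete_fox_twist: "complete_dgla (twist fox ((0, 0), eul))"
  by (rule complete_dgla.complete_dgla_twist[OF complete_fox fox_MC])

end

section \<open>The universal property of the disjoint product\<close>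

lemma cont_mapI:
  assumes "\<And>n x. x \<in> gr G n \<Longrightarrow> f n x \<in> gr H n"
    and "\<And>n x y. \<lbrakk>x \<in> gr G n; y \<in> gr G n\<rbrakk> \<Longrightarrow> f n (x + y) = f n x + f n y"
    and "\<And>n c x. x \<in> gr G n \<Longrightarrow> f n (smul G c x) = smul H c (f n x)"
    and "\<And>m n x y. \<lbrakk>x \<in> gr G m; y \<in> gr G n\<rbrakk> \<Longrightarrow> f (m + n) (brk G m n x y) = brk H m n (f m x) (f n y)"
    and "\<And>n x. x \<in> gr G n \<Longrightarrow> f (n - 1) (dif G n x) = dif H n (f n x)"
    and "\<And>V. V \<in> opens H \<Longrightarrow> \<exists>U \<in> opens G. \<forall>n. f n ` U n \<subseteq> V n"
  shows "cont_map G H f"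
  using assms by (auto simp: cont_map_def)

lemma cont_map_0: assumes "dgla G" "dgla H" "cont_map G H f" shows "f n 0 = 0"
proof -
  interpret G: dgla G by fact
  have "f n (0 + 0) = f n 0 + f n 0" by (intro cont_mapD(2)[OF assms(3)] G.gr_zero)
  then show ?thesis by simp
qed

lemma cont_map_diff:
  assumes "dgla G" "cont_map G H f" "x \<in> gr G n" "y \<in> gr G n"
  shows "f n (x - y) = f n x - f n y"
proof -
  interpret G: dgla G by fact
  have "f n (x - y + y) = f n (x - y) + f n y" using assms by (intro cont_mapD(2)[OF assms(2)] G.gr_diff)
  then show ?thesis by (simp add: algebra_simps)
qed

lemma cont_map_uminus:
  assumes "dgla G" "dgla H" "cont_map G H f" "x \<in> gr G n"
  shows "f n (- x) = - f n x"
  using cont_map_diff[OF assms(1,3) _ assms(4), of 0] cont_map_0[OF assms(1-3)] assms(1) by (simp add: dgla.gr_zero)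

lemma cont_map_id: "cont_map G G (\<lambda>n. id)"
  by (auto simp: cont_map_def)

lemma cont_map_zero:
  assumes "complete_dgla G" "complete_dgla H"
  shows "cont_map G H (\<lambda>n x. 0)"
proof -
  interpret G: complete_dgla G by fact
  interpret H: complete_dgla H by fact
  show ?thesis
    using G.opens_nonempty H.open_simps(1)
    by (intro cont_mapI) (auto simp: H.gr_zero H.brk_zero_left H.dif_zero)
qed

lemma cont_map_cong:
  assumes "cont_map G H f"
    and "smul G' = smul G" "gr G' = gr G" "brk G' = brk G" "opens G' = opens G" "\<And>n x. x \<in> gr G n \<Longrightarrow> dif G' n x = dif G n x"
    and "smul H' = smul H" "gr H' = gr H" "brk H' = brk H" "opens H' = opens H" "\<And>n x. x \<in> gr H n \<Longrightarrow> dif H' n x = dif H n x"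
  shows "cont_map G' H' f"
  using assms(1) unfolding cont_map_def assms(2-5,7-10) by (simp add: assms(6,11))

lemma cont_map_twist:
  assumes "dgla G" "cont_map G H f" "\<xi> \<in> gr G (- 1)" "\<eta> = f (- 1) \<xi>"
  shows "cont_map (twist G \<xi>) (twist H \<eta>) f"
proof -
  interpret G: dgla G by fact
  have b: "brk G (- 1) n \<xi> x \<in> gr G (n - 1)" if "x \<in> gr G n" for n x
    using G.brk_closed[OF assms(3) that] by simp
  have "f (n - 1) (brk G (- 1) n \<xi> x) = brk H (- 1) n \<eta> (f n x)" if "x \<in> gr G n" for n x
    using cont_mapD(4)[OF assms(2,3) that] assms(4) by simp
  then show ?thesis
    using cont_mapD[OF assms(2)] b by (intro cont_mapI) (simp_all add: G.dif_closed)
qed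

lemma cont_map_MC:
  assumes "dgla G" "dgla H" "cont_map G H f" "\<xi> \<in> MC G"
  shows "f (- 1) \<xi> \<in> MC H"
proof -
  interpret G: dgla G by fact
  note \<xi> = G.MC_dif(1)[OF assms(4)]
  have w: "brk G (- 1) (- 1) \<xi> \<xi> \<in> gr G (- 2)" using G.brk_closed[OF \<xi> \<xi>] by simp
  have "f (- 2) (dif G (- 1) \<xi> + smul G (1 / 2) (brk G (- 1) (- 1) \<xi> \<xi>)) = f (- 2) 0"
    using assms(4) by (simp add: MC_def)
  then show ?thesis
    using cont_mapD[OF assms(3)] cont_mapD(4,5)[OF assms(3) \<xi>] cont_mapD(4)[OF assms(3) \<xi> \<xi>] G.dif_closed[OF \<xi>] w \<xi>
      cont_map_0[OF assms(1-3)]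
    by (simp add: MC_def G.gr_smul)
qed

lemma eq_maps_iff: "eq_maps G f g \<longleftrightarrow> (\<forall>n x. x \<in> gr G n \<longrightarrow> f n x = g n x)" by (auto simp: eq_maps_def)

lemma eq_mapsD: "eq_maps G f g \<Longrightarrow> x \<in> gr G n \<Longrightarrow> f n x = g n x" by (simp add: eq_maps_def)

text \<open>Maps out of \<open>(G * s)\<^sup>x * H\<close> to test objects with carrier in the type given by the first argument.
  In the twisted differential \<open>- x\<close> is a Maurer--Cartan element, and \<open>G\<close> maps to the twist of the product by \<open>- x\<close>.\<close>

definition twistable :: "('k::field_char_0, 'a::ab_group_add, 'm) dgla_data_scheme \<Rightarrow> 'a \<Rightarrow> bool"
  where "twistable T y \<longleftrightarrow> y \<in> gr T (- 1) \<and> dif T (- 1) y = smul T (1 / 2) (brk T (- 1) (- 1) y y)"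

definition dp_map ::
    "('k::field_char_0, 'a::ab_group_add) cdgla_data \<Rightarrow> ('k, 'b::ab_group_add) cdgla_data \<Rightarrow>
      ('k, 'c::ab_group_add) cdgla_data \<Rightarrow> (int \<Rightarrow> 'a \<Rightarrow> 'c) \<Rightarrow> (int \<Rightarrow> 'b \<Rightarrow> 'c) \<Rightarrow> 'c \<Rightarrow>
      ('k, 'd::ab_group_add) cdgla_data \<Rightarrow> (int \<Rightarrow> 'a \<Rightarrow> 'd) \<Rightarrow> (int \<Rightarrow> 'b \<Rightarrow> 'd) \<Rightarrow> 'd \<Rightarrow> (int \<Rightarrow> 'c \<Rightarrow> 'd) \<Rightarrow> bool"
  where "dp_map G H P i j x T f g y h \<longleftrightarrow> cont_map P T h \<and> (\<forall>n. \<forall>u \<in> gr G n. h n (i n u) = f n u) \<and>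
    (\<forall>n. \<forall>u \<in> gr H n. h n (j n u) = g n u) \<and> h (- 1) x = y"

definition dp_universal :: "'d::ab_group_add itself \<Rightarrow>
    ('k::field_char_0, 'a::ab_group_add) cdgla_data \<Rightarrow> ('k, 'b::ab_group_add) cdgla_data \<Rightarrow>
      ('k, 'c::ab_group_add) cdgla_data \<Rightarrow> (int \<Rightarrow> 'a \<Rightarrow> 'c) \<Rightarrow> (int \<Rightarrow> 'b \<Rightarrow> 'c) \<Rightarrow> 'c \<Rightarrow> bool"
  where "dp_universal _ G H P i j x \<longleftrightarrow>
    (\<forall>(T :: ('k, 'd) cdgla_data) f g y.
      complete_dgla T \<and> twistable T y \<and> cont_map G (twist T (- y)) f \<and> cont_map H T g \<longrightarrow>
      (\<exists>h. dp_map G H P i j x T f g y h) \<and>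
      (\<forall>h h'. dp_map G H P i j x T f g y h \<longrightarrow> dp_map G H P i j x T f g y h' \<longrightarrow> eq_maps P h h'))"

lemma dp_universalI:
  assumes "\<And>(T :: ('k::field_char_0, 'd::ab_group_add) cdgla_data) f g y.
      complete_dgla T \<Longrightarrow> twistable T y \<Longrightarrow> cont_map G (twist T (- y)) f \<Longrightarrow> cont_map H T g \<Longrightarrow>
      (\<exists>h. dp_map G H P i j x T f g y h)"
    and "\<And>(T :: ('k::field_char_0, 'd::ab_group_add) cdgla_data) f g y h h'.
      complete_dgla T \<Longrightarrow> twistable T y \<Longrightarrow> cont_map G (twist T (- y)) f \<Longrightarrow> cont_map H T g \<Longrightarrow>
      dp_map G H P i j x T f g y h \<Longrightarrow> dp_map G H P i j x T f g y h' \<Longrightarrow> eq_maps P h h'"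
  shows "dp_universal TYPE('d) G H P i j x"
  using assms unfolding dp_universal_def by blast

lemma dp_universalD:
  assumes "dp_universal TYPE('d) G H P i j x"
    "complete_dgla (T :: ('k::field_char_0, 'd::ab_group_add) cdgla_data)"
    "twistable T y" "cont_map G (twist T (- y)) f" "cont_map H T g"
  shows "\<exists>h. dp_map G H P i j x T f g y h"
    and "dp_map G H P i j x T f g y h \<Longrightarrow> dp_map G H P i j x T f g y h' \<Longrightarrow> eq_maps P h h'"
  using assms unfolding dp_universal_def by blast+

lemma twistable_MC:
  assumes "dgla T" "y \<in> gr T (- 1)"
  shows "twistable T y \<longleftrightarrow> - y \<in> MC T"
proof -
  interpret dgla T by fact
  have "dif T (- 1) (- y) + smul T (1 / 2) (brk T (- 1) (- 1) (- y) (- y)) =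
      smul T (1 / 2) (brk T (- 1) (- 1) y y) - dif T (- 1) y"
    using assms(2) by (simp add: dif_uminus brk_uminus_left brk_uminus_right gr_uminus)
  then show ?thesis using assms(2) gr_uminus by (auto simp: twistable_def MC_def)
qed

lemma (in dgla) smul_half:
  "smul G (1 / 2) v + smul G (1 / 2) v = v" "v - smul G (1 / 2) v = smul G (1 / 2) v"
  "smul G (1 / 2) v - v = - smul G (1 / 2) v" "- smul G (1 / 2) v - smul G (1 / 2) v = - v"
proof -
  show 1: "smul G (1 / 2) v + smul G (1 / 2) v = v"
    using scale_left_distrib[of "1 / 2" "1 / 2" v] by simp
  then show "v - smul G (1 / 2) v = smul G (1 / 2) v" by (metis add_diff_cancel_right')
  then show "smul G (1 / 2) v - v = - smul G (1 / 2) v" by (metis minus_diff_eq)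
  show "- smul G (1 / 2) v - smul G (1 / 2) v = - v" using 1 by (metis minus_add_distrib add_uminus_conv_diff)
qed

text \<open>For odd \<open>y\<close> the Jacobi identity gives 3 [y, [y, y]] = 0, and the even
  element [y, y] commutes with itself by antisymmetry.\<close>

lemma (in dgla) brk_cube:
  assumes y: "y \<in> gr G (- 1)"
  shows "brk G (- 1) (- 2) y (brk G (- 1) (- 1) y y) = 0" "brk G (- 2) (- 1) (brk G (- 1) (- 1) y y) y = 0"
    "brk G (- 2) (- 2) (brk G (- 1) (- 1) y y) (brk G (- 1) (- 1) y y) = 0"
proof -
  let ?w = "brk G (- 1) (- 1) y y" let ?v = "brk G (- 1) (- 2) y ?w"
  have w: "?w \<in> gr G (- 2)" using brk_closed[OF y y] by simp
  have 1: "brk G (- 2) (- 1) ?w y = - ?v" using brk_antisym[OF w y] by (simp add: ksign_def)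
  have "?v = - ?v - ?v" using brk_Jacobi[OF y y y] 1 by (simp add: ksign_def)
  then have "smul G 3 ?v = 0" using scale_left_distrib[of 2 1 ?v] scale_left_distrib[of 1 1 ?v]
    by (simp add: algebra_simps)
  then show "?v = 0" by simp
  then show "brk G (- 2) (- 1) ?w y = 0" using 1 by simp
  have "brk G (- 2) (- 2) ?w ?w = - brk G (- 2) (- 2) ?w ?w" using brk_antisym[OF w w] by (simp add: ksign_def)
  then have "smul G 2 (brk G (- 2) (- 2) ?w ?w) = 0" using scale_left_distrib[of 1 1 "brk G (- 2) (- 2) ?w ?w"]
    by (metis ab_group_add_class.ab_left_minus one_add_one scale_one)
  then show "brk G (- 2) (- 2) ?w ?w = 0" by simp
qed

text \<open>\<open>sdgla\<close> represents Maurer--Cartan elements: by \<open>brk_cube\<close> the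
  brackets of \<open>y\<close> stop at [y, y], in accordance with the basis of
  \<open>sdgla\<close>.\<close>

lemma sdgla_map:
  assumes T: "complete_dgla T" and y: "y \<in> MC T"
  obtains k where "cont_map sdgla T k" "k (- 1) (1, 0) = y"
    "\<And>k'. cont_map sdgla T k' \<Longrightarrow> k' (- 1) (1, 0) = y \<Longrightarrow> eq_maps sdgla k' k"
proof -
  interpret complete_dgla T by fact
  let ?s = "sdgla :: ('a, 'a \<times> 'a) cdgla_data"
  interpret s: complete_dgla ?s by (rule complete_dgla_sdgla)
  let ?w = "brk T (- 1) (- 1) y y"
  have y': "y \<in> gr T (- 1)" "dif T (- 1) y = smul T (- (1 / 2)) ?w" using MC_dif[OF y] by auto
  have w: "?w \<in> gr T (- 2)" using brk_closed[OF y'(1,1)] by simp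
  have dw: "dif T (- 2) ?w = 0"
    using dif_brk[OF y'(1,1)] brk_cube(1,2)[OF y'(1)]
    by (simp add: y'(2) w y'(1) brk_smul_left brk_smul_right brk_uminus_left brk_uminus_right gr_smul)
  define k where "k n p = (if n = - 1 then smul T (fst p) y else if n = - 2 then smul T (snd p) ?w else 0)"
    for n :: int and p
  have "cont_map ?s T k"
  proof (rule cont_mapI, goal_cases)
    case (1 n x) then show ?case using y' w by (simp add: k_def gr_smul gr_zero)
  next
    case (2 n x z) then show ?case by (cases x; cases z) (simp add: k_def scale_left_distrib)
  next
    case (3 n c x) then show ?case by (cases x) (simp add: k_def sdgla_def)
  next
    case (4 m n p q)
    then show ?case using brk_cube[OF y'(1)] y'(1) w
      by (cases p; cases q) (auto simp: k_def sdgla_def brk_smul_left brk_smul_right gr_smul brk_zero_left brk_zero_right gr_zero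
        mult.commute split: if_splits)
  next
    case (5 n p)
    then show ?case using y'(1) w dw y'(2) by (cases p) (auto simp: k_def sdgla_def dif_smul dif_zero split: if_splits)
  next
    case (6 V)
    then show ?case using open_simps(1) by (auto simp: sdgla_def k_def)
  qed
  moreover have "k (- 1) (1, 0) = y" by (simp add: k_def)
  moreover have "eq_maps ?s k' k" if k': "cont_map ?s T k'" and one: "k' (- 1) (1, 0) = y" for k'
    unfolding eq_maps_iff
  proof (intro allI impI)
    fix n p assume p: "p \<in> gr ?s n"
    note h = cont_mapD(3)[OF k']
    have x: "(1, 0) \<in> gr ?s (- 1)" "(0, 1) \<in> gr ?s (- 2)" by (auto simp: sdgla_def)
    have "k' (- 2) (0, 1) = ?w" using cont_mapD(4)[OF k' x(1,1)] one by (simp add: sdgla_def)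
    then show "k' n p = k n p"
      using p h[OF x(1), of "fst p"] h[OF x(2), of "snd p"] one cont_map_0[OF s.dgla_axioms dgla_axioms k']
      by (cases p) (auto simp: k_def sdgla_def zero_prod_def split: if_splits)
  qed
  ultimately show ?thesis by (rule that)
qed

locale disjoint_product_data =
  fixes G :: "('k::field_char_0, 'a::ab_group_add) cdgla_data" and H :: "('k, 'b::ab_group_add) cdgla_data"
    and P :: "('k, 'c::ab_group_add) cdgla_data" and i :: "int \<Rightarrow> 'a \<Rightarrow> 'c" and j :: "int \<Rightarrow> 'b \<Rightarrow> 'c" and x :: 'c
  assumes complete_G: "complete_dgla G" and complete_H: "complete_dgla H" and complete_P: "complete_dgla P"
    and twistable_x: "twistable P x" and cont_i: "cont_map G (twist P (- x)) i" and cont_j: "cont_map H P j"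

text \<open>Linearity of the bracket is available only on homogeneous elements, so the double twist
  is undone pointwise there and maps are transported by \<open>cont_map_cong\<close>.\<close>

lemma twist_twist_uminus:
  assumes "dgla T" "y \<in> gr T (- 1)" "v \<in> gr T n"
  shows "dif (twist (twist T (- y)) y) n v = dif T n v" "dif (twist (twist T y) (- y)) n v = dif T n v"
    "dif (twist (twist T (- y)) (- (- y))) n v = dif T n v"
  using dgla.brk_uminus_left[OF assms] by simp_all

text \<open>In the twist of \<open>A\<close> the differential of \<open>xA\<close> is + 1/2
  [xA, xA], so - x is Maurer--Cartan in \<open>P\<close>, and undoing the twist there gives the map
  from \<open>G\<close>. A test datum \<open>f\<close>, \<open>g\<close>, \<open>y\<close> extends
  first over \<open>A\<close> into the twist of \<open>T\<close> by - y, where \<open>y\<close> is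
  Maurer--Cartan, and after untwisting over \<open>P\<close>.\<close>

lemma coproducts_disjoint_product_data:
  assumes GA: "is_coproduct G sdgla A iA jA" and AP: "is_coproduct (twist A (jA (- 1) (1, 0))) H P i' j'"
    and G: "complete_dgla G" and H: "complete_dgla H"
  defines "xA \<equiv> jA (- 1) (1, 0)"
  shows "disjoint_product_data G H P (\<lambda>n. i' n \<circ> iA n) j' (i' (- 1) xA)"
    and "dp_universal TYPE('d::ab_group_add) G H P (\<lambda>n. i' n \<circ> iA n) j' (i' (- 1) xA)"
proof -
  interpret A: complete_dgla A using GA by (simp add: is_coproduct_def)
  interpret P: complete_dgla P using AP by (simp add: is_coproduct_def)
  note dA = A.dgla_axioms and dP = P.dgla_axioms
  have iA: "cont_map G A iA" and jA: "cont_map sdgla A jA" using GA by (simp_all add: is_coproduct_def)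
  have i': "cont_map (twist A xA) P i'" and j': "cont_map H P j'" using AP by (simp_all add: is_coproduct_def xA_def)
  have s1: "(1, 0) \<in> gr (sdgla :: ('a, 'a \<times> 'a) cdgla_data) (- 1)" by (simp add: sdgla_def)
  have s2: "(1, 0) \<in> MC (sdgla :: ('a, 'a \<times> 'a) cdgla_data)" by (simp add: MC_def sdgla_def zero_prod_def)
  have xA: "xA \<in> gr A (- 1)" using cont_mapD(1)[OF jA s1] by (simp add: xA_def)
  have xAMC: "xA \<in> MC A" unfolding xA_def by (rule cont_map_MC[OF dgla_sdgla A.dgla_axioms jA s2])
  interpret A': complete_dgla "twist A xA" by (rule A.complete_dgla_twist[OF xAMC])
  let ?x = "i' (- 1) xA" let ?i = "\<lambda>n. i' n \<circ> iA n"
  have x: "?x \<in> gr P (- 1)" using cont_mapD(1)[OF i'] xA by simp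
  have wA: "brk A (- 1) (- 1) xA xA \<in> gr A (- 2)" using A.brk_closed[OF xA xA] by simp
  have tx: "twistable P ?x"
  proof -
    have "dif P (- 1) ?x = i' (- 2) (dif A (- 1) xA + brk A (- 1) (- 1) xA xA)"
      using cont_mapD(5)[OF i', of xA "- 1"] xA by simp
    also have "dif A (- 1) xA + brk A (- 1) (- 1) xA xA = smul A (1 / 2) (brk A (- 1) (- 1) xA xA)"
      using A.MC_dif(2)[OF xAMC] A.scale_left_distrib[of "- (1 / 2)" 1 "brk A (- 1) (- 1) xA xA"] by simp
    also have "i' (- 2) \<dots> = smul P (1 / 2) (brk P (- 1) (- 1) ?x ?x)"
      using cont_mapD(3)[OF i', of "brk A (- 1) (- 1) xA xA" "- 2"] cont_mapD(4)[OF i', of xA "- 1" xA "- 1"] xA wA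
      by simp
    finally show ?thesis using x by (simp add: twistable_def)
  qed
  have xm: "i' (- 1) (- xA) = - ?x"
    using cont_map_uminus[OF A'.dgla_axioms dP i', of xA "- 1"] xA by simp
  have i2: "cont_map (twist (twist A xA) (- xA)) (twist P (- ?x)) i'"
    using cont_map_twist[OF A'.dgla_axioms i' _ xm[symmetric]] xA A.gr_uminus by simp
  have i3: "cont_map A (twist P (- ?x)) i'"
    by (rule cont_map_cong[OF i2]) (use twist_twist_uminus(2)[OF dA xA] in \<open>simp_all\<close>)
  show "disjoint_product_data G H P ?i j' ?x"
    using G H tx j' P.complete_dgla_axioms cont_map_comp[OF iA i3] by (intro disjoint_product_data.intro)
  show "dp_universal TYPE('d::ab_group_add) G H P ?i j' ?x"
  proof (rule dp_universalI)
    fix T :: "('a, 'd) cdgla_data" and f g y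
    assume T: "complete_dgla T" and y: "twistable T y" and f: "cont_map G (twist T (- y)) f" and g: "cont_map H T g"
    interpret T: complete_dgla T by fact
    note dT = T.dgla_axioms
    have yg: "y \<in> gr T (- 1)" "dif T (- 1) y = smul T (1 / 2) (brk T (- 1) (- 1) y y)" using y by (auto simp: twistable_def)
    have my: "- y \<in> MC T" using y twistable_MC[OF dT yg(1)] by simp
    interpret T1: complete_dgla "twist T (- y)" by (rule T.complete_dgla_twist[OF my])
    have w: "brk T (- 1) (- 1) y y \<in> gr T (- 2)" using T.brk_closed[OF yg(1,1)] by simp
    have "y \<in> MC (twist T (- y))"
      using yg T.smul_half[of "brk T (- 1) (- 1) y y"]
      by (simp add: MC_def T.brk_uminus_left)
    then obtain k where k: "cont_map sdgla (twist T (- y)) k" "k (- 1) (1, 0) = y"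
      "\<And>k'. cont_map sdgla (twist T (- y)) k' \<Longrightarrow> k' (- 1) (1, 0) = y \<Longrightarrow> eq_maps sdgla k' k"
      using sdgla_map[OF T1.complete_dgla_axioms] by blast
    obtain h1 where h1: "is_copairing G sdgla A iA jA (twist T (- y)) f k h1"
      and u1: "\<And>h'. is_copairing G sdgla A iA jA (twist T (- y)) f k h' \<Longrightarrow> eq_maps A h' h1"
      using is_coproduct_universal[OF GA T1.complete_dgla_axioms f k(1)] by blast
    have h1c: "cont_map A (twist T (- y)) h1" and h1x: "h1 (- 1) xA = y"
      and h1i: "\<And>n u. u \<in> gr G n \<Longrightarrow> h1 n (iA n u) = f n u"
      using h1 k(2) eq_mapsD[of sdgla _ k "(1, 0)" "- 1"] s1 by (auto simp: is_copairing_def xA_def eq_maps_def)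
    have "cont_map (twist A xA) (twist (twist T (- y)) y) h1"
      by (rule cont_map_twist[OF dA h1c xA h1x[symmetric]])
    then have h1c': "cont_map (twist A xA) T h1"
      by (rule cont_map_cong) (use twist_twist_uminus(1)[OF dT yg(1)] in \<open>simp_all\<close>)
    have AP': "is_coproduct (twist A xA) H P i' j'" using AP by (simp add: xA_def)
    obtain h2 where h2: "is_copairing (twist A xA) H P i' j' T h1 g h2"
      and u2: "\<And>h'. is_copairing (twist A xA) H P i' j' T h1 g h' \<Longrightarrow> eq_maps P h' h2"
      using is_coproduct_universal[OF AP' T h1c' g] by blast
    show "\<exists>h. dp_map G H P ?i j' ?x T f g y h"
      using h2 h1x xA h1i cont_mapD(1)[OF iA] by (intro exI[of _ h2]) (simp add: dp_map_def is_copairing_def eq_maps_def)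
    have uniq: "eq_maps P h h2" if h: "dp_map G H P ?i j' ?x T f g y h" for h
    proof -
      have hc: "cont_map P T h" and hx: "h (- 1) ?x = y" using h by (auto simp: dp_map_def)
      have "cont_map (twist P (- ?x)) (twist T (- y)) h"
        using cont_map_twist[OF dP hc P.gr_uminus[OF x], of "- y"] cont_map_uminus[OF dP dT hc x] hx by simp
      then have hi: "cont_map A (twist T (- y)) (\<lambda>n. h n \<circ> i' n)" by (rule cont_map_comp[OF i3])
      have "eq_maps sdgla (\<lambda>n. (h n \<circ> i' n) \<circ> jA n) k"
        using cont_map_comp[OF jA hi] hx by (intro k(3)) (simp_all add: xA_def)
      then have "is_copairing G sdgla A iA jA (twist T (- y)) f k (\<lambda>n. h n \<circ> i' n)"
        using hi h by (simp add: is_copairing_def dp_map_def eq_maps_def)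
      from u1[OF this] show ?thesis
        using h by (intro u2) (simp add: is_copairing_def dp_map_def eq_maps_def)
    qed
    show "eq_maps P h h'" if "dp_map G H P ?i j' ?x T f g y h" "dp_map G H P ?i j' ?x T f g y h'" for h h'
      using uniq[OF that(1)] uniq[OF that(2)] by (simp add: eq_maps_def)
  qed
qed

text \<open>The two injections enter the data symmetrically up to a twist, so twisting
  \<open>P\<close> by - x and all test objects by - y exchanges \<open>G\<close> and
  \<open>H\<close>, with - x in place of \<open>x\<close>.\<close>

lemma (in disjoint_product_data) swap:
  shows "disjoint_product_data H G (twist P (- x)) j i (- x)"
    and "dp_universal TYPE('d::ab_group_add) G H P i j x \<Longrightarrow> dp_universal TYPE('d) H G (twist P (- x)) j i (- x)"
proof -
  interpret P: complete_dgla P by (rule complete_P)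
  have x: "x \<in> gr P (- 1)" "dif P (- 1) x = smul P (1 / 2) (brk P (- 1) (- 1) x x)" using twistable_x by (auto simp: twistable_def)
  have mx: "- x \<in> MC P" using twistable_x twistable_MC[OF P.dgla_axioms x(1)] by simp
  interpret P': complete_dgla "twist P (- x)" by (rule P.complete_dgla_twist[OF mx])
  have w: "brk P (- 1) (- 1) x x \<in> gr P (- 2)" using P.brk_closed[OF x(1,1)] by simp
  have t: "twistable (twist P (- x)) (- x)"
    using x P.smul_half[of "brk P (- 1) (- 1) x x"]
    by (simp add: twistable_def P.gr_uminus P.dif_uminus P.brk_uminus_left P.brk_uminus_right)
  have jc: "cont_map H (twist (twist P (- x)) (- (- x))) j"
    by (rule cont_map_cong[OF cont_j]) (use twist_twist_uminus(3)[OF P.dgla_axioms x(1)] in \<open>simp_all\<close>)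
  show "disjoint_product_data H G (twist P (- x)) j i (- x)"
    using complete_G complete_H P'.complete_dgla_axioms t cont_i jc by (intro disjoint_product_data.intro)
  assume univ: "dp_universal TYPE('d::ab_group_add) G H P i j x"
  show "dp_universal TYPE('d) H G (twist P (- x)) j i (- x)"
  proof (rule dp_universalI)
    fix T :: "('k, 'd) cdgla_data" and f g y
    assume T: "complete_dgla T" and y: "twistable T y" and f: "cont_map H (twist T (- y)) f" and g: "cont_map G T g"
    interpret T: complete_dgla T by fact
    note dT = T.dgla_axioms
    have yg: "y \<in> gr T (- 1)" "dif T (- 1) y = smul T (1 / 2) (brk T (- 1) (- 1) y y)" using y by (auto simp: twistable_def)
    have my: "- y \<in> MC T" using y twistable_MC[OF dT yg(1)] by simp
    interpret T1: complete_dgla "twist T (- y)" by (rule T.complete_dgla_twist[OF my])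
    have w: "brk T (- 1) (- 1) y y \<in> gr T (- 2)" using T.brk_closed[OF yg(1,1)] by simp
    have t1: "twistable (twist T (- y)) (- y)"
      using yg T.smul_half[of "brk T (- 1) (- 1) y y"]
      by (simp add: twistable_def T.gr_uminus T.dif_uminus T.brk_uminus_left T.brk_uminus_right)
    have g1: "cont_map G (twist (twist T (- y)) (- (- y))) g"
      by (rule cont_map_cong[OF g]) (use twist_twist_uminus(3)[OF dT yg(1)] in \<open>simp_all\<close>)
    have fwd: "cont_map (twist P (- x)) T h" if h: "cont_map P (twist T (- y)) h" "h (- 1) x = - y" for h
    proof -
      have "cont_map (twist P (- x)) (twist (twist T (- y)) (h (- 1) (- x))) h"
        by (rule cont_map_twist[OF P.dgla_axioms h(1) P.gr_uminus[OF x(1)] refl])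
      moreover have "h (- 1) (- x) = y"
        using cont_map_uminus[OF P.dgla_axioms T1.dgla_axioms h(1) x(1)] h(2) by simp
      ultimately have "cont_map (twist P (- x)) (twist (twist T (- y)) y) h" by simp
      then show ?thesis by (rule cont_map_cong) (use twist_twist_uminus(1)[OF dT yg(1)] in \<open>simp_all\<close>)
    qed
    have bwd: "cont_map P (twist T (- y)) h \<and> h (- 1) x = - y" if h: "cont_map (twist P (- x)) T h" "h (- 1) (- x) = y" for h
    proof -
      have hx: "h (- 1) x = - y"
        using cont_map_uminus[OF P'.dgla_axioms dT h(1), of x "- 1"] x(1) h(2) by (metis minus_minus twist_simps(2))
      have "cont_map (twist (twist P (- x)) x) (twist T (- y)) h"
        using cont_map_twist[OF P'.dgla_axioms h(1), of x "- y"] x(1) hx by simp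
      then have "cont_map P (twist T (- y)) h"
        by (rule cont_map_cong) (use twist_twist_uminus(1)[OF P.dgla_axioms x(1)] in \<open>simp_all\<close>)
      then show ?thesis using hx by simp
    qed
    obtain h where h: "dp_map G H P i j x (twist T (- y)) g f (- y) h"
      using dp_universalD(1)[OF univ T1.complete_dgla_axioms t1 g1 f] by blast
    have "h (- 1) (- x) = y"
      using cont_map_uminus[OF P.dgla_axioms T1.dgla_axioms _ x(1), of h] h by (simp add: dp_map_def)
    then show "\<exists>h. dp_map H G (twist P (- x)) j i (- x) T f g y h"
      using h fwd[of h] by (intro exI[of _ h]) (simp add: dp_map_def)
    fix h h' assume hh: "dp_map H G (twist P (- x)) j i (- x) T f g y h" "dp_map H G (twist P (- x)) j i (- x) T f g y h'"
    have "eq_maps P h h'"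
      using hh bwd[of h] bwd[of h'] by (intro dp_universalD(2)[OF univ T1.complete_dgla_axioms t1 g1 f]) (simp_all add: dp_map_def)
    then show "eq_maps (twist P (- x)) h h'" by (simp add: eq_maps_def)
  qed
qed

section \<open>The twisted Fox dgla\<close>

context complete_dgla
begin

text \<open>Twisting by the Eulerian idempotent makes a map \<open>(id, e, \<sigma>)\<close> to \<open>foxT\<close> satisfy
  \<open>\<sigma> d = - d \<sigma> - shift (id - e) eul\<close>; on the empty word this reads \<open>d s + s d = e - id\<close>.\<close>

definition foxT :: "('k, ('a \<times> 'a) \<times> ((int \<times> 'a) list \<Rightarrow> 'a)) cdgla_data"
  where "foxT = twist fox ((0, 0), eul)"

lemma cact_zero_left: "F \<in> envlin N \<Longrightarrow> cact m N (0, 0) F = 0"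
  using cact_smul_left[OF gr_zero gr_zero, of F N m 0] by simp

lemma cact_zero_right: "a \<in> gr G m \<Longrightarrow> b \<in> gr G m \<Longrightarrow> cact m N (a, b) 0 = 0"
  using cact_scl_right[OF _ _ envlin_zero, of a m b N 0] by simp

lemma cact_eul: "a \<in> gr G n \<Longrightarrow> b \<in> gr G n \<Longrightarrow> cact n 0 (a, b) eul = shift n (a - b) eul"
  by (simp add: cact_def dl_eul[OF derivation_ad])

lemma cact_Nil: "cact m N (a, b) F [] = brk G m N b (F []) + F [(m, a - b)]"
  by (simp add: cact_def shift_def)

lemma eul_shift_zero: "shift n 0 eul = 0"
  using envlin_lin(3)[OF eul_envlin gr_zero gr_zero, of n] by simp

lemma brk_fox_eul:
  assumes "a \<in> gr G n" "b \<in> gr G n" "F \<in> modf (n + 1)"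
  shows "brk fox (- 1) n ((0, 0), eul) ((a, b), F) = ((0, 0), - shift n (a - b) eul)"
proof -
  have k: "ksign (- n) * ksign n = (1 :: 'k)" by (simp add: ksign_def)
  have "fox_brk (- 1) n (0, 0) (a, b) eul F = - shift n (a - b) eul"
    using assms(3) by (simp add: fox_brk_def cact_zero_left modf_envlin cact_eul[OF assms(1,2)] k)
  then show ?thesis
    using assms(1,2) by (simp add: fox_simps brk_zero_left)
qed

lemma foxT_simps:
  "smul foxT c ((a, b), F) = ((smul G c a, smul G c b), scl c F)"
  "((a, b), F) \<in> gr foxT n \<longleftrightarrow> a \<in> gr G n \<and> b \<in> gr G n \<and> F \<in> modf (n + 1)"
  "brk foxT m n ((a, b), F) ((a', b'), F') = ((brk G m n a a', brk G m n b b'), fox_brk m n (a, b) (a', b') F F')"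
  "a \<in> gr G n \<Longrightarrow> b \<in> gr G n \<Longrightarrow> F \<in> modf (n + 1) \<Longrightarrow> dif foxT n ((a, b), F) =
    ((dif G n a, dif G n b), - dl (dif G) (- 1) (n + 1) F - shift n (a - b) eul)"
  "opens foxT = foxopen ` opens G"
  by (simp_all add: foxT_def fox_simps(1,2,4,5) brk_fox_eul) (simp add: fox_simps)

lemma complete_foxT: "complete_dgla foxT"
  unfolding foxT_def by (rule complete_fox_twist)

lemma dl_zero: "dl (dif G) (- 1) N 0 = 0"
  using dl_scl[OF derivation_dif LF_zero, of N 0] by simp

text \<open>Makes \<open>((x, 0), eul)\<close> an admissible image of \<open>x\<close>: in the
  module component the twist contributes - shift x eul to its differential, and this is half its
  bracket with itself.\<close>

lemma foxT_twistable:
  assumes x: "twistable G x"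
  shows "twistable foxT ((x, 0), eul)"
proof -
  have x: "x \<in> gr G (- 1)" "dif G (- 1) x = smul G (1 / 2) (brk G (- 1) (- 1) x x)" using x by (auto simp: twistable_def)
  have c: "cact (- 1) 0 (x, 0) eul = shift (- 1) x eul" using cact_eul[OF x(1) gr_zero] by simp
  have "- scl (1 / 2) (shift (- 1) x eul) - scl (1 / 2) (shift (- 1) x eul) = - shift (- 1) x eul"
    by (rule ext) (simp add: scl_def smul_half)
  then have F: "- shift (- 1) x eul = scl (1 / 2) (fox_brk (- 1) (- 1) (x, 0) (x, 0) eul eul)"
    by (simp add: fox_brk_def c ksign_def scl_distrib)
  show ?thesis
    using x eul_modf gr_zero by (simp add: twistable_def foxT_simps dl_eul[OF derivation_dif] brk_zero_left dif_zero F)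
qed

end

lemma cont_foxT_proj:
  assumes "complete_dgla (G :: ('k::field_char_0, 'a::ab_group_add) cdgla_data)"
  shows "cont_map (complete_dgla.foxT G) G (\<lambda>n u. fst (fst u))" "cont_map (complete_dgla.foxT G) G (\<lambda>n u. snd (fst u))"
proof -
  interpret complete_dgla G by fact
  have o: "\<exists>V\<in>opens (complete_dgla.foxT G). \<forall>n. (\<lambda>u. fst (fst u)) ` V n \<subseteq> U n \<and> (\<lambda>u. snd (fst u)) ` V n \<subseteq> U n" if "U \<in> opens G" for U
    using that by (intro bexI[of _ "foxopen U"]) (auto simp: foxT_simps foxopen_def)
  show "cont_map (complete_dgla.foxT G) G (\<lambda>n u. fst (fst u))" using o by (intro cont_mapI) (force simp: foxT_simps)+
  show "cont_map (complete_dgla.foxT G) G (\<lambda>n u. snd (fst u))" using o by (intro cont_mapI) (force simp: foxT_simps)+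
qed

lemma twistable_0: "dgla T \<Longrightarrow> twistable T 0" and MC_0: "dgla T \<Longrightarrow> 0 \<in> MC T"
proof -
  assume "dgla T" then interpret T: dgla T .
  show "twistable T 0" "0 \<in> MC T" by (simp_all add: twistable_def MC_def T.gr_zero T.dif_zero T.brk_zero_left)
qed

lemma cont_zero_twist: "complete_dgla T \<Longrightarrow> complete_dgla S \<Longrightarrow> y \<in> MC S \<Longrightarrow> cont_map T (twist S y) (\<lambda>n u. 0)"
  by (intro cont_map_zero complete_dgla.complete_dgla_twist)

text \<open>One instance of the universal property for each carrier type of a target: the Fox dgla,
  \<open>P\<close> itself, the two factors and the dgla \<open>s\<close>.\<close>

locale disjoint_product = disjoint_product_data G H P i j x
  for G :: "('k::field_char_0, 'a::ab_group_add) cdgla_data" and H :: "('k, 'b::ab_group_add) cdgla_data"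
    and P :: "('k, 'c::ab_group_add) cdgla_data" and i j x +
  assumes univ_fox: "dp_universal TYPE(('c \<times> 'c) \<times> ((int \<times> 'c) list \<Rightarrow> 'c)) G H P i j x"
    and univ_P: "dp_universal TYPE('c) G H P i j x"
    and univ_H: "dp_universal TYPE('b) G H P i j x"
    and univ_G: "dp_universal TYPE('a) G H P i j x"
    and univ_s: "dp_universal TYPE('k \<times> 'k) G H P i j x"

sublocale disjoint_product \<subseteq> P: complete_dgla P by (rule complete_P)
sublocale disjoint_product \<subseteq> G: complete_dgla G by (rule complete_G)
sublocale disjoint_product \<subseteq> H: complete_dgla H by (rule complete_H)

lemma (in disjoint_product) swap_disjoint_product: "disjoint_product H G (twist P (- x)) j i (- x)"
  by (intro disjoint_product.intro disjoint_product_axioms.intro swap univ_fox univ_P univ_H univ_G univ_s)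

section \<open>The retraction onto H and the Fox derivative of P\<close>

context disjoint_product
begin

lemma x_gr: "x \<in> gr P (- 1)" and mx_MC: "- x \<in> MC P"
  using twistable_x twistable_MC[OF P.dgla_axioms, of x] by (simp_all add: twistable_def)

lemma i_gr: "u \<in> gr G n \<Longrightarrow> i n u \<in> gr P n" and j_gr: "v \<in> gr H n \<Longrightarrow> j n v \<in> gr P n"
  using cont_mapD(1)[OF cont_i] cont_mapD(1)[OF cont_j] by auto

text \<open>The map of \<open>P\<close> into \<open>R\<close> given by the universal property,
  followed by the inclusion, is the identity by uniqueness.\<close>

lemma closed_generated:
  assumes R: "closed_subdgla P R" and gen: "\<And>n u. u \<in> gr G n \<Longrightarrow> i n u \<in> R n"
    "\<And>n v. v \<in> gr H n \<Longrightarrow> j n v \<in> R n" "x \<in> R (- 1)"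
  shows "R n = gr P n"
proof -
  have Rsub: "R n \<subseteq> gr P n" for n using R by (simp add: closed_subdgla_def)
  interpret R: complete_dgla "subdgla P R" by (rule complete_subdgla[OF complete_P R])
  have t: "twistable (subdgla P R) x" using twistable_x gen(3) by (simp add: twistable_def)
  have ti: "cont_map G (twist (subdgla P R) (- x)) i"
  proof (rule cont_mapI, goal_cases)
    case (6 V)
    then obtain U where U: "U \<in> opens P" "V = (\<lambda>n. U n \<inter> R n)" by auto
    then obtain W where W: "W \<in> opens G" "\<And>n. i n ` W n \<subseteq> U n" using cont_mapD(6)[OF cont_i, of U] by auto
    have "i n ` W n \<subseteq> V n" for n using W G.openD(2)[OF W(1), of n] gen(1) U(2) by auto
    then show ?case using W(1) by blast
  qed (use gen cont_mapD[OF cont_i] in \<open>simp_all\<close>)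
  have tj: "cont_map H (subdgla P R) j"
  proof (rule cont_mapI, goal_cases)
    case (6 V)
    then obtain U where U: "U \<in> opens P" "V = (\<lambda>n. U n \<inter> R n)" by auto
    then obtain W where W: "W \<in> opens H" "\<And>n. j n ` W n \<subseteq> U n" using cont_mapD(6)[OF cont_j, of U] by auto
    have "j n ` W n \<subseteq> V n" for n using W H.openD(2)[OF W(1), of n] gen(2) U(2) by auto
    then show ?case using W(1) by blast
  qed (use gen cont_mapD[OF cont_j] in \<open>simp_all\<close>)
  obtain h where h: "dp_map G H P i j x (subdgla P R) i j x h"
    using dp_universalD(1)[OF univ_P R.complete_dgla_axioms t ti tj] by blast
  have "cont_map (subdgla P R) P (\<lambda>n. id)"
    using Rsub by (intro cont_mapI) auto
  then have "cont_map P P (\<lambda>n. id \<circ> h n)" using cont_map_comp[of P "subdgla P R" h P "\<lambda>n. id"] h by (auto simp: dp_map_def)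
  then have "dp_map G H P i j x P i j x h" using h by (simp add: dp_map_def)
  moreover have "dp_map G H P i j x P i j x (\<lambda>n. id)" by (simp add: dp_map_def cont_map_id)
  ultimately have "eq_maps P h (\<lambda>n. id)"
    using dp_universalD(2)[OF univ_P complete_P twistable_x cont_i cont_j] by blast
  moreover have "h n z \<in> R n" if "z \<in> gr P n" for z
    using cont_mapD(1)[of P "subdgla P R" h] h that by (simp add: dp_map_def)
  ultimately show ?thesis using Rsub[of n] by (auto simp: eq_maps_iff)
qed

definition r :: "int \<Rightarrow> 'c \<Rightarrow> 'b" where "r = (SOME h. dp_map G H P i j x H (\<lambda>n u. 0) (\<lambda>n. id) 0 h)"

lemma r: "dp_map G H P i j x H (\<lambda>n u. 0) (\<lambda>n. id) 0 r"
proof -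
  have "\<exists>h. dp_map G H P i j x H (\<lambda>n u. 0) (\<lambda>n. id) 0 h"
    by (rule dp_universalD(1)[OF univ_H complete_H twistable_0[OF H.dgla_axioms]])
      (use cont_zero_twist[OF complete_G complete_H MC_0[OF H.dgla_axioms]] cont_map_id in auto)
  from someI_ex[OF this] show ?thesis unfolding r_def .
qed

lemma r_simps: "cont_map P H r" "u \<in> gr G n \<Longrightarrow> r n (i n u) = 0" "v \<in> gr H n \<Longrightarrow> r n (j n v) = v" "r (- 1) x = 0"
  using r by (simp_all add: dp_map_def)

definition e :: "int \<Rightarrow> 'c \<Rightarrow> 'c" where "e n z = j n (r n z)"

lemma cont_e: "cont_map P P e"
  using cont_map_comp[OF r_simps(1) cont_j] by (simp add: e_def[abs_def] comp_def)

lemma r_gr: "z \<in> gr P n \<Longrightarrow> r n z \<in> gr H n" by (rule cont_mapD(1)[OF r_simps(1)])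

lemma e_gr: "z \<in> gr P n \<Longrightarrow> e n z \<in> gr P n" by (rule cont_mapD(1)[OF cont_e])

lemma e_simps: "u \<in> gr G n \<Longrightarrow> e n (i n u) = 0" "v \<in> gr H n \<Longrightarrow> e n (j n v) = j n v" "e (- 1) x = 0"
  "z \<in> gr P n \<Longrightarrow> e n (e n z) = e n z"
  using r_gr cont_map_0[OF H.dgla_axioms P.dgla_axioms cont_j] by (simp_all add: e_def r_simps)

lemma e_linear: "y \<in> gr P n \<Longrightarrow> z \<in> gr P n \<Longrightarrow> e n (y + z) = e n y + e n z"
  "y \<in> gr P n \<Longrightarrow> z \<in> gr P n \<Longrightarrow> e n (y - z) = e n y - e n z"
  "z \<in> gr P n \<Longrightarrow> e n (smul P c z) = smul P c (e n z)"
  "y \<in> gr P m \<Longrightarrow> z \<in> gr P n \<Longrightarrow> e (m + n) (brk P m n y z) = brk P m n (e m y) (e n z)"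
  "z \<in> gr P n \<Longrightarrow> e (n - 1) (dif P n z) = dif P n (e n z)" "e n 0 = 0"
  using cont_mapD[OF cont_e] cont_map_diff[OF P.dgla_axioms cont_e] cont_map_0[OF P.dgla_axioms P.dgla_axioms cont_e]
  by auto

definition fox_map :: "int \<Rightarrow> 'c \<Rightarrow> ('c \<times> 'c) \<times> ((int \<times> 'c) list \<Rightarrow> 'c)"
  where "fox_map = (SOME h. dp_map G H P i j x P.foxT (\<lambda>n u. ((i n u, 0), 0)) (\<lambda>n v. ((j n v, j n v), 0)) ((x, 0), P.eul) h)"

text \<open>On \<open>i n u\<close> the differential of \<open>foxT\<close> contributes - shift (i n
  u) eul to the third component. The further twist by \<open>- ((x, 0), eul)\<close> cancels it, so
  0 is a consistent value of the Fox derivative on \<open>G\<close>.\<close>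

lemma cont_fox_i: "cont_map G (twist P.foxT (- ((x, 0), P.eul))) (\<lambda>n u. ((i n u, 0), 0))"
proof -
  have i: "i n u \<in> gr P n" "i n (u + u') = i n u + i n u'" "i n (smul G c u) = smul P c (i n u)"
    if "u \<in> gr G n" "u' \<in> gr G n" for u u' n c
    using cont_mapD(1-3)[OF cont_i] that by auto
  have ib: "i (m + n) (brk G m n u v) = brk P m n (i m u) (i n v)" if "u \<in> gr G m" "v \<in> gr G n" for m n u v
    using cont_mapD(4)[OF cont_i that] by simp
  have id: "i (n - 1) (dif G n u) = dif P n (i n u) - brk P (- 1) n x (i n u)" if "u \<in> gr G n" for u n
    using cont_mapD(5)[OF cont_i that] i(1)[OF that that] by (simp add: P.brk_uminus_left x_gr)
  have z: "P.fox_brk m n (a, 0) (b, 0) 0 0 = 0" if "a \<in> gr P m" "b \<in> gr P n" for m n a b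
    using that by (simp add: P.fox_brk_def P.cact_zero_right P.gr_zero)
  have k: "ksign (- n) * ksign n = (1 :: 'k)" for n by (simp add: ksign_def)
  have c: "P.cact n 0 (a, 0) (- P.eul) = - P.shift n a P.eul" if "a \<in> gr P n" for n a
    using P.cact_scl_right[OF that P.gr_zero P.eul_envlin, of "- 1"] P.cact_eul[OF that P.gr_zero] by simp
  have y: "P.fox_brk (- 1) n (- x, 0) (a, 0) (- P.eul) 0 = P.shift n a P.eul" if "a \<in> gr P n" for a n
    using that by (simp add: P.fox_brk_def k c P.cact_zero_right P.gr_zero P.gr_uminus x_gr)
  show ?thesis
  proof (rule cont_mapI, goal_cases)
    case (6 V)
    then obtain U where U: "U \<in> opens P" "V = P.foxopen U" by (auto simp: P.foxT_simps)
    then obtain W where W: "W \<in> opens G" "\<And>n. i n ` W n \<subseteq> U n" using cont_mapD(6)[OF cont_i, of U] by auto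
    have "((i n u, 0), 0) \<in> P.foxopen U n" if "u \<in> W n" for n u
      using that W P.open_simps(1)[OF U(1)] P.modf_zero P.raises_zero[OF P.cfilt_mfilt[OF P.cfilt_openfilt[OF U(1)]]]
      by (auto simp: P.foxopen_def)
    then show ?case using W(1) U(2) by blast
  qed (simp_all add: P.foxT_simps i ib id P.gr_zero P.modf_zero P.brk_zero_left P.dif_zero z y P.dl_zero P.brk_uminus_left x_gr)
qed

text \<open>The two components in \<open>P\<close> agree, so the contribution of \<open>eul\<close>
  is a shift by 0.\<close>

lemma cont_fox_j: "cont_map H P.foxT (\<lambda>n v. ((j n v, j n v), 0))"
proof -
  note jc = cont_mapD(1-5)[OF cont_j]
  have z: "P.fox_brk m n (a, a) (b, b) 0 0 = 0" if "a \<in> gr P m" "b \<in> gr P n" for m n a b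
    using that by (simp add: P.fox_brk_def P.cact_zero_right)
  show ?thesis
  proof (rule cont_mapI, goal_cases)
    case (6 V)
    then obtain U where U: "U \<in> opens P" "V = P.foxopen U" by (auto simp: P.foxT_simps)
    then obtain W where W: "W \<in> opens H" "\<And>n. j n ` W n \<subseteq> U n" using cont_mapD(6)[OF cont_j, of U] by auto
    have "((j n u, j n u), 0) \<in> P.foxopen U n" if "u \<in> W n" for n u
      using that W P.modf_zero P.raises_zero[OF P.cfilt_mfilt[OF P.cfilt_openfilt[OF U(1)]]]
      by (auto simp: P.foxopen_def)
    then show ?case using W(1) U(2) by blast
  qed (simp_all add: P.foxT_simps jc P.modf_zero z P.dl_zero P.eul_shift_zero)
qed

lemma fox_map: "dp_map G H P i j x P.foxT (\<lambda>n u. ((i n u, 0), 0)) (\<lambda>n v. ((j n v, j n v), 0)) ((x, 0), P.eul) fox_map"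
proof -
  have "\<exists>h. dp_map G H P i j x P.foxT (\<lambda>n u. ((i n u, 0), 0)) (\<lambda>n v. ((j n v, j n v), 0)) ((x, 0), P.eul) h"
    by (rule dp_universalD(1)[OF univ_fox P.complete_foxT P.foxT_twistable[OF twistable_x] cont_fox_i cont_fox_j])
  from someI_ex[OF this] show ?thesis unfolding fox_map_def .
qed

definition \<sigma> :: "int \<Rightarrow> 'c \<Rightarrow> (int \<times> 'c) list \<Rightarrow> 'c" where "\<sigma> n z = snd (fox_map n z)"

text \<open>Each projection of \<open>fox_map\<close> to \<open>P\<close> has the same values on the
  generators as the identity or as \<open>e\<close>, and uniqueness identifies them.\<close>

lemma fox_map_eq:
  assumes z: "z \<in> gr P n"
  shows "fox_map n z = ((z, e n z), \<sigma> n z)"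
proof -
  have c: "cont_map P P.foxT fox_map" using fox_map by (simp add: dp_map_def)
  have "dp_map G H P i j x P i j x (\<lambda>n z. fst (fst (fox_map n z)))"
    using fox_map cont_map_comp[OF c cont_foxT_proj(1)[OF complete_P]] by (simp add: dp_map_def comp_def)
  moreover have "dp_map G H P i j x P i j x (\<lambda>n. id)" by (simp add: dp_map_def cont_map_id)
  ultimately have "eq_maps P (\<lambda>n z. fst (fst (fox_map n z))) (\<lambda>n. id)"
    using dp_universalD(2)[OF univ_P complete_P twistable_x cont_i cont_j] by blast
  then have 1: "fst (fst (fox_map n z)) = z" using z by (simp add: eq_maps_iff)
  have "dp_map G H P i j x P (\<lambda>n u. 0) j 0 (\<lambda>n z. snd (fst (fox_map n z)))"
    using fox_map cont_map_comp[OF c cont_foxT_proj(2)[OF complete_P]] by (simp add: dp_map_def comp_def)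
  moreover have "dp_map G H P i j x P (\<lambda>n u. 0) j 0 e" by (simp add: dp_map_def cont_e e_simps)
  moreover have "cont_map G (twist P (- 0)) (\<lambda>n u. 0)"
    using cont_zero_twist[OF complete_G complete_P MC_0[OF P.dgla_axioms]] by simp
  ultimately have "eq_maps P (\<lambda>n z. snd (fst (fox_map n z))) e"
    using dp_universalD(2)[OF univ_P complete_P twistable_0[OF P.dgla_axioms] _ cont_j] by blast
  then have 2: "snd (fst (fox_map n z)) = e n z" using z by (simp add: eq_maps_iff)
  show ?thesis using 1 2 unfolding \<sigma>_def by (metis prod.collapse)
qed

lemma \<sigma>_simps:
  "z \<in> gr P n \<Longrightarrow> \<sigma> n z \<in> P.modf (n + 1)"
  "z \<in> gr P n \<Longrightarrow> y \<in> gr P n \<Longrightarrow> \<sigma> n (z + y) = \<sigma> n z + \<sigma> n y"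
  "z \<in> gr P n \<Longrightarrow> \<sigma> n (smul P c z) = P.scl c (\<sigma> n z)"
  "y \<in> gr P m \<Longrightarrow> z \<in> gr P n \<Longrightarrow> \<sigma> (m + n) (brk P m n y z) = P.fox_brk m n (y, e m y) (z, e n z) (\<sigma> m y) (\<sigma> n z)"
  "z \<in> gr P n \<Longrightarrow> \<sigma> (n - 1) (dif P n z) = - P.dl (dif P) (- 1) (n + 1) (\<sigma> n z) - P.shift n (z - e n z) P.eul"
  "u \<in> gr G n \<Longrightarrow> \<sigma> n (i n u) = 0" "v \<in> gr H n \<Longrightarrow> \<sigma> n (j n v) = 0" "\<sigma> (- 1) x = P.eul"
proof -
  have c: "cont_map P P.foxT fox_map" using fox_map by (simp add: dp_map_def)
  show "u \<in> gr G n \<Longrightarrow> \<sigma> n (i n u) = 0" "v \<in> gr H n \<Longrightarrow> \<sigma> n (j n v) = 0" "\<sigma> (- 1) x = P.eul"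
    using fox_map by (simp_all add: dp_map_def \<sigma>_def)
  have m: "\<sigma> n z \<in> P.modf (n + 1)" if "z \<in> gr P n" for n z
    using cont_mapD(1)[OF c that] by (simp add: fox_map_eq[OF that] P.foxT_simps)
  show "\<sigma> n z \<in> P.modf (n + 1)" if "z \<in> gr P n" using m[OF that] .
  show "\<sigma> n (z + y) = \<sigma> n z + \<sigma> n y" if "z \<in> gr P n" "y \<in> gr P n"
    using cont_mapD(2)[OF c that] by (simp add: fox_map_eq that P.gr_add)
  show "\<sigma> n (smul P c z) = P.scl c (\<sigma> n z)" if "z \<in> gr P n"
    using cont_mapD(3)[OF c that] by (simp add: fox_map_eq that P.gr_smul P.foxT_simps)
  show "\<sigma> (m + n) (brk P m n y z) = P.fox_brk m n (y, e m y) (z, e n z) (\<sigma> m y) (\<sigma> n z)" if "y \<in> gr P m" "z \<in> gr P n"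
    using cont_mapD(4)[OF c that] by (simp add: fox_map_eq that P.brk_closed P.foxT_simps)
  show "\<sigma> (n - 1) (dif P n z) = - P.dl (dif P) (- 1) (n + 1) (\<sigma> n z) - P.shift n (z - e n z) P.eul" if "z \<in> gr P n"
    using cont_mapD(5)[OF c that] by (simp add: fox_map_eq that P.dif_closed P.foxT_simps e_gr m)
qed

text \<open>Continuity of \<open>fox_map\<close> by components, as needed to show that the
  \<sigma>-stable part of a closed filtration is closed.\<close>

lemma \<sigma>_near:
  assumes U: "U \<in> opens P"
  obtains W where "W \<in> opens P" "\<And>n z z'. z \<in> gr P n \<Longrightarrow> z' \<in> gr P n \<Longrightarrow> z - z' \<in> W n \<Longrightarrow>
    P.near (n + 1) (\<sigma> n z) U (\<sigma> n z') \<and> e n z - e n z' \<in> U n \<and> z - z' \<in> U n"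
proof -
  have c: "cont_map P P.foxT fox_map" using fox_map by (simp add: dp_map_def)
  obtain W where W: "W \<in> opens P" "\<And>n. fox_map n ` W n \<subseteq> P.foxopen U n"
    using cont_mapD(6)[OF c, of "P.foxopen U"] U by (auto simp: P.foxT_simps)
  have "P.near (n + 1) (\<sigma> n z) U (\<sigma> n z') \<and> e n z - e n z' \<in> U n \<and> z - z' \<in> U n"
    if z: "z \<in> gr P n" "z' \<in> gr P n" "z - z' \<in> W n" for n z z'
  proof -
    have d: "z - z' \<in> gr P n" using z by (simp add: P.gr_diff)
    have "((z - z', e n (z - z')), \<sigma> n (z - z')) \<in> P.foxopen U n"
      using W(2) z(3) fox_map_eq[OF d] by (metis image_subset_iff)
    moreover have "\<sigma> n (z - z' + z') = \<sigma> n (z - z') + \<sigma> n z'" by (rule \<sigma>_simps(2)[OF d z(2)])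
    then have "\<sigma> n z w - \<sigma> n z' w = \<sigma> n (z - z') w" for w by simp
    ultimately show ?thesis
      using P.modf_LF[OF \<sigma>_simps(1)[OF z(2)]] z by (simp add: P.foxopen_iff[OF U] P.near_def e_linear)
  qed
  with W(1) show ?thesis by (rule that)
qed

end

lemma (in complete_dgla) raises_near:
  assumes "cfilt \<Phi>" "F \<in> LF N" "\<And>U. U \<in> opens G \<Longrightarrow> \<exists>F'. raises \<Phi> p N F' \<and> near N F U F'"
  shows "raises \<Phi> p N F"
  unfolding raises_def
proof
  fix n show "dep \<Phi> n p N F"
    using assms(3) by (intro dep_limit[OF assms(1,2)]) (auto simp: raises_def)
qed

section \<open>The weight filtration and the coefficient of x\<close>

context disjoint_product
begin

text \<open>The least closed multiplicative filtration in which the images of \<open>G\<close> and \<open>H\<close> have weight one.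
  The element \<open>x\<close> has weight zero only.\<close>

definition fil :: "nat \<Rightarrow> int \<Rightarrow> 'c set"
  where "fil p n = (\<Inter>\<Psi> \<in> {\<Psi>. P.cfilt \<Psi> \<and> (\<forall>n. \<forall>u \<in> gr G n. i n u \<in> \<Psi> 1 n) \<and> (\<forall>n. \<forall>v \<in> gr H n. j n v \<in> \<Psi> 1 n)}. \<Psi> p n)"

lemma fil_least:
  assumes "P.cfilt \<Psi>" "\<And>n u. u \<in> gr G n \<Longrightarrow> i n u \<in> \<Psi> 1 n" "\<And>n v. v \<in> gr H n \<Longrightarrow> j n v \<in> \<Psi> 1 n"
  shows "fil p n \<subseteq> \<Psi> p n"
  using assms unfolding fil_def by blast

lemma fil_gens: "u \<in> gr G n \<Longrightarrow> i n u \<in> fil 1 n" "v \<in> gr H n \<Longrightarrow> j n v \<in> fil 1 n"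
  by (auto simp: fil_def)

text \<open>\<open>nilfilt U\<close> competes in the definition of \<open>fil\<close> because its
  first level is everything; by nilpotency, elements of high weight then lie in
  \<open>U\<close>.\<close>

lemma fil_nilfilt:
  assumes U: "U \<in> opens P" shows "fil p n \<subseteq> P.nilfilt U p n"
  using i_gr j_gr P.nilfilt_1[OF U] by (intro fil_least P.cfilt_nilfilt U) auto

lemma cfilt_fil: "P.cfilt fil"
proof -
  obtain U where U: "U \<in> opens P" using P.opens_nonempty by blast
  define S where "S = {\<Psi>. P.cfilt \<Psi> \<and> (\<forall>n. \<forall>u \<in> gr G n. i n u \<in> \<Psi> 1 n) \<and> (\<forall>n. \<forall>v \<in> gr H n. j n v \<in> \<Psi> 1 n)}"
  have fil: "fil p n = (\<Inter>\<Psi> \<in> S. \<Psi> p n)" for p n by (simp add: fil_def S_def)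
  have S: "P.cfilt \<Psi>" if "\<Psi> \<in> S" for \<Psi> using that by (simp add: S_def)
  \<comment> \<open>One competing filtration is needed, since an empty intersection would be too
    large at level 0.\<close>
  have ne: "P.nilfilt U \<in> S" using i_gr j_gr P.nilfilt_1[OF U] P.cfilt_nilfilt[OF U] by (simp add: S_def)
  have m: "P.mfilt \<Psi>" if "\<Psi> \<in> S" for \<Psi> using P.cfilt_mfilt S[OF that] by blast
  note ms = P.mfilt_simps[OF m]
  have m0: "\<Psi> 0 n = gr P n" and mS: "\<Psi> (Suc p) n \<subseteq> \<Psi> p n" if "\<Psi> \<in> S" for n \<Psi> p
    using m[OF that] by (simp_all add: P.mfilt_def)
  have c1: "P.subspace (fil p n)" for p n
    unfolding fil by (rule P.subspaceI) (use ms(1,2,4) in \<open>auto\<close>)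
  have "(\<Inter>\<Psi> \<in> S. \<Psi> 0 n) = (\<Inter>\<Psi> \<in> S. gr P n)" for n by (intro INF_cong refl m0)
  then have c2: "fil 0 n = gr P n" for n using ne unfolding fil by auto
  have c3: "fil (Suc p) n \<subseteq> fil p n" for p n
    unfolding fil by (rule INF_mono) (use mS in blast)
  have c4: "brk P m n y z \<in> fil (p + q) (m + n)" if "y \<in> fil p m" "z \<in> fil q n" for p q m n y z
    unfolding fil by (rule INT_I, rule ms(6)) (use that in \<open>auto simp: fil\<close>)
  have c5: "dif P n z \<in> fil p (n - 1)" if "z \<in> fil p n" for p n z
    unfolding fil by (rule INT_I, rule ms(7)) (use that in \<open>auto simp: fil\<close>)
  have c6: "z \<in> fil p n" if "z \<in> gr P n" and lim: "\<forall>U \<in> opens P. \<exists>l \<in> fil p n. z - l \<in> U n" for z p n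
  proof -
    have "z \<in> \<Psi> p n" if "\<Psi> \<in> S" for \<Psi>
    proof (rule P.cfilt_closed[OF S[OF that] \<open>z \<in> gr P n\<close>])
      fix U assume "U \<in> opens P"
      then obtain l where "l \<in> fil p n" "z - l \<in> U n" using lim by blast
      then show "\<exists>l \<in> \<Psi> p n. z - l \<in> U n" using that unfolding fil by blast
    qed
    then show ?thesis by (simp add: fil)
  qed
  show ?thesis
    unfolding P.cfilt_def P.mfilt_def by (intro conjI allI ballI impI c1 c2 c3) (fact c4 c5 c6)+
qed

lemmas mfilt_fil = P.cfilt_mfilt[OF cfilt_fil]
lemmas fil_simps = P.mfilt_simps[OF mfilt_fil]

lemma fil_gr: "z \<in> fil p n \<Longrightarrow> z \<in> gr P n" using P.mfilt_gr[OF mfilt_fil] by blast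

lemma fil_0: "fil 0 n = gr P n" using mfilt_fil by (simp add: P.mfilt_def)

lemma fil_mono: "p \<le> q \<Longrightarrow> z \<in> fil q n \<Longrightarrow> z \<in> fil p n" using P.mfilt_mono[OF mfilt_fil] by blast

lemma fil_null:
  assumes U: "U \<in> opens P"
  obtains N where "\<And>p n. N \<le> p \<Longrightarrow> fil p n \<subseteq> U n"
proof -
  obtain k where k: "\<And>n. lower_central P k n \<subseteq> U n"
    using P.opens_nilpotent[OF U] by (auto simp: nilpotent_quotient_def)
  have "fil p n \<subseteq> U n" if "Suc k \<le> p" for p n
    using fil_mono[OF that] fil_nilfilt[OF U] P.nilfilt_open[OF U k] by blast
  then show ?thesis by (rule that)
qed

text \<open>By minimality: the \<open>\<sigma>\<close>-stable part of \<open>fil\<close> is again a filtration of this kind.\<close>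

lemma fil_stable:
  assumes "z \<in> fil p n"
  shows "P.raises fil p (n + 1) (\<sigma> n z)" and "e n z \<in> fil p n"
proof -
  define \<Psi> where "\<Psi> p n = {z \<in> fil p n. P.raises fil p (n + 1) (\<sigma> n z) \<and> e n z \<in> fil p n}" for p n
  have g: "z \<in> gr P n" if "z \<in> \<Psi> p n" for z p n using that fil_gr unfolding \<Psi>_def by blast
  have z0: "\<sigma> n 0 = 0" for n using \<sigma>_simps(3)[OF P.gr_zero, of n 0] by simp
  have c1: "P.subspace (\<Psi> p n)" for p n
  proof (rule P.subspaceI)
    show "0 \<in> \<Psi> p n" using P.raises_zero[OF mfilt_fil] fil_simps(1) by (simp add: \<Psi>_def z0 e_linear)
    show "y + z \<in> \<Psi> p n" if "y \<in> \<Psi> p n" "z \<in> \<Psi> p n" for y z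
      using that fil_simps(2) P.raises_add[OF mfilt_fil] \<sigma>_simps(2)[OF g[OF that(1)] g[OF that(2)]] e_linear(1)[OF g[OF that(1)] g[OF that(2)]]
      by (simp add: \<Psi>_def)
    show "smul P c z \<in> \<Psi> p n" if "z \<in> \<Psi> p n" for c z
      using that fil_simps(4) P.raises_scl[OF mfilt_fil] \<sigma>_simps(3)[OF g[OF that]] e_linear(3)[OF g[OF that]] by (simp add: \<Psi>_def)
  qed
  \<comment> \<open>At level 0 the condition on \<open>\<sigma> n z\<close> holds because elements
    of \<open>modf\<close> respect every closed filtration, hence also \<open>fil\<close>.\<close>
  have c2: "\<Psi> 0 n = gr P n" for n
    using P.modf_raises[OF \<sigma>_simps(1) cfilt_fil] e_gr by (auto simp: \<Psi>_def fil_0)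
  have c3: "\<Psi> (Suc p) n \<subseteq> \<Psi> p n" for p n
  proof
    fix z assume z: "z \<in> \<Psi> (Suc p) n"
    then have "P.raises fil p (n + 1) (\<sigma> n z)"
      using P.raises_mono[OF mfilt_fil, of "Suc p" "n + 1" "\<sigma> n z" p] by (simp add: \<Psi>_def)
    then show "z \<in> \<Psi> p n" using z fil_mono[of p "Suc p"] by (simp add: \<Psi>_def)
  qed
  have c4: "brk P m n y z \<in> \<Psi> (p + q) (m + n)" if y: "y \<in> \<Psi> p m" and z: "z \<in> \<Psi> q n" for p q m n y z
  proof -
    have "P.raises fil (min (p + q) (q + p)) (m + n + 1) (P.fox_brk m n (y, e m y) (z, e n z) (\<sigma> m y) (\<sigma> n z))"
      using y z by (intro P.raises_fox_brk[OF cfilt_fil]) (auto simp: \<Psi>_def)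
    then have "P.raises fil (p + q) (m + n + 1) (\<sigma> (m + n) (brk P m n y z))"
      by (simp add: \<sigma>_simps(4) g[OF y] g[OF z] add.commute)
    then show ?thesis using y z by (simp add: \<Psi>_def fil_simps(6) e_linear(4) g[OF y] g[OF z])
  qed
  have c5: "dif P n z \<in> \<Psi> p (n - 1)" if z: "z \<in> \<Psi> p n" for p n z
  proof -
    have 1: "P.raises fil p (n + 1 - 1) (P.dl (dif P) (- 1) (n + 1) (\<sigma> n z))"
      using z by (intro P.raises_dif[OF mfilt_fil]) (simp add: \<Psi>_def)
    have "z - e n z \<in> fil p n" using z by (simp add: \<Psi>_def fil_simps(3))
    then have 2: "P.raises fil (0 + p) (0 + n) (P.shift n (z - e n z) P.eul)"
      by (rule P.raises_shift[OF P.raises_eul[OF mfilt_fil]])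
    have "P.raises fil p n (P.scl (- 1) (P.dl (dif P) (- 1) (n + 1) (\<sigma> n z)) - P.shift n (z - e n z) P.eul)"
      using 1 2 by (intro P.raises_diff[OF mfilt_fil] P.raises_scl[OF mfilt_fil]) simp_all
    then show ?thesis using z by (simp add: \<Psi>_def fil_simps(7) \<sigma>_simps(5) e_linear(5) g[OF z])
  qed
  have c6: "z \<in> \<Psi> p n" if z: "z \<in> gr P n" and lim: "\<forall>U \<in> opens P. \<exists>l \<in> \<Psi> p n. z - l \<in> U n" for z p n
  proof -
    have l: "\<exists>l \<in> \<Psi> p n. P.near (n + 1) (\<sigma> n z) U (\<sigma> n l) \<and> e n z - e n l \<in> U n \<and> z - l \<in> U n" if U: "U \<in> opens P" for U
    proof (rule \<sigma>_near[OF U])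
      fix W assume W: "W \<in> opens P" "\<And>n z z'. z \<in> gr P n \<Longrightarrow> z' \<in> gr P n \<Longrightarrow> z - z' \<in> W n \<Longrightarrow>
        P.near (n + 1) (\<sigma> n z) U (\<sigma> n z') \<and> e n z - e n z' \<in> U n \<and> z - z' \<in> U n"
      obtain l where "l \<in> \<Psi> p n" "z - l \<in> W n" using lim W(1) by blast
      then show ?thesis using W(2)[OF z g] by blast
    qed
    have "z \<in> fil p n"
      using l by (intro P.cfilt_closed[OF cfilt_fil z]) (auto simp: \<Psi>_def)
    moreover have "e n z \<in> fil p n"
    proof (rule P.cfilt_closed[OF cfilt_fil e_gr[OF z]])
      fix U assume "U \<in> opens P"
      then obtain l' where "l' \<in> \<Psi> p n" "e n z - e n l' \<in> U n" using l by blast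
      then show "\<exists>l \<in> fil p n. e n z - l \<in> U n" by (intro bexI[of _ "e n l'"]) (simp_all add: \<Psi>_def)
    qed
    moreover have "P.raises fil p (n + 1) (\<sigma> n z)"
    proof (rule P.raises_near[OF cfilt_fil P.modf_LF[OF \<sigma>_simps(1)[OF z]]])
      fix U assume "U \<in> opens P"
      then obtain l' where "l' \<in> \<Psi> p n" "P.near (n + 1) (\<sigma> n z) U (\<sigma> n l')" using l by blast
      then show "\<exists>F'. P.raises fil p (n + 1) F' \<and> P.near (n + 1) (\<sigma> n z) U F'"
        by (intro exI[of _ "\<sigma> n l'"]) (simp add: \<Psi>_def)
    qed
    ultimately show ?thesis by (simp add: \<Psi>_def)
  qed
  have "P.cfilt \<Psi>"
    unfolding P.cfilt_def P.mfilt_def by (intro conjI allI ballI impI c1 c2 c3) (fact c4 c5 c6)+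
  then have "fil p n \<subseteq> \<Psi> p n"
  proof (rule fil_least)
    show "i n u \<in> \<Psi> 1 n" if "u \<in> gr G n" for n u
      using P.raises_zero[OF mfilt_fil] fil_simps(1) fil_gens(1)[OF that] that
      unfolding \<Psi>_def by (simp add: e_simps \<sigma>_simps(6,7))
    show "j n u \<in> \<Psi> 1 n" if "u \<in> gr H n" for n u
      using P.raises_zero[OF mfilt_fil] fil_simps(1) fil_gens(2)[OF that] that
      unfolding \<Psi>_def by (simp add: e_simps \<sigma>_simps(6,7))
  qed
  then show "P.raises fil p (n + 1) (\<sigma> n z)" "e n z \<in> fil p n" using assms by (auto simp: \<Psi>_def)
qed

text \<open>The map \<open>\<alpha>\<close> reads off the coefficient of \<open>x\<close>; on Maurer--Cartan elements it is \<open>0\<close> or \<open>- 1\<close>, and this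
  tells the elements coming from \<open>H\<close> from those coming from \<open>G\<close>.\<close>

definition sbase :: "('k, 'k \<times> 'k) cdgla_data" where "sbase = twist sdgla (1, 0)"

lemma sdgla_one_MC: "(1, 0) \<in> MC (sdgla :: ('k, 'k \<times> 'k) cdgla_data)"
  by (simp add: MC_def sdgla_def zero_prod_def)

lemma complete_sbase: "complete_dgla sbase"
  unfolding sbase_def by (rule complete_dgla.complete_dgla_twist[OF complete_dgla_sdgla sdgla_one_MC])

lemma sbase_simps: "smul sbase c (a, b) = (c * a, c * b)"
  "gr sbase n = (if n = - 1 then UNIV \<times> {0} else if n = - 2 then {0} \<times> UNIV else {0})"
  "brk sbase m n (a, b) (a', b') = (if m = - 1 \<and> n = - 1 then (0, a * a') else 0)"
  "dif sbase n (a, b) = (if n = - 1 then (0, a / 2) else 0)"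
  by (auto simp: sbase_def sdgla_def zero_prod_def)

lemma twistable_sbase: "twistable sbase (1, 0)"
  by (simp add: twistable_def sbase_simps)

definition \<alpha> :: "int \<Rightarrow> 'c \<Rightarrow> 'k \<times> 'k" where "\<alpha> = (SOME h. dp_map G H P i j x sbase (\<lambda>n u. 0) (\<lambda>n v. 0) (1, 0) h)"

lemma \<alpha>: "cont_map P sbase \<alpha>" "u \<in> gr G n \<Longrightarrow> \<alpha> n (i n u) = 0" "v \<in> gr H n \<Longrightarrow> \<alpha> n (j n v) = 0" "\<alpha> (- 1) x = (1, 0)"
proof -
  interpret S: complete_dgla sbase by (rule complete_sbase)
  have "- (1, 0) \<in> MC sbase" using twistable_MC[OF S.dgla_axioms] twistable_sbase by (simp add: sbase_simps)
  then have "\<exists>h. dp_map G H P i j x sbase (\<lambda>n u. 0) (\<lambda>n v. 0) (1, 0) h"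
    by (intro dp_universalD(1)[OF univ_s complete_sbase twistable_sbase]
      cont_zero_twist complete_G cont_map_zero complete_H complete_sbase)
  from someI_ex[OF this] have "dp_map G H P i j x sbase (\<lambda>n u. 0) (\<lambda>n v. 0) (1, 0) \<alpha>" unfolding \<alpha>_def .
  then show "cont_map P sbase \<alpha>" "u \<in> gr G n \<Longrightarrow> \<alpha> n (i n u) = 0" "v \<in> gr H n \<Longrightarrow> \<alpha> n (j n v) = 0" "\<alpha> (- 1) x = (1, 0)"
    by (simp_all add: dp_map_def)
qed

lemma \<alpha>_MC:
  assumes "\<zeta> \<in> MC P"
  shows "\<alpha> (- 1) \<zeta> = 0 \<or> \<alpha> (- 1) \<zeta> = (- 1, 0)"
proof -
  interpret S: complete_dgla sbase by (rule complete_sbase)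
  have "\<alpha> (- 1) \<zeta> \<in> MC sbase" by (rule cont_map_MC[OF P.dgla_axioms S.dgla_axioms \<alpha>(1) assms])
  then obtain a where a: "\<alpha> (- 1) \<zeta> = (a, 0)" "a / 2 + 1 / 2 * (a * a) = 0" by (cases "\<alpha> (- 1) \<zeta>") (auto simp: MC_def sbase_simps zero_prod_def)
  then have "a * (a + 1) = 0" by (simp add: field_simps)
  then show ?thesis using a(1) by (auto simp: zero_prod_def eq_neg_iff_add_eq_0)
qed

text \<open>A map \<iota> from \<open>sbase\<close> back to \<open>P\<close> sends the generator to
  \<open>x\<close>. The elements that differ from their image under \<beta> = \<iota> \<alpha> by
  weight one form a closed sub-dgla containing the generators, hence are everything; on the kernel
  of \<alpha> the image is 0.\<close>

lemma \<alpha>_zero_fil: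
  assumes z: "z \<in> gr P n" and "\<alpha> n z = 0"
  shows "z \<in> fil 1 n"
proof -
  interpret S: complete_dgla sbase by (rule complete_sbase)
  interpret P': complete_dgla "twist P (- x)" by (rule P.complete_dgla_twist[OF mx_MC])
  have "x \<in> MC (twist P (- x))"
    using twistable_x P.smul_half[of "brk P (- 1) (- 1) x x"] x_gr by (simp add: MC_def twistable_def P.brk_uminus_left)
  then obtain \<iota> where \<iota>': "cont_map sdgla (twist P (- x)) \<iota>" and \<iota>1: "\<iota> (- 1) (1, 0) = x"
    using sdgla_map[OF P'.complete_dgla_axioms] by blast
  have "cont_map sbase (twist (twist P (- x)) x) \<iota>"
    unfolding sbase_def by (rule cont_map_twist[OF dgla_sdgla \<iota>' _ \<iota>1[symmetric]]) (simp add: sdgla_def)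
  then have \<iota>: "cont_map sbase P \<iota>"
    by (rule cont_map_cong) (use twist_twist_uminus(1)[OF P.dgla_axioms x_gr] in \<open>simp_all\<close>)
  define \<beta> where "\<beta> n z = \<iota> n (\<alpha> n z)" for n z
  have \<beta>: "cont_map P P \<beta>" using cont_map_comp[OF \<alpha>(1) \<iota>] by (simp add: \<beta>_def[abs_def] comp_def)
  note b = cont_mapD[OF \<beta>] cont_map_diff[OF P.dgla_axioms \<beta>]
  have i0: "\<iota> n 0 = 0" for n by (rule cont_map_0[OF S.dgla_axioms P.dgla_axioms \<iota>])
  define R where "R n = {z \<in> gr P n. z - \<beta> n z \<in> fil 1 n}" for n
  have "closed_subdgla P R"
    unfolding closed_subdgla_def
  proof (intro conjI allI ballI impI)
    fix n
    show "P.subspace (R n)"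
    proof (rule P.subspaceI)
      show "0 \<in> R n" using cont_map_0[OF P.dgla_axioms P.dgla_axioms \<beta>] fil_simps(1) by (simp add: R_def P.gr_zero)
      show "y + z \<in> R n" if "y \<in> R n" "z \<in> R n" for y z
        using that fil_simps(2)[of "y - \<beta> n y" 1 n "z - \<beta> n z"] by (simp add: R_def P.gr_add b algebra_simps)
      show "smul P c z \<in> R n" if "z \<in> R n" for c z
        using that fil_simps(4)[of "z - \<beta> n z" 1 n c] by (simp add: R_def P.gr_smul b P.scale_right_diff_distrib)
    qed
    show "R n \<subseteq> gr P n" by (auto simp: R_def)
  next
    fix m n y z assume y: "y \<in> R m" and z: "z \<in> R n"
    have g: "y \<in> gr P m" "z \<in> gr P n" "\<beta> m y \<in> gr P m" "\<beta> n z \<in> gr P n" using y z b(1) by (auto simp: R_def)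
    have "brk P m n (y - \<beta> m y) z \<in> fil (1 + 0) (m + n)" "brk P m n (\<beta> m y) (z - \<beta> n z) \<in> fil (0 + 1) (m + n)"
      using y z g by (intro fil_simps(6); simp add: R_def fil_0)+
    then have "brk P m n (y - \<beta> m y) z + brk P m n (\<beta> m y) (z - \<beta> n z) \<in> fil 1 (m + n)"
      using fil_simps(2) by simp
    moreover have "brk P m n (y - \<beta> m y) z + brk P m n (\<beta> m y) (z - \<beta> n z) = brk P m n y z - \<beta> (m + n) (brk P m n y z)"
      using g by (simp add: P.brk_diff_left P.brk_diff_right b)
    ultimately show "brk P m n y z \<in> R (m + n)" using g by (simp add: R_def P.brk_closed)
  next
    fix n z assume z: "z \<in> R n"
    then have "dif P n (z - \<beta> n z) \<in> fil 1 (n - 1)" by (intro fil_simps(7)) (simp add: R_def)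
    then show "dif P n z \<in> R (n - 1)" using z by (simp add: R_def P.dif_closed P.dif_diff b)
  next
    fix n z assume z: "z \<in> gr P n" and lim: "\<forall>U \<in> opens P. \<exists>r \<in> R n. z - r \<in> U n"
    have "z - \<beta> n z \<in> fil 1 n"
    proof (rule P.cfilt_closed[OF cfilt_fil P.gr_diff[OF z b(1)[OF z]]])
      fix U assume U: "U \<in> opens P"
      obtain W where W: "W \<in> opens P" "\<And>n. \<beta> n ` W n \<subseteq> U n" using b(6)[OF U] by blast
      obtain W' where W': "W' \<in> opens P" "W' \<le> W" "W' \<le> U" using P.opens_directed[OF W(1) U] by blast
      obtain s where s: "s \<in> R n" "z - s \<in> W' n" using lim W'(1) by blast
      have "\<beta> n (z - s) \<in> U n" "z - s \<in> U n" using s(2) W(2)[of n] W'(2,3) unfolding le_fun_def by blast+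
      then have "z - s - \<beta> n (z - s) \<in> U n" using P.open_simps(3)[OF U] by blast
      moreover have "z - s - \<beta> n (z - s) = z - \<beta> n z - (s - \<beta> n s)" using z s(1) by (simp add: b(7) R_def)
      ultimately show "\<exists>l \<in> fil 1 n. z - \<beta> n z - l \<in> U n" using s(1) by (intro bexI[of _ "s - \<beta> n s"]) (simp_all add: R_def)
    qed
    then show "z \<in> R n" using z by (simp add: R_def)
  qed
  then have "R n = gr P n"
    by (rule closed_generated)
      (use i_gr j_gr fil_gens fil_simps(1) x_gr in \<open>simp_all add: R_def \<beta>_def \<alpha> i0 \<iota>1\<close>)
  then have "z - \<beta> n z \<in> fil 1 n" using z unfolding R_def by blast
  then show ?thesis using assms i0 by (simp add: \<beta>_def)
qed

end

section \<open>Paths of Maurer--Cartan elements\<close>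

lemma sum_diff_reindex: "(\<Sum>i\<le>k. F i (k - i)) = (\<Sum>i\<le>(k::nat). F (k - i) i)"
  by (rule sum.reindex_bij_witness[of _ "\<lambda>i. k - i" "\<lambda>i. k - i"]) auto

lemma triple_sum1:
  "(\<Sum>i\<le>k. \<Sum>j\<le>k - i. F i j (k - i - j)) = (\<Sum>p\<le>k. \<Sum>i\<le>p. F i (p - i) (k - p :: nat))"
proof -
  have "(\<Sum>i\<le>k. \<Sum>j\<le>k - i. F i j (k - i - j)) = (\<Sum>(i, j) \<in> (SIGMA i:{..k}. {..k - i}). F i j (k - i - j))"
    by (simp add: sum.Sigma)
  also have "\<dots> = (\<Sum>(p, i) \<in> (SIGMA p:{..k}. {..p}). F i (p - i) (k - p))"
    by (rule sum.reindex_bij_witness[of _ "\<lambda>(p, i). (i, p - i)" "\<lambda>(i, j). (i + j, i)"]) auto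
  finally show ?thesis by (simp add: sum.Sigma)
qed

lemma triple_sum2:
  "(\<Sum>i\<le>k. \<Sum>j\<le>k - i. F i j (k - i - j)) = (\<Sum>j\<le>k. \<Sum>i\<le>k - j. F i j (k - j - i :: nat))"
proof -
  have "(\<Sum>i\<le>k. \<Sum>j\<le>k - i. F i j (k - i - j)) = (\<Sum>(i, j) \<in> (SIGMA i:{..k}. {..k - i}). F i j (k - i - j))"
    by (simp add: sum.Sigma)
  also have "\<dots> = (\<Sum>(j, i) \<in> (SIGMA j:{..k}. {..k - j}). F i j (k - j - i))"
    by (rule sum.reindex_bij_witness[of _ "\<lambda>(j, i). (i, j)" "\<lambda>(i, j). (j, i)"]) (auto simp: add.commute)
  finally show ?thesis by (simp add: sum.Sigma)
qed

section \<open>Formal power series and curvature\<close>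

context dgla
begin

text \<open>The dgla of formal power series in \<open>t\<close> with coefficients in \<open>G\<close>.\<close>

definition psd :: "('k, nat \<Rightarrow> 'a) dgla_data"
  where "psd = \<lparr>smul = (\<lambda>c f k. smul G c (f k)), gr = (\<lambda>n. {f. \<forall>k. f k \<in> gr G n}),
    brk = (\<lambda>m n f g k. \<Sum>i\<le>k. brk G m n (f i) (g (k - i))), dif = (\<lambda>n f k. dif G n (f k))\<rparr>"

lemma psd_simps [simp]: "smul psd c f k = smul G c (f k)" "f \<in> gr psd n \<longleftrightarrow> (\<forall>k. f k \<in> gr G n)"
  "brk psd m n f g k = (\<Sum>i\<le>k. brk G m n (f i) (g (k - i)))" "dif psd n f k = dif G n (f k)"
  by (simp_all add: psd_def)

lemma dgla_psd: "dgla psd"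
proof -
  interpret v: vector_space "smul psd"
    by unfold_locales (auto simp: fun_eq_iff scale_right_distrib scale_left_distrib)
  show ?thesis
  proof (unfold_locales, goal_cases)
    case (1 n) show ?case by (auto simp: v.subspace_def gr_zero gr_add gr_smul)
  next
    case (5 f m g n)
    show ?case
    proof
      fix k
      have "brk psd m n f g k = (\<Sum>i\<le>k. smul G (- ksign (m * n)) (brk G n m (g (k - i)) (f i)))"
        using 5 by (simp add: brk_antisym[of _ m _ n])
      then show "brk psd m n f g k = smul psd (- ksign (m * n)) (brk psd n m g f) k"
        unfolding psd_simps by (simp only: scale_sum_right sum_diff_reindex[of "\<lambda>i j. smul G (- ksign (m * n)) (brk G n m (g i) (f j))"])
    qed
  next
    case (6 f l g m h n)
    note c = brk_closed
    show ?case
    proof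
      fix k
      have "brk psd l (m + n) f (brk psd m n g h) k =
          (\<Sum>i\<le>k. \<Sum>j\<le>k - i. brk G l (m + n) (f i) (brk G m n (g j) (h (k - i - j))))"
        using 6 by (simp add: brk_sum_right c)
      also have "\<dots> = (\<Sum>i\<le>k. \<Sum>j\<le>k - i. brk G (l + m) n (brk G l m (f i) (g j)) (h (k - i - j))) +
          (\<Sum>i\<le>k. \<Sum>j\<le>k - i. smul G (ksign (l * m)) (brk G m (l + n) (g j) (brk G l n (f i) (h (k - i - j)))))"
        unfolding sum.distrib[symmetric] using 6 by (intro sum.cong refl brk_Jacobi) auto
      also have "(\<Sum>i\<le>k. \<Sum>j\<le>k - i. brk G (l + m) n (brk G l m (f i) (g j)) (h (k - i - j))) =
          brk psd (l + m) n (brk psd l m f g) h k"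
        unfolding triple_sum1[of "\<lambda>i j r. brk G (l + m) n (brk G l m (f i) (g j)) (h r)"]
        using 6 by (simp add: brk_sum_left c)
      also have "(\<Sum>i\<le>k. \<Sum>j\<le>k - i. smul G (ksign (l * m)) (brk G m (l + n) (g j) (brk G l n (f i) (h (k - i - j))))) =
          smul psd (ksign (l * m)) (brk psd m (l + n) g (brk psd l n f h)) k"
        unfolding triple_sum2[of "\<lambda>i j r. smul G (ksign (l * m)) (brk G m (l + n) (g j) (brk G l n (f i) (h r)))"]
        using 6 by (simp add: brk_sum_right c scale_sum_right)
      finally show "brk psd l (m + n) f (brk psd m n g h) k = (brk psd (l + m) n (brk psd l m f g) h +
        smul psd (ksign (l * m)) (brk psd m (l + n) g (brk psd l n f h))) k" by simp
    qed
  next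
    case (11 f m g n)
    then show ?case
      by (auto simp: fun_eq_iff dif_sum brk_closed dif_brk sum.distrib scale_sum_right)
  qed (auto simp: fun_eq_iff gr_sum brk_closed brk_add_left brk_smul_left sum.distrib scale_sum_right
      dif_closed dif_add dif_smul dif_dif)
qed

definition ddt :: "(nat \<Rightarrow> 'a) \<Rightarrow> nat \<Rightarrow> 'a"
  where "ddt f k = smul G (of_nat (Suc k)) (f (Suc k))"

lemma ddt_simps:
  "ddt (f + g) = ddt f + ddt g" "ddt (smul psd c f) = smul psd c (ddt f)"
  "f \<in> gr psd n \<Longrightarrow> ddt (dif psd n f) = dif psd n (ddt f)" "f \<in> gr psd n \<Longrightarrow> ddt f \<in> gr psd n"
  by (auto simp: fun_eq_iff ddt_def scale_right_distrib dif_smul gr_smul mult.commute)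

lemma ddt_brk:
  assumes "f \<in> gr psd m" "g \<in> gr psd n"
  shows "ddt (brk psd m n f g) = brk psd m n (ddt f) g + brk psd m n f (ddt g)"
proof
  fix k
  have g: "f i \<in> gr G m" "g i \<in> gr G n" for i using assms by auto
  let ?b = "\<lambda>i j. brk G m n (f i) (g j)"
  have "ddt (brk psd m n f g) k = (\<Sum>i\<le>Suc k. smul G (of_nat i) (?b i (Suc k - i)) + smul G (of_nat (Suc k - i)) (?b i (Suc k - i)))"
    unfolding ddt_def psd_simps scale_sum_right scale_left_distrib[symmetric]
    by (intro sum.cong refl) (simp flip: of_nat_add of_nat_Suc)
  also have "\<dots> = (\<Sum>i\<le>Suc k. smul G (of_nat i) (?b i (Suc k - i))) + (\<Sum>i\<le>Suc k. smul G (of_nat (Suc k - i)) (?b i (Suc k - i)))"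
    by (rule sum.distrib)
  also have "(\<Sum>i\<le>Suc k. smul G (of_nat i) (?b i (Suc k - i))) = (\<Sum>i\<le>k. smul G (of_nat (Suc i)) (?b (Suc i) (k - i)))"
    by (simp only: sum.atMost_Suc_shift) simp
  also have "\<dots> = brk psd m n (ddt f) g k" by (simp add: ddt_def brk_smul_left g)
  also have "(\<Sum>i\<le>Suc k. smul G (of_nat (Suc k - i)) (?b i (Suc k - i))) = (\<Sum>i\<le>k. smul G (of_nat (Suc (k - i))) (?b i (Suc (k - i))))"
    by (simp add: Suc_diff_le add_diff_eq)
  also have "\<dots> = brk psd m n f (ddt g) k" by (simp add: ddt_def brk_smul_right g)
  finally show "ddt (brk psd m n f g) k = (brk psd m n (ddt f) g + brk psd m n f (ddt g)) k"
    by (simp only: plus_fun_apply)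
qed

definition curv :: "(nat \<Rightarrow> 'a) \<Rightarrow> nat \<Rightarrow> 'a"
  where "curv z = dif psd (- 1) z + smul psd (1 / 2) (brk psd (- 1) (- 1) z z)"

text \<open>A Bianchi identity along the gauge flow: where the defect \<open>E\<close> of the flow
  equation is zero, the curvature satisfies a linear equation and vanishes with its initial value.
  The defect is kept because it will be known only in terms of the curvature.\<close>

lemma ddt_curv:
  assumes z: "z \<in> gr psd (- 1)" and l: "l \<in> gr psd 0"
  defines "E \<equiv> ddt z - (dif psd 0 l + brk psd (- 1) 0 z l)"
  shows "ddt (curv z) = brk psd (- 2) 0 (curv z) l + (dif psd (- 1) E + brk psd (- 1) (- 1) z E)"
proof -
  interpret D: dgla psd by (rule dgla_psd)
  have g: "dif psd 0 l \<in> gr psd (- 1)" "brk psd (- 1) 0 z l \<in> gr psd (- 1)" "dif psd (- 1) z \<in> gr psd (- 2)"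
    "brk psd (- 1) (- 1) z z \<in> gr psd (- 2)"
    using D.dif_closed[OF l] D.brk_closed[OF z l] D.dif_closed[OF z] D.brk_closed[OF z z] by auto
  have v: "dif psd 0 l + brk psd (- 1) 0 z l \<in> gr psd (- 1)" using D.gr_add[OF g(1,2)] .
  have dz: "ddt z \<in> gr psd (- 1)" by (rule ddt_simps(4)[OF z])
  have E: "E \<in> gr psd (- 1)" unfolding E_def by (rule D.gr_diff[OF dz v])
  have ze: "ddt z = (dif psd 0 l + brk psd (- 1) 0 z l) + E" unfolding E_def by (metis add.commute diff_add_cancel)
  have sym: "brk psd (- 1) (- 1) (ddt z) z = brk psd (- 1) (- 1) z (ddt z)"
    using D.brk_antisym[OF dz z] by (simp add: ksign_def)
  have "ddt (curv z) = dif psd (- 1) (ddt z) + smul psd (1 / 2) (brk psd (- 1) (- 1) (ddt z) z + brk psd (- 1) (- 1) z (ddt z))"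
    unfolding curv_def ddt_simps(1,2) ddt_simps(3)[OF z] ddt_brk[OF z z] ..
  also have "\<dots> = dif psd (- 1) (ddt z) + brk psd (- 1) (- 1) z (ddt z)"
    unfolding sym D.scale_right_distrib D.smul_half ..
  also have "\<dots> = dif psd (- 1) (brk psd (- 1) 0 z l) + brk psd (- 1) (- 1) z (dif psd 0 l) +
      brk psd (- 1) (- 1) z (brk psd (- 1) 0 z l) + (dif psd (- 1) E + brk psd (- 1) (- 1) z E)"
  proof -
    have "dif psd (- 1) (ddt z) = dif psd (- 1) (dif psd 0 l) + dif psd (- 1) (brk psd (- 1) 0 z l) + dif psd (- 1) E"
      unfolding ze by (simp only: D.dif_add[OF v E] D.dif_add[OF g(1,2)])
    moreover have "dif psd (- 1) (dif psd 0 l) = 0" using D.dif_dif[OF l] by simp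
    moreover have "brk psd (- 1) (- 1) z (ddt z) = brk psd (- 1) (- 1) z (dif psd 0 l) +
      brk psd (- 1) (- 1) z (brk psd (- 1) 0 z l) + brk psd (- 1) (- 1) z E"
      unfolding ze by (simp only: D.brk_add_right[OF z v E] D.brk_add_right[OF z g(1,2)])
    ultimately show ?thesis by (simp only: add_0_left ac_simps)
  qed
  also have "dif psd (- 1) (brk psd (- 1) 0 z l) = brk psd (- 2) 0 (dif psd (- 1) z) l - brk psd (- 1) (- 1) z (dif psd 0 l)"
    using D.dif_brk[OF z l] by (simp add: ksign_def)
  also have "brk psd (- 1) (- 1) z (brk psd (- 1) 0 z l) = smul psd (1 / 2) (brk psd (- 2) 0 (brk psd (- 1) (- 1) z z) l)"
    using D.brk_brk_odd[OF z l] by simp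
  also have "brk psd (- 2) 0 (dif psd (- 1) z) l - brk psd (- 1) (- 1) z (dif psd 0 l) + brk psd (- 1) (- 1) z (dif psd 0 l) +
      smul psd (1 / 2) (brk psd (- 2) 0 (brk psd (- 1) (- 1) z z) l) = brk psd (- 2) 0 (curv z) l"
    unfolding curv_def D.brk_add_left[OF g(3) D.gr_smul[OF g(4)] l] D.brk_smul_left[OF g(4) l] by simp
  finally show ?thesis .
qed

end

section \<open>The contraction and its bilinear defect\<close>

context disjoint_product
begin

text \<open>With \<open>\<kappa> = z - e z\<close> and the curvature \<open>C\<close> of \<open>z\<close> of degree \<open>- 1\<close>, the map \<open>s\<close> satisfies
  \<open>d s z + [z, s z] = - \<kappa> - s C + Q \<kappa> \<kappa>\<close>.\<close>

definition s :: "int \<Rightarrow> 'c \<Rightarrow> 'c" where "s n z = \<sigma> n z []"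

definition Q :: "'c \<Rightarrow> 'c \<Rightarrow> 'c"
  where "Q a b = brk P (- 1) 0 a (s (- 1) b) - \<sigma> (- 1) b [(- 1, a)]"

lemma s_gr: "z \<in> gr P n \<Longrightarrow> s n z \<in> gr P (n + 1)"
  using P.LF_Nil[OF P.modf_LF[OF \<sigma>_simps(1)]] by (simp add: s_def)

lemma s_gr': "z \<in> gr P (- 1) \<Longrightarrow> s (- 1) z \<in> gr P 0" using s_gr[of z "- 1"] by simp

lemma s_linear: "y \<in> gr P n \<Longrightarrow> z \<in> gr P n \<Longrightarrow> s n (y + z) = s n y + s n z"
  "z \<in> gr P n \<Longrightarrow> s n (smul P c z) = smul P c (s n z)"
  by (simp_all add: s_def \<sigma>_simps P.scl_Nil)

lemma s_zero: "s n 0 = 0" using s_linear(2)[OF P.gr_zero, of n 0] by simp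

lemma s_diff: "y \<in> gr P n \<Longrightarrow> z \<in> gr P n \<Longrightarrow> s n (y - z) = s n y - s n z"
  using s_linear(1)[of "y - z" n z] by (simp add: P.gr_diff)

lemma s_sum: "(\<And>a. a \<in> A \<Longrightarrow> f a \<in> gr P n) \<Longrightarrow> s n (sum f A) = (\<Sum>a\<in>A. s n (f a))"
  by (induction A rule: infinite_finite_induct) (simp_all add: s_zero s_linear P.gr_sum)

lemma \<sigma>_e: "z \<in> gr P n \<Longrightarrow> \<sigma> n (e n z) = 0"
  using r_gr by (simp add: e_def \<sigma>_simps(7))

lemma \<sigma>_diff: "y \<in> gr P n \<Longrightarrow> z \<in> gr P n \<Longrightarrow> \<sigma> n (y - z) = \<sigma> n y - \<sigma> n z"
  using \<sigma>_simps(2)[of "y - z" n z] by (simp add: P.gr_diff)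

lemma \<sigma>_minus_e: "z \<in> gr P n \<Longrightarrow> \<sigma> n (z - e n z) = \<sigma> n z"
  by (simp add: \<sigma>_diff e_gr \<sigma>_e)

lemma s_dif: "z \<in> gr P n \<Longrightarrow> s (n - 1) (dif P n z) = - dif P (n + 1) (s n z) - (z - e n z)"
  by (simp add: s_def \<sigma>_simps(5) P.shift_def P.eul_single P.gr_diff e_gr)

lemma \<sigma>_arg_diff:
  assumes "a \<in> gr P (- 1)" "a' \<in> gr P (- 1)" "b \<in> gr P (- 1)"
  shows "\<sigma> (- 1) b [(- 1, a - a')] = \<sigma> (- 1) b [(- 1, a)] - \<sigma> (- 1) b [(- 1, a')]"
proof -
  have "P.shift (- 1) (a - a') (\<sigma> (- 1) b) = P.shift (- 1) a (\<sigma> (- 1) b) - P.shift (- 1) a' (\<sigma> (- 1) b)"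
    using \<sigma>_simps(1)[OF assms(3)] by (intro P.envlin_lin(3)[of _ 0] P.modf_envlin assms) simp
  then show ?thesis by (simp add: P.shift_def fun_eq_iff)
qed

lemma Q_diff:
  assumes "a \<in> gr P (- 1)" "a' \<in> gr P (- 1)" "b \<in> gr P (- 1)"
  shows "Q (a - a') b = Q a b - Q a' b" "Q b (a - a') = Q b a - Q b a'"
  using assms by (simp_all add: Q_def \<sigma>_arg_diff P.brk_diff_left s_gr' s_diff P.brk_diff_right \<sigma>_diff)

lemma Q_minus_e: "a \<in> gr P (- 1) \<Longrightarrow> b \<in> gr P (- 1) \<Longrightarrow> Q a (b - e (- 1) b) = Q a b"
  by (simp add: Q_def \<sigma>_minus_e s_def)

text \<open>At the empty word the action of the pair (y, e y) on \<sigma> z is [e y, s z] plus the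
  value of \<sigma> z at the letter y - e y, which equals [y, s z] - Q (y - e y) z.\<close>

lemma s_brk:
  assumes y: "y \<in> gr P (- 1)" and z: "z \<in> gr P (- 1)"
  shows "s (- 2) (brk P (- 1) (- 1) y z) =
    (Q (y - e (- 1) y) z - brk P (- 1) 0 y (s (- 1) z)) + (Q (z - e (- 1) z) y - brk P (- 1) 0 z (s (- 1) y))"
proof -
  have "s (- 2) (brk P (- 1) (- 1) y z) =
      - (brk P (- 1) 0 (e (- 1) y) (s (- 1) z) + \<sigma> (- 1) z [(- 1, y - e (- 1) y)])
      - (brk P (- 1) 0 (e (- 1) z) (s (- 1) y) + \<sigma> (- 1) y [(- 1, z - e (- 1) z)])"
    using \<sigma>_simps(4)[OF y z] by (simp add: s_def P.fox_brk_def P.cact_Nil ksign_def P.scl_Nil)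
  then show ?thesis
    using y z by (simp add: Q_def P.brk_diff_left s_gr' e_gr)
qed

text \<open>By \<open>fil_stable\<close> the function \<open>\<sigma> (- 1) b\<close> raises weights
  by the weight of \<open>b\<close>, at the empty word as well as at the letter
  \<open>a\<close>.\<close>

lemma Q_fil:
  assumes "a \<in> fil p (- 1)" "b \<in> fil q (- 1)"
  shows "Q a b \<in> fil (p + q) (- 1)"
proof -
  have s: "P.raises fil q 0 (\<sigma> (- 1) b)" using fil_stable(1)[OF assms(2)] by simp
  have "s (- 1) b \<in> fil q 0" using P.raises_Nil[OF s] by (simp add: s_def)
  then have 1: "brk P (- 1) 0 a (s (- 1) b) \<in> fil (p + q) (- 1)" using fil_simps(6)[OF assms(1)] by force
  have "P.raises fil (q + p) (0 + - 1) (P.shift (- 1) a (\<sigma> (- 1) b))" by (rule P.raises_shift[OF s assms(1)])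
  from P.raises_Nil[OF this] have "\<sigma> (- 1) b [(- 1, a)] \<in> fil (p + q) (- 1)" by (simp add: P.shift_def add.commute)
  then show ?thesis using 1 fil_simps(3) by (simp add: Q_def)
qed

lemma s_fil: "z \<in> fil p (- 1) \<Longrightarrow> s (- 1) z \<in> fil p 0"
  using P.raises_Nil[OF fil_stable(1)[of z p "- 1"]] by (simp add: s_def)

end

text \<open>Multiplication of a power series by \<open>1 - t\<close>.\<close>

definition bdiff :: "(nat \<Rightarrow> 'a::ab_group_add) \<Rightarrow> nat \<Rightarrow> 'a"
  where "bdiff f k = f k - (case k of 0 \<Rightarrow> 0 | Suc k' \<Rightarrow> f k')"

lemma bdiff_simps [simp]: "bdiff f 0 = f 0" "bdiff f (Suc k) = f (Suc k) - f k"
  by (simp_all add: bdiff_def)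

text \<open>Multiplication by 1 - t moves out of a convolution. \<open>B\<close> is assumed
  subtractive only on the differences that occur, because the operations are additive only on
  homogeneous elements.\<close>

lemma bdiff_conv:
  assumes "\<And>i j. B (f i) (g (Suc j) - g j) = B (f i) (g (Suc j)) - (B (f i) (g j) :: 'a::ab_group_add)"
  shows "(\<Sum>i\<le>k. B (f i) (bdiff g (k - i))) = bdiff (\<lambda>k. \<Sum>i\<le>k. B (f i) (g (k - i))) k"
proof (cases k)
  case (Suc n)
  have "(\<Sum>i\<le>n. B (f i) (bdiff g (Suc n - i))) = (\<Sum>i\<le>n. B (f i) (g (Suc n - i))) - (\<Sum>i\<le>n. B (f i) (g (n - i)))"
    unfolding sum_subtractf[symmetric] using assms by (intro sum.cong refl) (simp add: Suc_diff_le)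
  then show ?thesis by (simp add: Suc)
qed simp

lemma bdiff_conv':
  assumes "\<And>i j. B (f (Suc i) - f i) (g j) = B (f (Suc i)) (g j) - (B (f i) (g j) :: 'a::ab_group_add)"
  shows "(\<Sum>i\<le>k. B (bdiff f i) (g (k - i))) = bdiff (\<lambda>k. \<Sum>i\<le>k. B (f i) (g (k - i))) k"
  using bdiff_conv[of "\<lambda>x y. B y x" g f k] assms
  by (simp add: sum_diff_reindex[of "\<lambda>i j. B (bdiff f i) (g j)"] sum_diff_reindex[of "\<lambda>i j. B (f i) (g j)"])

lemma sum_bdiff: "(\<Sum>i\<le>k. bdiff f i) = f k"
  by (induction k) simp_all

text \<open>The recursive calls of \<open>mseq\<close> under the sum have index at most
  \<open>k\<close>; the congruence rule makes this bound available to the termination proof.\<close>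

declare sum.cong [fundef_cong]

section \<open>The path from a Maurer--Cartan element to the retract\<close>

context disjoint_product
begin

text \<open>The path from \<open>\<zeta>\<close> is \<open>z = \<eta> + (1 - t) m\<close> and \<open>l = s m\<close>, where \<open>m' = (1 - e) Q m m\<close> and \<open>\<eta>' = (1 - t) e Q m m\<close>
  with \<open>m(0) = \<zeta> - e \<zeta>\<close> and \<open>\<eta>(0) = e \<zeta>\<close>.  Then \<open>(1 - t) (z' - d l - [z, l]) = s C\<close> for the curvature \<open>C\<close> of \<open>z\<close>,
  and \<open>z(1)\<close> is fixed by \<open>e\<close>.\<close>

fun mseq :: "'c \<Rightarrow> nat \<Rightarrow> 'c"
  where "mseq \<zeta> 0 = \<zeta> - e (- 1) \<zeta>"
  | "mseq \<zeta> (Suc k) = smul P (1 / of_nat (Suc k))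
      ((\<Sum>i\<le>k. Q (mseq \<zeta> i) (mseq \<zeta> (k - i))) - e (- 1) (\<Sum>i\<le>k. Q (mseq \<zeta> i) (mseq \<zeta> (k - i))))"

definition qseq :: "'c \<Rightarrow> nat \<Rightarrow> 'c" where "qseq \<zeta> k = (\<Sum>i\<le>k. Q (mseq \<zeta> i) (mseq \<zeta> (k - i)))"

definition nseq :: "'c \<Rightarrow> nat \<Rightarrow> 'c"
  where "nseq \<zeta> k = (case k of 0 \<Rightarrow> e (- 1) \<zeta> | Suc k \<Rightarrow> smul P (1 / of_nat (Suc k)) (e (- 1) (bdiff (qseq \<zeta>) k)))"

definition zseq :: "'c \<Rightarrow> nat \<Rightarrow> 'c" where "zseq \<zeta> k = nseq \<zeta> k + bdiff (mseq \<zeta>) k"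

definition lseq :: "'c \<Rightarrow> nat \<Rightarrow> 'c" where "lseq \<zeta> k = s (- 1) (mseq \<zeta> k)"

lemma mseq_Suc: "mseq \<zeta> (Suc k) = smul P (1 / of_nat (Suc k)) (qseq \<zeta> k - e (- 1) (qseq \<zeta> k))"
  by (simp add: qseq_def)

declare mseq.simps(2) [simp del]

lemma e_fil: "z \<in> fil p n \<Longrightarrow> e n z \<in> fil p n" by (rule fil_stable(2))

context
  fixes \<zeta> assumes \<zeta>: "\<zeta> \<in> fil 1 (- 1)"
begin

text \<open>Coefficient \<open>n + 1\<close> combines coefficients \<open>i\<close> and
  \<open>n - i\<close> of weights i + 1 and n - i + 1, so weights grow with the index; the initial
  weight one is the hypothesis on \<zeta>.\<close>

lemma mseq_fil: "mseq \<zeta> k \<in> fil (Suc k) (- 1)"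
proof (induction k rule: less_induct)
  case (less k)
  show ?case
  proof (cases k)
    case 0
    then show ?thesis using \<zeta> e_fil[OF \<zeta>] fil_simps(3) by simp
  next
    case (Suc n)
    have "Q (mseq \<zeta> i) (mseq \<zeta> (n - i)) \<in> fil (Suc k) (- 1)" if "i \<le> n" for i
      using Q_fil[OF less[of i] less[of "n - i"]] that Suc by simp
    then have "qseq \<zeta> n \<in> fil (Suc k) (- 1)"
      unfolding qseq_def using P.mfilt_simps(1,2)[OF mfilt_fil]
      by (intro P.subspace_sum) (use mfilt_fil in \<open>auto simp: P.mfilt_def\<close>)
    then show ?thesis
      unfolding Suc mseq_Suc using e_fil fil_simps(3,4) Suc by simp
  qed
qed

lemma mseq_gr: "mseq \<zeta> k \<in> gr P (- 1)" using mseq_fil fil_gr by blast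

lemma \<zeta>_gr: "\<zeta> \<in> gr P (- 1)" using \<zeta> fil_gr by blast

lemma qseq_fil: "qseq \<zeta> k \<in> fil (Suc (Suc k)) (- 1)"
proof -
  have "Q (mseq \<zeta> i) (mseq \<zeta> (k - i)) \<in> fil (Suc (Suc k)) (- 1)" if "i \<le> k" for i
    using Q_fil[OF mseq_fil[of i] mseq_fil[of "k - i"]] that by simp
  then show ?thesis
    unfolding qseq_def by (intro P.subspace_sum) (use mfilt_fil in \<open>auto simp: P.mfilt_def\<close>)
qed

lemma qseq_gr: "qseq \<zeta> k \<in> gr P (- 1)" using qseq_fil fil_gr by blast

lemma bdiff_fil:
  assumes f: "\<And>k. f k \<in> fil (Suc k + p) n"
  shows "bdiff f k \<in> fil (k + p) n"
proof -
  have "f k \<in> fil (k + p) n" by (rule fil_mono[OF _ f]) simp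
  then show ?thesis using f[of "k - 1"] by (cases k) (simp_all add: fil_simps(3))
qed

lemma bdiff_gr: "(\<And>k. f k \<in> gr P n) \<Longrightarrow> bdiff f k \<in> gr P n"
  by (cases k) (auto intro: P.gr_diff)

lemma e_mseq: "e (- 1) (mseq \<zeta> k) = 0"
  by (cases k) (simp_all add: mseq_Suc e_linear e_gr \<zeta>_gr e_simps qseq_gr P.gr_diff)

lemma nseq_fil: "nseq \<zeta> k \<in> fil k (- 1)"
proof (cases k)
  case 0 then show ?thesis by (simp add: nseq_def fil_0 e_gr \<zeta>_gr)
next
  case (Suc n)
  have "bdiff (qseq \<zeta>) n \<in> fil (n + 1) (- 1)" using qseq_fil by (intro bdiff_fil) simp
  then show ?thesis using e_fil fil_simps(4) by (simp add: nseq_def Suc)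
qed

lemma nseq_gr: "nseq \<zeta> k \<in> gr P (- 1)" using nseq_fil fil_gr by blast

lemma e_nseq: "e (- 1) (nseq \<zeta> k) = nseq \<zeta> k"
  by (cases k) (simp_all add: nseq_def e_linear e_gr \<zeta>_gr e_simps bdiff_gr[OF qseq_gr])

lemma zseq_fil: "zseq \<zeta> k \<in> fil k (- 1)"
  using nseq_fil[of k] bdiff_fil[of "mseq \<zeta>" 0 "- 1" k] mseq_fil by (simp add: zseq_def fil_simps(2))

lemma zseq_gr: "zseq \<zeta> k \<in> gr P (- 1)" using zseq_fil fil_gr by blast

lemma lseq_fil: "lseq \<zeta> k \<in> fil (Suc k) 0"
  using mseq_fil s_fil by (simp add: lseq_def)

lemma lseq_gr: "lseq \<zeta> k \<in> gr P 0" using lseq_fil fil_gr by blast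

lemma e_bdiff_mseq: "e (- 1) (bdiff (mseq \<zeta>) k) = 0"
  by (cases k) (simp_all add: e_mseq e_linear mseq_gr del: mseq.simps)

lemma zseq_minus_e: "zseq \<zeta> k - e (- 1) (zseq \<zeta> k) = bdiff (mseq \<zeta>) k"
  by (simp add: zseq_def e_linear e_nseq e_bdiff_mseq nseq_gr bdiff_gr mseq_gr)

lemma s_zseq: "s (- 1) (zseq \<zeta> k) = bdiff (lseq \<zeta>) k"
proof -
  have "s (- 1) (zseq \<zeta> k) = s (- 1) (zseq \<zeta> k - e (- 1) (zseq \<zeta> k))"
    using \<sigma>_minus_e[OF zseq_gr] by (simp add: s_def)
  also have "\<dots> = bdiff (lseq \<zeta>) k"
    unfolding zseq_minus_e by (cases k) (simp_all add: lseq_def s_diff mseq_gr del: mseq.simps)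
  finally show ?thesis .
qed

lemma zseq_0: "zseq \<zeta> 0 = \<zeta>" by (simp add: zseq_def nseq_def)

text \<open>The relation for \<open>s\<close> applied to the power series z. Both z - e z = (1 - t)
  m and s z = (1 - t) l are multiples of 1 - t, so s C is one as well.\<close>

lemma s_curv:
  "s (- 2) (P.curv (zseq \<zeta>) k) = bdiff (\<lambda>k. bdiff (qseq \<zeta>) k - mseq \<zeta> k - dif P 0 (lseq \<zeta> k) -
    (\<Sum>i\<le>k. brk P (- 1) 0 (zseq \<zeta> i) (lseq \<zeta> (k - i)))) k"
proof -
  let ?z = "zseq \<zeta>" and ?l = "lseq \<zeta>" and ?m = "mseq \<zeta>"
  have b: "brk P (- 1) (- 1) (?z i) (?z j) \<in> gr P (- 2)" for i j using P.brk_closed[OF zseq_gr zseq_gr] by simp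
  have d: "dif P (- 1) (?z i) \<in> gr P (- 2)" for i using P.dif_closed[OF zseq_gr] by simp
  have "s (- 2) (P.curv ?z k) = s (- 2) (dif P (- 1) (?z k)) + smul P (1 / 2) (\<Sum>i\<le>k. s (- 2) (brk P (- 1) (- 1) (?z i) (?z (k - i))))"
    by (simp add: P.curv_def s_linear d b P.gr_sum P.gr_smul s_sum)
  also have "s (- 2) (dif P (- 1) (?z k)) = - dif P 0 (bdiff ?l k) - bdiff ?m k"
    using s_dif[OF zseq_gr, of k] by (simp add: s_zseq zseq_minus_e)
  also have "dif P 0 (bdiff ?l k) = bdiff (\<lambda>k. dif P 0 (?l k)) k"
    by (cases k) (simp_all add: P.dif_diff lseq_gr)
  also have "smul P (1 / 2) (\<Sum>i\<le>k. s (- 2) (brk P (- 1) (- 1) (?z i) (?z (k - i)))) =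
      (\<Sum>i\<le>k. Q (bdiff ?m i) (bdiff ?m (k - i)) - brk P (- 1) 0 (?z i) (bdiff ?l (k - i)))"
  proof -
    \<comment> \<open>The two halves of \<open>s_brk\<close> differ by an exchange of indices, so
      the factor 1/2 leaves one of them.\<close>
    define F where "F i j = Q (bdiff ?m i) (bdiff ?m j) - brk P (- 1) 0 (?z i) (bdiff ?l j)" for i j
    have "s (- 2) (brk P (- 1) (- 1) (?z i) (?z j)) = F i j + F j i" for i j
      using Q_minus_e[OF bdiff_gr[OF mseq_gr] zseq_gr, of _ i] Q_minus_e[OF bdiff_gr[OF mseq_gr] zseq_gr, of _ j]
      unfolding s_brk[OF zseq_gr zseq_gr] s_zseq zseq_minus_e F_def by simp
    then have "(\<Sum>i\<le>k. s (- 2) (brk P (- 1) (- 1) (?z i) (?z (k - i)))) = (\<Sum>i\<le>k. F i (k - i)) + (\<Sum>i\<le>k. F i (k - i))"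
      by (simp add: sum.distrib sum_diff_reindex[of "\<lambda>i j. F j i"])
    then show ?thesis by (simp add: P.scale_right_distrib P.smul_half F_def)
  qed
  also have "\<dots> = (\<Sum>i\<le>k. Q (bdiff ?m i) (bdiff ?m (k - i))) - (\<Sum>i\<le>k. brk P (- 1) 0 (?z i) (bdiff ?l (k - i)))"
    by (rule sum_subtractf)
  also have "(\<Sum>i\<le>k. brk P (- 1) 0 (?z i) (bdiff ?l (k - i))) = bdiff (\<lambda>k. \<Sum>i\<le>k. brk P (- 1) 0 (?z i) (?l (k - i))) k"
    by (rule bdiff_conv) (simp add: P.brk_diff_right zseq_gr lseq_gr)
  also have "(\<Sum>i\<le>k. Q (bdiff ?m i) (bdiff ?m (k - i))) = bdiff (\<lambda>k. \<Sum>i\<le>k. Q (bdiff ?m i) (?m (k - i))) k"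
    by (rule bdiff_conv) (simp add: Q_diff bdiff_gr mseq_gr del: mseq.simps)
  also have "(\<lambda>k. \<Sum>i\<le>k. Q (bdiff ?m i) (?m (k - i))) = bdiff (\<lambda>k. \<Sum>i\<le>k. Q (?m i) (?m (k - i)))"
    by (rule ext, rule bdiff_conv') (simp add: Q_diff mseq_gr del: mseq.simps)
  also have "(\<lambda>k. \<Sum>i\<le>k. Q (?m i) (?m (k - i))) = qseq \<zeta>" by (simp add: qseq_def fun_eq_iff)
  finally show ?thesis by (cases k) simp_all
qed

text \<open>The division of \<open>s_curv\<close> by 1 - t, which takes coefficients to their
  partial sums; the recursion for m and \<eta> was chosen so that z' = (1 - t) q - m with q = Q m
  m.\<close>

lemma flow_defect:
  "(P.ddt (zseq \<zeta>) - (dif P.psd 0 (lseq \<zeta>) + brk P.psd (- 1) 0 (zseq \<zeta>) (lseq \<zeta>))) k =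
    (\<Sum>i\<le>k. s (- 2) (P.curv (zseq \<zeta>) i))"
proof -
  have c: "smul P (of_nat (Suc n)) (smul P (1 / of_nat (Suc n)) y) = y" for n y
    using of_nat_neq_0[of n, where ?'a = 'k] by simp
  have "P.ddt (mseq \<zeta>) n = qseq \<zeta> n - e (- 1) (qseq \<zeta> n)" for n
    unfolding P.ddt_def mseq_Suc c ..
  moreover have "P.ddt (nseq \<zeta>) k = e (- 1) (bdiff (qseq \<zeta>) k)"
    unfolding P.ddt_def nseq_def nat.case c ..
  moreover have "e (- 1) (bdiff (qseq \<zeta>) k) = bdiff (\<lambda>k. e (- 1) (qseq \<zeta> k)) k"
    by (cases k) (simp_all add: e_linear qseq_gr)
  \<comment> \<open>Coefficients of m + t m', as they occur in the derivative of (1 - t) m.\<close>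
  moreover have "smul P (of_nat (Suc k)) (mseq \<zeta> k) = mseq \<zeta> k + (case k of 0 \<Rightarrow> 0 | Suc n \<Rightarrow> P.ddt (mseq \<zeta>) n)"
  proof (cases k)
    case (Suc n)
    show ?thesis unfolding Suc nat.case P.ddt_def by (metis P.scale_left_distrib P.scale_one of_nat_Suc)
  qed simp
  moreover have "P.ddt (zseq \<zeta>) k = P.ddt (nseq \<zeta>) k + P.ddt (mseq \<zeta>) k - smul P (of_nat (Suc k)) (mseq \<zeta> k)"
    by (simp add: P.ddt_def zseq_def P.scale_right_distrib P.scale_right_diff_distrib del: mseq.simps)
  ultimately have "P.ddt (zseq \<zeta>) k = bdiff (qseq \<zeta>) k - mseq \<zeta> k"
    by (cases k) (simp_all del: mseq.simps)
  then show ?thesis unfolding s_curv sum_bdiff by simp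
qed

text \<open>Coefficient \<open>n\<close> of the defect involves the curvature only up to
  \<open>n\<close>, and \<open>ddt_curv\<close> determines coefficient \<open>n + 1\<close> of the
  curvature from coefficients up to \<open>n\<close> of both. So both vanish, starting from the
  Maurer--Cartan equation of \<zeta>.\<close>

lemma curv_zseq:
  assumes MC: "\<zeta> \<in> MC P"
  shows "P.curv (zseq \<zeta>) = 0"
    and "P.ddt (zseq \<zeta>) = dif P.psd 0 (lseq \<zeta>) + brk P.psd (- 1) 0 (zseq \<zeta>) (lseq \<zeta>)"
proof -
  define E where "E = P.ddt (zseq \<zeta>) - (dif P.psd 0 (lseq \<zeta>) + brk P.psd (- 1) 0 (zseq \<zeta>) (lseq \<zeta>))"
  have E: "E k = (\<Sum>i\<le>k. s (- 2) (P.curv (zseq \<zeta>) i))" for k unfolding E_def by (rule flow_defect)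
  have z: "zseq \<zeta> \<in> gr P.psd (- 1)" and l: "lseq \<zeta> \<in> gr P.psd 0" using zseq_gr lseq_gr by simp_all
  note dC = P.ddt_curv[OF z l, folded E_def]
  have C: "P.curv (zseq \<zeta>) k = 0" for k
  proof (induction k rule: less_induct)
    case (less k)
    show ?case
    proof (cases k)
      case 0 then show ?thesis using MC by (simp add: P.curv_def zseq_0 MC_def)
    next
      case (Suc n)
      have 1: "P.curv (zseq \<zeta>) a = 0" if "a \<le> n" for a using less[of a] that Suc by simp
      then have 2: "E a = 0" if "a \<le> n" for a using that by (simp add: E s_zero)
      have "P.ddt (P.curv (zseq \<zeta>)) n = 0"
        unfolding dC by (simp add: 1 2 P.brk_zero_left P.brk_zero_right P.dif_zero zseq_gr lseq_gr)
      then show ?thesis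
        using of_nat_neq_0[of n, where ?'a = 'k] unfolding P.ddt_def Suc by (simp only: P.scale_eq_0_iff simp_thms)
    qed
  qed
  then show "P.curv (zseq \<zeta>) = 0" by (simp add: fun_eq_iff)
  have "E = 0" using C by (simp add: fun_eq_iff E s_zero)
  then show "P.ddt (zseq \<zeta>) = dif P.psd 0 (lseq \<zeta>) + brk P.psd (- 1) 0 (zseq \<zeta>) (lseq \<zeta>)"
    unfolding E_def by simp
qed

text \<open>Evaluation of z - e z = (1 - t) m at t = 1 by partial sums: they telescope to a single
  coefficient of m, whose weight tends to infinity.\<close>

lemma zseq_sum: "(\<Sum>i\<le>k. zseq \<zeta> i) - e (- 1) (\<Sum>i\<le>k. zseq \<zeta> i) = mseq \<zeta> k"
proof -
  have "e (- 1) (\<Sum>i\<le>k. zseq \<zeta> i) = (\<Sum>i\<le>k. e (- 1) (zseq \<zeta> i))"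
    by (induction k) (simp_all add: e_linear P.gr_sum zseq_gr)
  then show ?thesis by (simp add: sum_subtractf[symmetric] zseq_minus_e sum_bdiff)
qed

end

end

section \<open>Convergent series and paths\<close>

context complete_dgla
begin

definition null :: "int \<Rightarrow> (nat \<Rightarrow> 'a) \<Rightarrow> bool"
  where "null n f \<longleftrightarrow> (\<forall>k. f k \<in> gr G n) \<and> (\<forall>U \<in> opens G. finite {k. f k \<notin> U n})"

text \<open>Summing the terms outside \<open>U\<close> follows the form of the sums in
  \<open>tensor_pullback\<close>; \<open>total_partial\<close> relates this to limits of partial
  sums.\<close>

definition total :: "int \<Rightarrow> (nat \<Rightarrow> 'a) \<Rightarrow> 'a \<Rightarrow> bool"
  where "total n f y \<longleftrightarrow> y \<in> gr G n \<and> (\<forall>U \<in> opens G. y - (\<Sum>k \<in> {k. f k \<notin> U n}. f k) \<in> U n)"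

lemma null_gr: "null n f \<Longrightarrow> f k \<in> gr G n" and null_psd: "null n f \<Longrightarrow> f \<in> gr psd n"
  by (simp_all add: null_def)

lemma null_bound:
  assumes "null n f" "U \<in> opens G" obtains N where "\<And>k. N \<le> k \<Longrightarrow> f k \<in> U n"
proof -
  have "finite {k. f k \<notin> U n}" using assms by (simp add: null_def)
  then obtain N where "\<forall>k \<in> {k. f k \<notin> U n}. k < N" using finite_nat_set_iff_bounded by blast
  then have "f k \<in> U n" if "N \<le> k" for k using that by (metis (mono_tags, lifting) linorder_not_less mem_Collect_eq)
  then show ?thesis by (rule that)
qed

lemma nullI:
  assumes "\<And>k. f k \<in> gr G n" "\<And>U. U \<in> opens G \<Longrightarrow> \<exists>N. \<forall>k \<ge> N. f k \<in> U n"
  shows "null n f"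
  unfolding null_def
proof (intro conjI ballI allI)
  fix U assume "U \<in> opens G"
  then obtain N where "\<forall>k \<ge> N. f k \<in> U n" using assms(2) by blast
  then have "{k. f k \<notin> U n} \<subseteq> {..<N}" by (auto simp: not_le[symmetric])
  then show "finite {k. f k \<notin> U n}" by (rule finite_subset) simp
qed (rule assms(1))

lemma sum_near:
  assumes U: "U \<in> opens G" and "finite A" "finite B" "\<And>k. k \<in> A - B \<Longrightarrow> f k \<in> U n" "\<And>k. k \<in> B - A \<Longrightarrow> f k \<in> U n"
  shows "sum f A - sum f B \<in> U n"
proof -
  have "sum f A = sum f (A \<inter> B) + sum f (A - B)" "sum f B = sum f (A \<inter> B) + sum f (B - A)"
    using sum.Int_Diff[of A f B] sum.Int_Diff[of B f A] assms(2,3) by (simp_all add: Int_commute)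
  then have "sum f A - sum f B = sum f (A - B) - sum f (B - A)" by simp
  then show ?thesis using open_simps(6)[OF U, of "A - B" f n] open_simps(6)[OF U, of "B - A" f n] open_simps(3)[OF U] assms(4,5)
    by simp
qed

lemma total_partial:
  assumes f: "null n f"
  shows "total n f y \<longleftrightarrow> y \<in> gr G n \<and> (\<forall>U \<in> opens G. \<exists>N. \<forall>m \<ge> N. y - (\<Sum>k\<le>m. f k) \<in> U n)"
proof -
  have "y - (\<Sum>k \<in> {k. f k \<notin> U n}. f k) \<in> U n \<longleftrightarrow> (\<exists>N. \<forall>m \<ge> N. y - (\<Sum>k\<le>m. f k) \<in> U n)" if U: "U \<in> opens G" for U
  proof -
    obtain N where N: "\<And>k. N \<le> k \<Longrightarrow> f k \<in> U n" using null_bound[OF f U] by blast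
    have d: "(\<Sum>k \<in> {k. f k \<notin> U n}. f k) - (\<Sum>k\<le>m. f k) \<in> U n" if "m \<ge> N" for m
    proof (rule sum_near[OF U])
      show "finite {k. f k \<notin> U n}" using f U by (simp add: null_def)
      show "f k \<in> U n" if "k \<in> {k. f k \<notin> U n} - {..m}" for k using that N[of k] \<open>m \<ge> N\<close> by auto
    qed auto
    have "y - (\<Sum>k \<in> {k. f k \<notin> U n}. f k) \<in> U n \<longleftrightarrow> y - (\<Sum>k\<le>m. f k) \<in> U n" if "m \<ge> N" for m
      using open_simps(2)[OF U _ d[OF that], of "y - (\<Sum>k \<in> {k. f k \<notin> U n}. f k)"]
        open_simps(3)[OF U _ d[OF that], of "y - (\<Sum>k\<le>m. f k)"] by (auto simp: algebra_simps)
    then show ?thesis by (meson nat_le_linear order_refl)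
  qed
  then show ?thesis by (auto simp: total_def)
qed

lemma total_unique:
  assumes "total n f y" "total n f y'"
  shows "y = y'"
proof -
  have "y - y' \<in> U n" if U: "U \<in> opens G" for U
    using assms U open_simps(3)[OF U, of "y - (\<Sum>k \<in> {k. f k \<notin> U n}. f k)" n "y' - (\<Sum>k \<in> {k. f k \<notin> U n}. f k)"]
    by (simp add: total_def)
  then have "y - y' = 0" using assms by (intro separated[of _ n]) (auto simp: total_def gr_diff)
  then show ?thesis by simp
qed

lemma total_exists:
  assumes f: "null n f"
  shows "\<exists>y. total n f y"
proof -
  have "(\<Sum>k \<in> {k. f k \<notin> V n}. f k) - (\<Sum>k \<in> {k. f k \<notin> U n}. f k) \<in> U n"
    if "U \<in> opens G" "V \<in> opens G" "V \<le> U" for U V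
    using f that by (intro sum_near[OF that(1)]) (auto simp: null_def le_fun_def)
  then have "\<exists>y \<in> gr G n. \<forall>U \<in> opens G. y - (\<Sum>k \<in> {k. f k \<notin> U n}. f k) \<in> U n"
    using null_gr[OF f] by (intro complete[of "\<lambda>U. \<Sum>k \<in> {k. f k \<notin> U n}. f k"]) (auto intro: gr_sum)
  then show ?thesis by (auto simp: total_def)
qed

lemma null_add: "null n f \<Longrightarrow> null n g \<Longrightarrow> null n (f + g)"
  by (rule nullI) (auto simp: null_gr gr_add, metis null_bound open_simps(2) le_trans nat_le_linear)

lemma null_smul: "null n f \<Longrightarrow> null n (smul psd c f)"
  by (rule nullI) (auto simp: null_gr gr_smul, metis null_bound open_simps(4))

lemma null_dif: "null n f \<Longrightarrow> null (n - 1) (dif psd n f)"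
  by (rule nullI) (auto simp: null_gr dif_closed, metis null_bound openD(4))

lemma null_brk:
  assumes f: "null m f" and g: "null n g" shows "null (m + n) (brk psd m n f g)"
proof (rule nullI)
  show "brk psd m n f g k \<in> gr G (m + n)" for k using null_gr[OF f] null_gr[OF g] by (auto intro!: gr_sum brk_closed)
  fix U assume U: "U \<in> opens G"
  obtain M where M: "\<And>k. M \<le> k \<Longrightarrow> f k \<in> U m" using null_bound[OF f U] by blast
  obtain N where N: "\<And>k. N \<le> k \<Longrightarrow> g k \<in> U n" using null_bound[OF g U] by blast
  have "brk G m n (f i) (g (k - i)) \<in> U (m + n)" if "k \<ge> M + N" for k i
    using openD(3)[OF U null_gr[OF f] N, of "k - i" i] openD(5)[OF U null_gr[OF g] M, of i "k - i"] that
    by (cases "M \<le> i") auto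
  then show "\<exists>N. \<forall>k \<ge> N. brk psd m n f g k \<in> U (m + n)"
    by (intro exI[of _ "M + N"] allI impI) (simp add: open_simps(6)[OF U])
qed

lemma total_add:
  assumes "null n f" "null n g" "total n f y" "total n g y'"
  shows "total n (f + g) (y + y')"
  unfolding total_partial[OF null_add[OF assms(1,2)]]
proof (intro conjI ballI)
  show "y + y' \<in> gr G n" using assms(3,4) by (simp add: total_def gr_add)
  fix U assume U: "U \<in> opens G"
  obtain M where M: "\<And>m. M \<le> m \<Longrightarrow> y - (\<Sum>k\<le>m. f k) \<in> U n" using assms(3) U unfolding total_partial[OF assms(1)] by blast
  obtain N where N: "\<And>m. N \<le> m \<Longrightarrow> y' - (\<Sum>k\<le>m. g k) \<in> U n" using assms(4) U unfolding total_partial[OF assms(2)] by blast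
  show "\<exists>N. \<forall>m \<ge> N. y + y' - (\<Sum>k\<le>m. (f + g) k) \<in> U n"
  proof (intro exI[of _ "max M N"] allI impI)
    fix m assume "m \<ge> max M N"
    then have "(y - (\<Sum>k\<le>m. f k)) + (y' - (\<Sum>k\<le>m. g k)) \<in> U n" using M N open_simps(2)[OF U] by simp
    then show "y + y' - (\<Sum>k\<le>m. (f + g) k) \<in> U n" by (simp add: sum.distrib algebra_simps)
  qed
qed

lemma total_smul:
  assumes "null n f" "total n f y"
  shows "total n (smul psd c f) (smul G c y)"
  unfolding total_partial[OF null_smul[OF assms(1)]]
proof (intro conjI ballI)
  show "smul G c y \<in> gr G n" using assms(2) by (simp add: total_def gr_smul)
  fix U assume U: "U \<in> opens G"
  obtain N where "\<And>m. N \<le> m \<Longrightarrow> y - (\<Sum>k\<le>m. f k) \<in> U n" using assms(2) U unfolding total_partial[OF assms(1)] by blast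
  then show "\<exists>N. \<forall>m \<ge> N. smul G c y - (\<Sum>k\<le>m. smul psd c f k) \<in> U n"
    using open_simps(4)[OF U] by (intro exI[of _ N]) (simp flip: scale_sum_right scale_right_diff_distrib)
qed

lemma total_dif:
  assumes f: "null n f" "total n f y"
  shows "total (n - 1) (dif psd n f) (dif G n y)"
  unfolding total_partial[OF null_dif[OF assms(1)]]
proof (intro conjI ballI)
  have y: "y \<in> gr G n" using assms(2) by (simp add: total_def)
  then show "dif G n y \<in> gr G (n - 1)" by (rule dif_closed)
  fix U assume U: "U \<in> opens G"
  obtain N where "\<And>m. N \<le> m \<Longrightarrow> y - (\<Sum>k\<le>m. f k) \<in> U n" using assms(2) U unfolding total_partial[OF assms(1)] by blast
  then show "\<exists>N. \<forall>m \<ge> N. dif G n y - (\<Sum>k\<le>m. dif psd n f k) \<in> U (n - 1)"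
    using openD(4)[OF U] null_gr[OF f(1)] by (intro exI[of _ N]) (simp flip: dif_sum dif_diff add: gr_sum y)
qed

text \<open>The Cauchy product converges: for \<open>k \<ge> 2 * N\<close> an index pair of the
  square off the triangle has an index so large that its factor lies in \<open>U\<close>.\<close>

lemma total_brk:
  assumes f: "null m f" "total m f y" and g: "null n g" "total n g y'"
  shows "total (m + n) (brk psd m n f g) (brk G m n y y')"
  unfolding total_partial[OF null_brk[OF f(1) g(1)]]
proof (intro conjI ballI)
  have y: "y \<in> gr G m" "y' \<in> gr G n" using assms by (simp_all add: total_def)
  then show "brk G m n y y' \<in> gr G (m + n)" by (rule brk_closed)
  fix U assume U: "U \<in> opens G"
  note fg = null_gr[OF f(1)] null_gr[OF g(1)]
  obtain N1 where N1: "\<And>k. N1 \<le> k \<Longrightarrow> f k \<in> U m" using null_bound[OF f(1) U] by blast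
  obtain N2 where N2: "\<And>k. N2 \<le> k \<Longrightarrow> g k \<in> U n" using null_bound[OF g(1) U] by blast
  obtain N3 where N3: "\<And>k. N3 \<le> k \<Longrightarrow> y - (\<Sum>i\<le>k. f i) \<in> U m" using f(2) U unfolding total_partial[OF f(1)] by blast
  obtain N4 where N4: "\<And>k. N4 \<le> k \<Longrightarrow> y' - (\<Sum>i\<le>k. g i) \<in> U n" using g(2) U unfolding total_partial[OF g(1)] by blast
  define N where "N = max (max N1 N2) (max N3 N4)"
  let ?B = "\<lambda>i j. brk G m n (f i) (g j)"
  show "\<exists>N. \<forall>k \<ge> N. brk G m n y y' - (\<Sum>p\<le>k. brk psd m n f g p) \<in> U (m + n)"
  proof (intro exI[of _ "2 * N"] allI impI)
    fix k assume k: "k \<ge> 2 * N"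
    let ?f = "\<Sum>i\<le>k. f i" let ?g = "\<Sum>i\<le>k. g i"
    have s: "?f \<in> gr G m" "?g \<in> gr G n" using fg by (auto intro: gr_sum)
    have kN: "k \<ge> N3" "k \<ge> N4" using k by (auto simp: N_def)
    have "brk G m n y y' - brk G m n ?f ?g = brk G m n (y - ?f) y' + brk G m n ?f (y' - ?g)"
      using y s by (simp add: brk_diff_left brk_diff_right)
    also have "\<dots> \<in> U (m + n)"
      by (intro open_simps(2)[OF U] openD(5)[OF U y(2) N3] openD(3)[OF U s(1) N4] kN)
    finally have 1: "brk G m n y y' - brk G m n ?f ?g \<in> U (m + n)" .
    have "brk G m n ?f ?g = (\<Sum>i\<le>k. \<Sum>j\<le>k. ?B i j)" using fg s by (simp add: brk_sum_left[OF fg(1) s(2)] brk_sum_right)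
    also have "\<dots> = (\<Sum>(i, j) \<in> {..k} \<times> {..k}. ?B i j)" by (simp add: sum.cartesian_product)
    finally have 2: "brk G m n ?f ?g = (\<Sum>(i, j) \<in> {..k} \<times> {..k}. ?B i j)" .
    have "(\<Sum>p\<le>k. brk psd m n f g p) = (\<Sum>(p, i) \<in> (SIGMA p:{..k}. {..p}). ?B i (p - i))"
      by (simp add: sum.Sigma)
    also have "\<dots> = (\<Sum>(i, j) \<in> {(i, j). i + j \<le> k}. ?B i j)"
      by (rule sum.reindex_bij_witness[of _ "\<lambda>(i, j). (i + j, i)" "\<lambda>(p, i). (i, p - i)"]) auto
    finally have 3: "(\<Sum>p\<le>k. brk psd m n f g p) = (\<Sum>(i, j) \<in> {(i, j). i + j \<le> k}. ?B i j)" .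
    have d: "(\<Sum>(i, j) \<in> {..k} \<times> {..k}. ?B i j) - (\<Sum>(i, j) \<in> {(i, j). i + j \<le> k}. ?B i j) \<in> U (m + n)"
    proof (rule sum_near[OF U], goal_cases)
      case 2
      have "{(i, j). i + j \<le> k} \<subseteq> {..k} \<times> {..k}" by auto
      then show ?case by (rule finite_subset) simp
    next
      case (3 p)
      then obtain i j where p: "p = (i, j)" and ij: "i + j > k" by (cases p) auto
      have "N1 \<le> i \<or> N2 \<le> j" using ij k by (auto simp: N_def)
      then show ?case using openD(5)[OF U fg(2) N1, of i j] openD(3)[OF U fg(1) N2, of j i] by (auto simp: p)
    qed auto
    show "brk G m n y y' - (\<Sum>p\<le>k. brk psd m n f g p) \<in> U (m + n)"
      using open_simps(2)[OF U 1[unfolded 2] d] unfolding 3 by (simp only: diff_add_eq add_diff_eq diff_add_cancel add_diff_cancel_right')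
  qed
qed

lemma total_curv:
  assumes "null (- 1) z" "total (- 1) z y"
  shows "total (- 2) (curv z) (dif G (- 1) y + smul G (1 / 2) (brk G (- 1) (- 1) y y))"
  unfolding curv_def
  using null_dif[of "- 1" z] null_brk[of "- 1" z "- 1" z] total_dif[of "- 1" z y] total_brk[of "- 1" z y "- 1" z y] assms
  by (intro total_add total_smul null_smul) simp_all

text \<open>The existence of a \<open>1\<close>-simplex \<open>z(t) + l(t) dt\<close> with vertices \<open>z(0) = a\<close> and \<open>z(1) = b\<close>.\<close>

definition mcpath :: "'a \<Rightarrow> 'a \<Rightarrow> bool"
  where "mcpath a b \<longleftrightarrow> (\<exists>z l. null (- 1) z \<and> null 0 l \<and> curv z = 0 \<and>
    ddt z = dif psd 0 l + brk psd (- 1) 0 z l \<and> z 0 = a \<and> total (- 1) z b)"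

lemma mcpath_MC:
  assumes "mcpath a b" shows "a \<in> MC G" "b \<in> MC G"
proof -
  obtain z l where z: "null (- 1) z" "curv z = 0" "z 0 = a" "total (- 1) z b" using assms by (auto simp: mcpath_def)
  have "curv z 0 = 0" using z(2) by simp
  then show "a \<in> MC G" using z(3) null_gr[OF z(1), of 0] by (simp add: curv_def MC_def)
  have "total (- 2) (\<lambda>k. 0) 0" using open_simps(1) by (auto simp: total_def gr_zero)
  moreover have "total (- 2) (\<lambda>k. 0) (dif G (- 1) b + smul G (1 / 2) (brk G (- 1) (- 1) b b))"
    using total_curv[OF z(1,4)] unfolding z(2) zero_fun_def .
  ultimately have "dif G (- 1) b + smul G (1 / 2) (brk G (- 1) (- 1) b b) = 0" using total_unique by blast
  then show "b \<in> MC G" using z(4) by (simp add: MC_def total_def)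
qed

end

lemma mcpath_cont:
  assumes G: "complete_dgla G" and H: "complete_dgla H" and f: "cont_map G H f" and p: "complete_dgla.mcpath G a b"
  shows "complete_dgla.mcpath H (f (- 1) a) (f (- 1) b)"
proof -
  interpret G: complete_dgla G by fact
  interpret H: complete_dgla H by fact
  note fD = cont_mapD[OF f] cont_map_diff[OF G.dgla_axioms f]
  obtain z l where z: "G.null (- 1) z" and l: "G.null 0 l" and c: "G.curv z = 0"
    and e: "G.ddt z = dif G.psd 0 l + brk G.psd (- 1) 0 z l" and z0: "z 0 = a" and t: "G.total (- 1) z b"
    using p by (auto simp: G.mcpath_def)
  have nf: "H.null n (\<lambda>k. f n (u k))" if u: "G.null n u" for n u
  proof (rule H.nullI)
    show "f n (u k) \<in> gr H n" for k using fD(1) G.null_gr[OF u] by blast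
    fix V assume "V \<in> opens H"
    then obtain U where U: "U \<in> opens G" "\<And>n. f n ` U n \<subseteq> V n" using fD(6) by blast
    then show "\<exists>N. \<forall>k \<ge> N. f n (u k) \<in> V n" using G.null_bound[OF u U(1)] by (metis image_subset_iff)
  qed
  have fs: "f n (sum u A) = (\<Sum>k \<in> A. f n (u k))" if "\<And>k. u k \<in> gr G n" for n and A :: "nat set" and u
    using that by (induction A rule: infinite_finite_induct) (simp_all add: cont_map_0[OF G.dgla_axioms H.dgla_axioms f] fD(2) G.gr_sum)
  have b: "b \<in> gr G (- 1)" using t by (simp add: G.total_def)
  have t': "H.total (- 1) (\<lambda>k. f (- 1) (z k)) (f (- 1) b)"
    unfolding H.total_partial[OF nf[OF z]]
  proof (intro conjI ballI)
    show "f (- 1) b \<in> gr H (- 1)" using fD(1) b .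
    fix V assume "V \<in> opens H"
    then obtain U where U: "U \<in> opens G" "\<And>n. f n ` U n \<subseteq> V n" using fD(6) by blast
    obtain N where "\<And>m. m \<ge> N \<Longrightarrow> b - (\<Sum>k\<le>m. z k) \<in> U (- 1)" using t U(1) unfolding G.total_partial[OF z] by blast
    then have "f (- 1) (b - (\<Sum>k\<le>m. z k)) \<in> V (- 1)" if "m \<ge> N" for m using that U(2) by (metis image_subset_iff)
    then show "\<exists>N. \<forall>m \<ge> N. f (- 1) b - (\<Sum>k\<le>m. f (- 1) (z k)) \<in> V (- 1)"
      using G.null_gr[OF z] by (intro exI[of _ N]) (simp add: fD(7) b G.gr_sum fs)
  qed
  note zg = G.null_gr[OF z] and lg = G.null_gr[OF l]
  have bg: "brk G (- 1) (- 1) (z i) (z k) \<in> gr G (- 2)" "brk G (- 1) 0 (z i) (l k) \<in> gr G (- 1)"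
    "dif G (- 1) (z i) \<in> gr G (- 2)" "dif G 0 (l i) \<in> gr G (- 1)" for i k
    using G.brk_closed[OF zg zg] G.brk_closed[OF zg lg] G.dif_closed[OF zg] G.dif_closed[OF lg] by simp_all
  have fb: "f (- 2) (brk G (- 1) (- 1) (z i) (z k)) = brk H (- 1) (- 1) (f (- 1) (z i)) (f (- 1) (z k))"
    "f (- 1) (brk G (- 1) 0 (z i) (l k)) = brk H (- 1) 0 (f (- 1) (z i)) (f 0 (l k))"
    "f (- 2) (dif G (- 1) (z i)) = dif H (- 1) (f (- 1) (z i))" "f (- 1) (dif G 0 (l i)) = dif H 0 (f 0 (l i))" for i k
    using fD(4)[OF zg zg] fD(4)[OF zg lg] fD(5)[OF zg] fD(5)[OF lg] by simp_all
  have "H.curv (\<lambda>k. f (- 1) (z k)) k = f (- 2) (G.curv z k)" for k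
    by (simp add: H.curv_def G.curv_def fD(2,3) bg G.gr_sum G.gr_smul fb fs)
  then have c': "H.curv (\<lambda>k. f (- 1) (z k)) = 0"
    unfolding c by (simp add: fun_eq_iff cont_map_0[OF G.dgla_axioms H.dgla_axioms f])
  have "H.ddt (\<lambda>k. f (- 1) (z k)) k = f (- 1) (G.ddt z k)" for k
    by (simp add: H.ddt_def G.ddt_def fD(3) zg)
  then have e': "H.ddt (\<lambda>k. f (- 1) (z k)) = dif H.psd 0 (\<lambda>k. f 0 (l k)) + brk H.psd (- 1) 0 (\<lambda>k. f (- 1) (z k)) (\<lambda>k. f 0 (l k))"
    unfolding e by (simp add: fun_eq_iff fD(2) bg G.gr_sum fb fs)
  show ?thesis
    unfolding H.mcpath_def using nf[OF z] nf[OF l] c' e' z0 t' by blast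
qed

text \<open>Subtract the constant series \<xi> from z and keep l: the curvature in the twisted dgla
  equals the original one, and the two flow equations agree.\<close>

lemma mcpath_twist:
  assumes G: "complete_dgla G" and \<xi>: "\<xi> \<in> MC G" and p: "complete_dgla.mcpath G a b"
  shows "complete_dgla.mcpath (twist G \<xi>) (a - \<xi>) (b - \<xi>)"
proof -
  interpret G: complete_dgla G by fact
  interpret T: complete_dgla "twist G \<xi>" by (rule G.complete_dgla_twist[OF \<xi>])
  interpret D: dgla G.psd by (rule G.dgla_psd)
  obtain z l where z: "G.null (- 1) z" and l: "G.null 0 l" and c: "G.curv z = 0"
    and e: "G.ddt z = dif G.psd 0 l + brk G.psd (- 1) 0 z l" and z0: "z 0 = a" and t: "G.total (- 1) z b"
    using p by (auto simp: G.mcpath_def)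
  define k where "k n = (if n = 0 then \<xi> else 0)" for n :: nat
  note x = G.MC_dif(1)[OF \<xi>]
  note zg = G.null_psd[OF z] and lg = G.null_psd[OF l]
  have kg: "k \<in> gr G.psd (- 1)" using x by (simp add: k_def G.gr_zero)
  have kb: "brk G.psd (- 1) n k u = (\<lambda>i. brk G (- 1) n \<xi> (u i))" if "u \<in> gr G.psd n" for n u
  proof
    fix m
    have "(\<Sum>i\<le>m. brk G (- 1) n (k i) (u (m - i))) = (\<Sum>i\<le>m. if i = 0 then brk G (- 1) n \<xi> (u m) else 0)"
      using that by (intro sum.cong refl) (simp add: k_def G.brk_zero_left)
    then show "brk G.psd (- 1) n k u m = brk G (- 1) n \<xi> (u m)" by simp
  qed
  have Tp: "smul T.psd = smul G.psd" "gr T.psd = gr G.psd" "brk T.psd = brk G.psd"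
    by (simp_all add: T.psd_def G.psd_def)
  have Td: "dif T.psd n u = dif G.psd n u + brk G.psd (- 1) n k u" if "u \<in> gr G.psd n" for n u
    by (simp add: kb[OF that] fun_eq_iff)
  have null: "T.null n u = G.null n u" "T.total n u y = G.total n u y" for n u y
    by (simp_all add: T.null_def G.null_def T.total_def G.total_def)
  have kMC: "dif G.psd (- 1) k = - smul G.psd (1 / 2) (brk G.psd (- 1) (- 1) k k)"
    using G.MC_dif(2)[OF \<xi>] unfolding kb[OF kg] by (auto simp: fun_eq_iff k_def G.dif_zero G.brk_zero_right x)
  have nk: "G.null (- 1) (smul G.psd (- 1) k)"
    by (rule G.nullI) (use x G.open_simps(1) in \<open>auto simp: k_def G.gr_uminus G.gr_zero intro!: exI[of _ 1]\<close>)
  have zk: "z - k = z + smul G.psd (- 1) k" by (simp add: fun_eq_iff)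
  have nz: "G.null (- 1) (z - k)" unfolding zk by (rule G.null_add[OF z nk])
  have "G.total (- 1) (smul G.psd (- 1) k) (- \<xi>)"
    unfolding G.total_partial[OF nk]
  proof (intro conjI ballI exI[of _ 0] allI impI)
    show "- \<xi> \<in> gr G (- 1)" using x by (rule G.gr_uminus)
    fix U and m :: nat assume U: "U \<in> opens G"
    have "(\<Sum>i\<le>m. smul G.psd (- 1) k i) = (\<Sum>i\<le>m. if i = 0 then - \<xi> else 0)" by (intro sum.cong refl) (simp add: k_def)
    then show "- \<xi> - (\<Sum>i\<le>m. smul G.psd (- 1) k i) \<in> U (- 1)" using G.open_simps(1)[OF U] by simp
  qed
  from G.total_add[OF z nk t this] have tz: "G.total (- 1) (z - k) (b - \<xi>)" unfolding zk by simp
  have zkg: "z - k \<in> gr G.psd (- 1)" by (rule D.gr_diff[OF zg kg])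
  have sym: "brk G.psd (- 1) (- 1) k z = brk G.psd (- 1) (- 1) z k"
    using D.brk_antisym[OF kg zg] by (simp add: ksign_def)
  have c': "T.curv (z - k) = 0"
  proof -
    have "T.curv (z - k) = G.curv z"
      unfolding T.curv_def G.curv_def Td[OF zkg] Tp D.dif_diff[OF zg kg] kMC D.brk_diff_left[OF zg kg zkg]
        D.brk_diff_right[OF kg zg kg] D.brk_diff_right[OF zg zg kg] sym
      by (rule ext) (simp add: G.scale_right_distrib G.scale_right_diff_distrib G.smul_half algebra_simps)
    then show ?thesis using c by simp
  qed
  have "T.ddt (z - k) = G.ddt z" by (simp add: fun_eq_iff T.ddt_def G.ddt_def k_def)
  then have e': "T.ddt (z - k) = dif T.psd 0 l + brk T.psd (- 1) 0 (z - k) l"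
    unfolding e Td[OF lg] Tp D.brk_diff_left[OF zg kg lg] by simp
  show ?thesis
    unfolding T.mcpath_def null
    by (rule exI[of _ "z - k"], rule exI[of _ l]) (use nz l c' e' tz z0 in \<open>simp add: k_def\<close>)
qed

section \<open>Forms on the interval\<close>

abbreviation t1 :: "nat \<Rightarrow> nat \<Rightarrow>\<^sub>0 nat" where "t1 k \<equiv> Poly_Mapping.single (Suc 0) k"

lemma forms_basis_0: "forms_basis 0 = {(0, {})}"
  by (auto simp: forms_basis_def)

lemma forms_basis_1: "b \<in> forms_basis (Suc 0) \<longleftrightarrow> (\<exists>k. b = (t1 k, {}) \<or> b = (t1 k, {Suc 0}))"
proof -
  obtain e S where b: "b = (e, S)" by force
  have "e = t1 (Poly_Mapping.lookup e (Suc 0))" if "Poly_Mapping.keys e \<subseteq> {Suc 0}"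
    using that by (intro poly_mapping_eqI) (auto simp: lookup_single when_def in_keys_iff)
  then have "Poly_Mapping.keys e \<subseteq> {Suc 0} \<longleftrightarrow> (\<exists>k. e = t1 k)" by (metis empty_subsetI keys_single subset_refl)
  moreover have "S \<subseteq> {Suc 0} \<longleftrightarrow> S = {} \<or> S = {Suc 0}" by (rule subset_singleton_iff)
  ultimately show ?thesis by (auto simp: b forms_basis_def)
qed

lemma forms_basis_1' [simp]: "(t1 k, {}) \<in> forms_basis (Suc 0)" "(t1 k, {Suc 0}) \<in> forms_basis (Suc 0)"
  by (auto simp: forms_basis_1)

lemma forms_basis_1_all:
  "(\<forall>b \<in> forms_basis (Suc 0). R b) \<longleftrightarrow> (\<forall>k. R (t1 k, {})) \<and> (\<forall>k. R (t1 k, {Suc 0}))"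
  unfolding Ball_def forms_basis_1 by blast

lemma t1_inj [simp]: "t1 j = t1 k \<longleftrightarrow> j = k"
  by (metis lookup_single_eq)

lemma wedge_sign_simps [simp]: "wedge_sign {} S = 1" "wedge_sign S {} = 1" "wedge_sign {Suc 0} {Suc 0} = 0"
  by (simp_all add: wedge_sign_def)

lemma wedge_basis:
  "wedge (basis_form a) (basis_form c :: 'k::{comm_ring_1} form) =
    Poly_Mapping.single (fst a + fst c, snd a \<union> snd c) (wedge_sign (snd a) (snd c))"
  by (simp add: wedge_def)

lemma form_d_t1:
  "form_d (basis_form (t1 k, S) :: 'k::comm_ring_1 form) =
    Poly_Mapping.single (t1 (k - 1), insert (Suc 0) S) (of_nat k * wedge_sign {Suc 0} S)"
  by (cases "k = 0") (simp_all add: form_d_def single_diff[symmetric])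

lemma t1_add: "t1 i + t1 j = t1 (i + j)" by (simp add: single_add)

text \<open>The pairs of basis forms contributing to a given basis form, parametrized by the
  exponent of one factor; this turns the sums in \<open>tensor_forms\<close> into
  convolutions.\<close>

lemma wedge_pairs_0:
  "{(a, c). a \<in> forms_basis (Suc 0) \<and> c \<in> forms_basis (Suc 0) \<and>
      Poly_Mapping.lookup (wedge (basis_form a) (basis_form c)) (t1 k, {}) \<noteq> (0 :: 'k::field)} =
    (\<lambda>i. ((t1 i, {}), (t1 (k - i), {}))) ` {..k}"
  by (force simp: wedge_basis lookup_single when_def forms_basis_1 t1_add image_iff split: if_splits)

lemma wedge_pairs_1:
  "{(a, c). a \<in> forms_basis (Suc 0) \<and> c \<in> forms_basis (Suc 0) \<and>
      Poly_Mapping.lookup (wedge (basis_form a) (basis_form c)) (t1 k, {Suc 0}) \<noteq> (0 :: 'k::field)} =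
    (\<lambda>i. ((t1 i, {}), (t1 (k - i), {Suc 0}))) ` {..k} \<union> (\<lambda>i. ((t1 i, {Suc 0}), (t1 (k - i), {}))) ` {..k}"
  by (force simp: wedge_basis lookup_single when_def forms_basis_1 t1_add image_iff split: if_splits)

lemma form_d_0: "{a \<in> forms_basis (Suc 0). Poly_Mapping.lookup (form_d (basis_form a)) (t1 k, {}) \<noteq> (0 :: 'k::field)} = {}"
  by (auto simp: forms_basis_1 form_d_t1 lookup_single when_def)

lemma form_d_1:
  "{a \<in> forms_basis (Suc 0). Poly_Mapping.lookup (form_d (basis_form a)) (t1 k, {Suc 0}) \<noteq> (0 :: 'k::field_char_0)} = {(t1 (Suc k), {})}"
proof -
  have 1: "Poly_Mapping.lookup (form_d (basis_form (t1 m, {}))) (t1 k, {Suc 0}) \<noteq> (0 :: 'k) \<longleftrightarrow> m = Suc k" for m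
    unfolding form_d_t1 by (cases m) (auto simp: lookup_single when_def simp del: of_nat_Suc)
  have 2: "Poly_Mapping.lookup (form_d (basis_form (t1 m, {Suc 0}))) (t1 k, {Suc 0}) = (0 :: 'k)" for m
    by (simp add: form_d_t1)
  show ?thesis
  proof (intro set_eqI)
    fix a
    show "a \<in> {a \<in> forms_basis (Suc 0). Poly_Mapping.lookup (form_d (basis_form a)) (t1 k, {Suc 0}) \<noteq> (0 :: 'k)} \<longleftrightarrow>
      a \<in> {(t1 (Suc k), {})}"
      unfolding mem_Collect_eq forms_basis_1 singleton_iff using 1 2 by metis
  qed
qed

lemma form_d_outside:
  assumes "b \<notin> forms_basis (Suc 0)"
  shows "{a \<in> forms_basis (Suc 0). Poly_Mapping.lookup (form_d (basis_form a)) b \<noteq> (0 :: 'k::field)} = {}"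
    "{(a, c). a \<in> forms_basis (Suc 0) \<and> c \<in> forms_basis (Suc 0) \<and>
      Poly_Mapping.lookup (wedge (basis_form a) (basis_form c)) b \<noteq> (0 :: 'k)} = {}"
  using assms by (auto simp: forms_basis_1 form_d_t1 wedge_basis t1_add lookup_single when_def split: if_splits)

abbreviation fpart :: "(form_basis \<Rightarrow> 'a) \<Rightarrow> nat \<Rightarrow> 'a" where "fpart \<phi> k \<equiv> \<phi> (t1 k, {})"
abbreviation dpart :: "(form_basis \<Rightarrow> 'a) \<Rightarrow> nat \<Rightarrow> 'a" where "dpart \<phi> k \<equiv> \<phi> (t1 k, {Suc 0})"

context
  fixes G :: "('k::field_char_0, 'a::ab_group_add) cdgla_data"
  assumes G: "complete_dgla G"
begin

interpretation G: complete_dgla G by (rule G)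

text \<open>In z(t) + l(t) dt, finite support modulo every open ideal is convergence to 0 of both
  coefficient sequences.\<close>

lemma gr_forms_1:
  "\<phi> \<in> gr (tensor_forms G (Suc 0)) (- 1) \<longleftrightarrow>
    (\<forall>b. b \<notin> forms_basis (Suc 0) \<longrightarrow> \<phi> b = 0) \<and> G.null (- 1) (fpart \<phi>) \<and> G.null 0 (dpart \<phi>)"
proof -
  have "{b \<in> forms_basis (Suc 0). \<phi> b \<notin> U (- 1 + form_deg b)} =
    (\<lambda>k. (t1 k, {})) ` {k. fpart \<phi> k \<notin> U (- 1)} \<union> (\<lambda>k. (t1 k, {Suc 0})) ` {k. dpart \<phi> k \<notin> U 0}" for U :: "int \<Rightarrow> 'a set"
    by (auto simp: forms_basis_1)
  moreover have "inj_on (\<lambda>k. (t1 k, {} :: nat set)) A" "inj_on (\<lambda>k. (t1 k, {Suc 0})) A" for A by (auto simp: inj_on_def)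
  ultimately have "finite {b \<in> forms_basis (Suc 0). \<phi> b \<notin> U (- 1 + form_deg b)} \<longleftrightarrow>
    finite {k. fpart \<phi> k \<notin> U (- 1)} \<and> finite {k. dpart \<phi> k \<notin> U 0}" for U :: "int \<Rightarrow> 'a set"
    by (simp add: finite_image_iff)
  moreover have "(\<forall>b \<in> forms_basis (Suc 0). \<phi> b \<in> gr G (- 1 + form_deg b)) \<longleftrightarrow> (\<forall>k. fpart \<phi> k \<in> gr G (- 1)) \<and> (\<forall>k. dpart \<phi> k \<in> gr G 0)"
    unfolding forms_basis_1_all by simp
  ultimately show ?thesis by (auto simp: tensor_forms_def G.null_def)
qed

text \<open>For z(t) + l(t) dt the part without dt of the Maurer--Cartan expression is the curvature
  of z, and the dt part is d l + [z, l] - z'.\<close>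

lemma MC_forms_1:
  "\<phi> \<in> MC (tensor_forms G (Suc 0)) \<longleftrightarrow>
    (\<forall>b. b \<notin> forms_basis (Suc 0) \<longrightarrow> \<phi> b = 0) \<and> G.null (- 1) (fpart \<phi>) \<and> G.null 0 (dpart \<phi>) \<and>
    G.curv (fpart \<phi>) = 0 \<and> G.ddt (fpart \<phi>) = dif G.psd 0 (dpart \<phi>) + brk G.psd (- 1) 0 (fpart \<phi>) (dpart \<phi>)"
proof (cases "\<phi> \<in> gr (tensor_forms G (Suc 0)) (- 1)")
  case True
  let ?z = "fpart \<phi>" and ?l = "dpart \<phi>"
  let ?E = "dif (tensor_forms G (Suc 0)) (- 1) \<phi> +
    smul (tensor_forms G (Suc 0)) (1 / 2) (brk (tensor_forms G (Suc 0)) (- 1) (- 1) \<phi> \<phi>)"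
  have z: "?z k \<in> gr G (- 1)" and l: "?l k \<in> gr G 0" for k using True by (auto simp: gr_forms_1 G.null_def)
  have inj: "inj_on (\<lambda>i. ((t1 i, {} :: nat set), (t1 (k - i), S :: nat set))) {..k}" 
    "inj_on (\<lambda>i. ((t1 i, {Suc 0}), (t1 (k - i), S :: nat set))) {..k}" for k S
    by (auto simp: inj_on_def)
  have brk: "brk (tensor_forms G (Suc 0)) M N \<phi> \<psi> b =
      (\<Sum>(a, c) \<in> {(a, c). a \<in> forms_basis (Suc 0) \<and> c \<in> forms_basis (Suc 0) \<and>
          Poly_Mapping.lookup (wedge (basis_form a) (basis_form c)) b \<noteq> (0 :: 'k)}.
        smul G (ksign (form_deg a * (N + form_deg c)) * Poly_Mapping.lookup (wedge (basis_form a) (basis_form c)) b)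
          (brk G (M + form_deg a) (N + form_deg c) (\<phi> a) (\<psi> c)))" for M N \<phi> \<psi> b
    unfolding tensor_forms_def by (simp only: dgla_data.select_convs)
  have b0: "brk (tensor_forms G (Suc 0)) (- 1) (- 1) \<phi> \<phi> (t1 k, {}) = (\<Sum>i\<le>k. brk G (- 1) (- 1) (?z i) (?z (k - i)))" for k
    unfolding brk wedge_pairs_0 sum.reindex[OF inj(1)] by (simp add: wedge_basis t1_add lookup_single ksign_def)
  have "brk (tensor_forms G (Suc 0)) (- 1) (- 1) \<phi> \<phi> (t1 k, {Suc 0}) =
      (\<Sum>i\<le>k. brk G (- 1) 0 (?z i) (?l (k - i))) + (\<Sum>i\<le>k. - brk G 0 (- 1) (?l i) (?z (k - i)))" for k
    unfolding brk wedge_pairs_1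
    by (subst sum.union_disjoint)
      (auto simp: sum.reindex[OF inj(1)] sum.reindex[OF inj(2)] wedge_basis t1_add lookup_single ksign_def)
  \<comment> \<open>Both mixed brackets contribute [z, l], which makes up for the factor
    1/2.\<close>
  moreover have "- brk G 0 (- 1) (?l i) (?z j) = brk G (- 1) 0 (?z j) (?l i)" for i j
    using G.brk_antisym[OF l z, of i j] by (simp add: ksign_def)
  ultimately have b1: "brk (tensor_forms G (Suc 0)) (- 1) (- 1) \<phi> \<phi> (t1 k, {Suc 0}) =
      (\<Sum>i\<le>k. brk G (- 1) 0 (?z i) (?l (k - i))) + (\<Sum>i\<le>k. brk G (- 1) 0 (?z i) (?l (k - i)))" for k
    by (simp add: sum_diff_reindex[of "\<lambda>i j. brk G (- 1) 0 (?z j) (?l i)"])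
  have d0: "dif (tensor_forms G (Suc 0)) (- 1) \<phi> (t1 k, {}) = dif G (- 1) (?z k)" for k
    by (simp add: tensor_forms_def form_d_0)
  have d1: "dif (tensor_forms G (Suc 0)) (- 1) \<phi> (t1 k, {Suc 0}) = dif G 0 (?l k) - smul G (of_nat (Suc k)) (?z (Suc k))" for k
    unfolding tensor_forms_def by (simp add: form_d_1 form_d_t1 ksign_def del: of_nat_Suc) simp
  have sm: "smul (tensor_forms G (Suc 0)) c \<psi> b = smul G c (\<psi> b)" for c \<psi> b by (simp add: tensor_forms_def)
  have 0: "?E (t1 k, {}) = G.curv ?z k" for k
    by (simp add: sm b0 d0 G.curv_def)
  have 1: "?E (t1 k, {Suc 0}) = (dif G.psd 0 ?l + brk G.psd (- 1) 0 ?z ?l) k - G.ddt ?z k" for k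
    by (simp add: sm b1 d1 G.ddt_def G.scale_right_distrib G.smul_half)
  have out: "?E b = 0" if "b \<notin> forms_basis (Suc 0)" for b
    using that unfolding plus_fun_apply sm by (simp add: tensor_forms_def form_d_outside)
  have "?E = 0 \<longleftrightarrow> (\<forall>b \<in> forms_basis (Suc 0). ?E b = 0)"
    using out unfolding fun_eq_iff by (metis zero_fun_apply)
  also have "\<dots> \<longleftrightarrow> (\<forall>k. ?E (t1 k, {}) = 0) \<and> (\<forall>k. ?E (t1 k, {Suc 0}) = 0)"
    by (rule forms_basis_1_all)
  also have "\<dots> \<longleftrightarrow> G.curv ?z = 0 \<and> G.ddt ?z = dif G.psd 0 ?l + brk G.psd (- 1) 0 ?z ?l"
    unfolding 0 1 fun_eq_iff[of "G.curv ?z"] fun_eq_iff[of "G.ddt ?z"] by (auto simp del: plus_fun_apply)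
  finally show ?thesis using True gr_forms_1[of \<phi>] by (simp add: MC_def)
next
  case False
  then show ?thesis unfolding MC_def using gr_forms_1[of \<phi>] by blast
qed

lemma MC_forms_0:
  "\<phi> \<in> MC (tensor_forms G 0) \<longleftrightarrow> (\<forall>b. b \<noteq> (0, {}) \<longrightarrow> \<phi> b = 0) \<and> \<phi> (0, {}) \<in> MC G"
proof -
  let ?T = "tensor_forms G 0"
  let ?E = "dif ?T (- 1) \<phi> + smul ?T (1 / 2) (brk ?T (- 1) (- 1) \<phi> \<phi>)"
  have gr: "\<phi> \<in> gr ?T (- 1) \<longleftrightarrow> (\<forall>b. b \<noteq> (0, {}) \<longrightarrow> \<phi> b = 0) \<and> \<phi> (0, {}) \<in> gr G (- 1)"
    by (auto simp: tensor_forms_def forms_basis_0)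
  have w: "wedge (basis_form (0, {})) (basis_form (0, {})) = (basis_form (0, {}) :: 'k form)" by (simp add: wedge_basis)
  have p: "{(a, c). a = (0, {}) \<and> c = (0, {}) \<and> Poly_Mapping.lookup (wedge (basis_form a) (basis_form c)) b \<noteq> (0 :: 'k)} =
    (if b = (0, {}) then {((0, {}), (0, {}))} else {})" for b
    by (auto simp: w lookup_single when_def)
  have d: "form_d (basis_form (0, {})) = (0 :: 'k form)" by (simp add: form_d_def)
  have "{a. a = (0, {}) \<and> Poly_Mapping.lookup (form_d (basis_form a)) b \<noteq> (0 :: 'k)} = {}" for b by (auto simp: d)
  then have E: "?E b = (if b = (0, {}) then dif G (- 1) (\<phi> b) + smul G (1 / 2) (brk G (- 1) (- 1) (\<phi> b) (\<phi> b)) else 0)" for b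
    by (simp add: tensor_forms_def forms_basis_0 p w ksign_def)
  have "?E = 0 \<longleftrightarrow> (\<forall>b. ?E b = 0)" unfolding fun_eq_iff by (metis zero_fun_apply)
  then have "?E = 0 \<longleftrightarrow> dif G (- 1) (\<phi> (0, {})) + smul G (1 / 2) (brk G (- 1) (- 1) (\<phi> (0, {})) (\<phi> (0, {}))) = 0"
    unfolding E by auto
  then show ?thesis by (auto simp: MC_def gr)
qed

lemma wedge_zero: "wedge 0 \<omega> = 0" by (simp add: wedge_def)

lemma wedge_one: "wedge form_one form_one = form_one" by (simp add: form_one_def wedge_basis)

lemma pullback_bary: "bary_pullback 0 (coface (Suc 0)) (Suc 0) = 0" "bary_pullback 0 (coface 0) (Suc 0) = form_one"
  by (simp_all add: bary_pullback_def coface_def bary_def Collect_conv_if)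

text \<open>\<open>coface (Suc 0)\<close> picks the vertex t = 0, where only the constant monomial
  survives, and \<open>coface 0\<close> the vertex t = 1; dt restricts to 0.\<close>

lemma form_pullback_0:
  "form_pullback 0 (Suc 0) (coface (Suc 0)) (t1 k, {}) = (if k = 0 then form_one else (0 :: 'k form))"
  "form_pullback 0 (Suc 0) (coface (Suc 0)) (t1 k, {Suc 0}) = (0 :: 'k form)"
  "form_pullback 0 (Suc 0) (coface 0) (t1 k, {}) = (form_one :: 'k form)"
  "form_pullback 0 (Suc 0) (coface 0) (t1 k, {Suc 0}) = (0 :: 'k form)"
proof -
  have d: "form_d form_one = (0 :: 'k form)" "form_d 0 = (0 :: 'k form)" by (simp_all add: form_d_def form_one_def)
  have z: "wedge \<omega> 0 = (0 :: 'k form)" for \<omega> by (simp add: wedge_def)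
  have r: "(wedge form_one ^^ k) form_one = (form_one :: 'k form)"
    "(wedge \<omega> ^^ k) 0 = (0 :: 'k form)" "(wedge 0 ^^ k) \<omega> = (if k = 0 then \<omega> else (0 :: 'k form))" for k \<omega>
    by (induction k) (simp_all add: wedge_one z wedge_zero)
  show "form_pullback 0 (Suc 0) (coface (Suc 0)) (t1 k, {}) = (if k = 0 then form_one else (0 :: 'k form))"
    "form_pullback 0 (Suc 0) (coface (Suc 0)) (t1 k, {Suc 0}) = (0 :: 'k form)"
    "form_pullback 0 (Suc 0) (coface 0) (t1 k, {}) = (form_one :: 'k form)"
    "form_pullback 0 (Suc 0) (coface 0) (t1 k, {Suc 0}) = (0 :: 'k form)"
    by (simp_all add: form_pullback_def pullback_bary d wedge_zero r)
qed

definition vertex :: "'a \<Rightarrow> form_basis \<Rightarrow> 'a" where "vertex a b = (if b = (0, {}) then a else 0)"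

text \<open>At t = 1 the pullback is an infinite sum. The property that singles it out in
  \<open>tensor_pullback\<close> is \<open>total\<close>, and it has at most one solution by
  separatedness.\<close>

lemma pullback_vertices:
  assumes \<phi>: "\<phi> \<in> MC (tensor_forms G (Suc 0))"
  shows "tensor_pullback G (- 1) 0 (Suc 0) (coface (Suc 0)) \<phi> = vertex (fpart \<phi> 0)"
    and "G.total (- 1) (fpart \<phi>) y \<Longrightarrow> tensor_pullback G (- 1) 0 (Suc 0) (coface 0) \<phi> = vertex y"
proof -
  let ?z = "fpart \<phi>"
  have nz: "G.null (- 1) ?z" and nl: "G.null 0 (dpart \<phi>)" using \<phi> by (auto simp: MC_forms_1)
  let ?c = "\<lambda>\<theta> a. Poly_Mapping.lookup (form_pullback 0 (Suc 0) \<theta> a :: 'k form) (0, {})"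
  have S: "(\<Sum>a \<in> {a \<in> forms_basis (Suc 0). \<phi> a \<notin> U (- 1 + form_deg a)}. smul G (?c \<theta> a) (\<phi> a)) =
    (\<Sum>k \<in> {k. ?z k \<notin> U (- 1)}. smul G (?c \<theta> (t1 k, {})) (?z k))"
    if U: "U \<in> opens G" and \<theta>: "\<theta> = coface (Suc 0) \<or> \<theta> = coface 0" for U \<theta>
  proof -
    have e: "{a \<in> forms_basis (Suc 0). \<phi> a \<notin> U (- 1 + form_deg a)} =
        (\<lambda>k. (t1 k, {})) ` {k. ?z k \<notin> U (- 1)} \<union> (\<lambda>k. (t1 k, {Suc 0})) ` {k. dpart \<phi> k \<notin> U 0}"
      by (auto simp: forms_basis_1)
    have "finite {k. ?z k \<notin> U (- 1)}" "finite {k. dpart \<phi> k \<notin> U 0}" using nz nl U by (auto simp: G.null_def)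
    moreover have "smul G (?c \<theta> (t1 k, {Suc 0})) (dpart \<phi> k) = 0" for k using \<theta> by (auto simp: form_pullback_0)
    moreover have "(\<Sum>k \<in> {k. dpart \<phi> k \<notin> U 0}. smul G (?c \<theta> (t1 k, {Suc 0})) (dpart \<phi> k)) = 0"
      by (rule sum.neutral) (use calculation(3) in blast)
    ultimately show ?thesis unfolding e
      by (subst sum.union_disjoint) (auto simp: sum.reindex inj_on_def simp del: G.scale_eq_0_iff)
  qed
  have pull: "tensor_pullback G (- 1) 0 (Suc 0) \<theta> \<phi> = vertex y"
    if \<theta>: "\<theta> = coface (Suc 0) \<or> \<theta> = coface 0" and y: "y \<in> gr G (- 1)"
      "\<And>U. U \<in> opens G \<Longrightarrow> y - (\<Sum>k \<in> {k. ?z k \<notin> U (- 1)}. smul G (?c \<theta> (t1 k, {})) (?z k)) \<in> U (- 1)" for \<theta> y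
  proof
    fix b
    have "(THE y. y \<in> gr G (- 1) \<and> (\<forall>U \<in> opens G.
        y - (\<Sum>a \<in> {a \<in> forms_basis (Suc 0). \<phi> a \<notin> U (- 1 + form_deg a)}. smul G (?c \<theta> a) (\<phi> a)) \<in> U (- 1))) = y"
    proof (rule the_equality)
      show "y \<in> gr G (- 1) \<and> (\<forall>U \<in> opens G.
        y - (\<Sum>a \<in> {a \<in> forms_basis (Suc 0). \<phi> a \<notin> U (- 1 + form_deg a)}. smul G (?c \<theta> a) (\<phi> a)) \<in> U (- 1))"
        using y(1) by (intro conjI ballI) (simp_all only: S[OF _ \<theta>] y(2))
      fix y' assume y': "y' \<in> gr G (- 1) \<and> (\<forall>U \<in> opens G.
        y' - (\<Sum>a \<in> {a \<in> forms_basis (Suc 0). \<phi> a \<notin> U (- 1 + form_deg a)}. smul G (?c \<theta> a) (\<phi> a)) \<in> U (- 1))"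
      have "y' - y \<in> U (- 1)" if U: "U \<in> opens G" for U
      proof -
        have "y' - (\<Sum>k \<in> {k. ?z k \<notin> U (- 1)}. smul G (?c \<theta> (t1 k, {})) (?z k)) \<in> U (- 1)"
          using y' U unfolding S[OF U \<theta>, symmetric] by blast
        from G.open_simps(3)[OF U this y(2)[OF U]] show ?thesis by simp
      qed
      then show "y' = y" using G.separated[of "y' - y" "- 1"] y' y(1) by (simp add: G.gr_diff)
    qed
    then show "tensor_pullback G (- 1) 0 (Suc 0) \<theta> \<phi> b = vertex y b"
      by (simp add: tensor_pullback_def forms_basis_0 vertex_def)
  qed
  have one: "Poly_Mapping.lookup (form_one :: 'k form) (0, {}) = 1" by (simp add: form_one_def)
  show "tensor_pullback G (- 1) 0 (Suc 0) (coface (Suc 0)) \<phi> = vertex (?z 0)"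
  proof (rule pull)
    show "?z 0 \<in> gr G (- 1)" by (rule G.null_gr[OF nz])
    fix U assume U: "U \<in> opens G"
    have "(\<Sum>k \<in> {k. ?z k \<notin> U (- 1)}. smul G (?c (coface (Suc 0)) (t1 k, {})) (?z k)) =
        (\<Sum>k \<in> {k. ?z k \<notin> U (- 1)}. if k = 0 then ?z 0 else 0)"
      by (intro sum.cong refl) (simp add: form_pullback_0(1) one)
    also have "\<dots> = (if ?z 0 \<notin> U (- 1) then ?z 0 else 0)" using nz U by (simp add: G.null_def)
    finally show "?z 0 - (\<Sum>k \<in> {k. ?z k \<notin> U (- 1)}. smul G (?c (coface (Suc 0)) (t1 k, {})) (?z k)) \<in> U (- 1)"
      using G.open_simps(1)[OF U] by simp
  qed simp
  show "tensor_pullback G (- 1) 0 (Suc 0) (coface 0) \<phi> = vertex y" if "G.total (- 1) ?z y"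
    using that by (intro pull) (simp_all add: G.total_def form_pullback_0(3) one)
qed

end

section \<open>Components\<close>

definition mcrel :: "('k::field_char_0, 'a::ab_group_add) cdgla_data \<Rightarrow> ('a \<times> 'a) set"
  where "mcrel G = ({(a, b). complete_dgla.mcpath G a b} \<union> {(a, b). complete_dgla.mcpath G a b}\<inverse>)\<^sup>* \<inter> MC G \<times> MC G"

lemma equiv_connected: "equiv A ((E \<union> E\<inverse>)\<^sup>* \<inter> A \<times> A)"
proof (intro equivI refl_onI symI transI)
  show "(b, a) \<in> (E \<union> E\<inverse>)\<^sup>* \<inter> A \<times> A" if "(a, b) \<in> (E \<union> E\<inverse>)\<^sup>* \<inter> A \<times> A" for a b
    using that symD[OF sym_rtrancl[OF sym_Un_converse[of E]]] by blast
qed auto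

lemma equiv_mcrel: "equiv (MC G) (mcrel G)"
  unfolding mcrel_def by (rule equiv_connected)

lemma mcrelD: "(a, b) \<in> mcrel G \<Longrightarrow> a \<in> MC G \<and> b \<in> MC G" by (simp add: mcrel_def)

lemma mcrel_refl: "a \<in> MC G \<Longrightarrow> (a, a) \<in> mcrel G" by (simp add: mcrel_def)

lemma mcrel_sym: "(a, b) \<in> mcrel G \<Longrightarrow> (b, a) \<in> mcrel G"
  using equiv_mcrel by (rule equivE) (auto dest: symD)

lemma mcrel_trans: "(a, b) \<in> mcrel G \<Longrightarrow> (b, c) \<in> mcrel G \<Longrightarrow> (a, c) \<in> mcrel G"
  using equiv_mcrel by (rule equivE) (auto dest: transD)

lemma mcrel_mcpath: "complete_dgla G \<Longrightarrow> complete_dgla.mcpath G a b \<Longrightarrow> (a, b) \<in> mcrel G"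
  using complete_dgla.mcpath_MC[of G a b] by (auto simp: mcrel_def)

lemma mcrel_induct:
  assumes ab: "(a, b) \<in> mcrel G" and G: "complete_dgla G"
    and refl: "R a a"
    and step: "\<And>b c. R a b \<Longrightarrow> complete_dgla.mcpath G b c \<Longrightarrow> R a c" "\<And>b c. R a b \<Longrightarrow> complete_dgla.mcpath G c b \<Longrightarrow> R a c"
  shows "R a b"
proof -
  have "(a, b) \<in> ({(a, b). complete_dgla.mcpath G a b} \<union> {(a, b). complete_dgla.mcpath G a b}\<inverse>)\<^sup>*"
    using ab by (simp add: mcrel_def)
  then show ?thesis
  proof (induction rule: rtrancl_induct)
    case (step y z)
    then consider "complete_dgla.mcpath G y z" | "complete_dgla.mcpath G z y" by blast
    then show ?case using assms(4,5)[OF step.IH] by cases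
  qed (rule refl)
qed

lemma mcrel_map:
  assumes G: "complete_dgla G" and H: "complete_dgla H"
    and f: "\<And>a b. complete_dgla.mcpath G a b \<Longrightarrow> complete_dgla.mcpath H (f a) (f b)" "\<And>a. a \<in> MC G \<Longrightarrow> f a \<in> MC H"
    and ab: "(a, b) \<in> mcrel G"
  shows "(f a, f b) \<in> mcrel H"
proof (rule mcrel_induct[OF ab G, of "\<lambda>a b. (f a, f b) \<in> mcrel H"])
  show "(f a, f a) \<in> mcrel H" using f(2) mcrelD[OF ab] by (intro mcrel_refl) blast
  fix b c assume b: "(f a, f b) \<in> mcrel H"
  show "(f a, f c) \<in> mcrel H" if "complete_dgla.mcpath G b c"
    using mcrel_trans[OF b mcrel_mcpath[OF H f(1)[OF that]]] .
  show "(f a, f c) \<in> mcrel H" if "complete_dgla.mcpath G c b"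
    using mcrel_trans[OF b mcrel_sym[OF mcrel_mcpath[OF H f(1)[OF that]]]] .
qed

lemma mcrel_cont:
  assumes G: "complete_dgla G" and H: "complete_dgla H" and f: "cont_map G H f" and ab: "(a, b) \<in> mcrel G"
  shows "(f (- 1) a, f (- 1) b) \<in> mcrel H"
  using mcrel_map[OF G H, of "f (- 1)", OF mcpath_cont[OF G H f] _ ab]
    cont_map_MC[OF complete_dgla.axioms(1)[OF G] complete_dgla.axioms(1)[OF H] f] by blast

lemma MC_twist:
  assumes G: "dgla G" and \<xi>: "\<xi> \<in> MC G" and a: "a \<in> MC G"
  shows "a - \<xi> \<in> MC (twist G \<xi>)"
proof -
  interpret G: dgla G by fact
  note x = G.MC_dif[OF \<xi>] G.MC_dif[OF a]
  have sym: "brk G (- 1) (- 1) a \<xi> = brk G (- 1) (- 1) \<xi> a" using G.brk_antisym[OF x(3,1)] by (simp add: ksign_def)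
  have h: "smul G (1 / 2) (u - v - v + w) = smul G (1 / 2) u - v + smul G (1 / 2) w" for u v w
    using G.smul_half(1)[of v] by (simp add: G.scale_right_distrib G.scale_right_diff_distrib algebra_simps)
  have "dif (twist G \<xi>) (- 1) (a - \<xi>) + smul G (1 / 2) (brk G (- 1) (- 1) (a - \<xi>) (a - \<xi>)) = 0"
    using x G.smul_half(1)[of "brk G (- 1) (- 1) \<xi> \<xi>"]
    by (simp add: G.dif_diff G.brk_diff_left G.brk_diff_right sym G.gr_diff G.scale_right_distrib G.scale_right_diff_distrib
        G.smul_half algebra_simps)
  then show ?thesis using x by (simp add: MC_def G.gr_diff)
qed

lemma mcrel_twist:
  assumes G: "complete_dgla G" and \<xi>: "\<xi> \<in> MC G" and ab: "(a, b) \<in> mcrel G"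
  shows "(a - \<xi>, b - \<xi>) \<in> mcrel (twist G \<xi>)"
  using mcrel_map[OF G complete_dgla.complete_dgla_twist[OF G \<xi>], of "\<lambda>a. a - \<xi>", OF mcpath_twist[OF G \<xi>] _ ab]
    MC_twist[OF complete_dgla.axioms(1)[OF G] \<xi>] by blast

lemma MC_minus: "dgla G \<Longrightarrow> \<xi> \<in> MC G \<Longrightarrow> - \<xi> \<in> MC (twist G \<xi>)"
  using MC_twist[of G \<xi> 0] MC_0[of G] by simp

lemma mcrel_untwist:
  assumes G: "complete_dgla G" and \<xi>: "\<xi> \<in> MC G" and ab: "(a, b) \<in> mcrel (twist G \<xi>)"
  shows "(a + \<xi>, b + \<xi>) \<in> mcrel G"
proof -
  interpret G: complete_dgla G by fact
  interpret T: complete_dgla "twist G \<xi>" by (rule G.complete_dgla_twist[OF \<xi>])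
  have m: "- \<xi> \<in> MC (twist G \<xi>)" by (rule MC_minus[OF G.dgla_axioms \<xi>])
  have "cont_map (twist (twist G \<xi>) (- \<xi>)) G (\<lambda>n. id)"
    by (rule cont_map_cong[OF cont_map_id]) (use twist_twist_uminus(2)[OF G.dgla_axioms G.MC_dif(1)[OF \<xi>]] in \<open>simp_all\<close>)
  from mcrel_cont[OF T.complete_dgla_twist[OF m] G this mcrel_twist[OF T.complete_dgla_axioms m ab]]
  show ?thesis by simp
qed

section \<open>Components of a disjoint product\<close>

context disjoint_product
begin

text \<open>Weights make the series of the path converge. Its endpoint satisfies y = e y, so it is
  the image of \<open>r (- 1) y\<close>.\<close>

lemma mcrel_in_H:
  assumes \<zeta>: "\<zeta> \<in> MC P" and fil: "\<zeta> \<in> fil 1 (- 1)"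
  shows "\<exists>b \<in> MC H. (j (- 1) b, \<zeta>) \<in> mcrel P"
proof -
  have null: "P.null n f" if f: "\<And>k. f k \<in> fil k n" for n f
  proof (rule P.nullI)
    show "f k \<in> gr P n" for k using f fil_gr by blast
    show "\<exists>N. \<forall>k \<ge> N. f k \<in> U n" if "U \<in> opens P" for U using fil_null[OF that] f by (metis subsetD)
  qed
  have z: "P.null (- 1) (zseq \<zeta>)" using zseq_fil[OF fil] by (rule null)
  have l: "P.null 0 (lseq \<zeta>)" using lseq_fil[OF fil] fil_mono[of _ "Suc _"] by (intro null) (meson le_SucI order_refl)
  obtain y where y: "P.total (- 1) (zseq \<zeta>) y" using P.total_exists[OF z] by blast
  then have p: "P.mcpath \<zeta> y"
    unfolding P.mcpath_def using z l curv_zseq[OF fil \<zeta>] zseq_0[OF fil] by blast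
  have yg: "y \<in> gr P (- 1)" using y by (simp add: P.total_def)
  have "y - e (- 1) y \<in> U (- 1)" if U: "U \<in> opens P" for U
  proof -
    obtain W where W: "W \<in> opens P" "\<And>n. e n ` W n \<subseteq> U n" using cont_mapD(6)[OF cont_e U] by blast
    obtain N1 where N1: "\<And>m. N1 \<le> m \<Longrightarrow> y - (\<Sum>k\<le>m. zseq \<zeta> k) \<in> W (- 1)"
      using y W(1) unfolding P.total_partial[OF z] by blast
    obtain N2 where N2: "\<And>m. N2 \<le> m \<Longrightarrow> y - (\<Sum>k\<le>m. zseq \<zeta> k) \<in> U (- 1)"
      using y U unfolding P.total_partial[OF z] by blast
    obtain N3 where N3: "\<And>p n. N3 \<le> p \<Longrightarrow> fil p n \<subseteq> U n" using fil_null[OF U] by blast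
    define m where "m = max N1 (max N2 N3)"
    let ?S = "\<Sum>k\<le>m. zseq \<zeta> k"
    have S: "?S \<in> gr P (- 1)" using zseq_gr[OF fil] by (intro P.gr_sum)
    have "e (- 1) (y - ?S) \<in> U (- 1)" using N1[of m] W(2) by (auto simp: m_def)
    moreover have "y - ?S \<in> U (- 1)" using N2[of m] by (simp add: m_def)
    moreover have "N3 \<le> Suc m" by (simp add: m_def)
    then have "mseq \<zeta> m \<in> U (- 1)" using N3[of "Suc m" "- 1"] mseq_fil[OF fil, of m] by blast
    ultimately have "(y - ?S) - e (- 1) (y - ?S) + mseq \<zeta> m \<in> U (- 1)" using P.open_simps(2,3)[OF U] by blast
    then show ?thesis unfolding zseq_sum[OF fil, symmetric] by (simp add: e_linear(2)[OF yg S])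
  qed
  then have "y - e (- 1) y = 0" using P.separated yg e_gr P.gr_diff by blast
  then have ye: "j (- 1) (r (- 1) y) = y" by (simp add: e_def)
  have "r (- 1) y \<in> MC H" by (rule cont_map_MC[OF P.dgla_axioms H.dgla_axioms r_simps(1) P.mcpath_MC(2)[OF p]])
  moreover have "(j (- 1) (r (- 1) y), \<zeta>) \<in> mcrel P" unfolding ye by (rule mcrel_sym[OF mcrel_mcpath[OF complete_P p]])
  ultimately show ?thesis by blast
qed

text \<open>Brackets with \<open>x\<close> preserve weights, as \<open>x\<close> has weight 0, so
  the original differential respects the filtration too.\<close>

lemma cfilt_untwist:
  assumes "complete_dgla.cfilt (twist P (- x)) \<Psi>"
  shows "P.cfilt \<Psi>"
proof -
  interpret P': complete_dgla "twist P (- x)" by (rule P.complete_dgla_twist[OF mx_MC])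
  note m = P'.cfilt_mfilt[OF assms]
  note ms = P'.mfilt_simps[OF m]
  have 0: "\<Psi> 0 n = gr P n" for n using m by (simp add: P'.mfilt_def)
  have "dif P n y \<in> \<Psi> p (n - 1)" if y: "y \<in> \<Psi> p n" for p n y
  proof -
    have "y \<in> gr P n" using P'.mfilt_gr[OF m] y by auto
    moreover have "brk P (- 1) n x y \<in> \<Psi> (0 + p) (- 1 + n)" using ms(6)[of x 0 "- 1" y p n] y x_gr by (simp add: 0)
    moreover have "dif (twist P (- x)) n y \<in> \<Psi> p (n - 1)" by (rule ms(7)[OF y])
    ultimately show ?thesis
      using ms(2)[of "dif (twist P (- x)) n y" p "n - 1" "brk P (- 1) n x y"] by (simp add: P.brk_uminus_left x_gr)
  qed
  then show ?thesis
    using assms unfolding P.cfilt_def P'.cfilt_def P.mfilt_def P'.mfilt_def by simp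
qed

text \<open>\<open>\<alpha>_zero_fil\<close> speaks of the filtration of \<open>P\<close>, whereas
  \<open>mcrel_in_H\<close> is also applied to the swapped product; minimality compares the two
  filtrations.\<close>

lemma fil_swap: "fil p n \<subseteq> disjoint_product.fil H G (twist P (- x)) j i p n"
proof -
  interpret sw: disjoint_product H G "twist P (- x)" j i "- x" by (rule swap_disjoint_product)
  have "z \<in> sw.fil p n" if z: "z \<in> fil p n" for z
    unfolding sw.fil_def
  proof (rule INT_I)
    fix \<Psi> assume "\<Psi> \<in> {\<Psi>. sw.P.cfilt \<Psi> \<and> (\<forall>n. \<forall>u \<in> gr H n. j n u \<in> \<Psi> 1 n) \<and> (\<forall>n. \<forall>v \<in> gr G n. i n v \<in> \<Psi> 1 n)}"
    then show "z \<in> \<Psi> p n" using fil_least[of \<Psi> p n] cfilt_untwist z by blast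
  qed
  then show ?thesis by blast
qed

lemma complete_P': "complete_dgla (twist P (- x))" by (rule P.complete_dgla_twist[OF mx_MC])

text \<open>\<open>G\<close> maps to the twist of \<open>P\<close> by - x; adding the twisting
  element turns Maurer--Cartan elements of the twist into those of \<open>P\<close>.\<close>

definition iMC :: "'a \<Rightarrow> 'c" where "iMC a = i (- 1) a - x"

lemma iMC_mcrel: "(a, b) \<in> mcrel G \<Longrightarrow> (iMC a, iMC b) \<in> mcrel P"
  using mcrel_untwist[OF complete_P mx_MC mcrel_cont[OF complete_G complete_P' cont_i]] by (simp add: iMC_def)

lemma j_mcrel: "(a, b) \<in> mcrel H \<Longrightarrow> (j (- 1) a, j (- 1) b) \<in> mcrel P"
  by (rule mcrel_cont[OF complete_H complete_P cont_j])

lemma j_mcrel_iff: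
  assumes "a \<in> MC H" "b \<in> MC H"
  shows "(j (- 1) a, j (- 1) b) \<in> mcrel P \<longleftrightarrow> (a, b) \<in> mcrel H"
  using j_mcrel mcrel_cont[OF complete_P complete_H r_simps(1), of "j (- 1) a" "j (- 1) b"] assms
    H.MC_dif(1) by (auto simp: r_simps(3))

lemma iMC_mcrel_iff:
  assumes "a \<in> MC G" "b \<in> MC G"
  shows "(iMC a, iMC b) \<in> mcrel P \<longleftrightarrow> (a, b) \<in> mcrel G"
proof -
  interpret sw: disjoint_product H G "twist P (- x)" j i "- x" by (rule swap_disjoint_product)
  have "(i (- 1) a, i (- 1) b) \<in> mcrel (twist P (- x))" if "(iMC a, iMC b) \<in> mcrel P"
    using mcrel_twist[OF complete_P mx_MC that] by (simp add: iMC_def)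
  then show ?thesis using sw.j_mcrel_iff[OF assms] iMC_mcrel by blast
qed

text \<open>\<open>sbase\<close> is zero in degree 0, so every path has l = 0, hence z' = 0 and z is
  constant.\<close>

lemma mcrel_sbase: "(a, b) \<in> mcrel sbase \<Longrightarrow> a = b"
proof -
  interpret S: complete_dgla sbase by (rule complete_sbase)
  have "a = b" if p: "S.mcpath a b" for a b
  proof -
    obtain z l where z: "S.null (- 1) z" and l: "S.null 0 l"
      and e: "S.ddt z = dif S.psd 0 l + brk S.psd (- 1) 0 z l" and z0: "z 0 = a" and t: "S.total (- 1) z b"
      using p by (auto simp: S.mcpath_def)
    have "l k = 0" for k using S.null_gr[OF l, of k] by (simp add: sbase_simps)
    then have "S.ddt z k = 0" for k
      unfolding e using S.null_gr[OF z] by (simp add: S.dif_zero S.brk_zero_right)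
    then have zS: "z (Suc k) = 0" for k
      using of_nat_neq_0[of k, where ?'a = 'k] unfolding S.ddt_def by (metis S.scale_eq_0_iff)
    have sum: "(\<Sum>k\<le>m. z k) = a" for m by (induction m) (simp_all add: z0 zS)
    have "b - a \<in> U (- 1)" if "U \<in> opens sbase" for U
      using t that unfolding S.total_partial[OF z] sum by blast
    moreover have "b - a \<in> gr sbase (- 1)" using t S.null_gr[OF z, of 0] z0 by (simp add: S.total_def S.gr_diff)
    ultimately have "b - a = 0" using S.separated by blast
    then show ?thesis by simp
  qed
  then show "a = b" if "(a, b) \<in> mcrel sbase" using mcrel_induct[OF that S.complete_dgla_axioms, of "(=)"] by blast
qed

lemma iMC_j_mcrel:
  assumes "a \<in> MC G" "b \<in> MC H"
  shows "(iMC a, j (- 1) b) \<notin> mcrel P"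
proof
  assume "(iMC a, j (- 1) b) \<in> mcrel P"
  from mcrel_sbase[OF mcrel_cont[OF complete_P complete_sbase \<alpha>(1) this]]
  have "\<alpha> (- 1) (iMC a) = 0" using H.MC_dif(1)[OF assms(2)] by (simp add: \<alpha>)
  then show False
    using G.MC_dif(1)[OF assms(1)]
    by (simp add: iMC_def cont_map_diff[OF P.dgla_axioms \<alpha>(1)] i_gr x_gr \<alpha> zero_prod_def)
qed

lemma mcrel_cases:
  assumes \<zeta>: "\<zeta> \<in> MC P"
  shows "(\<exists>a \<in> MC G. (iMC a, \<zeta>) \<in> mcrel P) \<or> (\<exists>b \<in> MC H. (j (- 1) b, \<zeta>) \<in> mcrel P)"
proof -
  note g = P.MC_dif(1)[OF \<zeta>]
  consider "\<alpha> (- 1) \<zeta> = 0" | "\<alpha> (- 1) \<zeta> = (- 1, 0)" using \<alpha>_MC[OF \<zeta>] by blast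
  then show ?thesis
  proof cases
    case 1
    then show ?thesis using mcrel_in_H[OF \<zeta> \<alpha>_zero_fil[OF g 1]] by blast
  next
    case 2
    interpret sw: disjoint_product H G "twist P (- x)" j i "- x" by (rule swap_disjoint_product)
    have "\<alpha> (- 1) (\<zeta> - (- x)) = 0"
      using cont_mapD(2)[OF \<alpha>(1) g x_gr] 2 by (simp add: \<alpha>(4) zero_prod_def)
    then have "\<zeta> - (- x) \<in> fil 1 (- 1)" using g x_gr by (intro \<alpha>_zero_fil) (simp_all add: P.gr_add)
    then have "\<zeta> - (- x) \<in> sw.fil 1 (- 1)" using fil_swap by blast
    moreover have "\<zeta> - (- x) \<in> MC (twist P (- x))" by (rule MC_twist[OF P.dgla_axioms mx_MC \<zeta>])
    ultimately obtain a where a: "a \<in> MC G" "(i (- 1) a, \<zeta> - (- x)) \<in> mcrel (twist P (- x))"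
      using sw.mcrel_in_H by blast
    have "(i (- 1) a + - x, \<zeta> - (- x) + - x) \<in> mcrel P" by (rule mcrel_untwist[OF complete_P mx_MC a(2)])
    then show ?thesis using a(1) by (auto simp: iMC_def)
  qed
qed

end

text \<open>Maps inducing a bijection of the quotients by \<open>R\<close> and \<open>S\<close>.\<close>

definition sequiv :: "'x set \<Rightarrow> ('x \<times> 'x) set \<Rightarrow> 'y set \<Rightarrow> ('y \<times> 'y) set \<Rightarrow> ('x \<Rightarrow> 'y) \<Rightarrow> bool"
  where "sequiv A R B S f \<longleftrightarrow> (\<forall>a \<in> A. f a \<in> B) \<and> (\<forall>a \<in> A. \<forall>a' \<in> A. (a, a') \<in> R \<longleftrightarrow> (f a, f a') \<in> S) \<and>
    (\<forall>b \<in> B. \<exists>a \<in> A. (f a, b) \<in> S)"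

lemma sequiv_bij:
  assumes R: "equiv A R" and S: "equiv B S" and f: "sequiv A R B S f"
  shows "bij_betw (\<lambda>X. S `` (f ` X)) (A // R) (B // S)"
proof -
  have fD: "a \<in> A \<Longrightarrow> f a \<in> B" "a \<in> A \<Longrightarrow> a' \<in> A \<Longrightarrow> (a, a') \<in> R \<longleftrightarrow> (f a, f a') \<in> S" "b \<in> B \<Longrightarrow> \<exists>a \<in> A. (f a, b) \<in> S" for a a' b
    using f by (auto simp: sequiv_def)
  have S3: "S \<subseteq> B \<times> B" "sym S" "trans S" "R \<subseteq> A \<times> A" using R S by (auto simp: equiv_def refl_on_def)
  have im: "S `` (f ` (R `` {a})) = S `` {f a}" if a: "a \<in> A" for a
  proof
    show "S `` (f ` (R `` {a})) \<subseteq> S `` {f a}"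
    proof
      fix y assume "y \<in> S `` (f ` (R `` {a}))"
      then obtain a' where a': "(a, a') \<in> R" "(f a', y) \<in> S" by blast
      then have "(f a, f a') \<in> S" using fD(2)[OF a] S3(4) by blast
      then show "y \<in> S `` {f a}" using a'(2) transD[OF S3(3)] by blast
    qed
    show "S `` {f a} \<subseteq> S `` (f ` (R `` {a}))" using equiv_class_self[OF R a] by blast
  qed
  show ?thesis
    unfolding bij_betw_def
  proof
    show "inj_on (\<lambda>X. S `` (f ` X)) (A // R)"
    proof (rule inj_onI)
      fix X Y assume "X \<in> A // R" "Y \<in> A // R" and e: "S `` (f ` X) = S `` (f ` Y)"
      then obtain a b where a: "a \<in> A" "X = R `` {a}" and b: "b \<in> A" "Y = R `` {b}" by (auto elim!: quotientE)
      have "S `` {f a} = S `` {f b}" using e a b by (simp add: im)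
      then have "(f a, f b) \<in> S" using eq_equiv_class[OF _ S] fD(1)[OF b(1)] by blast
      then have "(a, b) \<in> R" using fD(2)[OF a(1) b(1)] by blast
      then show "X = Y" using equiv_class_eq[OF R] a b by blast
    qed
    show "(\<lambda>X. S `` (f ` X)) ` (A // R) = B // S"
    proof (intro equalityI subsetI)
      fix Y assume "Y \<in> (\<lambda>X. S `` (f ` X)) ` (A // R)"
      then obtain a where "a \<in> A" "Y = S `` (f ` (R `` {a}))" by (auto elim!: quotientE)
      then show "Y \<in> B // S" using fD(1) im by (auto intro: quotientI)
    next
      fix Y assume "Y \<in> B // S"
      then obtain b where b: "b \<in> B" "Y = S `` {b}" by (auto elim!: quotientE)
      obtain a where a: "a \<in> A" "(f a, b) \<in> S" using fD(3)[OF b(1)] by blast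
      then have "Y = S `` (f ` (R `` {a}))" using im[OF a(1)] equiv_class_eq[OF S a(2)] b(2) by simp
      then show "Y \<in> (\<lambda>X. S `` (f ` X)) ` (A // R)" using quotientI[OF a(1), of R] by blast
    qed
  qed
qed

section \<open>Identification with the moduli sets\<close>

lemma vertex_path:
  assumes G: "complete_dgla (G :: ('k::field_char_0, 'a::ab_group_add) cdgla_data)"
  shows "{(act (MC_sset G) 0 1 (coface 1) e, act (MC_sset G) 0 1 (coface 0) e) | e. e \<in> simplices (MC_sset G) 1} =
    {(vertex a, vertex b) | a b. complete_dgla.mcpath G a b}" (is "?L = ?R")
proof -
  interpret G: complete_dgla G by fact
  have s: "simplices (MC_sset G) 1 = MC (tensor_forms G (Suc 0))" "act (MC_sset G) 0 1 \<theta> = tensor_pullback G (- 1) 0 (Suc 0) \<theta>" for \<theta>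
    by (simp_all add: MC_sset_def)
  have "?L \<subseteq> ?R"
  proof
    fix p assume "p \<in> ?L"
    then obtain \<phi> where \<phi>: "\<phi> \<in> MC (tensor_forms G (Suc 0))"
      and p: "p = (tensor_pullback G (- 1) 0 (Suc 0) (coface (Suc 0)) \<phi>, tensor_pullback G (- 1) 0 (Suc 0) (coface 0) \<phi>)"
      unfolding s by auto
    note h = \<phi>[unfolded MC_forms_1[OF G]]
    obtain b where b: "G.total (- 1) (fpart \<phi>) b" using G.total_exists h by blast
    have "G.mcpath (fpart \<phi> 0) b" unfolding G.mcpath_def using h b by blast
    then show "p \<in> ?R" unfolding p pullback_vertices(1)[OF G \<phi>] pullback_vertices(2)[OF G \<phi> b] by blast
  qed
  moreover have "?R \<subseteq> ?L"
  proof
    fix p assume "p \<in> ?R"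
    then obtain a b where p: "p = (vertex a, vertex b)" and "G.mcpath a b" by blast
    then obtain z l where zl: "G.null (- 1) z" "G.null 0 l" "G.curv z = 0"
      "G.ddt z = dif G.psd 0 l + brk G.psd (- 1) 0 z l" "z 0 = a" "G.total (- 1) z b"
      by (auto simp: G.mcpath_def)
    define \<phi> where "\<phi> = (\<lambda>(e, S). if (e, S) \<notin> forms_basis (Suc 0) then 0
      else if S = {} then z (Poly_Mapping.lookup e (Suc 0)) else l (Poly_Mapping.lookup e (Suc 0)))"
    have "fpart \<phi> = z" "dpart \<phi> = l" by (simp_all add: fun_eq_iff \<phi>_def)
    moreover have "\<phi> b = 0" if "b \<notin> forms_basis (Suc 0)" for b using that by (cases b) (simp add: \<phi>_def)
    ultimately have \<phi>: "\<phi> \<in> MC (tensor_forms G (Suc 0))" and f: "fpart \<phi> = z"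
      using zl unfolding MC_forms_1[OF G] by simp_all
    have f0: "fpart \<phi> 0 = a" using fun_cong[OF f, of 0] zl(5) by simp
    have "p = (tensor_pullback G (- 1) 0 (Suc 0) (coface (Suc 0)) \<phi>, tensor_pullback G (- 1) 0 (Suc 0) (coface 0) \<phi>)"
      unfolding p pullback_vertices(1)[OF G \<phi>] pullback_vertices(2)[OF G \<phi>, unfolded f, OF zl(6)] using f0 by simp
    then show "p \<in> ?L" unfolding s unfolding One_nat_def using \<phi> by blast
  qed
  ultimately show ?thesis by blast
qed

text \<open>\<open>vertex\<close> matches Maurer--Cartan elements with 0-simplices and, by
  \<open>vertex_path\<close>, paths with the pairs of endpoints of 1-simplices, so the generated
  relations correspond.\<close>

lemma moduli_bij:
  assumes G: "complete_dgla (G :: ('k::field_char_0, 'a::ab_group_add) cdgla_data)"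
  shows "\<exists>F. bij_betw F (MC G // mcrel G) (MC_moduli G)"
proof -
  let ?E = "{(a, b). complete_dgla.mcpath G a b}"
  let ?V = "{(vertex a, vertex b) | a b. complete_dgla.mcpath G a b}"
  let ?S = "MC (tensor_forms G 0)"
  define Q where "Q = (?V \<union> ?V\<inverse>)\<^sup>* \<inter> ?S \<times> ?S"
  have Q: "MC_moduli G = ?S // Q"
    unfolding MC_moduli_def pi0_def vertex_path[OF G] Let_def Q_def by (simp add: MC_sset_def)
  have vi: "vertex a = vertex b \<longleftrightarrow> a = b" for a b :: 'a by (metis vertex_def[OF G])
  have vS: "\<phi> \<in> ?S \<longleftrightarrow> (\<exists>a \<in> MC G. \<phi> = vertex a)" for \<phi>
    unfolding MC_forms_0[OF G] by (auto simp: vertex_def[OF G] fun_eq_iff)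
  have "equiv ?S Q"
    unfolding Q_def by (rule equiv_connected)
  moreover have "sequiv (MC G) (mcrel G) ?S Q vertex"
    unfolding sequiv_def
  proof (intro conjI ballI)
    show "vertex a \<in> ?S" if "a \<in> MC G" for a using that vS by blast
    show "\<exists>a \<in> MC G. (vertex a, \<phi>) \<in> Q" if "\<phi> \<in> ?S" for \<phi> using that vS[of \<phi>] by (auto simp: Q_def)
    fix a b assume ab: "a \<in> MC G" "b \<in> MC G"
    have 1: "(vertex a, vertex c) \<in> (?V \<union> ?V\<inverse>)\<^sup>*" if "(a, c) \<in> (?E \<union> ?E\<inverse>)\<^sup>*" for c
      using that
    proof (induction rule: rtrancl_induct)
      case (step y z)
      then have "(vertex y, vertex z) \<in> ?V \<union> ?V\<inverse>" by auto
      then show ?case using step.IH by (rule rtrancl_into_rtrancl[rotated])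
    qed simp
    have 2: "\<exists>c. \<phi> = vertex c \<and> (a, c) \<in> (?E \<union> ?E\<inverse>)\<^sup>*" if "(vertex a, \<phi>) \<in> (?V \<union> ?V\<inverse>)\<^sup>*" for \<phi>
      using that
    proof (induction rule: rtrancl_induct)
      case (step y z)
      then obtain c where c: "y = vertex c" "(a, c) \<in> (?E \<union> ?E\<inverse>)\<^sup>*" by blast
      obtain d where "z = vertex d" "(c, d) \<in> ?E \<union> ?E\<inverse>" using step(2) by (auto simp: c(1) vi)
      then show ?case using c(2) by (blast intro: rtrancl_into_rtrancl)
    qed blast
    have "(a, b) \<in> (?E \<union> ?E\<inverse>)\<^sup>* \<longleftrightarrow> (vertex a, vertex b) \<in> (?V \<union> ?V\<inverse>)\<^sup>*"
    proof
      assume "(vertex a, vertex b) \<in> (?V \<union> ?V\<inverse>)\<^sup>*"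
      then obtain c where "vertex b = vertex c" "(a, c) \<in> (?E \<union> ?E\<inverse>)\<^sup>*" using 2 by blast
      then show "(a, b) \<in> (?E \<union> ?E\<inverse>)\<^sup>*" by (simp only: vi)
    qed (rule 1)
    moreover have "vertex a \<in> ?S" "vertex b \<in> ?S" using ab vS by blast+
    ultimately show "(a, b) \<in> mcrel G \<longleftrightarrow> (vertex a, vertex b) \<in> Q"
      unfolding Q_def mcrel_def using ab by blast
  qed
  ultimately show ?thesis unfolding Q using sequiv_bij[OF equiv_mcrel] by blast
qed

text \<open>The disjoint union is indexed by positions in the list, so that it splits along
  concatenation.\<close>

definition summc :: "('k::field_char_0, 'a::ab_group_add) cdgla_data list \<Rightarrow> (nat \<times> 'a) set"
  where "summc Gs = (SIGMA k:{..<length Gs}. MC (Gs ! k))"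

definition sumrel :: "('k::field_char_0, 'a::ab_group_add) cdgla_data list \<Rightarrow> ((nat \<times> 'a) \<times> (nat \<times> 'a)) set"
  where "sumrel Gs = {((k, a), (k', b)). k = k' \<and> k < length Gs \<and> (a, b) \<in> mcrel (Gs ! k)}"

text \<open>Positions below \<open>length Gs\<close> go to \<open>P\<close> through
  \<open>iMC\<close>, the others through \<open>j'\<close>; \<open>iMC_j_mcrel\<close> keeps the two
  parts in different components, and \<open>mcrel_cases\<close> shows that they meet every
  component.\<close>

lemma disjoint_product_sequiv:
  fixes A B P :: "('k::field_char_0, 'c::ab_group_add) cdgla_data"
  assumes A: "complete_dgla A" and B: "complete_dgla B" and P: "is_disjoint_product A B P"
    and f: "sequiv (summc Gs) (sumrel Gs) (MC A) (mcrel A) f" and g: "sequiv (summc Hs) (sumrel Hs) (MC B) (mcrel B) g"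
  shows "complete_dgla P \<and> (\<exists>h. sequiv (summc (Gs @ Hs)) (sumrel (Gs @ Hs)) (MC P) (mcrel P) h)"
proof -
  obtain A' iA jA i' j' where AA: "is_coproduct A sdgla (A' :: ('k, 'c) cdgla_data) iA jA" "is_coproduct (twist A' (jA (- 1) (1, 0))) B P i' j'"
    using P by (auto simp: is_disjoint_product_def)
  define i x where "i = (\<lambda>n. i' n \<circ> iA n)" and "x = i' (- 1) (jA (- 1) (1, 0))"
  note AB = coproducts_disjoint_product_data[OF AA A B, folded i_def x_def]
  interpret disjoint_product A B P i j' x
    by (intro disjoint_product.intro disjoint_product_axioms.intro AB)
  define h where "h p = (if fst p < length Gs then iMC (f p) else j' (- 1) (g (fst p - length Gs, snd p)))" for p
  have f1: "(k, a) \<in> summc Gs \<Longrightarrow> f (k, a) \<in> MC A"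
    "(k, a) \<in> summc Gs \<Longrightarrow> (k', a') \<in> summc Gs \<Longrightarrow> ((k, a), (k', a')) \<in> sumrel Gs \<longleftrightarrow> (f (k, a), f (k', a')) \<in> mcrel A"
    "b \<in> MC A \<Longrightarrow> \<exists>k a. (k, a) \<in> summc Gs \<and> (f (k, a), b) \<in> mcrel A" for k a k' a' b
    using f unfolding sequiv_def by (blast, blast, metis surj_pair)
  have g1: "(k, a) \<in> summc Hs \<Longrightarrow> g (k, a) \<in> MC B"
    "(k, a) \<in> summc Hs \<Longrightarrow> (k', a') \<in> summc Hs \<Longrightarrow> ((k, a), (k', a')) \<in> sumrel Hs \<longleftrightarrow> (g (k, a), g (k', a')) \<in> mcrel B"
    "b \<in> MC B \<Longrightarrow> \<exists>k a. (k, a) \<in> summc Hs \<and> (g (k, a), b) \<in> mcrel B" for k a k' a' b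
    using g unfolding sequiv_def by (blast, blast, metis surj_pair)
  have sA: "(k, a) \<in> summc (Gs @ Hs) \<longleftrightarrow> (k, a) \<in> summc Gs" if "k < length Gs" for k a
    using that by (auto simp: summc_def nth_append)
  have sB: "(k, a) \<in> summc (Gs @ Hs) \<longleftrightarrow> (k - length Gs, a) \<in> summc Hs" if "\<not> k < length Gs" for k a
    using that by (auto simp: summc_def nth_append)
  have eA: "((k, a), (k', a')) \<in> sumrel (Gs @ Hs) \<longleftrightarrow> ((k, a), (k', a')) \<in> sumrel Gs" if "k < length Gs" "k' < length Gs" for k a k' a'
    using that by (auto simp: sumrel_def nth_append)
  have eB: "((k, a), (k', a')) \<in> sumrel (Gs @ Hs) \<longleftrightarrow> ((k - length Gs, a), (k' - length Gs, a')) \<in> sumrel Hs"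
    if "\<not> k < length Gs" "\<not> k' < length Gs" for k a k' a'
    using that by (auto simp: sumrel_def nth_append)
  have eAB: "((k, a), (k', a')) \<notin> sumrel (Gs @ Hs)" if "(k < length Gs) \<noteq> (k' < length Gs)" for k a k' a'
    using that by (auto simp: sumrel_def)
  have "sequiv (summc (Gs @ Hs)) (sumrel (Gs @ Hs)) (MC P) (mcrel P) h"
    unfolding sequiv_def
  proof (intro conjI ballI)
    fix p assume p: "p \<in> summc (Gs @ Hs)"
    obtain k a where ka: "p = (k, a)" by force
    show "h p \<in> MC P"
    proof (cases "k < length Gs")
      case True
      then have "f (k, a) \<in> MC A" using f1(1) p sA ka by blast
      then show ?thesis using iMC_mcrel[OF mcrel_refl] mcrelD True by (simp add: h_def ka) blast
    next
      case False
      then have "g (k - length Gs, a) \<in> MC B" using g1(1) p sB ka by blast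
      then show ?thesis using j_mcrel[OF mcrel_refl] mcrelD False by (simp add: h_def ka) blast
    qed
    fix p' assume p': "p' \<in> summc (Gs @ Hs)"
    obtain k' a' where ka': "p' = (k', a')" by force
    show "(p, p') \<in> sumrel (Gs @ Hs) \<longleftrightarrow> (h p, h p') \<in> mcrel P"
    proof (cases "k < length Gs"; cases "k' < length Gs")
      assume k: "k < length Gs" "k' < length Gs"
      then have s: "(k, a) \<in> summc Gs" "(k', a') \<in> summc Gs" using p p' ka ka' sA by blast+
      show ?thesis unfolding ka ka' eA[OF k] f1(2)[OF s] using k by (simp add: h_def iMC_mcrel_iff[OF f1(1)[OF s(1)] f1(1)[OF s(2)]])
    next
      assume k: "\<not> k < length Gs" "\<not> k' < length Gs"
      then have s: "(k - length Gs, a) \<in> summc Hs" "(k' - length Gs, a') \<in> summc Hs" using p p' ka ka' sB by blast+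
      show ?thesis unfolding ka ka' eB[OF k] g1(2)[OF s] using k by (simp add: h_def j_mcrel_iff[OF g1(1)[OF s(1)] g1(1)[OF s(2)]])
    next
      assume k: "k < length Gs" "\<not> k' < length Gs"
      then have s: "(k, a) \<in> summc Gs" "(k' - length Gs, a') \<in> summc Hs" using p p' ka ka' sA sB by blast+
      show ?thesis using k eAB[of k k' a a'] iMC_j_mcrel[OF f1(1)[OF s(1)] g1(1)[OF s(2)]] by (simp add: h_def ka ka')
    next
      assume k: "\<not> k < length Gs" "k' < length Gs"
      then have s: "(k - length Gs, a) \<in> summc Hs" "(k', a') \<in> summc Gs" using p p' ka ka' sA sB by blast+
      show ?thesis using k eAB[of k k' a a'] iMC_j_mcrel[OF f1(1)[OF s(2)] g1(1)[OF s(1)]] mcrel_sym by (auto simp: h_def ka ka')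
    qed
  next
    fix \<zeta> assume "\<zeta> \<in> MC P"
    then consider a where "a \<in> MC A" "(iMC a, \<zeta>) \<in> mcrel P" | b where "b \<in> MC B" "(j' (- 1) b, \<zeta>) \<in> mcrel P"
      using mcrel_cases by blast
    then show "\<exists>p \<in> summc (Gs @ Hs). (h p, \<zeta>) \<in> mcrel P"
    proof cases
      case 1
      then obtain k a' where k: "(k, a') \<in> summc Gs" "(f (k, a'), a) \<in> mcrel A" using f1(3) by blast
      then have "k < length Gs" by (simp add: summc_def)
      then show ?thesis using mcrel_trans[OF iMC_mcrel[OF k(2)] 1(2)] k(1) sA by (intro bexI[of _ "(k, a')"]) (simp_all add: h_def)
    next
      case 2
      then obtain k b' where k: "(k, b') \<in> summc Hs" "(g (k, b'), b) \<in> mcrel B" using g1(3) by blast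
      then show ?thesis using mcrel_trans[OF j_mcrel[OF k(2)] 2(2)] sB[of "k + length Gs" b']
        by (intro bexI[of _ "(k + length Gs, b')"]) (simp_all add: h_def)
    qed
  qed
  then show ?thesis using complete_P by blast
qed

lemma iterated_sequiv:
  assumes "is_iterated_disjoint_product Gs P" and "\<And>G. G \<in> set Gs \<Longrightarrow> complete_dgla G"
  shows "complete_dgla P \<and> (\<exists>h. sequiv (summc Gs) (sumrel Gs) (MC P) (mcrel P) h)"
  using assms
proof (induction rule: is_iterated_disjoint_product.induct)
  case (single P G)
  then have G: "complete_dgla G" and P: "complete_dgla P" by simp_all
  obtain f f' where f: "cont_map G P f" "cont_map P G f'" "\<And>n u. u \<in> gr G n \<Longrightarrow> f' n (f n u) = u" "\<And>n u. u \<in> gr P n \<Longrightarrow> f n (f' n u) = u"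
    using single.hyps(2) by (auto simp: cdgla_iso_def eq_maps_def)
  interpret G: complete_dgla G by (rule G)
  interpret P: complete_dgla P by (rule P)
  note dG = G.dgla_axioms and dP = P.dgla_axioms
  have "sequiv (summc [G]) (sumrel [G]) (MC P) (mcrel P) (\<lambda>(k, a). f (- 1) a)"
    unfolding sequiv_def
  proof (intro conjI ballI)
    fix p assume "p \<in> summc [G]"
    then obtain a where p: "p = (0, a)" and a: "a \<in> MC G" by (auto simp: summc_def)
    show "(case p of (k, a) \<Rightarrow> f (- 1) a) \<in> MC P" using cont_map_MC[OF dG dP f(1) a] by (simp add: p)
    fix p' assume "p' \<in> summc [G]"
    then obtain a' where p': "p' = (0, a')" and a': "a' \<in> MC G" by (auto simp: summc_def)
    have "(f (- 1) a, f (- 1) a') \<in> mcrel P \<longleftrightarrow> (a, a') \<in> mcrel G"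
      using mcrel_cont[OF G P f(1), of a a'] mcrel_cont[OF P G f(2), of "f (- 1) a" "f (- 1) a'"]
        f(3)[OF G.MC_dif(1)[OF a]] f(3)[OF G.MC_dif(1)[OF a']] by auto
    then show "(p, p') \<in> sumrel [G] \<longleftrightarrow> (case p of (k, a) \<Rightarrow> f (- 1) a, case p' of (k, a) \<Rightarrow> f (- 1) a) \<in> mcrel P"
      by (simp add: p p' sumrel_def)
  next
    fix b assume b: "b \<in> MC P"
    have "f' (- 1) b \<in> MC G" by (rule cont_map_MC[OF dP dG f(2) b])
    then show "\<exists>p \<in> summc [G]. (case p of (k, a) \<Rightarrow> f (- 1) a, b) \<in> mcrel P"
      using f(4)[OF P.MC_dif(1)[OF b]] mcrel_refl[OF b] by (intro bexI[of _ "(0, f' (- 1) b)"]) (simp_all add: summc_def)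
  qed
  then show ?case using P by blast
next
  case (join Gs A Hs B P)
  then obtain f g where "complete_dgla A" "complete_dgla B" "sequiv (summc Gs) (sumrel Gs) (MC A) (mcrel A) f"
    "sequiv (summc Hs) (sumrel Hs) (MC B) (mcrel B) g" by fastforce
  then show ?case using join.hyps(3) by (intro disjoint_product_sequiv)
qed

theorem corollary1p8:
  fixes J :: "'i set"
    and \<g> :: "'i \<Rightarrow> ('k::field_char_0, 'a::ab_group_add) cdgla_data"
    and P :: "('k, 'c::ab_group_add) cdgla_data"
    and js :: "'i list"
  assumes "finite J" and "J \<noteq> {}"
    and "\<And>i. i \<in> J \<Longrightarrow> complete_dgla (\<g> i)"
    and "distinct js" and "set js = J"
    and "is_iterated_disjoint_product (map \<g> js) P"
  shows "\<exists>F. bij_betw F (MC_moduli P) (SIGMA i:J. MC_moduli (\<g> i))"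
proof -
  let ?Gs = "map \<g> js"
  obtain h where P: "complete_dgla P" and h: "sequiv (summc ?Gs) (sumrel ?Gs) (MC P) (mcrel P) h"
    using iterated_sequiv[OF assms(6)] assms(3,5) by auto
  have "equiv (summc ?Gs) (sumrel ?Gs)"
    by (intro equivI refl_onI symI transI)
      (auto simp: summc_def sumrel_def dest: mcrelD intro: mcrel_refl mcrel_sym mcrel_trans)
  from bij_betw_inv_into[OF sequiv_bij[OF this equiv_mcrel h]]
  obtain F1 where F1: "bij_betw F1 (MC P // mcrel P) (summc ?Gs // sumrel ?Gs)" by blast
  \<comment> \<open>All members of a class share their position, so a class of the union is a
    position together with a class there.\<close>
  have cls: "sumrel ?Gs `` {(k, a)} = {k} \<times> (mcrel (\<g> (js ! k)) `` {a})" if "k < length js" for k a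
    using that by (auto simp: sumrel_def)
  let ?T = "SIGMA k:{..<length js}. MC (\<g> (js ! k)) // mcrel (\<g> (js ! k))"
  have "bij_betw (\<lambda>(k, X). {k} \<times> X) ?T (summc ?Gs // sumrel ?Gs)"
    unfolding bij_betw_def
  proof
    \<comment> \<open>The position can be recovered from a product with \<open>X\<close> only if
      \<open>X\<close> is nonempty.\<close>
    have "X \<noteq> {}" if "X \<in> MC G // mcrel G" for X and G :: "('k, 'a) cdgla_data"
      using that in_quotient_imp_non_empty[OF equiv_mcrel] by blast
    then show "inj_on (\<lambda>(k, X). {k} \<times> X) ?T" by (fastforce simp: inj_on_def times_eq_iff)
    show "(\<lambda>(k, X). {k} \<times> X) ` ?T = summc ?Gs // sumrel ?Gs"
    proof (intro equalityI subsetI)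
      fix Y assume "Y \<in> (\<lambda>(k, X). {k} \<times> X) ` ?T"
      then obtain k a where "k < length js" "a \<in> MC (\<g> (js ! k))" "Y = {k} \<times> (mcrel (\<g> (js ! k)) `` {a})"
        by (auto elim!: quotientE)
      then show "Y \<in> summc ?Gs // sumrel ?Gs"
        using quotientI[of "(k, a)" "summc ?Gs" "sumrel ?Gs"] by (simp add: cls summc_def)
    next
      fix Y assume "Y \<in> summc ?Gs // sumrel ?Gs"
      then obtain k a where "(k, a) \<in> summc ?Gs" and Y: "Y = sumrel ?Gs `` {(k, a)}" by (auto elim!: quotientE)
      then have k: "k < length js" "a \<in> MC (\<g> (js ! k))" by (auto simp: summc_def)
      then have "(k, mcrel (\<g> (js ! k)) `` {a}) \<in> ?T" by (auto intro: quotientI)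
      then show "Y \<in> (\<lambda>(k, X). {k} \<times> X) ` ?T"
        by (rule rev_image_eqI) (simp add: Y cls[OF k(1)])
    qed
  qed
  from bij_betw_inv_into[OF this]
  obtain F2 where F2: "bij_betw F2 (summc ?Gs // sumrel ?Gs) ?T" by blast
  have "\<exists>F. bij_betw F (MC (\<g> i) // mcrel (\<g> i)) (MC_moduli (\<g> i))" if "i \<in> J" for i
    by (rule moduli_bij[OF assms(3)[OF that]])
  then obtain F3 where F3: "\<And>i. i \<in> J \<Longrightarrow> bij_betw (F3 i) (MC (\<g> i) // mcrel (\<g> i)) (MC_moduli (\<g> i))" by metis
  have js: "js ! k \<in> J" if "k < length js" for k using that assms(5) by auto
  have F4: "bij_betw (\<lambda>(k, X). (js ! k, F3 (js ! k) X)) ?T (SIGMA i:J. MC_moduli (\<g> i))"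
    unfolding bij_betw_def
  proof
    show "inj_on (\<lambda>(k, X). (js ! k, F3 (js ! k) X)) ?T"
    proof (rule inj_onI, clarsimp)
      fix k X k' X' assume k: "k < length js" "k' < length js" "js ! k = js ! k'"
        and X: "X \<in> MC (\<g> (js ! k')) // mcrel (\<g> (js ! k'))" "X' \<in> MC (\<g> (js ! k')) // mcrel (\<g> (js ! k'))"
        and e: "F3 (js ! k') X = F3 (js ! k') X'"
      have "k = k'" using k assms(4) by (simp add: nth_eq_iff_index_eq)
      then show "k = k' \<and> X = X'" using bij_betw_imp_inj_on[OF F3[OF js[OF k(2)]]] X e by (auto dest: inj_onD)
    qed
    show "(\<lambda>(k, X). (js ! k, F3 (js ! k) X)) ` ?T = (SIGMA i:J. MC_moduli (\<g> i))"
    proof (intro equalityI subsetI)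
      fix p assume "p \<in> (\<lambda>(k, X). (js ! k, F3 (js ! k) X)) ` ?T"
      then show "p \<in> (SIGMA i:J. MC_moduli (\<g> i))" using js F3 by (auto dest!: bij_betw_apply)
    next
      fix p assume "p \<in> (SIGMA i:J. MC_moduli (\<g> i))"
      then obtain i Y where p: "p = (i, Y)" "i \<in> J" "Y \<in> MC_moduli (\<g> i)" by blast
      obtain k where k: "k < length js" "js ! k = i" using p(2) assms(5) by (auto simp: in_set_conv_nth)
      have "Y \<in> F3 i ` (MC (\<g> i) // mcrel (\<g> i))" using bij_betw_imp_surj_on[OF F3[OF p(2)]] p(3) by simp
      then obtain X where "X \<in> MC (\<g> i) // mcrel (\<g> i)" "F3 i X = Y" by (elim imageE) simp
      then show "p \<in> (\<lambda>(k, X). (js ! k, F3 (js ! k) X)) ` ?T"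
        using k by (intro rev_image_eqI[of "(k, X)"]) (auto simp: p(1))
    qed
  qed
  obtain F0 where F0: "bij_betw F0 (MC_moduli P) (MC P // mcrel P)"
    using moduli_bij[OF P] bij_betw_inv_into by blast
  show ?thesis by (rule exI) (rule bij_betw_trans[OF bij_betw_trans[OF bij_betw_trans[OF F0 F1] F2] F4])
qed

end
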